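(* Let $\Phi$ be a unital commutative ring containing $\frac12$ and let $V$ be a nondegenerate Jordan pair over $\Phi$. Then the central closure $\mathcal{C}(TKK(V))\,TKK(V)$ of the Tits-Kantor-Koecher algebra $TKK(V)$ of $V$ is isomorphic (as a Lie algebra) to the Tits-Kantor-Koecher algebra $TKK(\mathcal{C}(V)V)$ of the extended central closure $\mathcal{C}(V)V$ of $V$.
   Context: A Jordan pair $V=(V^+,V^-)$ over $\Phi$ has products $Q_xy$ ($x\in V^\sigma,y\in V^{-\sigma}$, $\sigma=\pm$) with linearizations $\{x,y,z\}=D_{x,y}z=Q_{x+z}y-Q_xy-Q_zy$. $V$ is nondegenerate if $Q_x=0$ implies $x=0$, for $x\in V^\sigma$. An ideal (of a Jordan pair or Lie algebra) is essential if it has nonzero intersection with every nonzero ideal. $TKK(V)=V^+\oplus\mathrm{IDer}\,V\oplus V^-$, where $\mathrm{IDer}\,V$ is spanned by the derivations $\delta(x,y)=(D_{x,y},-D_{y,x})$ for $x\in V^+,y\in V^-$; the bracket satisfies $[V^\sigma,V^\sigma]=0$, $[x,y]=\delta(x,y)$ for $x\in V^+,y\in V^-$, $\mathrm{IDer}\,V$ acts naturally on $V^\pm$ and has the commutator product. Lie side. For a semiprime Lie algebra $L$ (TKK-algebras of nondegenerate Jordan pairs are semiprime), a permissible map is a pair $(f,I)$ with $I$ an essential ideal of $L$ and $f:I\to L$ additive with $f([x,y])=[x,f(y)]$ for $x\in L$, $y\in I$; two are equivalent if they agree on some essential ideal contained in both domains. The extended centroid $\mathcal{C}(L)$ is the ring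 of classes $\overline{(f,I)}$, with sum induced by $f_1+f_2$ on $I_1\cap I_2$ and product induced by $f_1f_2$ on $f_2^{-1}(I_1)$. The central closure is $\mathcal{C}(L)L=(\mathcal{C}(L)\otimes_\Phi L)/M$, where $M$ is the unique ideal of $\mathcal{C}(L)\otimes L$ maximal with respect to $R\subseteq M$ and $M\cap(1\otimes L)=0$, $R$ being the ideal generated by all $\lambda\otimes u-1\otimes f(u)$ with $\lambda=\overline{(f,U)}$, $u\in U$. Jordan side. For an ideal $U$ of $V$, a $V$-homomorphism $g=(g^+,g^-):U\to V$ is a pair of linear maps $g^\sigma:U^\sigma\to V^\sigma$ such that for $\sigma=\pm$, $y^\sigma\in U^\sigma$, $x^\sigma,z^\sigma\in V^\sigma$: (a) $g^\sigma(Q_{x^\sigma}y^{-\sigma})=Q_{x^\sigma}g^{-\sigma}(y^{-\sigma})$; (b) $g^\sigma(Q_{U^\sigma}V^{-\sigma})\subseteq U^\sigma$ and $(g^\sigma)^2(Q_{y^\sigma}x^{-\sigma})=Q_{g^\sigma(y^\sigma)}x^{-\sigma}$; (c) $g^\sigma(\{y^\sigma,z^{-\sigma},x^\sigma\})=\{g^\sigma(y^\sigma),z^{-\sigma},x^\sigma\}$. A permissible map of $V$ is $(g,U)$ with $U$ an essential ideal and $g:U\to V$ a $V$-homomorphism; two are equivalent if they agree on some essential ideal contained in both domains. The extended centroid $\mathcal{C}(V)$ is the set of classes $[g,U]$. For ideals $I,K$ of $V$ let $K\ast I=(Q_{K^+}I^-+Q_{V^+}Q_{K^-}I^+,\ Q_{K^-}I^++Q_{V^-}Q_{K^+}I^-)$.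 Operations: $[g_1,U_1]+[g_2,U_2]=[g_1+g_2,K]$, $[g_1,U_1][g_2,U_2]=[g_1g_2,K\ast V]$ with $K=(U_1\cap U_2)\ast V$. Then $\mathcal{C}(V)$ is a commutative associative unital von Neumann regular ring. The extended central closure $\mathcal{C}(V)V$ is the Jordan pair over $\mathcal{C}(V)$ given by the quotient of $\mathcal{C}(V)\otimes_\Phi V$ by its unique ideal $M$ maximal with respect to: $M$ contains all $\rho\lambda\otimes u-\rho\otimes g^\sigma(u)$ with $\rho,\lambda\in\mathcal{C}(V)$, $\lambda=[g,U]$, $u\in U^\sigma$, $\sigma=\pm$, and $M\cap(1\otimes V)=0$. Thus $V\subseteq\mathcal{C}(V)V$, $\mathcal{C}(V)V$ is spanned by $V$ over $\mathcal{C}(V)$, $\lambda u=g^\sigma(u)$ for $\lambda=[g,U]$, $u\in U^\sigma$, and every nonzero ideal of $\mathcal{C}(V)V$ meets $V$ nontrivially. *)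

theory Defs
  imports "HOL-Algebra.Module" "HOL-Algebra.QuotRing" "HOL.Hull"
begin

text \<open>
  An algebra over \<open>R\<close> (not necessarily associative or unital) is a record of type \<^typ>\<open>('r, 'a) module\<close>
  whose \<^const>\<open>mult\<close> field is the product; for a Lie algebra, \<open>x \<otimes>\<^bsub>L\<^esub> y\<close> is the bracket.
  Fields \<^const>\<open>mult\<close> and \<^const>\<open>one\<close> that have no meaning for the object at hand are never used.
\<close>


section \<open>Modules: span, quotient, extension and restriction of scalars\<close>

definition mspan :: "('r, 'e) ring_scheme \<Rightarrow> ('r, 'a, 'f) module_scheme \<Rightarrow> 'a set \<Rightarrow> 'a set" where
  "mspan R M A = (\<lambda>N. submodule N R M) hull A"

definition quot_mod :: "('r, 'a, 'f) module_scheme \<Rightarrow> 'a set \<Rightarrow> ('r, 'a set) module" where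
  "quot_mod M N =
    \<lparr>carrier = a_rcosets\<^bsub>M\<^esub> N, mult = rcoset_mult M N, one = undefined,
     zero = N, add = set_add M,
     smult = (\<lambda>r X. \<Union>x\<in>X. N +>\<^bsub>M\<^esub> (r \<odot>\<^bsub>M\<^esub> x))\<rparr>"

text \<open>
  The tensor product \<open>A \<otimes>\<^sub>R M\<close>: a list \<open>[(a\<^sub>1, x\<^sub>1), \<dots>, (a\<^sub>n, x\<^sub>n)]\<close> stands for the sum
  \<open>a\<^sub>1 \<otimes> x\<^sub>1 + \<dots> + a\<^sub>n \<otimes> x\<^sub>n\<close>, and lists are identified by the least additive congruence that makes
  \<open>(a, x) \<mapsto> a \<otimes> x\<close> an \<open>R\<close>-balanced biadditive map.  The rule \<open>zero\<close> is needed because the lists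
  form only a monoid; with it, \<open>(-a) \<otimes> x\<close> is the negative of \<open>a \<otimes> x\<close>.
\<close>

inductive tensor_eq ::
  "('r, 'e) ring_scheme \<Rightarrow> ('r, 'c, 'f) module_scheme \<Rightarrow> ('r, 'a, 'g) module_scheme \<Rightarrow>
   ('c \<times> 'a) list \<Rightarrow> ('c \<times> 'a) list \<Rightarrow> bool"
  for R :: "('r, 'e) ring_scheme" and A :: "('r, 'c, 'f) module_scheme"
    and M :: "('r, 'a, 'g) module_scheme"
where
  refl: "xs \<in> lists (carrier A \<times> carrier M) \<Longrightarrow> tensor_eq R A M xs xs"
| sym: "tensor_eq R A M xs ys \<Longrightarrow> tensor_eq R A M ys xs"
| trans: "tensor_eq R A M xs ys \<Longrightarrow> tensor_eq R A M ys zs \<Longrightarrow> tensor_eq R A M xs zs"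
| append: "tensor_eq R A M xs xs' \<Longrightarrow> tensor_eq R A M ys ys' \<Longrightarrow>
    tensor_eq R A M (xs @ ys) (xs' @ ys')"
| commute: "xs \<in> lists (carrier A \<times> carrier M) \<Longrightarrow> ys \<in> lists (carrier A \<times> carrier M) \<Longrightarrow>
    tensor_eq R A M (xs @ ys) (ys @ xs)"
| zero: "x \<in> carrier M \<Longrightarrow> tensor_eq R A M [(\<zero>\<^bsub>A\<^esub>, x)] []"
| add_left: "a \<in> carrier A \<Longrightarrow> b \<in> carrier A \<Longrightarrow> x \<in> carrier M \<Longrightarrow>
    tensor_eq R A M [(a \<oplus>\<^bsub>A\<^esub> b, x)] [(a, x), (b, x)]"
| add_right: "a \<in> carrier A \<Longrightarrow> x \<in> carrier M \<Longrightarrow> y \<in> carrier M \<Longrightarrow>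
    tensor_eq R A M [(a, x \<oplus>\<^bsub>M\<^esub> y)] [(a, x), (a, y)]"
| balance: "r \<in> carrier R \<Longrightarrow> a \<in> carrier A \<Longrightarrow> x \<in> carrier M \<Longrightarrow>
    tensor_eq R A M [(r \<odot>\<^bsub>A\<^esub> a, x)] [(a, r \<odot>\<^bsub>M\<^esub> x)]"

definition tensor_class ::
  "('r, 'e) ring_scheme \<Rightarrow> ('r, 'c, 'f) module_scheme \<Rightarrow> ('r, 'a, 'g) module_scheme \<Rightarrow>
   ('c \<times> 'a) list \<Rightarrow> ('c \<times> 'a) list set" where
  "tensor_class R A M xs = {ys. tensor_eq R A M xs ys}"

text \<open>For an \<open>R\<close>-algebra \<open>A\<close>, the \<open>A\<close>-algebra \<open>A \<otimes>\<^sub>R M\<close>, with product \<open>(a \<otimes> x)(b \<otimes> y) = ab \<otimes> xy\<close>.\<close>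

definition tensor ::
  "('r, 'e) ring_scheme \<Rightarrow> ('r, 'c, 'f) module_scheme \<Rightarrow> ('r, 'a, 'g) module_scheme \<Rightarrow>
   ('c, ('c \<times> 'a) list set) module" where
  "tensor R A M =
    \<lparr>carrier = tensor_class R A M ` lists (carrier A \<times> carrier M),
     mult = (\<lambda>X Y. \<Union>xs\<in>X. \<Union>ys\<in>Y.
       tensor_class R A M [(a \<otimes>\<^bsub>A\<^esub> b, x \<otimes>\<^bsub>M\<^esub> y). (a, x) \<leftarrow> xs, (b, y) \<leftarrow> ys]),
     one = undefined,
     zero = tensor_class R A M [],
     add = (\<lambda>X Y. \<Union>xs\<in>X. \<Union>ys\<in>Y. tensor_class R A M (xs @ ys)),
     smult = (\<lambda>c X. \<Union>xs\<in>X. tensor_class R A M [(c \<otimes>\<^bsub>A\<^esub> a, x). (a, x) \<leftarrow> xs])\<rparr>"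

definition pure_tensor ::
  "('r, 'e) ring_scheme \<Rightarrow> ('r, 'c, 'f) module_scheme \<Rightarrow> ('r, 'a, 'g) module_scheme \<Rightarrow>
   'c \<Rightarrow> 'a \<Rightarrow> ('c \<times> 'a) list set" where
  "pure_tensor R A M a x = tensor_class R A M [(a, x)]"

text \<open>An algebra over the unital \<open>R\<close>-algebra \<open>A\<close>, regarded as an algebra over \<open>R\<close>.\<close>

definition restrict_scalars ::
  "('r, 'c, 'f) module_scheme \<Rightarrow> ('c, 'a, 'g) module_scheme \<Rightarrow> ('r, 'a) module" where
  "restrict_scalars A M =
    \<lparr>carrier = carrier M, mult = mult M, one = one M, zero = zero M, add = add M,
     smult = (\<lambda>r x. (r \<odot>\<^bsub>A\<^esub> \<one>\<^bsub>A\<^esub>) \<odot>\<^bsub>M\<^esub> x)\<rparr>"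

definition algebra_isomorphic ::
  "('r, 'e) ring_scheme \<Rightarrow> ('r, 'a, 'f) module_scheme \<Rightarrow> ('r, 'b, 'g) module_scheme \<Rightarrow> bool" where
  "algebra_isomorphic R L L' \<longleftrightarrow>
    (\<exists>h. bij_betw h (carrier L) (carrier L') \<and>
      (\<forall>x\<in>carrier L. \<forall>y\<in>carrier L. h (x \<oplus>\<^bsub>L\<^esub> y) = h x \<oplus>\<^bsub>L'\<^esub> h y) \<and>
      (\<forall>r\<in>carrier R. \<forall>x\<in>carrier L. h (r \<odot>\<^bsub>L\<^esub> x) = r \<odot>\<^bsub>L'\<^esub> h x) \<and>
      (\<forall>x\<in>carrier L. \<forall>y\<in>carrier L. h (x \<otimes>\<^bsub>L\<^esub> y) = h x \<otimes>\<^bsub>L'\<^esub> h y))"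


section \<open>Jordan pairs\<close>

datatype sign = Pos | Neg

primrec opp :: "sign \<Rightarrow> sign" where
  "opp Pos = Neg"
| "opp Neg = Pos"

text \<open>The two modules share one type \<open>'a\<close>, but are independent of each other.\<close>

record ('r, 'a) jpair =
  jmod :: "sign \<Rightarrow> ('r, 'a) module"
  jQ :: "sign \<Rightarrow> 'a \<Rightarrow> 'a \<Rightarrow> 'a"

abbreviation jcarrier :: "('r, 'a) jpair \<Rightarrow> sign \<Rightarrow> 'a set" where
  "jcarrier V s \<equiv> carrier (jmod V s)"

definition jtriple :: "('r, 'a) jpair \<Rightarrow> sign \<Rightarrow> 'a \<Rightarrow> 'a \<Rightarrow> 'a \<Rightarrow> 'a" where
  "jtriple V s x y z =
    (jQ V s (x \<oplus>\<^bsub>jmod V s\<^esub> z) y \<ominus>\<^bsub>jmod V s\<^esub> jQ V s x y) \<ominus>\<^bsub>jmod V s\<^esub> jQ V s z y"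

text \<open>
  Jordan pairs in the sense of Loos: the identities \<open>JP1\<close>, \<open>JP2\<close>, \<open>JP3\<close> hold in all scalar extensions,
  that is, together with all their linearizations.  \<open>JP1_lin\<close> and \<open>JP3_lin\<close> are the components of
  \<open>JP1\<close> and \<open>JP3\<close> of degree 1 in \<open>w\<close> after the substitution \<open>x \<mapsto> x + w\<close>; every other
  linearization follows from the five identities by polarization over \<open>R\<close> itself.
\<close>

locale jordan_pair =
  fixes R :: "('r, 'e) ring_scheme" and V :: "('r, 'a) jpair"
  assumes modules: "module R (jmod V s)"
    and Q_closed: "\<lbrakk>x \<in> jcarrier V s; y \<in> jcarrier V (opp s)\<rbrakk> \<Longrightarrow> jQ V s x y \<in> jcarrier V s"
    and Q_add: "\<lbrakk>x \<in> jcarrier V s; y \<in> jcarrier V (opp s); y' \<in> jcarrier V (opp s)\<rbrakk> \<Longrightarrow>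
      jQ V s x (y \<oplus>\<^bsub>jmod V (opp s)\<^esub> y') = jQ V s x y \<oplus>\<^bsub>jmod V s\<^esub> jQ V s x y'"
    and Q_smult: "\<lbrakk>r \<in> carrier R; x \<in> jcarrier V s; y \<in> jcarrier V (opp s)\<rbrakk> \<Longrightarrow>
      jQ V s x (r \<odot>\<^bsub>jmod V (opp s)\<^esub> y) = r \<odot>\<^bsub>jmod V s\<^esub> jQ V s x y"
    and Q_quadratic: "\<lbrakk>r \<in> carrier R; x \<in> jcarrier V s; y \<in> jcarrier V (opp s)\<rbrakk> \<Longrightarrow>
      jQ V s (r \<odot>\<^bsub>jmod V s\<^esub> x) y = (r \<otimes>\<^bsub>R\<^esub> r) \<odot>\<^bsub>jmod V s\<^esub> jQ V s x y"
    and triple_add: "\<lbrakk>x \<in> jcarrier V s; x' \<in> jcarrier V s; y \<in> jcarrier V (opp s); z \<in> jcarrier V s\<rbrakk> \<Longrightarrow>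
      jtriple V s (x \<oplus>\<^bsub>jmod V s\<^esub> x') y z = jtriple V s x y z \<oplus>\<^bsub>jmod V s\<^esub> jtriple V s x' y z"
    and triple_smult: "\<lbrakk>r \<in> carrier R; x \<in> jcarrier V s; y \<in> jcarrier V (opp s); z \<in> jcarrier V s\<rbrakk> \<Longrightarrow>
      jtriple V s (r \<odot>\<^bsub>jmod V s\<^esub> x) y z = r \<odot>\<^bsub>jmod V s\<^esub> jtriple V s x y z"
    and JP1: "\<lbrakk>x \<in> jcarrier V s; y \<in> jcarrier V (opp s); z \<in> jcarrier V (opp s)\<rbrakk> \<Longrightarrow>
      jtriple V s x y (jQ V s x z) = jQ V s x (jtriple V (opp s) y x z)"
    and JP1_lin: "\<lbrakk>x \<in> jcarrier V s; w \<in> jcarrier V s; y \<in> jcarrier V (opp s); z \<in> jcarrier V (opp s)\<rbrakk> \<Longrightarrow>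
      jtriple V s w y (jQ V s x z) \<oplus>\<^bsub>jmod V s\<^esub> jtriple V s x y (jtriple V s x z w)
      = jtriple V s x (jtriple V (opp s) y x z) w \<oplus>\<^bsub>jmod V s\<^esub> jQ V s x (jtriple V (opp s) y w z)"
    and JP2: "\<lbrakk>x \<in> jcarrier V s; y \<in> jcarrier V (opp s); z \<in> jcarrier V s\<rbrakk> \<Longrightarrow>
      jtriple V s (jQ V s x y) y z = jtriple V s x (jQ V (opp s) y x) z"
    and JP3: "\<lbrakk>x \<in> jcarrier V s; y \<in> jcarrier V (opp s); z \<in> jcarrier V (opp s)\<rbrakk> \<Longrightarrow>
      jQ V s (jQ V s x y) z = jQ V s x (jQ V (opp s) y (jQ V s x z))"
    and JP3_lin: "\<lbrakk>x \<in> jcarrier V s; w \<in> jcarrier V s; y \<in> jcarrier V (opp s); z \<in> jcarrier V (opp s)\<rbrakk> \<Longrightarrow>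
      jtriple V s (jQ V s x y) z (jtriple V s x y w)
      = jtriple V s x (jQ V (opp s) y (jQ V s x z)) w
        \<oplus>\<^bsub>jmod V s\<^esub> jQ V s x (jQ V (opp s) y (jtriple V s x z w))"

definition jnondegenerate :: "('r, 'a) jpair \<Rightarrow> bool" where
  "jnondegenerate V \<longleftrightarrow>
    (\<forall>s. \<forall>x\<in>jcarrier V s.
      (\<forall>y\<in>jcarrier V (opp s). jQ V s x y = \<zero>\<^bsub>jmod V s\<^esub>) \<longrightarrow> x = \<zero>\<^bsub>jmod V s\<^esub>)"

definition jideal :: "('r, 'e) ring_scheme \<Rightarrow> ('r, 'a) jpair \<Rightarrow> (sign \<Rightarrow> 'a set) \<Rightarrow> bool" where
  "jideal R V U \<longleftrightarrow>
    (\<forall>s. submodule (U s) R (jmod V s) \<and>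
      (\<forall>u\<in>U s. \<forall>y\<in>jcarrier V (opp s). jQ V s u y \<in> U s) \<and>
      (\<forall>x\<in>jcarrier V s. \<forall>u\<in>U (opp s). jQ V s x u \<in> U s) \<and>
      (\<forall>u\<in>U s. \<forall>y\<in>jcarrier V (opp s). \<forall>z\<in>jcarrier V s. jtriple V s u y z \<in> U s))"

definition jessential :: "('r, 'e) ring_scheme \<Rightarrow> ('r, 'a) jpair \<Rightarrow> (sign \<Rightarrow> 'a set) \<Rightarrow> bool" where
  "jessential R V U \<longleftrightarrow> jideal R V U \<and>
    (\<forall>W. jideal R V W \<and> (\<exists>s. W s \<noteq> {\<zero>\<^bsub>jmod V s\<^esub>}) \<longrightarrow>
      (\<exists>s. U s \<inter> W s \<noteq> {\<zero>\<^bsub>jmod V s\<^esub>}))"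

definition jstar ::
  "('r, 'e) ring_scheme \<Rightarrow> ('r, 'a) jpair \<Rightarrow> (sign \<Rightarrow> 'a set) \<Rightarrow> (sign \<Rightarrow> 'a set) \<Rightarrow> sign \<Rightarrow> 'a set" where
  "jstar R V K I s = mspan R (jmod V s)
    ({jQ V s k i | k i. k \<in> K s \<and> i \<in> I (opp s)} \<union>
     {jQ V s v (jQ V (opp s) k i) | v k i. v \<in> jcarrier V s \<and> k \<in> K (opp s) \<and> i \<in> I s})"


section \<open>The extended centroid and the extended central closure of a Jordan pair\<close>

definition jhom ::
  "('r, 'e) ring_scheme \<Rightarrow> ('r, 'a) jpair \<Rightarrow> (sign \<Rightarrow> 'a set) \<Rightarrow> (sign \<Rightarrow> 'a \<Rightarrow> 'a) \<Rightarrow> bool" where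
  "jhom R V U g \<longleftrightarrow>
    (\<forall>s.
      g s \<in> U s \<rightarrow> jcarrier V s \<and>
      (\<forall>u\<in>U s. \<forall>u'\<in>U s. g s (u \<oplus>\<^bsub>jmod V s\<^esub> u') = g s u \<oplus>\<^bsub>jmod V s\<^esub> g s u') \<and>
      (\<forall>r\<in>carrier R. \<forall>u\<in>U s. g s (r \<odot>\<^bsub>jmod V s\<^esub> u) = r \<odot>\<^bsub>jmod V s\<^esub> g s u) \<and>
      (\<forall>x\<in>jcarrier V s. \<forall>y\<in>U (opp s). g s (jQ V s x y) = jQ V s x (g (opp s) y)) \<and>
      (\<forall>y\<in>U s. \<forall>x\<in>jcarrier V (opp s).
        g s (jQ V s y x) \<in> U s \<and> g s (g s (jQ V s y x)) = jQ V s (g s y) x) \<and>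
      (\<forall>y\<in>U s. \<forall>z\<in>jcarrier V (opp s). \<forall>x\<in>jcarrier V s.
        g s (jtriple V s y z x) = jtriple V s (g s y) z x))"

type_synonym 'a jpartial = "(sign \<Rightarrow> 'a \<Rightarrow> 'a) \<times> (sign \<Rightarrow> 'a set)"

definition jpermissible :: "('r, 'e) ring_scheme \<Rightarrow> ('r, 'a) jpair \<Rightarrow> 'a jpartial set" where
  "jpermissible R V = {(g, U). jessential R V U \<and> jhom R V U g}"

definition jequiv :: "('r, 'e) ring_scheme \<Rightarrow> ('r, 'a) jpair \<Rightarrow> ('a jpartial \<times> 'a jpartial) set" where
  "jequiv R V = {((g, U), (h, W)).
    (g, U) \<in> jpermissible R V \<and> (h, W) \<in> jpermissible R V \<and>
    (\<exists>K. jessential R V K \<and> (\<forall>s. K s \<subseteq> U s \<inter> W s) \<and> (\<forall>s. \<forall>x\<in>K s. g s x = h s x))}"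

definition jclass :: "('r, 'e) ring_scheme \<Rightarrow> ('r, 'a) jpair \<Rightarrow> 'a jpartial \<Rightarrow> 'a jpartial set" where
  "jclass R V p = jequiv R V `` {p}"

text \<open>
  Operations on classes are unions over all representatives, as in \<^const>\<open>rcoset_mult\<close>.  The extended
  centroid is an algebra over \<open>R\<close> by \<open>r [g, U] = [r g, U]\<close>, which is what the tensor product
  over \<open>R\<close> refers to.
\<close>

definition jcentroid :: "('r, 'e) ring_scheme \<Rightarrow> ('r, 'a) jpair \<Rightarrow> ('r, 'a jpartial set) module" where
  "jcentroid R V =
    (let K = (\<lambda>U\<^sub>1 U\<^sub>2. jstar R V (\<lambda>s. U\<^sub>1 s \<inter> U\<^sub>2 s) (jcarrier V)) in
    \<lparr>carrier = jpermissible R V // jequiv R V,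
     mult = (\<lambda>X Y. \<Union>(g\<^sub>1, U\<^sub>1)\<in>X. \<Union>(g\<^sub>2, U\<^sub>2)\<in>Y.
       jclass R V (\<lambda>s x. g\<^sub>1 s (g\<^sub>2 s x), jstar R V (K U\<^sub>1 U\<^sub>2) (jcarrier V))),
     one = jclass R V (\<lambda>s x. x, jcarrier V),
     zero = jclass R V (\<lambda>s x. \<zero>\<^bsub>jmod V s\<^esub>, jcarrier V),
     add = (\<lambda>X Y. \<Union>(g\<^sub>1, U\<^sub>1)\<in>X. \<Union>(g\<^sub>2, U\<^sub>2)\<in>Y.
       jclass R V (\<lambda>s x. g\<^sub>1 s x \<oplus>\<^bsub>jmod V s\<^esub> g\<^sub>2 s x, K U\<^sub>1 U\<^sub>2)),
     smult = (\<lambda>r X. \<Union>(g, U)\<in>X. jclass R V (\<lambda>s x. r \<odot>\<^bsub>jmod V s\<^esub> g s x, U))\<rparr>)"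

text \<open>
  The quadratic operator of \<open>A \<otimes>\<^sub>R V\<close> on formal sums:
  with \<open>x = \<Sum>\<^sub>i a\<^sub>i \<otimes> x\<^sub>i\<close>, the operator \<open>Q\<^sub>x\<close> maps \<open>b \<otimes> y\<close> to
  \<open>\<Sum>\<^sub>i a\<^sub>i a\<^sub>i b \<otimes> Q\<^bsub>x\<^sub>i\<^esub> y + \<Sum>\<^bsub>i < j\<^esub> a\<^sub>i a\<^sub>j b \<otimes> {x\<^sub>i, y, x\<^sub>j}\<close>.
\<close>

primrec tensor_Q ::
  "('r, 'c, 'f) module_scheme \<Rightarrow> ('r, 'a) jpair \<Rightarrow> sign \<Rightarrow>
   ('c \<times> 'a) list \<Rightarrow> ('c \<times> 'a) list \<Rightarrow> ('c \<times> 'a) list" where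
  "tensor_Q A V s [] ys = []"
| "tensor_Q A V s (p # xs) ys =
    [(fst p \<otimes>\<^bsub>A\<^esub> fst p \<otimes>\<^bsub>A\<^esub> b, jQ V s (snd p) y). (b, y) \<leftarrow> ys] @
    [(fst p \<otimes>\<^bsub>A\<^esub> c \<otimes>\<^bsub>A\<^esub> b, jtriple V s (snd p) y z). (b, y) \<leftarrow> ys, (c, z) \<leftarrow> xs] @
    tensor_Q A V s xs ys"

definition jtensor ::
  "('r, 'e) ring_scheme \<Rightarrow> ('r, 'c, 'f) module_scheme \<Rightarrow> ('r, 'a) jpair \<Rightarrow>
   ('c, ('c \<times> 'a) list set) jpair" where
  "jtensor R A V =
    \<lparr>jmod = (\<lambda>s. tensor R A (jmod V s)),
     jQ = (\<lambda>s X Y. \<Union>xs\<in>X. \<Union>ys\<in>Y. tensor_class R A (jmod V s) (tensor_Q A V s xs ys))\<rparr>"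

definition jquot :: "('r, 'a) jpair \<Rightarrow> (sign \<Rightarrow> 'a set) \<Rightarrow> ('r, 'a set) jpair" where
  "jquot V M =
    \<lparr>jmod = (\<lambda>s. quot_mod (jmod V s) (M s)),
     jQ = (\<lambda>s X Y. \<Union>x\<in>X. \<Union>y\<in>Y. M s +>\<^bsub>jmod V s\<^esub> jQ V s x y)\<rparr>"

definition jclosure_cond ::
  "('r, 'e) ring_scheme \<Rightarrow> ('r, 'a) jpair \<Rightarrow>
   (sign \<Rightarrow> ('a jpartial set \<times> 'a) list set set) \<Rightarrow> bool" where
  "jclosure_cond R V M \<longleftrightarrow>
    (let C = jcentroid R V; T = jtensor R C V; p = (\<lambda>s. pure_tensor R C (jmod V s)) in
      jideal C T M \<and>
      (\<forall>s. \<forall>\<rho>\<in>carrier C. \<forall>(g, U)\<in>jpermissible R V. \<forall>u\<in>U s.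
        p s (\<rho> \<otimes>\<^bsub>C\<^esub> jclass R V (g, U)) u \<ominus>\<^bsub>jmod T s\<^esub> p s \<rho> (g s u) \<in> M s) \<and>
      (\<forall>s. M s \<inter> p s \<one>\<^bsub>C\<^esub> ` jcarrier V s = {\<zero>\<^bsub>jmod T s\<^esub>}))"

definition jclosure_ideal ::
  "('r, 'e) ring_scheme \<Rightarrow> ('r, 'a) jpair \<Rightarrow> sign \<Rightarrow> ('a jpartial set \<times> 'a) list set set" where
  "jclosure_ideal R V =
    (THE M. jclosure_cond R V M \<and> (\<forall>N. jclosure_cond R V N \<and> M \<le> N \<longrightarrow> N = M))"

definition jcentral_closure ::
  "('r, 'e) ring_scheme \<Rightarrow> ('r, 'a) jpair \<Rightarrow>
   ('a jpartial set, ('a jpartial set \<times> 'a) list set set) jpair" where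
  "jcentral_closure R V = jquot (jtensor R (jcentroid R V) V) (jclosure_ideal R V)"


section \<open>The Tits-Kantor-Koecher algebra\<close>

text \<open>
  Endomorphisms of a module are represented by functions that are \<^const>\<open>undefined\<close> outside the carrier,
  so that equality of operators is equality on the carrier.
\<close>

definition jEnd :: "('r, 'e) ring_scheme \<Rightarrow> ('r, 'a) jpair \<Rightarrow> ('r, sign \<Rightarrow> 'a \<Rightarrow> 'a) module" where
  "jEnd R V =
    \<lparr>carrier = {d. \<forall>s. d s \<in> jcarrier V s \<rightarrow>\<^sub>E jcarrier V s \<and>
       (\<forall>x\<in>jcarrier V s. \<forall>y\<in>jcarrier V s.
         d s (x \<oplus>\<^bsub>jmod V s\<^esub> y) = d s x \<oplus>\<^bsub>jmod V s\<^esub> d s y) \<and>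
       (\<forall>r\<in>carrier R. \<forall>x\<in>jcarrier V s. d s (r \<odot>\<^bsub>jmod V s\<^esub> x) = r \<odot>\<^bsub>jmod V s\<^esub> d s x)},
     mult = (\<lambda>d e s. \<lambda>x\<in>jcarrier V s. d s (e s x) \<ominus>\<^bsub>jmod V s\<^esub> e s (d s x)),
     one = undefined,
     zero = (\<lambda>s. \<lambda>x\<in>jcarrier V s. \<zero>\<^bsub>jmod V s\<^esub>),
     add = (\<lambda>d e s. \<lambda>x\<in>jcarrier V s. d s x \<oplus>\<^bsub>jmod V s\<^esub> e s x),
     smult = (\<lambda>r d s. \<lambda>x\<in>jcarrier V s. r \<odot>\<^bsub>jmod V s\<^esub> d s x)\<rparr>"

definition jdelta :: "('r, 'a) jpair \<Rightarrow> 'a \<Rightarrow> 'a \<Rightarrow> sign \<Rightarrow> 'a \<Rightarrow> 'a" where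
  "jdelta V x y s =
    (case s of
      Pos \<Rightarrow> (\<lambda>z\<in>jcarrier V Pos. jtriple V Pos x y z)
    | Neg \<Rightarrow> (\<lambda>z\<in>jcarrier V Neg. \<ominus>\<^bsub>jmod V Neg\<^esub> jtriple V Neg y x z))"

definition IDer :: "('r, 'e) ring_scheme \<Rightarrow> ('r, 'a) jpair \<Rightarrow> (sign \<Rightarrow> 'a \<Rightarrow> 'a) set" where
  "IDer R V = mspan R (jEnd R V) {jdelta V x y | x y. x \<in> jcarrier V Pos \<and> y \<in> jcarrier V Neg}"

text \<open>The triple \<open>(x, d, y)\<close> is \<open>x + d + y\<close> in \<open>V\<^sup>+ \<oplus> IDer V \<oplus> V\<^sup>-\<close>.\<close>

definition TKK ::
  "('r, 'e) ring_scheme \<Rightarrow> ('r, 'a) jpair \<Rightarrow> ('r, 'a \<times> (sign \<Rightarrow> 'a \<Rightarrow> 'a) \<times> 'a) module" where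
  "TKK R V =
    (let P = jmod V Pos; D = jEnd R V; N = jmod V Neg in
    \<lparr>carrier = carrier P \<times> IDer R V \<times> carrier N,
     mult = (\<lambda>(x, d, y) (x', d', y').
       (d Pos x' \<ominus>\<^bsub>P\<^esub> d' Pos x,
        (d \<otimes>\<^bsub>D\<^esub> d' \<oplus>\<^bsub>D\<^esub> jdelta V x y') \<ominus>\<^bsub>D\<^esub> jdelta V x' y,
        d Neg y' \<ominus>\<^bsub>N\<^esub> d' Neg y)),
     one = undefined,
     zero = (\<zero>\<^bsub>P\<^esub>, \<zero>\<^bsub>D\<^esub>, \<zero>\<^bsub>N\<^esub>),
     add = (\<lambda>(x, d, y) (x', d', y'). (x \<oplus>\<^bsub>P\<^esub> x', d \<oplus>\<^bsub>D\<^esub> d', y \<oplus>\<^bsub>N\<^esub> y')),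
     smult = (\<lambda>r (x, d, y). (r \<odot>\<^bsub>P\<^esub> x, r \<odot>\<^bsub>D\<^esub> d, r \<odot>\<^bsub>N\<^esub> y))\<rparr>)"


section \<open>The extended centroid and the central closure of a Lie algebra\<close>

definition lie_ideal :: "('r, 'e) ring_scheme \<Rightarrow> ('r, 'a) module \<Rightarrow> 'a set \<Rightarrow> bool" where
  "lie_ideal R L I \<longleftrightarrow> submodule I R L \<and> (\<forall>x\<in>carrier L. \<forall>y\<in>I. x \<otimes>\<^bsub>L\<^esub> y \<in> I)"

definition lie_essential :: "('r, 'e) ring_scheme \<Rightarrow> ('r, 'a) module \<Rightarrow> 'a set \<Rightarrow> bool" where
  "lie_essential R L I \<longleftrightarrow> lie_ideal R L I \<and>
    (\<forall>J. lie_ideal R L J \<and> J \<noteq> {\<zero>\<^bsub>L\<^esub>} \<longrightarrow> I \<inter> J \<noteq> {\<zero>\<^bsub>L\<^esub>})"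

type_synonym 'a lpartial = "('a \<Rightarrow> 'a) \<times> 'a set"

definition lie_permissible :: "('r, 'e) ring_scheme \<Rightarrow> ('r, 'a) module \<Rightarrow> 'a lpartial set" where
  "lie_permissible R L = {(f, I). lie_essential R L I \<and> f \<in> I \<rightarrow> carrier L \<and>
    (\<forall>x\<in>I. \<forall>y\<in>I. f (x \<oplus>\<^bsub>L\<^esub> y) = f x \<oplus>\<^bsub>L\<^esub> f y) \<and>
    (\<forall>x\<in>carrier L. \<forall>y\<in>I. f (x \<otimes>\<^bsub>L\<^esub> y) = x \<otimes>\<^bsub>L\<^esub> f y)}"

definition lie_equiv ::
  "('r, 'e) ring_scheme \<Rightarrow> ('r, 'a) module \<Rightarrow> ('a lpartial \<times> 'a lpartial) set" where
  "lie_equiv R L = {((f, I), (h, J)).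
    (f, I) \<in> lie_permissible R L \<and> (h, J) \<in> lie_permissible R L \<and>
    (\<exists>K. lie_essential R L K \<and> K \<subseteq> I \<inter> J \<and> (\<forall>x\<in>K. f x = h x))}"

definition lie_class :: "('r, 'e) ring_scheme \<Rightarrow> ('r, 'a) module \<Rightarrow> 'a lpartial \<Rightarrow> 'a lpartial set" where
  "lie_class R L p = lie_equiv R L `` {p}"

definition lie_centroid :: "('r, 'e) ring_scheme \<Rightarrow> ('r, 'a) module \<Rightarrow> ('r, 'a lpartial set) module" where
  "lie_centroid R L =
    \<lparr>carrier = lie_permissible R L // lie_equiv R L,
     mult = (\<lambda>X Y. \<Union>(f\<^sub>1, I\<^sub>1)\<in>X. \<Union>(f\<^sub>2, I\<^sub>2)\<in>Y.
       lie_class R L (\<lambda>x. f\<^sub>1 (f\<^sub>2 x), {x \<in> I\<^sub>2. f\<^sub>2 x \<in> I\<^sub>1})),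
     one = lie_class R L (\<lambda>x. x, carrier L),
     zero = lie_class R L (\<lambda>x. \<zero>\<^bsub>L\<^esub>, carrier L),
     add = (\<lambda>X Y. \<Union>(f\<^sub>1, I\<^sub>1)\<in>X. \<Union>(f\<^sub>2, I\<^sub>2)\<in>Y.
       lie_class R L (\<lambda>x. f\<^sub>1 x \<oplus>\<^bsub>L\<^esub> f\<^sub>2 x, I\<^sub>1 \<inter> I\<^sub>2)),
     smult = (\<lambda>r X. \<Union>(f, I)\<in>X. lie_class R L (\<lambda>x. r \<odot>\<^bsub>L\<^esub> f x, I))\<rparr>"

definition lie_closure_rel ::
  "('r, 'e) ring_scheme \<Rightarrow> ('r, 'a) module \<Rightarrow> ('a lpartial set \<times> 'a) list set set" where
  "lie_closure_rel R L =
    (let C = lie_centroid R L; T = tensor R C L; p = pure_tensor R C L in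
      (\<lambda>I. lie_ideal C T I) hull
        {p (lie_class R L (f, U)) u \<ominus>\<^bsub>T\<^esub> p \<one>\<^bsub>C\<^esub> (f u) | f U u. (f, U) \<in> lie_permissible R L \<and> u \<in> U})"

definition lie_closure_cond ::
  "('r, 'e) ring_scheme \<Rightarrow> ('r, 'a) module \<Rightarrow> ('a lpartial set \<times> 'a) list set set \<Rightarrow> bool" where
  "lie_closure_cond R L M \<longleftrightarrow>
    (let C = lie_centroid R L; T = tensor R C L in
      lie_ideal C T M \<and> lie_closure_rel R L \<subseteq> M \<and>
      M \<inter> pure_tensor R C L \<one>\<^bsub>C\<^esub> ` carrier L = {\<zero>\<^bsub>T\<^esub>})"

definition lie_closure_ideal ::
  "('r, 'e) ring_scheme \<Rightarrow> ('r, 'a) module \<Rightarrow> ('a lpartial set \<times> 'a) list set set" where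
  "lie_closure_ideal R L =
    (THE M. lie_closure_cond R L M \<and> (\<forall>N. lie_closure_cond R L N \<and> M \<subseteq> N \<longrightarrow> N = M))"

definition lie_central_closure ::
  "('r, 'e) ring_scheme \<Rightarrow> ('r, 'a) module \<Rightarrow>
   ('a lpartial set, ('a lpartial set \<times> 'a) list set set) module" where
  "lie_central_closure R L = quot_mod (tensor R (lie_centroid R L) L) (lie_closure_ideal R L)"

end

theory Submission
  imports Defs
begin

text \<open>
  Write \<open>L = TKK(V)\<close>, graded as \<open>V\<^sup>+ \<oplus> IDer V \<oplus> V\<^sup>-\<close>.  The theorem compares two constructions, and both
  comparisons rest on one fact: nondegeneracy makes each component of \<open>L\<close> visible from \<open>V\<^sup>+\<close> and
  \<open>V\<^sup>-\<close>.  An inner derivation that kills one of the two modules kills the other one (\<open>D_zero_if\<close>), and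
  an element of \<open>V\<^sup>\<sigma>\<close> that pairs to zero with the opposite module is zero (\<open>dl_faithful\<close>).

  The extended centroids agree.  Every nonzero ideal of \<open>L\<close> meets \<open>V\<^sup>+\<close> or \<open>V\<^sup>-\<close> (\<open>lideal_meets_V\<close>), so
  an essential ideal of either structure yields one of the other (\<open>dom_ess\<close>, \<open>Uof_jess\<close>).  A
  permissible map of \<open>L\<close> commutes with all brackets, hence respects the grading (\<open>perm_graded\<close>) and
  restricts to a homomorphism of the pair (\<open>res_lin\<close>); a homomorphism of the pair extends to the
  ideal of \<open>L\<close> above its domain (\<open>ext_perm\<close>).  The quadratic conditions on homomorphisms follow from
  the trilinear ones because \<open>Q\<^sub>x y = {x, y, x} / 2\<close> (\<open>jhom_iff\<close>).  On classes this gives an isomorphism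
  \<open>psi\<close> from \<open>C(V)\<close> onto \<open>C(L)\<close> (\<open>psi_hom\<close>, \<open>psi_inj\<close>, \<open>psi_image\<close>).

  The maximal ideals are explicit.  A formal sum \<open>\<Sum>\<^sub>i c\<^sub>i \<otimes> x\<^sub>i\<close> in \<open>C(L) \<otimes> L\<close> acts on a small essential ideal
  by \<open>y \<mapsto> \<Sum>\<^sub>i [x\<^sub>i, c\<^sub>i y]\<close>.  The sums that act as zero form an ideal \<open>NL\<close>, and this is the ideal that
  defines the central closure of \<open>L\<close> (\<open>lie_closure_ideal_eq\<close>).  Its preimage \<open>MV\<close> in \<open>C(V) \<otimes> V\<close> is the
  ideal that defines the extended central closure of \<open>V\<close> (\<open>jclosure_ideal_eq\<close>).

  The isomorphism.  An inner derivation \<open>d\<close> of \<open>V\<close> has a unique scalar extension \<open>dh d\<close> to \<open>C(V)V\<close>, and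
  \<open>c \<otimes> (a, d, b) \<mapsto> (c a, c (dh d), c b)\<close> defines a homomorphism \<open>hh\<close> from \<open>C(L) \<otimes> L\<close> to \<open>TKK(C(V)V)\<close>.  It is
  onto because the target is generated by its two outer components (\<open>hh_surj\<close>).  The ideal \<open>NL\<close> is
  graded (\<open>proj_NL\<close>), and each homogeneous part of an element of \<open>NL\<close> is killed by \<open>hh\<close>
  (\<open>NL_ker\<close>); conversely the kernel of \<open>hh\<close> satisfies the conditions whose largest solution is \<open>NL\<close>
  (\<open>ker_NL\<close>).  So \<open>hh\<close> induces an isomorphism on the quotient.
\<close>

section \<open>Sums over lists in abelian groups\<close>

definition lsum :: "('g, 'e) ring_scheme \<Rightarrow> ('p \<Rightarrow> 'g) \<Rightarrow> 'p list \<Rightarrow> 'g" where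
  "lsum G f xs = foldr (\<lambda>p s. f p \<oplus>\<^bsub>G\<^esub> s) xs \<zero>\<^bsub>G\<^esub>"

lemma lsum_Nil [simp]: "lsum G f [] = \<zero>\<^bsub>G\<^esub>"
  and lsum_Cons [simp]: "lsum G f (p # xs) = f p \<oplus>\<^bsub>G\<^esub> lsum G f xs"
  by (simp_all add: lsum_def)

lemma lsum_map: "lsum G f (map g xs) = lsum G (\<lambda>p. f (g p)) xs"
  by (induction xs) auto

lemma lsum_cong: "(\<And>p. p \<in> set xs \<Longrightarrow> f p = g p) \<Longrightarrow> lsum G f xs = lsum G g xs"
  by (induction xs) auto

context abelian_group
begin

lemma lsum_closed [intro]: "(\<And>p. p \<in> set xs \<Longrightarrow> f p \<in> carrier G) \<Longrightarrow> lsum G f xs \<in> carrier G"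
  by (induction xs) auto

lemma lsum_append:
  assumes "\<And>p. p \<in> set xs \<union> set ys \<Longrightarrow> f p \<in> carrier G"
  shows "lsum G f (xs @ ys) = lsum G f xs \<oplus> lsum G f ys"
  using assms
proof (induction xs)
  case Nil
  then show ?case by (simp add: lsum_closed)
next
  case (Cons p xs)
  then show ?case
    by (simp add: lsum_closed a_assoc)
qed

lemma lsum_concat:
  assumes "\<And>p q. p \<in> set xs \<Longrightarrow> q \<in> set (g p) \<Longrightarrow> f q \<in> carrier G"
  shows "lsum G f (concat (map g xs)) = lsum G (\<lambda>p. lsum G f (g p)) xs"
  using assms
proof (induction xs)
  case (Cons p xs)
  then have IH: "lsum G f (concat (map g xs)) = lsum G (\<lambda>p. lsum G f (g p)) xs" by auto
  show ?case using Cons.prems by (simp add: IH[symmetric], subst lsum_append) auto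
qed simp

lemma lsum_add:
  assumes "\<And>p. p \<in> set xs \<Longrightarrow> f p \<in> carrier G" "\<And>p. p \<in> set xs \<Longrightarrow> g p \<in> carrier G"
  shows "lsum G (\<lambda>p. f p \<oplus> g p) xs = lsum G f xs \<oplus> lsum G g xs"
  using assms
proof (induction xs)
  case (Cons p xs)
  then show ?case by (simp add: lsum_closed a_ac)
qed (simp add: l_zero)

lemma lsum_zero: "(\<And>p. p \<in> set xs \<Longrightarrow> f p = \<zero>) \<Longrightarrow> lsum G f xs = \<zero>"
  by (induction xs) (auto simp: l_zero)

lemma lsum_hom:
  assumes "abelian_group H" "\<And>x y. x \<in> carrier G \<Longrightarrow> y \<in> carrier G \<Longrightarrow> \<phi> (x \<oplus> y) = \<phi> x \<oplus>\<^bsub>H\<^esub> \<phi> y"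
    "\<phi> \<zero> = \<zero>\<^bsub>H\<^esub>" "\<And>p. p \<in> set xs \<Longrightarrow> f p \<in> carrier G"
  shows "\<phi> (lsum G f xs) = lsum H (\<lambda>p. \<phi> (f p)) xs"
  using assms(4) by (induction xs) (auto simp: assms(2,3) lsum_closed)

lemma add_self_zero: "x \<in> carrier G \<Longrightarrow> x \<oplus> x = x \<Longrightarrow> x = \<zero>"
  by (metis add.r_cancel_one)

lemma eq_if_minus_zero: "x \<in> carrier G \<Longrightarrow> y \<in> carrier G \<Longrightarrow> x \<ominus> y = \<zero> \<longleftrightarrow> x = y"
  by (metis a_minus_def a_inv_closed minus_equality minus_minus r_neg)

lemma minus_eq_iff: "\<lbrakk>x \<in> carrier G; y \<in> carrier G; z \<in> carrier G\<rbrakk> \<Longrightarrow> x \<ominus> y = z \<longleftrightarrow> x = z \<oplus> y"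
  by (metis a_assoc a_inv_closed a_minus_def l_neg r_neg r_zero)

lemma add4: "\<lbrakk>a \<in> carrier G; b \<in> carrier G; c \<in> carrier G; d \<in> carrier G\<rbrakk> \<Longrightarrow>
   (a \<oplus> b) \<oplus> (c \<oplus> d) = (a \<oplus> c) \<oplus> (b \<oplus> d)"
  by (simp add: a_ac)

lemma minus_add4: "\<lbrakk>a \<in> carrier G; b \<in> carrier G; c \<in> carrier G; d \<in> carrier G\<rbrakk> \<Longrightarrow>
   (a \<oplus> b) \<ominus> (c \<oplus> d) = (a \<ominus> c) \<oplus> (b \<ominus> d)"
  by (simp add: a_minus_def minus_add a_ac)

end

section \<open>Scalar extension\<close>

locale tensor_module = A: algebra R A + M: module R M
  for R :: "('r, 'e) ring_scheme" and A :: "('r, 'c, 'f) module_scheme"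
    and M :: "('r, 'a, 'g) module_scheme"
begin

abbreviation T where "T \<equiv> tensor R A M"
abbreviation tc where "tc \<equiv> tensor_class R A M"
abbreviation teq where "teq \<equiv> tensor_eq R A M"
definition "tlists = lists (carrier A \<times> carrier M)"

lemma tlists_simps [simp]:
  "[] \<in> tlists"
  "(a, x) # xs \<in> tlists \<longleftrightarrow> a \<in> carrier A \<and> x \<in> carrier M \<and> xs \<in> tlists"
  "xs @ ys \<in> tlists \<longleftrightarrow> xs \<in> tlists \<and> ys \<in> tlists"
  by (auto simp: tlists_def)

lemma tlistsD: "(a, x) \<in> set xs \<Longrightarrow> xs \<in> tlists \<Longrightarrow> a \<in> carrier A \<and> x \<in> carrier M"
  by (auto simp: tlists_def)

lemma tlists_induct [consumes 1, case_names Nil Cons]: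
  assumes "xs \<in> tlists" "P []"
    "\<And>a x xs. \<lbrakk>a \<in> carrier A; x \<in> carrier M; xs \<in> tlists; P xs\<rbrakk> \<Longrightarrow> P ((a, x) # xs)"
  shows "P xs"
  using assms by (induction xs) (auto simp: tlists_def)

lemma teq_lists: "teq xs ys \<Longrightarrow> xs \<in> tlists \<and> ys \<in> tlists"
  by (induction rule: tensor_eq.induct) (simp_all add: tlists_def)

lemma teq_refl: "xs \<in> tlists \<Longrightarrow> teq xs xs"
  by (simp add: tlists_def tensor_eq.refl)

lemma teq_commute: "xs \<in> tlists \<Longrightarrow> ys \<in> tlists \<Longrightarrow> teq (xs @ ys) (ys @ xs)"
  by (simp add: tlists_def tensor_eq.commute)

text \<open>
  The congruence on lists is generated by identities that every balanced biadditive map satisfies, so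
  the sum of the values of such a map depends on the class only: the universal property.
\<close>

lemma teq_lift:
  assumes "teq xs ys" and G: "abelian_group G"
    and cl: "\<And>a x. a \<in> carrier A \<Longrightarrow> x \<in> carrier M \<Longrightarrow> B a x \<in> carrier G"
    and l: "\<And>a b x. \<lbrakk>a \<in> carrier A; b \<in> carrier A; x \<in> carrier M\<rbrakk> \<Longrightarrow> B (a \<oplus>\<^bsub>A\<^esub> b) x = B a x \<oplus>\<^bsub>G\<^esub> B b x"
    and r: "\<And>a x y. \<lbrakk>a \<in> carrier A; x \<in> carrier M; y \<in> carrier M\<rbrakk> \<Longrightarrow> B a (x \<oplus>\<^bsub>M\<^esub> y) = B a x \<oplus>\<^bsub>G\<^esub> B a y"
    and b: "\<And>r a x. \<lbrakk>r \<in> carrier R; a \<in> carrier A; x \<in> carrier M\<rbrakk> \<Longrightarrow> B (r \<odot>\<^bsub>A\<^esub> a) x = B a (r \<odot>\<^bsub>M\<^esub> x)"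
  shows "lsum G (\<lambda>(a, x). B a x) xs = lsum G (\<lambda>(a, x). B a x) ys"
proof -
  interpret G: abelian_group G by fact
  show ?thesis using assms(1)
  proof (induction rule: tensor_eq.induct)
    case (append xs xs' ys ys')
    then have "xs \<in> tlists" "xs' \<in> tlists" "ys \<in> tlists" "ys' \<in> tlists"
      using teq_lists by auto
    with append cl show ?case by (subst (1 2) G.lsum_append) (auto dest: tlistsD)
  next
    case (commute xs ys)
    have *: "p \<in> set xs \<union> set ys \<Longrightarrow> (case p of (a, x) \<Rightarrow> B a x) \<in> carrier G" for p
      using commute cl by (auto simp: tlists_def)
    then show ?case
      by (subst (1 2) G.lsum_append) (auto intro!: G.a_comm G.lsum_closed)
  next
    case (zero x)
    have "B \<zero>\<^bsub>A\<^esub> x = \<zero>\<^bsub>G\<^esub>"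
      using l[of "\<zero>\<^bsub>A\<^esub>" "\<zero>\<^bsub>A\<^esub>" x] zero cl[of "\<zero>\<^bsub>A\<^esub>" x] by (intro G.add_self_zero) auto
    then show ?case by simp
  qed (simp_all add: l r b cl)
qed

lemma tc_mem: "ys \<in> tc xs \<longleftrightarrow> teq xs ys"
  by (simp add: tensor_class_def)

lemma tc_eqI:
  assumes "teq xs ys"
  shows "tc xs = tc ys"
  using tensor_eq.trans[OF assms] tensor_eq.trans[OF tensor_eq.sym[OF assms]]
  by (simp add: tensor_class_def set_eq_iff) blast

lemma tc_eq_iff:
  assumes "xs \<in> tlists"
  shows "tc xs = tc ys \<longleftrightarrow> teq xs ys"
proof
  assume *: "tc xs = tc ys"
  have "xs \<in> tc ys" using teq_refl[OF assms] by (simp add: *[symmetric] tc_mem)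
  then have "teq ys xs" by (simp add: tc_mem)
  then show "teq xs ys" by (rule tensor_eq.sym)
qed (rule tc_eqI)

lemma Union_tc:
  assumes "xs \<in> tlists" and "\<And>xs'. teq xs xs' \<Longrightarrow> F xs' = F xs"
  shows "(\<Union>xs'\<in>tc xs. F xs') = F xs"
proof -
  have "xs \<in> tc xs" using teq_refl[OF assms(1)] by (simp add: tc_mem)
  moreover have "F xs' = F xs" if "xs' \<in> tc xs" for xs' using that by (simp add: tc_mem assms(2))
  ultimately show ?thesis by blast
qed

lemma Union_tc2:
  assumes "xs \<in> tlists" "ys \<in> tlists"
    and "\<And>xs' ys'. teq xs xs' \<Longrightarrow> teq ys ys' \<Longrightarrow> F xs' ys' = F xs ys"
  shows "(\<Union>xs'\<in>tc xs. \<Union>ys'\<in>tc ys. F xs' ys') = F xs ys"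
proof -
  have "(\<Union>ys'\<in>tc ys. F xs' ys') = F xs ys" if "teq xs xs'" for xs'
    using teq_refl[OF assms(2)] by (auto simp: tc_mem assms(3)[OF that])
  then show ?thesis
    using teq_refl[OF assms(1)] by (auto simp: tc_mem)
qed

lemma T_carrier: "carrier T = tc ` tlists"
  and T_zero: "\<zero>\<^bsub>T\<^esub> = tc []"
  by (simp_all add: tensor_def tlists_def)

lemma T_cases:
  assumes "X \<in> carrier T"
  obtains xs where "xs \<in> tlists" "X = tc xs"
  using assms by (auto simp: T_carrier)

lemma tc_closed [simp, intro]: "xs \<in> tlists \<Longrightarrow> tc xs \<in> carrier T"
  by (simp add: T_carrier)

lemma T_add: "xs \<in> tlists \<Longrightarrow> ys \<in> tlists \<Longrightarrow> tc xs \<oplus>\<^bsub>T\<^esub> tc ys = tc (xs @ ys)"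
  unfolding tensor_def
  by (simp, rule Union_tc2)
    (assumption+, rule tc_eqI, rule tensor_eq.append, erule tensor_eq.sym, erule tensor_eq.sym)

abbreviation scale where "scale c \<equiv> map (\<lambda>(a, x). (c \<otimes>\<^bsub>A\<^esub> a, x))"

lemma scale_lists [simp]: "c \<in> carrier A \<Longrightarrow> xs \<in> tlists \<Longrightarrow> scale c xs \<in> tlists"
  by (rotate_tac, induction rule: tlists_induct) auto

lemma smult_comm: "r \<in> carrier R \<Longrightarrow> a \<in> carrier A \<Longrightarrow> c \<in> carrier A \<Longrightarrow>
    c \<otimes>\<^bsub>A\<^esub> (r \<odot>\<^bsub>A\<^esub> a) = r \<odot>\<^bsub>A\<^esub> (c \<otimes>\<^bsub>A\<^esub> a)"
  using A.smult_assoc2[of r a c] by (simp add: A.m_comm)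

lemma scale_cong: "teq xs ys \<Longrightarrow> c \<in> carrier A \<Longrightarrow> teq (scale c xs) (scale c ys)"
proof (induction rule: tensor_eq.induct)
  case (trans xs ys zs)
  then show ?case by (meson tensor_eq.trans)
next
  case (commute xs ys)
  then show ?case by (simp add: tlists_def[symmetric] teq_commute)
next
  case (refl xs)
  then show ?case by (simp add: tlists_def[symmetric] teq_refl)
next
  case (add_left a b x)
  then show ?case using tensor_eq.add_left[of "c \<otimes>\<^bsub>A\<^esub> a" A "c \<otimes>\<^bsub>A\<^esub> b" x M R] by (simp add: A.r_distr)
next
  case (sym xs ys)
  then show ?case by (meson tensor_eq.sym)
next
  case (append xs xs' ys ys')
  then show ?case by (simp add: tensor_eq.append)
next
  case (zero x)
  then show ?case by (simp add: tensor_eq.zero)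
next
  case (add_right a x y)
  then show ?case by (simp add: tensor_eq.add_right)
next
  case (balance r a x)
  then show ?case using tensor_eq.balance[of r R "c \<otimes>\<^bsub>A\<^esub> a" A x M] by (simp add: smult_comm)
qed

lemma T_smult: "c \<in> carrier A \<Longrightarrow> xs \<in> tlists \<Longrightarrow> c \<odot>\<^bsub>T\<^esub> tc xs = tc (scale c xs)"
  unfolding tensor_def
  by (simp, rule Union_tc) (assumption+, rule tc_eqI, rule scale_cong, erule tensor_eq.sym)

lemma T_abelian_group: "abelian_group T"
proof (rule abelian_groupI)
  show "x \<oplus>\<^bsub>T\<^esub> y \<in> carrier T" if "x \<in> carrier T" "y \<in> carrier T" for x y
    using that by (elim T_cases, simp add: T_add)
  show "\<zero>\<^bsub>T\<^esub> \<in> carrier T" by (auto simp: T_zero)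
  show "x \<oplus>\<^bsub>T\<^esub> y \<oplus>\<^bsub>T\<^esub> z = x \<oplus>\<^bsub>T\<^esub> (y \<oplus>\<^bsub>T\<^esub> z)"
    if "x \<in> carrier T" "y \<in> carrier T" "z \<in> carrier T" for x y z
    using that by (elim T_cases, simp add: T_add)
  show "x \<oplus>\<^bsub>T\<^esub> y = y \<oplus>\<^bsub>T\<^esub> x" if "x \<in> carrier T" "y \<in> carrier T" for x y
    using that by (elim T_cases) (simp add: T_add, rule tc_eqI, rule teq_commute)
  show "\<zero>\<^bsub>T\<^esub> \<oplus>\<^bsub>T\<^esub> x = x" if "x \<in> carrier T" for x
    using that by (elim T_cases, simp add: T_add T_zero)
  show "\<exists>y\<in>carrier T. y \<oplus>\<^bsub>T\<^esub> x = \<zero>\<^bsub>T\<^esub>" if "x \<in> carrier T" for x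
    using that
  proof (elim T_cases)
    fix xs assume xs: "xs \<in> tlists" and x: "x = tc xs"
    have "\<exists>ys\<in>tlists. teq (ys @ xs) []" using xs
    proof (induction rule: tlists_induct)
      case Nil
      then show ?case using teq_refl[of "[]"] by (intro bexI[of _ "[]"]) auto
    next
      case p: (Cons a y xs)
      then obtain ys where ys: "ys \<in> tlists" "teq (ys @ xs) []" by auto
      let ?n = "[(\<ominus>\<^bsub>A\<^esub> a, y), (a, y)]"
      have a: "teq [(\<zero>\<^bsub>A\<^esub>, y)] ?n"
        using p tensor_eq.add_left[of "\<ominus>\<^bsub>A\<^esub> a" A a y M R] by (simp add: A.l_neg)
      have b: "teq [(\<zero>\<^bsub>A\<^esub>, y)] []"
        using p by (intro tensor_eq.zero) auto
      have 1: "teq ?n []" by (rule tensor_eq.trans[OF tensor_eq.sym[OF a] b])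
      have 2: "teq ((ys @ ?n) @ xs) ((?n @ ys) @ xs)"
        using p ys by (intro tensor_eq.append[OF teq_commute teq_refl]) auto
      have 3: "teq (?n @ (ys @ xs)) []"
        using tensor_eq.append[OF 1 ys(2)] by simp
      have "teq ((ys @ ?n) @ xs) []"
        by (rule tensor_eq.trans[OF 2]) (use 3 in simp)
      then have "teq ((ys @ [(\<ominus>\<^bsub>A\<^esub> a, y)]) @ (a, y) # xs) []" by simp
      then show ?case using p ys by (intro bexI[of _ "ys @ [(\<ominus>\<^bsub>A\<^esub> a, y)]"]) auto
    qed
    then obtain ys where "ys \<in> tlists" "teq (ys @ xs) []" by blast
    with xs x have "tc ys \<oplus>\<^bsub>T\<^esub> x = \<zero>\<^bsub>T\<^esub>" "tc ys \<in> carrier T"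
      using tc_eqI[of "ys @ xs" "[]"] by (simp_all add: T_add T_zero)
    then show ?thesis by blast
  qed
qed

sublocale T: abelian_group T by (rule T_abelian_group)

abbreviation pt where "pt a x \<equiv> tc [(a, x)]"

lemma tc_lsum: "xs \<in> tlists \<Longrightarrow> tc xs = lsum T (\<lambda>(a, x). pt a x) xs"
proof (induction rule: tlists_induct)
  case (Cons a x xs)
  then have "tc ((a, x) # xs) = pt a x \<oplus>\<^bsub>T\<^esub> tc xs" by (subst T_add) auto
  with Cons show ?case by simp
qed (simp add: T_zero)

lemma pt_add_left: "\<lbrakk>a \<in> carrier A; b \<in> carrier A; x \<in> carrier M\<rbrakk> \<Longrightarrow> pt (a \<oplus>\<^bsub>A\<^esub> b) x = pt a x \<oplus>\<^bsub>T\<^esub> pt b x"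
  by (subst T_add) (auto intro!: tc_eqI tensor_eq.add_left)

lemma pt_add_right: "\<lbrakk>a \<in> carrier A; x \<in> carrier M; y \<in> carrier M\<rbrakk> \<Longrightarrow> pt a (x \<oplus>\<^bsub>M\<^esub> y) = pt a x \<oplus>\<^bsub>T\<^esub> pt a y"
  by (subst T_add) (auto intro!: tc_eqI tensor_eq.add_right)

lemma pt_balance: "\<lbrakk>r \<in> carrier R; a \<in> carrier A; x \<in> carrier M\<rbrakk> \<Longrightarrow> pt (r \<odot>\<^bsub>A\<^esub> a) x = pt a (r \<odot>\<^bsub>M\<^esub> x)"
  by (auto intro!: tc_eqI tensor_eq.balance)

lemma pt_smult: "\<lbrakk>c \<in> carrier A; a \<in> carrier A; x \<in> carrier M\<rbrakk> \<Longrightarrow> c \<odot>\<^bsub>T\<^esub> pt a x = pt (c \<otimes>\<^bsub>A\<^esub> a) x"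
  by (subst T_smult) auto

lemma pt_zero_right: "a \<in> carrier A \<Longrightarrow> pt a \<zero>\<^bsub>M\<^esub> = \<zero>\<^bsub>T\<^esub>"
  using pt_add_right[of a "\<zero>\<^bsub>M\<^esub>" "\<zero>\<^bsub>M\<^esub>"] by (intro T.add_self_zero) auto

lemma pt_minus_right: "a \<in> carrier A \<Longrightarrow> x \<in> carrier M \<Longrightarrow> pt a (\<ominus>\<^bsub>M\<^esub> x) = \<ominus>\<^bsub>T\<^esub> pt a x"
  using pt_add_right[of a "\<ominus>\<^bsub>M\<^esub> x" x] by (intro T.minus_equality[symmetric]) (auto simp: M.l_neg pt_zero_right)

lemma tc_scale: "c \<in> carrier A \<Longrightarrow> xs \<in> tlists \<Longrightarrow>
    tc (scale c xs) = lsum T (\<lambda>(a, x). pt (c \<otimes>\<^bsub>A\<^esub> a) x) xs"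
  by (subst tc_lsum[OF scale_lists]) (simp_all add: lsum_map case_prod_unfold)

lemma T_module: "module A T"
proof (rule moduleI)
  show "cring A" by (rule A.M_cring)
  show "abelian_group T" by (rule T_abelian_group)
  show "c \<odot>\<^bsub>T\<^esub> X \<in> carrier T" if "c \<in> carrier A" "X \<in> carrier T" for c X
    using that by (elim T_cases, simp add: T_smult)
  show "c \<odot>\<^bsub>T\<^esub> (X \<oplus>\<^bsub>T\<^esub> Y) = c \<odot>\<^bsub>T\<^esub> X \<oplus>\<^bsub>T\<^esub> c \<odot>\<^bsub>T\<^esub> Y"
    if "c \<in> carrier A" "X \<in> carrier T" "Y \<in> carrier T" for c X Y
    using that by (elim T_cases, simp add: T_smult T_add)
  show "\<one>\<^bsub>A\<^esub> \<odot>\<^bsub>T\<^esub> X = X" if "X \<in> carrier T" for X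
    using that
  proof (elim T_cases)
    fix xs assume "xs \<in> tlists" "X = tc xs"
    moreover from this have "scale \<one>\<^bsub>A\<^esub> xs = xs" by (intro map_idI) (auto dest: tlistsD)
    ultimately show ?thesis by (simp add: T_smult)
  qed
  show "c \<otimes>\<^bsub>A\<^esub> e \<odot>\<^bsub>T\<^esub> X = c \<odot>\<^bsub>T\<^esub> (e \<odot>\<^bsub>T\<^esub> X)"
    if "c \<in> carrier A" "e \<in> carrier A" "X \<in> carrier T" for c e X
    using that(3)
  proof (elim T_cases)
    fix xs assume xs: "xs \<in> tlists" and X: "X = tc xs"
    have "scale (c \<otimes>\<^bsub>A\<^esub> e) xs = scale c (scale e xs)"
      using xs that by (auto simp: A.m_assoc dest: tlistsD)
    then show ?thesis using xs X that by (simp add: T_smult del: map_map)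
  qed
  show "(c \<oplus>\<^bsub>A\<^esub> e) \<odot>\<^bsub>T\<^esub> X = c \<odot>\<^bsub>T\<^esub> X \<oplus>\<^bsub>T\<^esub> e \<odot>\<^bsub>T\<^esub> X"
    if "c \<in> carrier A" "e \<in> carrier A" "X \<in> carrier T" for c e X
    using that(3)
  proof (elim T_cases)
    fix xs assume xs: "xs \<in> tlists" and X: "X = tc xs"
    have "tc (scale (c \<oplus>\<^bsub>A\<^esub> e) xs) = lsum T (\<lambda>(a, x). pt ((c \<oplus>\<^bsub>A\<^esub> e) \<otimes>\<^bsub>A\<^esub> a) x) xs"
      using xs that by (intro tc_scale) auto
    also have "\<dots> = lsum T (\<lambda>p. (case p of (a, x) \<Rightarrow> pt (c \<otimes>\<^bsub>A\<^esub> a) x) \<oplus>\<^bsub>T\<^esub> (case p of (a, x) \<Rightarrow> pt (e \<otimes>\<^bsub>A\<^esub> a) x)) xs"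
      using xs that by (intro lsum_cong) (auto simp: A.l_distr pt_add_left dest: tlistsD)
    also have "\<dots> = tc (scale c xs) \<oplus>\<^bsub>T\<^esub> tc (scale e xs)"
      using xs that by (subst T.lsum_add) (auto simp: tc_scale intro!: tc_closed dest: tlistsD)
    finally show ?thesis using xs X that by (simp add: T_smult)
  qed
qed

sublocale T: module A T by (rule T_module)

lemma T_induct [consumes 1, case_names zero add]:
  assumes "X \<in> carrier T" and "P \<zero>\<^bsub>T\<^esub>"
    and "\<And>a x Y. \<lbrakk>a \<in> carrier A; x \<in> carrier M; Y \<in> carrier T; P Y\<rbrakk> \<Longrightarrow> P (pt a x \<oplus>\<^bsub>T\<^esub> Y)"
  shows "P X"
proof -
  obtain xs where xs: "xs \<in> tlists" "X = tc xs" using assms(1) by (rule T_cases)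
  have "P (tc xs)" using xs(1)
  proof (induction rule: tlists_induct)
    case (Cons a x xs)
    then have "tc ((a, x) # xs) = pt a x \<oplus>\<^bsub>T\<^esub> tc xs" by (subst T_add) auto
    with Cons assms(3) show ?case by auto
  qed (use assms(2) in \<open>simp add: T_zero\<close>)
  with xs show ?thesis by simp
qed

end

definition tprod :: "('r, 'c, 'f) module_scheme \<Rightarrow> ('r, 'a, 'g) module_scheme \<Rightarrow> ('c \<times> 'a) list \<Rightarrow>
    ('c \<times> 'a) list \<Rightarrow> ('c \<times> 'a) list" where
  "tprod A M xs ys = [(a \<otimes>\<^bsub>A\<^esub> b, x \<otimes>\<^bsub>M\<^esub> y). (a, x) \<leftarrow> xs, (b, y) \<leftarrow> ys]"

locale tensor_algebra = tensor_module +
  assumes mult_closed: "x \<in> carrier M \<Longrightarrow> y \<in> carrier M \<Longrightarrow> x \<otimes>\<^bsub>M\<^esub> y \<in> carrier M"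
    and mult_add_left: "\<lbrakk>x \<in> carrier M; x' \<in> carrier M; y \<in> carrier M\<rbrakk> \<Longrightarrow>
      (x \<oplus>\<^bsub>M\<^esub> x') \<otimes>\<^bsub>M\<^esub> y = x \<otimes>\<^bsub>M\<^esub> y \<oplus>\<^bsub>M\<^esub> x' \<otimes>\<^bsub>M\<^esub> y"
    and mult_add_right: "\<lbrakk>x \<in> carrier M; y \<in> carrier M; y' \<in> carrier M\<rbrakk> \<Longrightarrow>
      x \<otimes>\<^bsub>M\<^esub> (y \<oplus>\<^bsub>M\<^esub> y') = x \<otimes>\<^bsub>M\<^esub> y \<oplus>\<^bsub>M\<^esub> x \<otimes>\<^bsub>M\<^esub> y'"
    and mult_smult_left: "\<lbrakk>r \<in> carrier R; x \<in> carrier M; y \<in> carrier M\<rbrakk> \<Longrightarrow>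
      (r \<odot>\<^bsub>M\<^esub> x) \<otimes>\<^bsub>M\<^esub> y = r \<odot>\<^bsub>M\<^esub> (x \<otimes>\<^bsub>M\<^esub> y)"
    and mult_smult_right: "\<lbrakk>r \<in> carrier R; x \<in> carrier M; y \<in> carrier M\<rbrakk> \<Longrightarrow>
      x \<otimes>\<^bsub>M\<^esub> (r \<odot>\<^bsub>M\<^esub> y) = r \<odot>\<^bsub>M\<^esub> (x \<otimes>\<^bsub>M\<^esub> y)"
begin

lemma tprod_lists:
  assumes "xs \<in> tlists" "ys \<in> tlists"
  shows "tprod A M xs ys \<in> tlists"
proof -
  have "p \<in> carrier A \<times> carrier M" if "p \<in> set (tprod A M xs ys)" for p
    using that assms by (auto simp: tprod_def mult_closed dest!: tlistsD)
  then show ?thesis by (simp add: tlists_def in_lists_conv_set)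
qed

lemma tc_tprod:
  assumes "xs \<in> tlists" "ys \<in> tlists"
  shows "tc (tprod A M xs ys) =
    lsum T (\<lambda>(a, x). lsum T (\<lambda>(b, y). pt (a \<otimes>\<^bsub>A\<^esub> b) (x \<otimes>\<^bsub>M\<^esub> y)) ys) xs"
  unfolding tc_lsum[OF tprod_lists[OF assms]] unfolding tprod_def
  using assms
  by (subst T.lsum_concat) (auto simp: lsum_map case_prod_unfold mult_closed dest!: tlistsD intro!: lsum_cong)

lemma teq_tprod:
  assumes "teq xs xs'" "teq ys ys'"
  shows "tc (tprod A M xs ys) = tc (tprod A M xs' ys')"
proof -
  have l: "xs \<in> tlists" "xs' \<in> tlists" "ys \<in> tlists" "ys' \<in> tlists"
    using assms teq_lists by auto
  let ?B = "\<lambda>zs a x. lsum T (\<lambda>(b, y). pt (a \<otimes>\<^bsub>A\<^esub> b) (x \<otimes>\<^bsub>M\<^esub> y)) zs"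
  have cl: "\<And>a x zs. a \<in> carrier A \<Longrightarrow> x \<in> carrier M \<Longrightarrow> zs \<in> tlists \<Longrightarrow> ?B zs a x \<in> carrier T"
    by (auto intro!: T.lsum_closed mult_closed tc_closed dest: tlistsD)
  have 1: "lsum T (\<lambda>(a, x). ?B ys a x) xs = lsum T (\<lambda>(a, x). ?B ys a x) xs'"
  proof (rule teq_lift[OF assms(1) T_abelian_group])
    show "?B ys (a \<oplus>\<^bsub>A\<^esub> b) x = ?B ys a x \<oplus>\<^bsub>T\<^esub> ?B ys b x"
      if "a \<in> carrier A" "b \<in> carrier A" "x \<in> carrier M" for a b x
      using that l(3)
      by (subst T.lsum_add[symmetric]) (auto intro!: lsum_cong simp: pt_add_left mult_closed A.l_distr dest: tlistsD)
    show "?B ys a (x \<oplus>\<^bsub>M\<^esub> y) = ?B ys a x \<oplus>\<^bsub>T\<^esub> ?B ys a y"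
      if "a \<in> carrier A" "x \<in> carrier M" "y \<in> carrier M" for a x y
      using that l(3)
      by (subst T.lsum_add[symmetric]) (auto intro!: lsum_cong simp: pt_add_right mult_closed mult_add_left dest: tlistsD)
    show "?B ys (r \<odot>\<^bsub>A\<^esub> a) x = ?B ys a (r \<odot>\<^bsub>M\<^esub> x)"
      if "r \<in> carrier R" "a \<in> carrier A" "x \<in> carrier M" for r a x
      using that l(3)
      by (auto intro!: lsum_cong[of ys] simp: mult_closed A.smult_assoc2 mult_smult_left pt_balance dest: tlistsD)
  qed (use l cl in auto)
  have 2: "?B ys a x = ?B ys' a x" if "a \<in> carrier A" "x \<in> carrier M" for a x
    using that
    by (intro teq_lift[OF assms(2) T_abelian_group])
       (simp_all add: mult_closed A.r_distr pt_add_left mult_add_right pt_add_right smult_comm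
         pt_balance mult_smult_right)
  show ?thesis
    unfolding tc_tprod[OF l(1,3)] tc_tprod[OF l(2,4)] 1
    using l(2) by (intro lsum_cong) (auto simp: 2 dest: tlistsD)
qed

lemma T_mult: "xs \<in> tlists \<Longrightarrow> ys \<in> tlists \<Longrightarrow> tc xs \<otimes>\<^bsub>T\<^esub> tc ys = tc (tprod A M xs ys)"
  unfolding tensor_def
  by (simp add: tprod_def[symmetric], rule Union_tc2) (assumption+, rule teq_tprod, erule tensor_eq.sym, erule tensor_eq.sym)

lemma T_mult_closed: "X \<in> carrier T \<Longrightarrow> Y \<in> carrier T \<Longrightarrow> X \<otimes>\<^bsub>T\<^esub> Y \<in> carrier T"
  by (elim T_cases, simp add: T_mult tprod_lists)

lemma T_mult_add_left: "\<lbrakk>X \<in> carrier T; X' \<in> carrier T; Y \<in> carrier T\<rbrakk> \<Longrightarrow>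
    (X \<oplus>\<^bsub>T\<^esub> X') \<otimes>\<^bsub>T\<^esub> Y = X \<otimes>\<^bsub>T\<^esub> Y \<oplus>\<^bsub>T\<^esub> X' \<otimes>\<^bsub>T\<^esub> Y"
  by (elim T_cases, simp add: T_mult T_add tprod_lists) (simp add: tprod_def)

lemma T_mult_add_right: "\<lbrakk>X \<in> carrier T; Y \<in> carrier T; Y' \<in> carrier T\<rbrakk> \<Longrightarrow>
    X \<otimes>\<^bsub>T\<^esub> (Y \<oplus>\<^bsub>T\<^esub> Y') = X \<otimes>\<^bsub>T\<^esub> Y \<oplus>\<^bsub>T\<^esub> X \<otimes>\<^bsub>T\<^esub> Y'"
proof (elim T_cases)
  fix xs ys zs assume *: "xs \<in> tlists" "ys \<in> tlists" "zs \<in> tlists" "X = tc xs" "Y = tc ys" "Y' = tc zs"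
  have row: "lsum T (\<lambda>(b, y). pt (a \<otimes>\<^bsub>A\<^esub> b) (x \<otimes>\<^bsub>M\<^esub> y)) (ys @ zs) =
      lsum T (\<lambda>(b, y). pt (a \<otimes>\<^bsub>A\<^esub> b) (x \<otimes>\<^bsub>M\<^esub> y)) ys \<oplus>\<^bsub>T\<^esub>
      lsum T (\<lambda>(b, y). pt (a \<otimes>\<^bsub>A\<^esub> b) (x \<otimes>\<^bsub>M\<^esub> y)) zs" if "(a, x) \<in> set xs" for a x
    using tlistsD[OF that] * by (intro T.lsum_append) (auto simp: mult_closed dest!: tlistsD)
  have "lsum T (\<lambda>(a, x). lsum T (\<lambda>(b, y). pt (a \<otimes>\<^bsub>A\<^esub> b) (x \<otimes>\<^bsub>M\<^esub> y)) (ys @ zs)) xs =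
     lsum T (\<lambda>p. (case p of (a, x) \<Rightarrow> lsum T (\<lambda>(b, y). pt (a \<otimes>\<^bsub>A\<^esub> b) (x \<otimes>\<^bsub>M\<^esub> y)) ys) \<oplus>\<^bsub>T\<^esub>
       (case p of (a, x) \<Rightarrow> lsum T (\<lambda>(b, y). pt (a \<otimes>\<^bsub>A\<^esub> b) (x \<otimes>\<^bsub>M\<^esub> y)) zs)) xs"
    by (intro lsum_cong) (auto simp: row)
  also have "\<dots> = tc (tprod A M xs ys) \<oplus>\<^bsub>T\<^esub> tc (tprod A M xs zs)"
    using * unfolding tc_tprod[OF *(1,2)] tc_tprod[OF *(1,3)]
    by (intro T.lsum_add) (auto intro!: T.lsum_closed simp: mult_closed dest!: tlistsD)
  finally show ?thesis
    using * by (simp add: T_mult T_add[OF *(2,3)] tc_tprod)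
qed

lemma pt_mult: "\<lbrakk>a \<in> carrier A; x \<in> carrier M; b \<in> carrier A; y \<in> carrier M\<rbrakk> \<Longrightarrow>
    pt a x \<otimes>\<^bsub>T\<^esub> pt b y = pt (a \<otimes>\<^bsub>A\<^esub> b) (x \<otimes>\<^bsub>M\<^esub> y)"
  by (simp add: T_mult tprod_def)

end

section \<open>Quotient modules and spans\<close>

lemma (in module) submodule_zero: "submodule H R M \<Longrightarrow> \<zero>\<^bsub>M\<^esub> \<in> H"
  using subgroup.one_closed[OF submodule.axioms(1)] by fastforce

lemma mspan_iff: "x \<in> mspan R M A \<longleftrightarrow> (\<forall>H. submodule H R M \<longrightarrow> A \<subseteq> H \<longrightarrow> x \<in> H)"
  by (auto simp: mspan_def hull_def)

lemma (in module) mspan_submodule: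
  assumes "A \<subseteq> carrier M"
  shows "submodule (mspan R M A) R M"
proof (rule submoduleI)
  show "mspan R M A \<subseteq> carrier M"
    using carrier_is_submodule assms by (simp add: subset_iff mspan_iff)
qed (simp_all add: mspan_iff submodule_zero submoduleE(3,4,5))

lemma mspan_subset: "submodule H R M \<Longrightarrow> A \<subseteq> H \<Longrightarrow> mspan R M A \<subseteq> H"
  unfolding mspan_def by (rule hull_minimal)

lemma mspan_inc: "x \<in> A \<Longrightarrow> x \<in> mspan R M A"
  unfolding mspan_def by (rule hull_inc)

lemma (in module) submodule_minus: "submodule H R M \<Longrightarrow> x \<in> H \<Longrightarrow> y \<in> H \<Longrightarrow> x \<ominus>\<^bsub>M\<^esub> y \<in> H"
  by (simp add: a_minus_def submoduleE(3,5))

lemma (in module) submodule_Int: "submodule H R M \<Longrightarrow> submodule K R M \<Longrightarrow> submodule (H \<inter> K) R M"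
  using submoduleE[of H] submoduleE[of K] submodule_zero
  by (intro submoduleI) auto

locale quotient_module = Mo: module R M
  for R :: "('r, 'e) ring_scheme" and M :: "('r, 'a, 'f) module_scheme" +
  fixes N assumes sub: "submodule N R M"
begin

abbreviation cs where "cs x \<equiv> N +>\<^bsub>M\<^esub> x"
abbreviation Q where "Q \<equiv> quot_mod M N"

sublocale N: abelian_subgroup N M
  by (rule abelian_subgroupI3)
     (simp_all add: additive_subgroup_def submodule.axioms(1)[OF sub] Mo.abelian_group_axioms)

lemma N_in: "n \<in> N \<Longrightarrow> n \<in> carrier M"
  using N.a_subset by blast

lemma cs_eq_iff:
  assumes "x \<in> carrier M" "y \<in> carrier M"
  shows "cs x = cs y \<longleftrightarrow> x \<ominus>\<^bsub>M\<^esub> y \<in> N"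
proof
  assume "cs x = cs y"
  then show "x \<ominus>\<^bsub>M\<^esub> y \<in> N"
    unfolding a_minus_def
    using assms by (intro Mo.a_coset_join1[OF Mo.a_coset_add_inv2 _ N.a_subgroup] N.a_subset) auto
next
  assume "x \<ominus>\<^bsub>M\<^esub> y \<in> N"
  then show "cs x = cs y"
    unfolding a_minus_def
    using assms by (intro Mo.a_coset_add_inv1[OF Mo.a_coset_join2[OF _ N.a_subgroup]] N.a_subset) auto
qed

lemma cs_add_N: "x \<in> carrier M \<Longrightarrow> n \<in> N \<Longrightarrow> cs (x \<oplus>\<^bsub>M\<^esub> n) = cs x"
  using N_in[of n] Mo.minus_eq_iff[of "x \<oplus>\<^bsub>M\<^esub> n" x n] by (simp add: cs_eq_iff Mo.a_comm)

lemma mem_cs: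
  assumes "x \<in> carrier M" "x' \<in> cs x"
  obtains n where "n \<in> N" "x' = x \<oplus>\<^bsub>M\<^esub> n"
  using assms N_in by (auto simp: a_r_coset_def' Mo.a_comm)

lemma Q_carrier: "carrier Q = cs ` carrier M"
  and Q_zero: "\<zero>\<^bsub>Q\<^esub> = N"
  by (auto simp: quot_mod_def A_RCOSETS_def')

lemma cs_closed [simp]: "x \<in> carrier M \<Longrightarrow> cs x \<in> carrier Q"
  by (simp add: Q_carrier)

lemma Q_cases:
  assumes "X \<in> carrier Q" obtains x where "x \<in> carrier M" "X = cs x"
  using assms by (auto simp: Q_carrier)

lemma cs_zero: "cs \<zero>\<^bsub>M\<^esub> = \<zero>\<^bsub>Q\<^esub>"
  by (simp add: Q_zero N.a_subset)

lemma cs_zero_iff: "x \<in> carrier M \<Longrightarrow> cs x = \<zero>\<^bsub>Q\<^esub> \<longleftrightarrow> x \<in> N"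
  using cs_eq_iff[of x "\<zero>\<^bsub>M\<^esub>"] Mo.minus_eq_iff[of x "\<zero>\<^bsub>M\<^esub>" x] by (simp add: cs_zero)

lemma Q_add: "x \<in> carrier M \<Longrightarrow> y \<in> carrier M \<Longrightarrow> cs x \<oplus>\<^bsub>Q\<^esub> cs y = cs (x \<oplus>\<^bsub>M\<^esub> y)"
  by (simp add: quot_mod_def N.a_rcos_sum)

lemma Union_cs:
  assumes "x \<in> carrier M" "\<And>n. n \<in> N \<Longrightarrow> F (x \<oplus>\<^bsub>M\<^esub> n) = F x"
  shows "(\<Union>x'\<in>cs x. F x') = F x"
proof -
  have "x \<in> cs x" by (rule N.a_rcos_self[OF assms(1)])
  moreover have "F x' = F x" if "x' \<in> cs x" for x'
    using mem_cs[OF assms(1) that] assms(2) by metis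
  ultimately show ?thesis by blast
qed

lemma Q_smult: "r \<in> carrier R \<Longrightarrow> x \<in> carrier M \<Longrightarrow> r \<odot>\<^bsub>Q\<^esub> cs x = cs (r \<odot>\<^bsub>M\<^esub> x)"
  unfolding quot_mod_def
  by (simp, rule Union_cs)
     (simp_all add: N_in Mo.smult_r_distr cs_add_N submodule.smult_closed[OF sub])

lemma Q_mult:
  assumes x: "x \<in> carrier M" and y: "y \<in> carrier M"
    and cl: "\<And>x y. x \<in> carrier M \<Longrightarrow> y \<in> carrier M \<Longrightarrow> x \<otimes>\<^bsub>M\<^esub> y \<in> carrier M"
    and l: "\<And>x x' y. \<lbrakk>x \<in> carrier M; x' \<in> carrier M; y \<in> carrier M\<rbrakk> \<Longrightarrow>
      (x \<oplus>\<^bsub>M\<^esub> x') \<otimes>\<^bsub>M\<^esub> y = x \<otimes>\<^bsub>M\<^esub> y \<oplus>\<^bsub>M\<^esub> x' \<otimes>\<^bsub>M\<^esub> y"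
    and r: "\<And>x y y'. \<lbrakk>x \<in> carrier M; y \<in> carrier M; y' \<in> carrier M\<rbrakk> \<Longrightarrow>
      x \<otimes>\<^bsub>M\<^esub> (y \<oplus>\<^bsub>M\<^esub> y') = x \<otimes>\<^bsub>M\<^esub> y \<oplus>\<^bsub>M\<^esub> x \<otimes>\<^bsub>M\<^esub> y'"
    and iR: "\<And>x n. x \<in> carrier M \<Longrightarrow> n \<in> N \<Longrightarrow> x \<otimes>\<^bsub>M\<^esub> n \<in> N"
    and iL: "\<And>x n. x \<in> carrier M \<Longrightarrow> n \<in> N \<Longrightarrow> n \<otimes>\<^bsub>M\<^esub> x \<in> N"
  shows "cs x \<otimes>\<^bsub>Q\<^esub> cs y = cs (x \<otimes>\<^bsub>M\<^esub> y)"
proof -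
  have "(\<Union>y'\<in>cs y. cs (x' \<otimes>\<^bsub>M\<^esub> y')) = cs (x' \<otimes>\<^bsub>M\<^esub> y)" if "x' \<in> carrier M" for x'
    by (rule Union_cs[OF y]) (simp add: that N_in r cl y iR cs_add_N)
  moreover have "cs x \<subseteq> carrier M" by (rule Mo.a_r_coset_subset_G[OF N.a_subset x])
  ultimately have "cs x \<otimes>\<^bsub>Q\<^esub> cs y = (\<Union>x'\<in>cs x. cs (x' \<otimes>\<^bsub>M\<^esub> y))"
    by (simp add: quot_mod_def rcoset_mult_def subset_iff)
  also have "\<dots> = cs (x \<otimes>\<^bsub>M\<^esub> y)"
    by (rule Union_cs[OF x]) (simp add: N_in l cl x y iL cs_add_N)
  finally show ?thesis .
qed

lemma Q_module: "module R Q"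
proof (rule moduleI)
  show "cring R" by (rule Mo.R.is_cring)
  show "abelian_group Q"
  proof (rule abelian_groupI)
    show "X \<oplus>\<^bsub>Q\<^esub> Y \<in> carrier Q" if "X \<in> carrier Q" "Y \<in> carrier Q" for X Y
      using that by (elim Q_cases) (simp add: Q_add)
    show "\<zero>\<^bsub>Q\<^esub> \<in> carrier Q" using cs_closed[of "\<zero>\<^bsub>M\<^esub>"] by (simp add: cs_zero)
    show "X \<oplus>\<^bsub>Q\<^esub> Y \<oplus>\<^bsub>Q\<^esub> Z = X \<oplus>\<^bsub>Q\<^esub> (Y \<oplus>\<^bsub>Q\<^esub> Z)"
      if "X \<in> carrier Q" "Y \<in> carrier Q" "Z \<in> carrier Q" for X Y Z
      using that by (elim Q_cases) (simp add: Q_add Mo.a_assoc)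
    show "X \<oplus>\<^bsub>Q\<^esub> Y = Y \<oplus>\<^bsub>Q\<^esub> X" if "X \<in> carrier Q" "Y \<in> carrier Q" for X Y
      using that by (elim Q_cases) (simp add: Q_add Mo.a_comm)
    show "\<zero>\<^bsub>Q\<^esub> \<oplus>\<^bsub>Q\<^esub> X = X" if "X \<in> carrier Q" for X
      using that by (elim Q_cases) (simp add: Q_add cs_zero[symmetric])
    show "\<exists>Y\<in>carrier Q. Y \<oplus>\<^bsub>Q\<^esub> X = \<zero>\<^bsub>Q\<^esub>" if "X \<in> carrier Q" for X
      using that
    proof (elim Q_cases)
      fix x assume x: "x \<in> carrier M" "X = cs x"
      then have "cs (\<ominus>\<^bsub>M\<^esub> x) \<oplus>\<^bsub>Q\<^esub> X = \<zero>\<^bsub>Q\<^esub>"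
        by (simp add: Q_add cs_zero[symmetric] Mo.l_neg)
      with x(1) show ?thesis by (intro bexI[of _ "cs (\<ominus>\<^bsub>M\<^esub> x)"]) auto
    qed
  qed
  show "r \<odot>\<^bsub>Q\<^esub> X \<in> carrier Q" if "r \<in> carrier R" "X \<in> carrier Q" for r X
    using that by (elim Q_cases) (simp add: Q_smult)
  show "(r \<oplus>\<^bsub>R\<^esub> r') \<odot>\<^bsub>Q\<^esub> X = r \<odot>\<^bsub>Q\<^esub> X \<oplus>\<^bsub>Q\<^esub> r' \<odot>\<^bsub>Q\<^esub> X"
    if "r \<in> carrier R" "r' \<in> carrier R" "X \<in> carrier Q" for r r' X
    using that by (elim Q_cases) (simp add: Q_smult Q_add Mo.smult_l_distr)
  show "r \<odot>\<^bsub>Q\<^esub> (X \<oplus>\<^bsub>Q\<^esub> Y) = r \<odot>\<^bsub>Q\<^esub> X \<oplus>\<^bsub>Q\<^esub> r \<odot>\<^bsub>Q\<^esub> Y"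
    if "r \<in> carrier R" "X \<in> carrier Q" "Y \<in> carrier Q" for r X Y
    using that by (elim Q_cases) (simp add: Q_smult Q_add Mo.smult_r_distr)
  show "r \<otimes>\<^bsub>R\<^esub> r' \<odot>\<^bsub>Q\<^esub> X = r \<odot>\<^bsub>Q\<^esub> (r' \<odot>\<^bsub>Q\<^esub> X)"
    if "r \<in> carrier R" "r' \<in> carrier R" "X \<in> carrier Q" for r r' X
    using that by (elim Q_cases) (simp add: Q_smult Mo.smult_assoc1)
  show "\<one>\<^bsub>R\<^esub> \<odot>\<^bsub>Q\<^esub> X = X" if "X \<in> carrier Q" for X
    using that by (elim Q_cases) (simp add: Q_smult)
qed

sublocale Q: module R Q by (rule Q_module)

lemma cs_minus: "x \<in> carrier M \<Longrightarrow> y \<in> carrier M \<Longrightarrow> cs x \<ominus>\<^bsub>Q\<^esub> cs y = cs (x \<ominus>\<^bsub>M\<^esub> y)"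
  by (subst Q.minus_eq_iff) (simp_all add: Q_add Mo.a_assoc Mo.l_neg a_minus_def)

end

section \<open>Triple systems and their inner derivations\<close>

text \<open>
  Only trilinearity of the triple product is needed to form the Tits-Kantor-Koecher construction as a
  module with a biadditive bracket; the Jordan identities enter only for closure and the Jacobi identity.
\<close>

locale triple_system =
  fixes R :: "('r, 'e) ring_scheme" and V :: "('r, 'a) jpair"
  assumes modules: "module R (jmod V s)"
    and t_closed [simp]: "\<lbrakk>x \<in> jcarrier V s; y \<in> jcarrier V (opp s); z \<in> jcarrier V s\<rbrakk> \<Longrightarrow>
      jtriple V s x y z \<in> jcarrier V s"
    and t_add1: "\<lbrakk>x \<in> jcarrier V s; x' \<in> jcarrier V s; y \<in> jcarrier V (opp s); z \<in> jcarrier V s\<rbrakk> \<Longrightarrow>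
      jtriple V s (x \<oplus>\<^bsub>jmod V s\<^esub> x') y z = jtriple V s x y z \<oplus>\<^bsub>jmod V s\<^esub> jtriple V s x' y z"
    and t_add2: "\<lbrakk>x \<in> jcarrier V s; y \<in> jcarrier V (opp s); y' \<in> jcarrier V (opp s); z \<in> jcarrier V s\<rbrakk> \<Longrightarrow>
      jtriple V s x (y \<oplus>\<^bsub>jmod V (opp s)\<^esub> y') z = jtriple V s x y z \<oplus>\<^bsub>jmod V s\<^esub> jtriple V s x y' z"
    and t_add3: "\<lbrakk>x \<in> jcarrier V s; y \<in> jcarrier V (opp s); z \<in> jcarrier V s; z' \<in> jcarrier V s\<rbrakk> \<Longrightarrow>
      jtriple V s x y (z \<oplus>\<^bsub>jmod V s\<^esub> z') = jtriple V s x y z \<oplus>\<^bsub>jmod V s\<^esub> jtriple V s x y z'"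
    and t_smult1: "\<lbrakk>r \<in> carrier R; x \<in> jcarrier V s; y \<in> jcarrier V (opp s); z \<in> jcarrier V s\<rbrakk> \<Longrightarrow>
      jtriple V s (r \<odot>\<^bsub>jmod V s\<^esub> x) y z = r \<odot>\<^bsub>jmod V s\<^esub> jtriple V s x y z"
    and t_smult2: "\<lbrakk>r \<in> carrier R; x \<in> jcarrier V s; y \<in> jcarrier V (opp s); z \<in> jcarrier V s\<rbrakk> \<Longrightarrow>
      jtriple V s x (r \<odot>\<^bsub>jmod V (opp s)\<^esub> y) z = r \<odot>\<^bsub>jmod V s\<^esub> jtriple V s x y z"
    and t_smult3: "\<lbrakk>r \<in> carrier R; x \<in> jcarrier V s; y \<in> jcarrier V (opp s); z \<in> jcarrier V s\<rbrakk> \<Longrightarrow>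
      jtriple V s x y (r \<odot>\<^bsub>jmod V s\<^esub> z) = r \<odot>\<^bsub>jmod V s\<^esub> jtriple V s x y z"
begin

sublocale M: module R "jmod V s" for s by (rule modules)

abbreviation t where "t \<equiv> jtriple V"
abbreviation pl where "pl s \<equiv> add (jmod V s)"
abbreviation mi where "mi s \<equiv> a_minus (jmod V s)"
abbreviation sm where "sm s \<equiv> smult (jmod V s)"
abbreviation ze where "ze s \<equiv> zero (jmod V s)"
abbreviation E where "E \<equiv> jEnd R V"
abbreviation L where "L \<equiv> TKK R V"
abbreviation D where "D \<equiv> IDer R V"

lemma E_carrier: "d \<in> carrier E \<longleftrightarrow> (\<forall>s. d s \<in> jcarrier V s \<rightarrow>\<^sub>E jcarrier V s \<and>
       (\<forall>x\<in>jcarrier V s. \<forall>y\<in>jcarrier V s. d s (pl s x y) = pl s (d s x) (d s y)) \<and>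
       (\<forall>r\<in>carrier R. \<forall>x\<in>jcarrier V s. d s (sm s r x) = sm s r (d s x)))"
  by (simp add: jEnd_def)

lemma E_ops_eq:
  "d \<oplus>\<^bsub>E\<^esub> e = (\<lambda>s. \<lambda>x\<in>jcarrier V s. pl s (d s x) (e s x))"
  "d \<otimes>\<^bsub>E\<^esub> e = (\<lambda>s. \<lambda>x\<in>jcarrier V s. mi s (d s (e s x)) (e s (d s x)))"
  "r \<odot>\<^bsub>E\<^esub> d = (\<lambda>s. \<lambda>x\<in>jcarrier V s. sm s r (d s x))"
  "\<zero>\<^bsub>E\<^esub> = (\<lambda>s. \<lambda>x\<in>jcarrier V s. ze s)"
  by (simp_all add: jEnd_def)

lemma E_apply [simp]:
  "x \<in> jcarrier V s \<Longrightarrow> (d \<oplus>\<^bsub>E\<^esub> e) s x = pl s (d s x) (e s x)"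
  "x \<in> jcarrier V s \<Longrightarrow> (d \<otimes>\<^bsub>E\<^esub> e) s x = mi s (d s (e s x)) (e s (d s x))"
  "x \<in> jcarrier V s \<Longrightarrow> (r \<odot>\<^bsub>E\<^esub> d) s x = sm s r (d s x)"
  "x \<in> jcarrier V s \<Longrightarrow> \<zero>\<^bsub>E\<^esub> s x = ze s"
  by (simp_all add: E_ops_eq)

lemma E_closed [simp]: "d \<in> carrier E \<Longrightarrow> x \<in> jcarrier V s \<Longrightarrow> d s x \<in> jcarrier V s"
  unfolding E_carrier by blast

lemma E_hom [simp]:
  "d \<in> carrier E \<Longrightarrow> x \<in> jcarrier V s \<Longrightarrow> y \<in> jcarrier V s \<Longrightarrow> d s (pl s x y) = pl s (d s x) (d s y)"
  "d \<in> carrier E \<Longrightarrow> r \<in> carrier R \<Longrightarrow> x \<in> jcarrier V s \<Longrightarrow> d s (sm s r x) = sm s r (d s x)"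
  unfolding E_carrier by blast+

lemma E_zero [simp]: "d \<in> carrier E \<Longrightarrow> d s (ze s) = ze s"
  using E_hom(1)[of d "ze s" s "ze s"] E_closed[of d "ze s" s] by (intro M.add_self_zero) auto

lemma E_ext:
  assumes "d \<in> carrier E" "e \<in> carrier E" "\<And>s x. x \<in> jcarrier V s \<Longrightarrow> d s x = e s x"
  shows "d = e"
proof (rule ext)
  fix s
  have "d s \<in> jcarrier V s \<rightarrow>\<^sub>E jcarrier V s" "e s \<in> jcarrier V s \<rightarrow>\<^sub>E jcarrier V s"
    using assms(1,2) unfolding E_carrier by blast+
  then show "d s = e s" by (rule PiE_ext) (rule assms(3))
qed

lemma E_I:
  assumes "\<And>s x. x \<in> jcarrier V s \<Longrightarrow> f s x \<in> jcarrier V s"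
    "\<And>s x y. x \<in> jcarrier V s \<Longrightarrow> y \<in> jcarrier V s \<Longrightarrow> f s (pl s x y) = pl s (f s x) (f s y)"
    "\<And>s r x. r \<in> carrier R \<Longrightarrow> x \<in> jcarrier V s \<Longrightarrow> f s (sm s r x) = sm s r (f s x)"
  shows "(\<lambda>s. \<lambda>x\<in>jcarrier V s. f s x) \<in> carrier E"
  unfolding E_carrier using assms by auto

lemma E_ops_closed:
  "d \<in> carrier E \<Longrightarrow> e \<in> carrier E \<Longrightarrow> d \<oplus>\<^bsub>E\<^esub> e \<in> carrier E"
  "d \<in> carrier E \<Longrightarrow> e \<in> carrier E \<Longrightarrow> d \<otimes>\<^bsub>E\<^esub> e \<in> carrier E"
  "r \<in> carrier R \<Longrightarrow> d \<in> carrier E \<Longrightarrow> r \<odot>\<^bsub>E\<^esub> d \<in> carrier E"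
  "\<zero>\<^bsub>E\<^esub> \<in> carrier E"
proof -
  assume d: "d \<in> carrier E" and e: "e \<in> carrier E"
  have "(\<lambda>s. \<lambda>x\<in>jcarrier V s. pl s (d s x) (e s x)) \<in> carrier E"
    using d e by (intro E_I) (simp_all add: M.add4 M.smult_r_distr)
  then show "d \<oplus>\<^bsub>E\<^esub> e \<in> carrier E" unfolding E_ops_eq .
  have "(\<lambda>s. \<lambda>x\<in>jcarrier V s. mi s (d s (e s x)) (e s (d s x))) \<in> carrier E"
    using d e by (intro E_I) (simp_all add: M.minus_add4, simp_all add: a_minus_def M.smult_r_distr M.smult_r_minus)
  then show "d \<otimes>\<^bsub>E\<^esub> e \<in> carrier E" unfolding E_ops_eq .
next
  assume r: "r \<in> carrier R" and d: "d \<in> carrier E"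
  have "(\<lambda>s. \<lambda>x\<in>jcarrier V s. sm s r (d s x)) \<in> carrier E"
    using d r by (intro E_I) (simp_all add: M.smult_r_distr M.smult_assoc1[symmetric] M.R.m_comm)
  then show "r \<odot>\<^bsub>E\<^esub> d \<in> carrier E" unfolding E_ops_eq .
next
  have "(\<lambda>s. \<lambda>x\<in>jcarrier V s. ze s) \<in> carrier E"
    by (intro E_I) simp_all
  then show "\<zero>\<^bsub>E\<^esub> \<in> carrier E" unfolding E_ops_eq .
qed

lemma t_minus:
  "\<lbrakk>x \<in> jcarrier V s; y \<in> jcarrier V (opp s); z \<in> jcarrier V s\<rbrakk> \<Longrightarrow>
    t s (\<ominus>\<^bsub>jmod V s\<^esub> x) y z = \<ominus>\<^bsub>jmod V s\<^esub> t s x y z"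
  "\<lbrakk>x \<in> jcarrier V s; y \<in> jcarrier V (opp s); z \<in> jcarrier V s\<rbrakk> \<Longrightarrow>
    t s x (\<ominus>\<^bsub>jmod V (opp s)\<^esub> y) z = \<ominus>\<^bsub>jmod V s\<^esub> t s x y z"
  "\<lbrakk>x \<in> jcarrier V s; y \<in> jcarrier V (opp s); z \<in> jcarrier V s\<rbrakk> \<Longrightarrow>
    t s x y (\<ominus>\<^bsub>jmod V s\<^esub> z) = \<ominus>\<^bsub>jmod V s\<^esub> t s x y z"
proof -
  have sm1: "\<ominus>\<^bsub>jmod V s\<^esub> x = sm s (\<ominus>\<^bsub>R\<^esub> \<one>\<^bsub>R\<^esub>) x" if "x \<in> jcarrier V s" for s x
    using that by (simp add: M.smult_l_minus)
  show "\<lbrakk>x \<in> jcarrier V s; y \<in> jcarrier V (opp s); z \<in> jcarrier V s\<rbrakk> \<Longrightarrow>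
    t s (\<ominus>\<^bsub>jmod V s\<^esub> x) y z = \<ominus>\<^bsub>jmod V s\<^esub> t s x y z"
   "\<lbrakk>x \<in> jcarrier V s; y \<in> jcarrier V (opp s); z \<in> jcarrier V s\<rbrakk> \<Longrightarrow>
    t s x (\<ominus>\<^bsub>jmod V (opp s)\<^esub> y) z = \<ominus>\<^bsub>jmod V s\<^esub> t s x y z"
   "\<lbrakk>x \<in> jcarrier V s; y \<in> jcarrier V (opp s); z \<in> jcarrier V s\<rbrakk> \<Longrightarrow>
    t s x y (\<ominus>\<^bsub>jmod V s\<^esub> z) = \<ominus>\<^bsub>jmod V s\<^esub> t s x y z"
    by (simp_all only: sm1 t_smult1[of "\<ominus>\<^bsub>R\<^esub> \<one>\<^bsub>R\<^esub>"] t_smult2[of "\<ominus>\<^bsub>R\<^esub> \<one>\<^bsub>R\<^esub>"]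
        t_smult3[of "\<ominus>\<^bsub>R\<^esub> \<one>\<^bsub>R\<^esub>"] t_closed M.R.a_inv_closed M.R.one_closed)
qed

lemma t_zero:
  "\<lbrakk>y \<in> jcarrier V (opp s); z \<in> jcarrier V s\<rbrakk> \<Longrightarrow> t s (ze s) y z = ze s"
  "\<lbrakk>x \<in> jcarrier V s; z \<in> jcarrier V s\<rbrakk> \<Longrightarrow> t s x (ze (opp s)) z = ze s"
  "\<lbrakk>x \<in> jcarrier V s; y \<in> jcarrier V (opp s)\<rbrakk> \<Longrightarrow> t s x y (ze s) = ze s"
  using t_add1[of "ze s" s "ze s" y z] t_add2[of x s "ze (opp s)" "ze (opp s)" z]
    t_add3[of x s y "ze s" "ze s"]
  by (auto intro!: M.add_self_zero)

lemma E_module: "module R E"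
proof (rule moduleI)
  show "cring R" by (rule M.R.is_cring)
  show "abelian_group E"
  proof (rule abelian_groupI)
    show "\<exists>e\<in>carrier E. e \<oplus>\<^bsub>E\<^esub> d = \<zero>\<^bsub>E\<^esub>" if "d \<in> carrier E" for d
    proof
      have m: "\<ominus>\<^bsub>R\<^esub> \<one>\<^bsub>R\<^esub> \<in> carrier R" by simp
      have e: "\<ominus>\<^bsub>R\<^esub> \<one>\<^bsub>R\<^esub> \<odot>\<^bsub>E\<^esub> d \<in> carrier E" using that by (simp add: E_ops_closed)
      then show "\<ominus>\<^bsub>R\<^esub> \<one>\<^bsub>R\<^esub> \<odot>\<^bsub>E\<^esub> d \<in> carrier E" .
      show "\<ominus>\<^bsub>R\<^esub> \<one>\<^bsub>R\<^esub> \<odot>\<^bsub>E\<^esub> d \<oplus>\<^bsub>E\<^esub> d = \<zero>\<^bsub>E\<^esub>"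
        using that e by (intro E_ext E_ops_closed) (simp_all add: M.smult_l_minus M.l_neg)
    qed
  qed (auto intro!: E_ext E_ops_closed simp: M.a_ac)
  show "r \<odot>\<^bsub>E\<^esub> d \<in> carrier E" if "r \<in> carrier R" "d \<in> carrier E" for r d
    using that by (rule E_ops_closed)
  show "(r \<oplus>\<^bsub>R\<^esub> r') \<odot>\<^bsub>E\<^esub> d = r \<odot>\<^bsub>E\<^esub> d \<oplus>\<^bsub>E\<^esub> r' \<odot>\<^bsub>E\<^esub> d"
    if "r \<in> carrier R" "r' \<in> carrier R" "d \<in> carrier E" for r r' d
    using that by (intro E_ext E_ops_closed) (simp_all add: M.smult_l_distr)
  show "r \<odot>\<^bsub>E\<^esub> (d \<oplus>\<^bsub>E\<^esub> e) = r \<odot>\<^bsub>E\<^esub> d \<oplus>\<^bsub>E\<^esub> r \<odot>\<^bsub>E\<^esub> e"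
    if "r \<in> carrier R" "d \<in> carrier E" "e \<in> carrier E" for r d e
    using that by (intro E_ext E_ops_closed) (simp_all add: M.smult_r_distr)
  show "r \<otimes>\<^bsub>R\<^esub> r' \<odot>\<^bsub>E\<^esub> d = r \<odot>\<^bsub>E\<^esub> (r' \<odot>\<^bsub>E\<^esub> d)"
    if "r \<in> carrier R" "r' \<in> carrier R" "d \<in> carrier E" for r r' d
    using that by (intro E_ext E_ops_closed) (simp_all add: M.smult_assoc1)
  show "\<one>\<^bsub>R\<^esub> \<odot>\<^bsub>E\<^esub> d = d" if "d \<in> carrier E" for d
    using that by (intro E_ext E_ops_closed) simp_all
qed

sublocale E: module R E by (rule E_module)

lemma E_minus_apply [simp]:
  assumes "d \<in> carrier E" "x \<in> jcarrier V s"
  shows "(\<ominus>\<^bsub>E\<^esub> d) s x = \<ominus>\<^bsub>jmod V s\<^esub> d s x"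
proof -
  have "pl s ((\<ominus>\<^bsub>E\<^esub> d) s x) (d s x) = ze s"
    using assms E_apply(1)[of x s "\<ominus>\<^bsub>E\<^esub> d" d, symmetric] by (simp add: E.l_neg del: E_apply(1))
  then show ?thesis using assms by (intro M.minus_equality[symmetric]) auto
qed

lemma E_diff_apply [simp]:
  "d \<in> carrier E \<Longrightarrow> e \<in> carrier E \<Longrightarrow> x \<in> jcarrier V s \<Longrightarrow> (d \<ominus>\<^bsub>E\<^esub> e) s x = mi s (d s x) (e s x)"
  by (simp add: a_minus_def)

lemma E_minus_hom:
  assumes "d \<in> carrier E" "x \<in> jcarrier V s"
  shows "d s (\<ominus>\<^bsub>jmod V s\<^esub> x) = \<ominus>\<^bsub>jmod V s\<^esub> d s x"
proof (rule M.minus_equality[symmetric])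
  have "pl s (d s (\<ominus>\<^bsub>jmod V s\<^esub> x)) (d s x) = d s (pl s (\<ominus>\<^bsub>jmod V s\<^esub> x) x)"
    using assms by (simp del: M.l_neg)
  then show "pl s (d s (\<ominus>\<^bsub>jmod V s\<^esub> x)) (d s x) = ze s" using assms by (simp add: M.l_neg)
qed (use assms in auto)

lemma E_diff_hom [simp]:
  "d \<in> carrier E \<Longrightarrow> x \<in> jcarrier V s \<Longrightarrow> y \<in> jcarrier V s \<Longrightarrow> d s (mi s x y) = mi s (d s x) (d s y)"
  by (simp add: a_minus_def E_minus_hom)

lemma E_mult_add:
  assumes "d \<in> carrier E" "e \<in> carrier E" "f \<in> carrier E"
  shows "(d \<oplus>\<^bsub>E\<^esub> e) \<otimes>\<^bsub>E\<^esub> f = d \<otimes>\<^bsub>E\<^esub> f \<oplus>\<^bsub>E\<^esub> e \<otimes>\<^bsub>E\<^esub> f"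
    "f \<otimes>\<^bsub>E\<^esub> (d \<oplus>\<^bsub>E\<^esub> e) = f \<otimes>\<^bsub>E\<^esub> d \<oplus>\<^bsub>E\<^esub> f \<otimes>\<^bsub>E\<^esub> e"
  using assms by (intro E_ext E_ops_closed; simp add: M.minus_add4)+

lemma E_mult_smult:
  assumes "r \<in> carrier R" "d \<in> carrier E" "f \<in> carrier E"
  shows "(r \<odot>\<^bsub>E\<^esub> d) \<otimes>\<^bsub>E\<^esub> f = r \<odot>\<^bsub>E\<^esub> (d \<otimes>\<^bsub>E\<^esub> f)"
    "f \<otimes>\<^bsub>E\<^esub> (r \<odot>\<^bsub>E\<^esub> d) = r \<odot>\<^bsub>E\<^esub> (f \<otimes>\<^bsub>E\<^esub> d)"
  using assms by (intro E_ext E_ops_closed;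
    simp add: a_minus_def M.smult_r_distr M.smult_r_minus)+

abbreviation dl where "dl \<equiv> jdelta V"

lemma dl_apply [simp]:
  "z \<in> jcarrier V Pos \<Longrightarrow> dl x y Pos z = t Pos x y z"
  "z \<in> jcarrier V Neg \<Longrightarrow> dl x y Neg z = \<ominus>\<^bsub>jmod V Neg\<^esub> t Neg y x z"
  by (simp_all add: jdelta_def)

lemma t_closed' [simp]:
  "\<lbrakk>x \<in> jcarrier V Pos; y \<in> jcarrier V Neg; z \<in> jcarrier V Pos\<rbrakk> \<Longrightarrow> t Pos x y z \<in> jcarrier V Pos"
  "\<lbrakk>x \<in> jcarrier V Neg; y \<in> jcarrier V Pos; z \<in> jcarrier V Neg\<rbrakk> \<Longrightarrow> t Neg x y z \<in> jcarrier V Neg"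
  using t_closed[of _ Pos] t_closed[of _ Neg] by simp_all

lemmas t_add' = t_add1[of _ Pos, simplified] t_add1[of _ Neg, simplified] t_add2[of _ Pos, simplified]
  t_add2[of _ Neg, simplified] t_add3[of _ Pos, simplified] t_add3[of _ Neg, simplified]

lemmas t_smult' = t_smult1[of _ _ Pos, simplified] t_smult1[of _ _ Neg, simplified]
  t_smult2[of _ _ Pos, simplified] t_smult2[of _ _ Neg, simplified]
  t_smult3[of _ _ Pos, simplified] t_smult3[of _ _ Neg, simplified]

lemma dl_closed [simp]:
  assumes "x \<in> jcarrier V Pos" "y \<in> jcarrier V Neg"
  shows "dl x y \<in> carrier E"
proof -
  let ?f = "\<lambda>s z. case s of Pos \<Rightarrow> t Pos x y z | Neg \<Rightarrow> \<ominus>\<^bsub>jmod V Neg\<^esub> t Neg y x z"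
  have "dl x y = (\<lambda>s. \<lambda>z\<in>jcarrier V s. ?f s z)"
    by (auto simp: jdelta_def fun_eq_iff split: sign.split)
  also have "\<dots> \<in> carrier E"
    using assms by (intro E_I)
      (auto split: sign.split simp: t_add' t_smult' M.minus_add M.smult_r_minus M.a_ac)
  finally show ?thesis .
qed

lemma E_extPN:
  assumes "d \<in> carrier E" "e \<in> carrier E" "\<And>x. x \<in> jcarrier V Pos \<Longrightarrow> d Pos x = e Pos x"
    "\<And>x. x \<in> jcarrier V Neg \<Longrightarrow> d Neg x = e Neg x"
  shows "d = e"
  using assms(1,2)
proof (rule E_ext)
  show "d s x = e s x" if "x \<in> jcarrier V s" for s x using that assms(3,4) by (cases s) auto
qed

lemma dl_add:
  "\<lbrakk>x \<in> jcarrier V Pos; x' \<in> jcarrier V Pos; y \<in> jcarrier V Neg\<rbrakk> \<Longrightarrow>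
    dl (pl Pos x x') y = dl x y \<oplus>\<^bsub>E\<^esub> dl x' y"
  "\<lbrakk>x \<in> jcarrier V Pos; y \<in> jcarrier V Neg; y' \<in> jcarrier V Neg\<rbrakk> \<Longrightarrow>
    dl x (pl Neg y y') = dl x y \<oplus>\<^bsub>E\<^esub> dl x y'"
  by (rule E_extPN; simp add: t_add' M.minus_add M.a_comm)+

lemma dl_smult:
  "\<lbrakk>r \<in> carrier R; x \<in> jcarrier V Pos; y \<in> jcarrier V Neg\<rbrakk> \<Longrightarrow> dl (sm Pos r x) y = r \<odot>\<^bsub>E\<^esub> dl x y"
  "\<lbrakk>r \<in> carrier R; x \<in> jcarrier V Pos; y \<in> jcarrier V Neg\<rbrakk> \<Longrightarrow> dl x (sm Neg r y) = r \<odot>\<^bsub>E\<^esub> dl x y"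
  by (rule E_extPN; simp add: t_smult' M.smult_r_minus E_ops_closed)+

abbreviation deltas where "deltas \<equiv> {dl x y | x y. x \<in> jcarrier V Pos \<and> y \<in> jcarrier V Neg}"

lemma D_submodule: "submodule D R E"
  unfolding IDer_def by (rule E.mspan_submodule) auto

lemma D_E: "d \<in> D \<Longrightarrow> d \<in> carrier E"
  using E.submoduleE(1)[OF D_submodule] by blast

lemma D_dl [simp]: "x \<in> jcarrier V Pos \<Longrightarrow> y \<in> jcarrier V Neg \<Longrightarrow> dl x y \<in> D"
  unfolding IDer_def by (rule mspan_inc) blast

lemma D_subsetI: "submodule H R E \<Longrightarrow> deltas \<subseteq> H \<Longrightarrow> D \<subseteq> H"
  unfolding IDer_def by (rule mspan_subset)

lemmas D_zero = E.submodule_zero[OF D_submodule]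
lemmas D_add = E.submoduleE(5)[OF D_submodule]
lemmas D_smult = E.submoduleE(4)[OF D_submodule]
lemmas D_inv = E.submoduleE(3)[OF D_submodule]
lemmas D_minus = E.submodule_minus[OF D_submodule]

lemma L_carrier [simp]: "(x, d, y) \<in> carrier L \<longleftrightarrow> x \<in> jcarrier V Pos \<and> d \<in> D \<and> y \<in> jcarrier V Neg"
  and L_add [simp]: "(x, d, y) \<oplus>\<^bsub>L\<^esub> (x', d', y') = (pl Pos x x', d \<oplus>\<^bsub>E\<^esub> d', pl Neg y y')"
  and L_smult [simp]: "r \<odot>\<^bsub>L\<^esub> (x, d, y) = (sm Pos r x, r \<odot>\<^bsub>E\<^esub> d, sm Neg r y)"
  and L_zero: "\<zero>\<^bsub>L\<^esub> = (ze Pos, \<zero>\<^bsub>E\<^esub>, ze Neg)"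
  and L_mult: "(x, d, y) \<otimes>\<^bsub>L\<^esub> (x', d', y') = (mi Pos (d Pos x') (d' Pos x),
      (d \<otimes>\<^bsub>E\<^esub> d' \<oplus>\<^bsub>E\<^esub> dl x y') \<ominus>\<^bsub>E\<^esub> dl x' y, mi Neg (d Neg y') (d' Neg y))"
  by (simp_all add: TKK_def Let_def)

lemma L_module: "module R L"
proof (rule moduleI)
  show "cring R" by (rule M.R.is_cring)
  show "abelian_group L"
  proof (rule abelian_groupI)
    show "\<exists>b\<in>carrier L. b \<oplus>\<^bsub>L\<^esub> a = \<zero>\<^bsub>L\<^esub>" if "a \<in> carrier L" for a
    proof -
      obtain x d y where a: "a = (x, d, y)" by (cases a)
      show ?thesis using that unfolding a
        by (intro bexI[of _ "(\<ominus>\<^bsub>jmod V Pos\<^esub> x, \<ominus>\<^bsub>E\<^esub> d, \<ominus>\<^bsub>jmod V Neg\<^esub> y)"])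
           (simp_all add: L_zero M.l_neg E.l_neg D_E D_inv)
    qed
  qed (auto simp: L_zero D_add D_zero D_E M.a_ac E.a_ac)
qed (auto simp: D_smult D_E M.smult_l_distr E.smult_l_distr M.smult_r_distr E.smult_r_distr
    M.smult_assoc1 E.smult_assoc1)

sublocale L: module R L by (rule L_module)

lemma L_bracket_add:
  assumes "X \<in> carrier L" "Y \<in> carrier L" "Z \<in> carrier L"
  shows "(X \<oplus>\<^bsub>L\<^esub> Y) \<otimes>\<^bsub>L\<^esub> Z = X \<otimes>\<^bsub>L\<^esub> Z \<oplus>\<^bsub>L\<^esub> Y \<otimes>\<^bsub>L\<^esub> Z"
    "Z \<otimes>\<^bsub>L\<^esub> (X \<oplus>\<^bsub>L\<^esub> Y) = Z \<otimes>\<^bsub>L\<^esub> X \<oplus>\<^bsub>L\<^esub> Z \<otimes>\<^bsub>L\<^esub> Y"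
proof -
  obtain x d y where X: "X = (x, d, y)" by (cases X)
  obtain x' d' y' where Y: "Y = (x', d', y')" by (cases Y)
  obtain x'' d'' y'' where Z: "Z = (x'', d'', y'')" by (cases Z)
  note * = assms[unfolded X Y Z, simplified]
  note ** = *[THEN conjunct2, THEN conjunct1, THEN D_E]
  show "(X \<oplus>\<^bsub>L\<^esub> Y) \<otimes>\<^bsub>L\<^esub> Z = X \<otimes>\<^bsub>L\<^esub> Z \<oplus>\<^bsub>L\<^esub> Y \<otimes>\<^bsub>L\<^esub> Z"
    "Z \<otimes>\<^bsub>L\<^esub> (X \<oplus>\<^bsub>L\<^esub> Y) = Z \<otimes>\<^bsub>L\<^esub> X \<oplus>\<^bsub>L\<^esub> Z \<otimes>\<^bsub>L\<^esub> Y"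
    unfolding X Y Z using * **
    by (simp_all add: L_mult M.minus_add4 E.minus_add4[symmetric] E.add4 E_mult_add dl_add E_ops_closed)
qed

lemma L_bracket_smult:
  assumes "r \<in> carrier R" "X \<in> carrier L" "Z \<in> carrier L"
  shows "(r \<odot>\<^bsub>L\<^esub> X) \<otimes>\<^bsub>L\<^esub> Z = r \<odot>\<^bsub>L\<^esub> (X \<otimes>\<^bsub>L\<^esub> Z)"
    "Z \<otimes>\<^bsub>L\<^esub> (r \<odot>\<^bsub>L\<^esub> X) = r \<odot>\<^bsub>L\<^esub> (Z \<otimes>\<^bsub>L\<^esub> X)"
proof -
  obtain x d y where X: "X = (x, d, y)" by (cases X)
  obtain x'' d'' y'' where Z: "Z = (x'', d'', y'')" by (cases Z)
  note * = assms(2,3)[unfolded X Z, simplified]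
  note ** = *[THEN conjunct2, THEN conjunct1, THEN D_E]
  show "(r \<odot>\<^bsub>L\<^esub> X) \<otimes>\<^bsub>L\<^esub> Z = r \<odot>\<^bsub>L\<^esub> (X \<otimes>\<^bsub>L\<^esub> Z)"
    "Z \<otimes>\<^bsub>L\<^esub> (r \<odot>\<^bsub>L\<^esub> X) = r \<odot>\<^bsub>L\<^esub> (Z \<otimes>\<^bsub>L\<^esub> X)"
    unfolding X Z using assms(1) * **
    by (simp_all add: L_mult a_minus_def M.smult_r_distr M.smult_r_minus E.smult_r_distr
      E.smult_r_minus E_mult_smult dl_smult E_ops_closed)
qed

end

section \<open>Identities of Jordan pairs\<close>

lemma opp_opp [simp]: "opp (opp s) = s"
  by (cases s) auto

text \<open>
  A normal form for sums and differences: every term becomes a difference of two sums, and an equation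
  between differences becomes one between sums, which associativity and commutativity decide.
\<close>

context abelian_group
begin

lemma diff_norm:
  "\<lbrakk>a \<in> carrier G; b \<in> carrier G\<rbrakk> \<Longrightarrow> a \<oplus> (\<ominus> b) = a \<ominus> b"
  "\<lbrakk>a \<in> carrier G; b \<in> carrier G\<rbrakk> \<Longrightarrow> (\<ominus> b) \<oplus> a = a \<ominus> b"
  "\<lbrakk>a \<in> carrier G; b \<in> carrier G\<rbrakk> \<Longrightarrow> a \<ominus> (\<ominus> b) = a \<oplus> b"
  "\<lbrakk>a \<in> carrier G; b \<in> carrier G\<rbrakk> \<Longrightarrow> (\<ominus> b) \<ominus> a = \<ominus> (b \<oplus> a)"
  "\<lbrakk>a \<in> carrier G; b \<in> carrier G\<rbrakk> \<Longrightarrow> \<ominus> (a \<ominus> b) = b \<ominus> a"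
  "\<lbrakk>a \<in> carrier G; b \<in> carrier G; c \<in> carrier G\<rbrakk> \<Longrightarrow> a \<oplus> (b \<ominus> c) = (a \<oplus> b) \<ominus> c"
  "\<lbrakk>a \<in> carrier G; b \<in> carrier G; c \<in> carrier G\<rbrakk> \<Longrightarrow> (b \<ominus> c) \<oplus> a = (b \<oplus> a) \<ominus> c"
  "\<lbrakk>a \<in> carrier G; b \<in> carrier G; c \<in> carrier G\<rbrakk> \<Longrightarrow> a \<ominus> (b \<ominus> c) = (a \<oplus> c) \<ominus> b"
  "\<lbrakk>a \<in> carrier G; b \<in> carrier G; c \<in> carrier G\<rbrakk> \<Longrightarrow> (b \<ominus> c) \<ominus> a = b \<ominus> (c \<oplus> a)"
  by (simp_all add: a_minus_def minus_add a_ac)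

lemma diff_eq:
  "\<lbrakk>a \<in> carrier G; b \<in> carrier G; c \<in> carrier G\<rbrakk> \<Longrightarrow> a \<ominus> b = c \<longleftrightarrow> a = c \<oplus> b"
  "\<lbrakk>a \<in> carrier G; b \<in> carrier G; c \<in> carrier G\<rbrakk> \<Longrightarrow> c = a \<ominus> b \<longleftrightarrow> c \<oplus> b = a"
  "\<lbrakk>b \<in> carrier G; c \<in> carrier G\<rbrakk> \<Longrightarrow> \<ominus> b = c \<longleftrightarrow> \<zero> = c \<oplus> b"
  "\<lbrakk>b \<in> carrier G; c \<in> carrier G\<rbrakk> \<Longrightarrow> c = \<ominus> b \<longleftrightarrow> c \<oplus> b = \<zero>"
  subgoal by (rule minus_eq_iff)
  subgoal using minus_eq_iff[of a b c] by auto
  subgoal using minus_eq_iff[of \<zero> b c] by (simp add: a_minus_def)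
  subgoal using minus_eq_iff[of \<zero> b c] by (auto simp: a_minus_def)
  done

lemma diff_add_cancel: "\<lbrakk>a \<in> carrier G; b \<in> carrier G\<rbrakk> \<Longrightarrow> (a \<ominus> b) \<oplus> b = a"
  by (simp add: a_minus_def a_assoc l_neg)

lemmas abg = diff_norm diff_eq a_ac

lemma cancel_eq: "\<lbrakk>p \<oplus> q = p' \<oplus> q'; p = p'; p \<in> carrier G; q \<in> carrier G; q' \<in> carrier G\<rbrakk> \<Longrightarrow> q = q'"
  by simp

end

locale half_pair = J: jordan_pair R V for R :: "('r, 'e) ring_scheme" and V :: "('r, 'a) jpair" +
  assumes half: "\<one>\<^bsub>R\<^esub> \<oplus>\<^bsub>R\<^esub> \<one>\<^bsub>R\<^esub> \<in> Units R"
begin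

sublocale M: module R "jmod V s" for s by (rule J.modules)

lemma triple_sym:
  assumes "x \<in> jcarrier V s" "y \<in> jcarrier V (opp s)" "z \<in> jcarrier V s"
  shows "jtriple V s x y z = jtriple V s z y x"
  using assms J.Q_closed[of _ s] by (simp add: jtriple_def M.abg)

sublocale triple_system R V
proof
  note [simp] = J.Q_closed
  show cl: "jtriple V s x y z \<in> jcarrier V s"
    if "x \<in> jcarrier V s" "y \<in> jcarrier V (opp s)" "z \<in> jcarrier V s" for s x y z
    using that by (simp add: jtriple_def)
  show a1: "jtriple V s (x \<oplus>\<^bsub>jmod V s\<^esub> x') y z = jtriple V s x y z \<oplus>\<^bsub>jmod V s\<^esub> jtriple V s x' y z"
    if "x \<in> jcarrier V s" "x' \<in> jcarrier V s" "y \<in> jcarrier V (opp s)" "z \<in> jcarrier V s" for s x x' y z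
    using that by (rule J.triple_add)
  show "jtriple V s x (y \<oplus>\<^bsub>jmod V (opp s)\<^esub> y') z = jtriple V s x y z \<oplus>\<^bsub>jmod V s\<^esub> jtriple V s x y' z"
    if "x \<in> jcarrier V s" "y \<in> jcarrier V (opp s)" "y' \<in> jcarrier V (opp s)" "z \<in> jcarrier V s" for s x y y' z
    using that by (simp add: jtriple_def J.Q_add M.minus_add4)
  show "jtriple V s x y (z \<oplus>\<^bsub>jmod V s\<^esub> z') = jtriple V s x y z \<oplus>\<^bsub>jmod V s\<^esub> jtriple V s x y z'"
    if "x \<in> jcarrier V s" "y \<in> jcarrier V (opp s)" "z \<in> jcarrier V s" "z' \<in> jcarrier V s" for s x y z z'
    using that a1[of z s z' y x] by (simp add: triple_sym[of x])
  show s1: "jtriple V s (r \<odot>\<^bsub>jmod V s\<^esub> x) y z = r \<odot>\<^bsub>jmod V s\<^esub> jtriple V s x y z"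
    if "r \<in> carrier R" "x \<in> jcarrier V s" "y \<in> jcarrier V (opp s)" "z \<in> jcarrier V s" for r s x y z
    using that by (rule J.triple_smult)
  show "jtriple V s x (r \<odot>\<^bsub>jmod V (opp s)\<^esub> y) z = r \<odot>\<^bsub>jmod V s\<^esub> jtriple V s x y z"
    if "r \<in> carrier R" "x \<in> jcarrier V s" "y \<in> jcarrier V (opp s)" "z \<in> jcarrier V s" for r s x y z
    using that by (simp add: jtriple_def J.Q_smult a_minus_def M.smult_r_distr M.smult_r_minus)
  show "jtriple V s x y (r \<odot>\<^bsub>jmod V s\<^esub> z) = r \<odot>\<^bsub>jmod V s\<^esub> jtriple V s x y z"
    if "r \<in> carrier R" "x \<in> jcarrier V s" "y \<in> jcarrier V (opp s)" "z \<in> jcarrier V s" for r s x y z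
    using that s1[of r z s y x] by (simp add: triple_sym[of x])
qed

lemma Q_closed' [simp]: "x \<in> jcarrier V s \<Longrightarrow> y \<in> jcarrier V (opp s) \<Longrightarrow> jQ V s x y \<in> jcarrier V s"
  by (rule J.Q_closed)

lemma t_closed_opp [simp]:
  "\<lbrakk>x \<in> jcarrier V (opp s); y \<in> jcarrier V s; z \<in> jcarrier V (opp s)\<rbrakk> \<Longrightarrow> t (opp s) x y z \<in> jcarrier V (opp s)"
  "\<lbrakk>x \<in> jcarrier V (opp s); y \<in> jcarrier V s\<rbrakk> \<Longrightarrow> jQ V (opp s) x y \<in> jcarrier V (opp s)"
  by simp_all

lemma Q_plus:
  "\<lbrakk>x \<in> jcarrier V s; y \<in> jcarrier V (opp s); z \<in> jcarrier V s\<rbrakk> \<Longrightarrow>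
    jQ V s (pl s x z) y = pl s (pl s (jQ V s x y) (jQ V s z y)) (t s x y z)"
  by (simp add: jtriple_def M.abg)

lemma Q_plus_opp:
  "\<lbrakk>x \<in> jcarrier V (opp s); y \<in> jcarrier V s; z \<in> jcarrier V (opp s)\<rbrakk> \<Longrightarrow>
    jQ V (opp s) (pl (opp s) x z) y = pl (opp s) (pl (opp s) (jQ V (opp s) x y) (jQ V (opp s) z y)) (t (opp s) x y z)"
  by (rule Q_plus) auto

definition "hf = inv\<^bsub>R\<^esub> (\<one>\<^bsub>R\<^esub> \<oplus>\<^bsub>R\<^esub> \<one>\<^bsub>R\<^esub>)"

lemma hf_closed [simp]: "hf \<in> carrier R"
  unfolding hf_def using half by (rule M.R.Units_inv_closed)

lemma hf_double: "x \<in> jcarrier V s \<Longrightarrow> sm s hf (pl s x x) = x"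
proof -
  assume x: "x \<in> jcarrier V s"
  have "pl s x x = sm s (\<one>\<^bsub>R\<^esub> \<oplus>\<^bsub>R\<^esub> \<one>\<^bsub>R\<^esub>) x" using x by (simp add: M.smult_l_distr)
  moreover have "hf \<otimes>\<^bsub>R\<^esub> (\<one>\<^bsub>R\<^esub> \<oplus>\<^bsub>R\<^esub> \<one>\<^bsub>R\<^esub>) = \<one>\<^bsub>R\<^esub>"
    unfolding hf_def using half by (rule M.R.Units_l_inv)
  ultimately show ?thesis using x by (simp add: M.smult_assoc1[symmetric])
qed

lemma t_diag:
  assumes "x \<in> jcarrier V s" "y \<in> jcarrier V (opp s)"
  shows "t s x y x = pl s (jQ V s x y) (jQ V s x y)"
proof -
  let ?q = "jQ V s x y" and ?two = "\<one>\<^bsub>R\<^esub> \<oplus>\<^bsub>R\<^esub> \<one>\<^bsub>R\<^esub>"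
  have "pl s x x = sm s ?two x" using assms by (simp add: M.smult_l_distr)
  then have "jQ V s (pl s x x) y = sm s (?two \<otimes>\<^bsub>R\<^esub> ?two) ?q"
    using assms by (simp add: J.Q_quadratic)
  also have "\<dots> = pl s (pl s ?q ?q) (pl s ?q ?q)"
    using assms by (simp add: M.smult_l_distr M.R.l_distr M.a_ac)
  finally show ?thesis using assms by (simp add: jtriple_def M.abg)
qed

lemma Q_half: "x \<in> jcarrier V s \<Longrightarrow> y \<in> jcarrier V (opp s) \<Longrightarrow> jQ V s x y = sm s hf (t s x y x)"
  by (simp add: t_diag hf_double)

lemma JP1_full:
  assumes "x \<in> jcarrier V s" "u \<in> jcarrier V s" "w \<in> jcarrier V s"
    "y \<in> jcarrier V (opp s)" "z \<in> jcarrier V (opp s)"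
  shows "pl s (t s w y (t s x z u)) (pl s (t s x y (t s u z w)) (t s u y (t s x z w))) =
    pl s (t s x (t (opp s) y u z) w) (pl s (t s u (t (opp s) y x z) w) (t s x (t (opp s) y w z) u))"
proof -
  have 1: "pl s (t s w y (jQ V s x z)) (t s x y (t s x z w)) =
      pl s (t s x (t (opp s) y x z) w) (jQ V s x (t (opp s) y w z))"
    and 2: "pl s (t s w y (jQ V s u z)) (t s u y (t s u z w)) =
      pl s (t s u (t (opp s) y u z) w) (jQ V s u (t (opp s) y w z))"
    and 3: "pl s (t s w y (jQ V s (pl s x u) z)) (t s (pl s x u) y (t s (pl s x u) z w)) =
      pl s (t s (pl s x u) (t (opp s) y (pl s x u) z) w) (jQ V s (pl s x u) (t (opp s) y w z))"
    using assms J.JP1_lin by simp_all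
  let ?a = "pl s (t s w y (jQ V s x z)) (t s x y (t s x z w))"
  let ?b = "pl s (t s w y (jQ V s u z)) (t s u y (t s u z w))"
  have t2: "t (opp s) y (pl s x u) z = pl (opp s) (t (opp s) y x z) (t (opp s) y u z)"
    using t_add2[of y "opp s" x u z] assms by simp
  have "pl s (pl s ?a ?b) (pl s (t s w y (t s x z u)) (pl s (t s x y (t s u z w)) (t s u y (t s x z w)))) =
    pl s (pl s (pl s (t s x (t (opp s) y x z) w) (jQ V s x (t (opp s) y w z)))
       (pl s (t s u (t (opp s) y u z) w) (jQ V s u (t (opp s) y w z))))
     (pl s (t s x (t (opp s) y u z) w) (pl s (t s u (t (opp s) y x z) w) (t s x (t (opp s) y w z) u)))"
    using 3 assms by (simp add: t2 Q_plus t_add1 t_add2 t_add3) (simp add: M.a_ac)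
  then show ?thesis
    using assms by (elim M.cancel_eq) (simp_all add: 1 2)
qed

lemma JP2_lin:
  assumes "x \<in> jcarrier V s" "z \<in> jcarrier V s" "y \<in> jcarrier V (opp s)" "v \<in> jcarrier V (opp s)"
  shows "pl s (t s (jQ V s x y) v z) (t s (jQ V s x v) y z) = t s x (t (opp s) y x v) z"
proof -
  have 1: "t s (jQ V s x y) y z = t s x (jQ V (opp s) y x) z"
    and 2: "t s (jQ V s x v) v z = t s x (jQ V (opp s) v x) z"
    and 3: "t s (jQ V s x (pl (opp s) y v)) (pl (opp s) y v) z = t s x (jQ V (opp s) (pl (opp s) y v) x) z"
    using assms J.JP2 by simp_all
  have "pl s (pl s (t s (jQ V s x y) y z) (t s (jQ V s x v) v z))
      (pl s (t s (jQ V s x y) v z) (t s (jQ V s x v) y z)) =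
    pl s (pl s (t s x (jQ V (opp s) y x) z) (t s x (jQ V (opp s) v x) z)) (t s x (t (opp s) y x v) z)"
    using 3 assms by (simp add: Q_plus_opp J.Q_add t_add1 t_add2) (simp add: M.a_ac)
  then show ?thesis
    using assms by (elim M.cancel_eq) (simp_all add: 1 2)
qed

lemma JP2_full:
  assumes "x \<in> jcarrier V s" "u \<in> jcarrier V s" "z \<in> jcarrier V s" "y \<in> jcarrier V (opp s)" "v \<in> jcarrier V (opp s)"
  shows "pl s (t s (t s x y u) v z) (t s (t s x v u) y z) =
    pl s (t s x (t (opp s) y u v) z) (t s u (t (opp s) y x v) z)"
proof -
  note 1 = JP2_lin[OF assms(1,3,4,5)] and 2 = JP2_lin[OF assms(2,3,4,5)]
  have 3: "pl s (t s (jQ V s (pl s x u) y) v z) (t s (jQ V s (pl s x u) v) y z) =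
      t s (pl s x u) (t (opp s) y (pl s x u) v) z"
    using assms by (intro JP2_lin) auto
  have t2: "t (opp s) y (pl s x u) v = pl (opp s) (t (opp s) y x v) (t (opp s) y u v)"
    using t_add2[of y "opp s" x u v] assms by simp
  have "pl s (pl s (pl s (t s (jQ V s x y) v z) (t s (jQ V s x v) y z))
       (pl s (t s (jQ V s u y) v z) (t s (jQ V s u v) y z)))
      (pl s (t s (t s x y u) v z) (t s (t s x v u) y z)) =
    pl s (pl s (t s x (t (opp s) y x v) z) (t s u (t (opp s) y u v) z))
      (pl s (t s x (t (opp s) y u v) z) (t s u (t (opp s) y x v) z))"
    using 3 assms by (simp add: t2 Q_plus t_add1 t_add2) (simp add: M.a_ac)
  then show ?thesis
    using assms by (elim M.cancel_eq) (simp_all add: 1 2)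
qed

lemma JP16:
  assumes "x \<in> jcarrier V s" "u \<in> jcarrier V s" "w \<in> jcarrier V s" "y \<in> jcarrier V (opp s)" "v \<in> jcarrier V (opp s)"
  shows "pl s (t s x y (t s u v w)) (t s u y (t s x v w)) =
    pl s (t s (t s x y u) v w) (t s x (t (opp s) y w v) u)"
proof -
  let ?b = "t s (t s x v u) y w"
  have b: "t s w y (t s x v u) = ?b" using assms by (intro triple_sym) auto
  note 1 = JP1_full[OF assms, unfolded b]
  note 2 = JP2_full[OF assms]
  have "pl s ?b (pl s (t s x y (t s u v w)) (t s u y (t s x v w))) =
     pl s (pl s (t s x (t (opp s) y u v) w) (t s u (t (opp s) y x v) w)) (t s x (t (opp s) y w v) u)"
    using 1 assms by (simp add: M.a_assoc)
  also have "\<dots> = pl s ?b (pl s (t s (t s x y u) v w) (t s x (t (opp s) y w v) u))"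
    unfolding 2[symmetric] using assms by (simp add: M.a_ac)
  finally show ?thesis using assms by simp
qed

text \<open>The identity \<open>[D\<^bsub>x,y\<^esub>, D\<^bsub>u,v\<^esub>] = D\<^bsub>{x,y,u},v\<^esub> - D\<^bsub>u,{y,x,v}\<^esub>\<close>.\<close>

lemma JP15:
  assumes "x \<in> jcarrier V s" "u \<in> jcarrier V s" "w \<in> jcarrier V s" "y \<in> jcarrier V (opp s)" "v \<in> jcarrier V (opp s)"
  shows "pl s (t s x y (t s u v w)) (t s u (t (opp s) y x v) w) =
    pl s (t s u v (t s x y w)) (t s (t s x y u) v w)"
proof -
  have "pl s (t s u v (t s w y x)) (t s w v (t s u y x)) =
    pl s (t s (t s u v w) y x) (t s u (t (opp s) v x y) w)"
    using assms by (intro JP16) auto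
  moreover have "t s w y x = t s x y w" "t s w v (t s u y x) = t s (t s x y u) v w"
    "t s (t s u v w) y x = t s x y (t s u v w)" "t (opp s) v x y = t (opp s) y x v"
    using assms triple_sym[of w s y x] triple_sym[of u s y x] triple_sym[of w s v "t s u y x"]
      triple_sym[of "t s u v w" s y x] triple_sym[of v "opp s" x y] by simp_all
  ultimately show ?thesis by simp
qed

section \<open>The Lie algebra of a Jordan pair\<close>

text \<open>
  The identity for \<open>D\<^bsub>x,y\<^esub>\<close> applied to a triple product says that \<open>\<delta>(x, y)\<close> is a derivation of the
  pair, and the derivations form a submodule.
\<close>

lemma D_derivation:
  assumes "d \<in> D" "u \<in> jcarrier V s" "v \<in> jcarrier V (opp s)" "w \<in> jcarrier V s"
  shows "d s (t s u v w) = pl s (t s (d s u) v w) (pl s (t s u (d (opp s) v) w) (t s u v (d s w)))"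
proof -
  let ?P = "\<lambda>d s u v w. d s (t s u v w) = pl s (t s (d s u) v w) (pl s (t s u (d (opp s) v) w) (t s u v (d s w)))"
  let ?H = "{d \<in> carrier E. \<forall>s. \<forall>u\<in>jcarrier V s. \<forall>v\<in>jcarrier V (opp s). \<forall>w\<in>jcarrier V s. ?P d s u v w}"
  have "submodule ?H R E"
  proof (rule E.submoduleI)
    fix a b assume *: "a \<in> ?H" "b \<in> ?H"
    have "?P (a \<oplus>\<^bsub>E\<^esub> b) s u v w" if "u \<in> jcarrier V s" "v \<in> jcarrier V (opp s)" "w \<in> jcarrier V s" for s u v w
      using * that by (simp add: t_add1 t_add2 t_add3 M.a_ac)
    then show "a \<oplus>\<^bsub>E\<^esub> b \<in> ?H" using * by (simp add: E_ops_closed)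
  next
    fix a assume *: "a \<in> ?H"
    have "?P (\<ominus>\<^bsub>E\<^esub> a) s u v w" if "u \<in> jcarrier V s" "v \<in> jcarrier V (opp s)" "w \<in> jcarrier V s" for s u v w
      using * that by (simp add: t_minus M.minus_add)
    then show "\<ominus>\<^bsub>E\<^esub> a \<in> ?H" using * by simp
  next
    fix r a assume *: "r \<in> carrier R" "a \<in> ?H"
    have "?P (r \<odot>\<^bsub>E\<^esub> a) s u v w" if "u \<in> jcarrier V s" "v \<in> jcarrier V (opp s)" "w \<in> jcarrier V s" for s u v w
      using * that by (simp add: t_smult1 t_smult2 t_smult3 M.smult_r_distr)
    then show "r \<odot>\<^bsub>E\<^esub> a \<in> ?H" using * by (simp add: E_ops_closed)
  next
    show "\<zero>\<^bsub>E\<^esub> \<in> ?H" by (simp add: t_zero)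
  qed auto
  moreover have "deltas \<subseteq> ?H"
  proof safe
    fix x y assume xy: "x \<in> jcarrier V Pos" "y \<in> jcarrier V Neg"
    then show "dl x y \<in> carrier E" by simp
    fix s u v w assume "u \<in> jcarrier V s" "v \<in> jcarrier V (opp s)" "w \<in> jcarrier V s"
    then show "?P (dl x y) s u v w"
    proof (cases s)
      case Pos
      with JP15[of x Pos u w y v] xy \<open>u \<in> _\<close> \<open>v \<in> _\<close> \<open>w \<in> _\<close> show ?thesis
        by (simp add: t_minus(2)[of _ Pos, simplified] M.abg)
    next
      case Neg
      with JP15[of y Neg u w x v] xy \<open>u \<in> _\<close> \<open>v \<in> _\<close> \<open>w \<in> _\<close> show ?thesis
        by (simp add: t_minus(1,3)[of _ Neg, simplified] M.abg)
    qed
  qed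
  ultimately show ?thesis using D_subsetI[of ?H] assms by blast
qed

lemma D_commutator_dl:
  assumes "d \<in> D" "x \<in> jcarrier V Pos" "y \<in> jcarrier V Neg"
  shows "d \<otimes>\<^bsub>E\<^esub> dl x y = dl (d Pos x) y \<oplus>\<^bsub>E\<^esub> dl x (d Neg y)"
proof (rule E_extPN)
  note [simp] = D_E[OF assms(1)]
  show "d \<otimes>\<^bsub>E\<^esub> dl x y \<in> carrier E" "dl (d Pos x) y \<oplus>\<^bsub>E\<^esub> dl x (d Neg y) \<in> carrier E"
    using assms(2,3) by (simp_all add: E_ops_closed)
  show "(d \<otimes>\<^bsub>E\<^esub> dl x y) Pos z = (dl (d Pos x) y \<oplus>\<^bsub>E\<^esub> dl x (d Neg y)) Pos z"
    if z: "z \<in> jcarrier V Pos" for z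
    using D_derivation[OF assms(1), of x Pos y z] assms(2,3) z by (simp add: M.abg)
  show "(d \<otimes>\<^bsub>E\<^esub> dl x y) Neg z = (dl (d Pos x) y \<oplus>\<^bsub>E\<^esub> dl x (d Neg y)) Neg z"
    if z: "z \<in> jcarrier V Neg" for z
    using D_derivation[OF assms(1), of y Neg x z] assms(2,3) z by (simp add: E_minus_hom M.abg)
qed

lemma D_mult_closed:
  assumes "d \<in> D" "e \<in> D"
  shows "d \<otimes>\<^bsub>E\<^esub> e \<in> D"
proof -
  let ?H = "{e \<in> carrier E. d \<otimes>\<^bsub>E\<^esub> e \<in> D}"
  note d [simp] = D_E[OF assms(1)]
  have "d \<otimes>\<^bsub>E\<^esub> \<zero>\<^bsub>E\<^esub> = \<zero>\<^bsub>E\<^esub>"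
    by (rule E_ext) (simp_all add: E_ops_closed M.abg)
  moreover have "d \<otimes>\<^bsub>E\<^esub> (\<ominus>\<^bsub>E\<^esub> a) = \<ominus>\<^bsub>E\<^esub> (d \<otimes>\<^bsub>E\<^esub> a)" if "a \<in> carrier E" for a
    using that by (intro E_ext) (simp_all add: E_ops_closed E_minus_hom M.abg)
  ultimately have "submodule ?H R E"
    by (intro E.submoduleI) (auto simp: E_ops_closed D_zero D_inv D_add D_smult E_mult_add E_mult_smult)
  moreover have "deltas \<subseteq> ?H"
    using D_commutator_dl[OF assms(1)] by (auto intro!: D_add)
  ultimately show ?thesis using D_subsetI[of ?H] assms(2) by blast
qed

lemma L_mult_closed:
  assumes "X \<in> carrier L" "Y \<in> carrier L"
  shows "X \<otimes>\<^bsub>L\<^esub> Y \<in> carrier L"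
proof -
  obtain x d y x' d' y' where *: "X = (x, d, y)" "Y = (x', d', y')" by (cases X, cases Y)
  show ?thesis using assms unfolding *
    by (simp add: L_mult D_minus D_add D_mult_closed D_E)
qed

lemma dl_diff:
  "\<lbrakk>x \<in> jcarrier V Pos; x' \<in> jcarrier V Pos; y \<in> jcarrier V Neg\<rbrakk> \<Longrightarrow>
    dl (mi Pos x x') y = dl x y \<ominus>\<^bsub>E\<^esub> dl x' y"
  "\<lbrakk>x \<in> jcarrier V Pos; y \<in> jcarrier V Neg; y' \<in> jcarrier V Neg\<rbrakk> \<Longrightarrow>
    dl x (mi Neg y y') = dl x y \<ominus>\<^bsub>E\<^esub> dl x y'"
proof -
  show "dl (mi Pos x x') y = dl x y \<ominus>\<^bsub>E\<^esub> dl x' y"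
    if "x \<in> jcarrier V Pos" "x' \<in> jcarrier V Pos" "y \<in> jcarrier V Neg"
    using that dl_add(1)[of "mi Pos x x'" x' y] by (simp add: M.diff_add_cancel E.diff_eq)
  show "dl x (mi Neg y y') = dl x y \<ominus>\<^bsub>E\<^esub> dl x y'"
    if "x \<in> jcarrier V Pos" "y \<in> jcarrier V Neg" "y' \<in> jcarrier V Neg"
    using that dl_add(2)[of x "mi Neg y y'" y'] by (simp add: M.diff_add_cancel E.diff_eq)
qed

lemma L_antisym:
  assumes "X \<in> carrier L" "Y \<in> carrier L"
  shows "X \<otimes>\<^bsub>L\<^esub> Y \<oplus>\<^bsub>L\<^esub> Y \<otimes>\<^bsub>L\<^esub> X = \<zero>\<^bsub>L\<^esub>"
proof -
  obtain x d y x' d' y' where *: "X = (x, d, y)" "Y = (x', d', y')" by (cases X, cases Y)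
  note ** = assms[unfolded *, simplified]
  note [simp] = **[THEN conjunct2, THEN conjunct1, THEN D_E]
  have "d \<otimes>\<^bsub>E\<^esub> d' \<oplus>\<^bsub>E\<^esub> d' \<otimes>\<^bsub>E\<^esub> d = \<zero>\<^bsub>E\<^esub>"
    by (intro E_ext) (simp_all add: E_ops_closed M.abg)
  then show ?thesis unfolding * L_zero using **
    by (simp add: L_mult E_ops_closed M.abg E.abg)
qed

lemma E_mult_diff:
  assumes "d \<in> carrier E" "e \<in> carrier E" "f \<in> carrier E"
  shows "(d \<ominus>\<^bsub>E\<^esub> e) \<otimes>\<^bsub>E\<^esub> f = d \<otimes>\<^bsub>E\<^esub> f \<ominus>\<^bsub>E\<^esub> e \<otimes>\<^bsub>E\<^esub> f"
    "f \<otimes>\<^bsub>E\<^esub> (d \<ominus>\<^bsub>E\<^esub> e) = f \<otimes>\<^bsub>E\<^esub> d \<ominus>\<^bsub>E\<^esub> f \<otimes>\<^bsub>E\<^esub> e"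
  using E_mult_add[of "d \<ominus>\<^bsub>E\<^esub> e" e f] assms by (simp_all add: E.diff_add_cancel E_ops_closed E.diff_eq)

lemma E_jacobi:
  assumes "d \<in> carrier E" "e \<in> carrier E" "f \<in> carrier E"
  shows "d \<otimes>\<^bsub>E\<^esub> (e \<otimes>\<^bsub>E\<^esub> f) = (d \<otimes>\<^bsub>E\<^esub> e) \<otimes>\<^bsub>E\<^esub> f \<oplus>\<^bsub>E\<^esub> e \<otimes>\<^bsub>E\<^esub> (d \<otimes>\<^bsub>E\<^esub> f)"
  using assms by (intro E_ext) (simp_all add: E_ops_closed M.abg)

lemma E_dl_commutator:
  assumes "d \<in> D" "x \<in> jcarrier V Pos" "y \<in> jcarrier V Neg"
  shows "dl x y \<otimes>\<^bsub>E\<^esub> d = \<ominus>\<^bsub>E\<^esub> (dl (d Pos x) y \<oplus>\<^bsub>E\<^esub> dl x (d Neg y))"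
proof -
  note [simp] = D_E[OF assms(1)]
  have "dl x y \<otimes>\<^bsub>E\<^esub> d = \<ominus>\<^bsub>E\<^esub> (d \<otimes>\<^bsub>E\<^esub> dl x y)"
    using assms(2,3) by (intro E_ext) (simp_all add: E_ops_closed M.abg)
  with D_commutator_dl[OF assms] show ?thesis by simp
qed

lemma L_jacobi:
  assumes "X \<in> carrier L" "Y \<in> carrier L" "Z \<in> carrier L"
  shows "X \<otimes>\<^bsub>L\<^esub> (Y \<otimes>\<^bsub>L\<^esub> Z) = (X \<otimes>\<^bsub>L\<^esub> Y) \<otimes>\<^bsub>L\<^esub> Z \<oplus>\<^bsub>L\<^esub> Y \<otimes>\<^bsub>L\<^esub> (X \<otimes>\<^bsub>L\<^esub> Z)"
proof -
  obtain x d y where X: "X = (x, d, y)" by (cases X)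
  obtain x' d' y' where Y: "Y = (x', d', y')" by (cases Y)
  obtain x'' d'' y'' where Z: "Z = (x'', d'', y'')" by (cases Z)
  note * = assms[unfolded X Y Z, simplified]
  note ** [simp] = *[THEN conjunct2, THEN conjunct1, THEN D_E]
  have sym: "t Pos a b c = t Pos c b a" if "a \<in> jcarrier V Pos" "b \<in> jcarrier V Neg" "c \<in> jcarrier V Pos" for a b c
    using that triple_sym[of a Pos b c] by simp
  have symN: "t Neg a b c = t Neg c b a" if "a \<in> jcarrier V Neg" "b \<in> jcarrier V Pos" "c \<in> jcarrier V Neg" for a b c
    using that triple_sym[of a Neg b c] by simp
  have P: "fst (X \<otimes>\<^bsub>L\<^esub> (Y \<otimes>\<^bsub>L\<^esub> Z)) = fst ((X \<otimes>\<^bsub>L\<^esub> Y) \<otimes>\<^bsub>L\<^esub> Z \<oplus>\<^bsub>L\<^esub> Y \<otimes>\<^bsub>L\<^esub> (X \<otimes>\<^bsub>L\<^esub> Z))"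
    unfolding X Y Z using *
    by (simp add: L_mult E_ops_closed M.abg sym[of x _ x'] sym[of x _ x''] sym[of x' _ x''])
  have N: "snd (snd (X \<otimes>\<^bsub>L\<^esub> (Y \<otimes>\<^bsub>L\<^esub> Z))) = snd (snd ((X \<otimes>\<^bsub>L\<^esub> Y) \<otimes>\<^bsub>L\<^esub> Z \<oplus>\<^bsub>L\<^esub> Y \<otimes>\<^bsub>L\<^esub> (X \<otimes>\<^bsub>L\<^esub> Z)))"
    unfolding X Y Z using *
    by (simp add: L_mult E_ops_closed M.abg symN[of y _ y'] symN[of y _ y''] symN[of y' _ y''])
  have M: "fst (snd (X \<otimes>\<^bsub>L\<^esub> (Y \<otimes>\<^bsub>L\<^esub> Z))) = fst (snd ((X \<otimes>\<^bsub>L\<^esub> Y) \<otimes>\<^bsub>L\<^esub> Z \<oplus>\<^bsub>L\<^esub> Y \<otimes>\<^bsub>L\<^esub> (X \<otimes>\<^bsub>L\<^esub> Z)))"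
    unfolding X Y Z using *
    by (simp add: L_mult E_ops_closed E_mult_diff E_mult_add D_commutator_dl E_dl_commutator dl_diff
        E_jacobi[of d d' d''] E.abg)
  from P N M show ?thesis by (intro prod_eqI)
qed

lemma Q_zero_right: "x \<in> jcarrier V s \<Longrightarrow> jQ V s x (ze (opp s)) = ze s"
  by (simp add: Q_half t_zero)

end

context half_pair
begin

lemma L_bracket_zero [simp]:
  "X \<in> carrier L \<Longrightarrow> X \<otimes>\<^bsub>L\<^esub> \<zero>\<^bsub>L\<^esub> = \<zero>\<^bsub>L\<^esub>"
  "X \<in> carrier L \<Longrightarrow> \<zero>\<^bsub>L\<^esub> \<otimes>\<^bsub>L\<^esub> X = \<zero>\<^bsub>L\<^esub>"
  using L_bracket_add[of "\<zero>\<^bsub>L\<^esub>" "\<zero>\<^bsub>L\<^esub>" X] by (auto intro!: L.add_self_zero L_mult_closed)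

lemma L_anti: "X \<in> carrier L \<Longrightarrow> Y \<in> carrier L \<Longrightarrow> X \<otimes>\<^bsub>L\<^esub> Y = \<ominus>\<^bsub>L\<^esub> (Y \<otimes>\<^bsub>L\<^esub> X)"
  using L_antisym[of X Y] by (intro L.minus_equality[symmetric]) (auto intro: L_mult_closed)

lemma L_bracket_minus:
  assumes "X \<in> carrier L" "Y \<in> carrier L"
  shows "X \<otimes>\<^bsub>L\<^esub> (\<ominus>\<^bsub>L\<^esub> Y) = \<ominus>\<^bsub>L\<^esub> (X \<otimes>\<^bsub>L\<^esub> Y)" "(\<ominus>\<^bsub>L\<^esub> X) \<otimes>\<^bsub>L\<^esub> Y = \<ominus>\<^bsub>L\<^esub> (X \<otimes>\<^bsub>L\<^esub> Y)"
proof -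
  have "X \<otimes>\<^bsub>L\<^esub> (\<ominus>\<^bsub>L\<^esub> Y) \<oplus>\<^bsub>L\<^esub> X \<otimes>\<^bsub>L\<^esub> Y = \<zero>\<^bsub>L\<^esub>"
    using L_bracket_add(2)[of "\<ominus>\<^bsub>L\<^esub> Y" Y X] assms by (simp add: L.l_neg)
  then show "X \<otimes>\<^bsub>L\<^esub> (\<ominus>\<^bsub>L\<^esub> Y) = \<ominus>\<^bsub>L\<^esub> (X \<otimes>\<^bsub>L\<^esub> Y)"
    using assms by (intro L.minus_equality[symmetric]) (auto intro: L_mult_closed)
  have "(\<ominus>\<^bsub>L\<^esub> X) \<otimes>\<^bsub>L\<^esub> Y \<oplus>\<^bsub>L\<^esub> X \<otimes>\<^bsub>L\<^esub> Y = \<zero>\<^bsub>L\<^esub>"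
    using L_bracket_add(1)[of "\<ominus>\<^bsub>L\<^esub> X" X Y] assms by (simp add: L.l_neg)
  then show "(\<ominus>\<^bsub>L\<^esub> X) \<otimes>\<^bsub>L\<^esub> Y = \<ominus>\<^bsub>L\<^esub> (X \<otimes>\<^bsub>L\<^esub> Y)"
    using assms by (intro L.minus_equality[symmetric]) (auto intro: L_mult_closed)
qed

lemma L_bracket_diff:
  assumes "X \<in> carrier L" "Y \<in> carrier L" "Z \<in> carrier L"
  shows "X \<otimes>\<^bsub>L\<^esub> (Y \<ominus>\<^bsub>L\<^esub> Z) = X \<otimes>\<^bsub>L\<^esub> Y \<ominus>\<^bsub>L\<^esub> X \<otimes>\<^bsub>L\<^esub> Z"
  using assms by (simp add: a_minus_def L_bracket_add L_bracket_minus)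

lemma L_diff_bracket_zero:
  assumes "X \<in> carrier L" "a \<in> carrier L" "b \<in> carrier L" "X \<otimes>\<^bsub>L\<^esub> a = X \<otimes>\<^bsub>L\<^esub> b"
  shows "(a \<ominus>\<^bsub>L\<^esub> b) \<otimes>\<^bsub>L\<^esub> X = \<zero>\<^bsub>L\<^esub>"
proof -
  have "X \<otimes>\<^bsub>L\<^esub> (a \<ominus>\<^bsub>L\<^esub> b) = X \<otimes>\<^bsub>L\<^esub> a \<ominus>\<^bsub>L\<^esub> X \<otimes>\<^bsub>L\<^esub> b"
    by (rule L_bracket_diff[OF assms(1-3)])
  also have "\<dots> = \<zero>\<^bsub>L\<^esub>"
    using assms by (simp add: a_minus_def L.r_neg L_mult_closed)
  finally have "X \<otimes>\<^bsub>L\<^esub> (a \<ominus>\<^bsub>L\<^esub> b) = \<zero>\<^bsub>L\<^esub>" .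
  then show ?thesis using assms by (subst L_anti) auto
qed

lemma L_jacobi':
  assumes "X \<in> carrier L" "Y \<in> carrier L" "Z \<in> carrier L"
  shows "(X \<otimes>\<^bsub>L\<^esub> Y) \<otimes>\<^bsub>L\<^esub> Z = X \<otimes>\<^bsub>L\<^esub> (Y \<otimes>\<^bsub>L\<^esub> Z) \<ominus>\<^bsub>L\<^esub> Y \<otimes>\<^bsub>L\<^esub> (X \<otimes>\<^bsub>L\<^esub> Z)"
  using L_jacobi[OF assms] assms by (simp add: L.diff_eq L_mult_closed)

definition emb :: "sign \<Rightarrow> 'a \<Rightarrow> 'a \<times> (sign \<Rightarrow> 'a \<Rightarrow> 'a) \<times> 'a" where
  "emb s x = (case s of Pos \<Rightarrow> (x, \<zero>\<^bsub>E\<^esub>, ze Neg) | Neg \<Rightarrow> (ze Pos, \<zero>\<^bsub>E\<^esub>, x))"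

lemma emb_simps: "emb Pos x = (x, \<zero>\<^bsub>E\<^esub>, ze Neg)" "emb Neg x = (ze Pos, \<zero>\<^bsub>E\<^esub>, x)"
  by (simp_all add: emb_def)

lemma emb_closed [simp]: "x \<in> jcarrier V s \<Longrightarrow> emb s x \<in> carrier L"
  by (cases s) (simp_all add: emb_simps D_zero)

lemma emb_inj: "emb s x = emb s y \<longleftrightarrow> x = y"
  by (cases s) (simp_all add: emb_simps)

lemma emb_zero: "emb s (ze s) = \<zero>\<^bsub>L\<^esub>"
  by (cases s) (simp_all add: emb_simps L_zero)

lemma emb_add: "x \<in> jcarrier V s \<Longrightarrow> y \<in> jcarrier V s \<Longrightarrow> emb s (pl s x y) = emb s x \<oplus>\<^bsub>L\<^esub> emb s y"
  by (cases s) (simp_all add: emb_simps)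

lemma emb_smult: "r \<in> carrier R \<Longrightarrow> x \<in> jcarrier V s \<Longrightarrow> emb s (sm s r x) = r \<odot>\<^bsub>L\<^esub> emb s x"
  by (cases s) (simp_all add: emb_simps)

lemma E_zero_mult:
  assumes "d \<in> carrier E"
  shows "d \<otimes>\<^bsub>E\<^esub> \<zero>\<^bsub>E\<^esub> = \<zero>\<^bsub>E\<^esub>" "\<zero>\<^bsub>E\<^esub> \<otimes>\<^bsub>E\<^esub> d = \<zero>\<^bsub>E\<^esub>"
  using assms by (intro E_ext; simp add: E_ops_closed M.abg)+

lemma dl_zero:
  "y \<in> jcarrier V Neg \<Longrightarrow> dl (ze Pos) y = \<zero>\<^bsub>E\<^esub>"
  "x \<in> jcarrier V Pos \<Longrightarrow> dl x (ze Neg) = \<zero>\<^bsub>E\<^esub>"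
  by (rule E_extPN; simp add: t_zero t_zero[of _ Pos, simplified] t_zero[of _ Neg, simplified])+

lemma bracket_emb:
  assumes "a \<in> jcarrier V Pos" "d \<in> D" "b \<in> jcarrier V Neg"
  shows "u \<in> jcarrier V Pos \<Longrightarrow> (a, d, b) \<otimes>\<^bsub>L\<^esub> emb Pos u = (d Pos u, \<ominus>\<^bsub>E\<^esub> dl u b, ze Neg)"
    "v \<in> jcarrier V Neg \<Longrightarrow> (a, d, b) \<otimes>\<^bsub>L\<^esub> emb Neg v = (ze Pos, dl a v, d Neg v)"
    "u \<in> jcarrier V Pos \<Longrightarrow> emb Pos u \<otimes>\<^bsub>L\<^esub> (a, d, b) = (\<ominus>\<^bsub>jmod V Pos\<^esub> d Pos u, dl u b, ze Neg)"
    "v \<in> jcarrier V Neg \<Longrightarrow> emb Neg v \<otimes>\<^bsub>L\<^esub> (a, d, b) = (ze Pos, \<ominus>\<^bsub>E\<^esub> dl a v, \<ominus>\<^bsub>jmod V Neg\<^esub> d Neg v)"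
  using assms D_E[OF assms(2)]
  by (simp_all add: emb_simps L_mult E_zero_mult dl_zero E_ops_closed a_minus_def)

lemma bracket_emb0: "d \<in> D \<Longrightarrow> x \<in> jcarrier V s \<Longrightarrow> (ze Pos, d, ze Neg) \<otimes>\<^bsub>L\<^esub> emb s x = emb s (d s x)"
  using D_E[of d] by (cases s) (simp_all add: bracket_emb dl_zero, simp_all add: emb_simps dl_zero)

lemma emb_bracket:
  assumes "x \<in> jcarrier V Pos" "y \<in> jcarrier V Neg"
  shows "emb Pos x \<otimes>\<^bsub>L\<^esub> emb Neg y = (ze Pos, dl x y, ze Neg)"
    "emb Neg y \<otimes>\<^bsub>L\<^esub> emb Pos x = (ze Pos, \<ominus>\<^bsub>E\<^esub> dl x y, ze Neg)"
  using assms bracket_emb(2)[of x "\<zero>\<^bsub>E\<^esub>" "ze Neg" y] bracket_emb(4)[of x "\<zero>\<^bsub>E\<^esub>" "ze Neg" y]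
  by (simp_all add: D_zero emb_simps(1))

lemma emb_triple:
  assumes "x \<in> jcarrier V s" "y \<in> jcarrier V (opp s)" "z \<in> jcarrier V s"
  shows "emb s (t s x y z) = (emb s x \<otimes>\<^bsub>L\<^esub> emb (opp s) y) \<otimes>\<^bsub>L\<^esub> emb s z"
proof (cases s)
  case Pos
  then show ?thesis using assms by (simp add: emb_bracket bracket_emb0)
next
  case Neg
  then show ?thesis using assms by (simp add: emb_bracket bracket_emb0 D_inv)
qed

lemma emb_Q:
  assumes "x \<in> jcarrier V s" "y \<in> jcarrier V (opp s)"
  shows "emb s (jQ V s x y) = hf \<odot>\<^bsub>L\<^esub> ((emb s x \<otimes>\<^bsub>L\<^esub> emb (opp s) y) \<otimes>\<^bsub>L\<^esub> emb s x)"
  using assms by (simp add: Q_half emb_smult emb_triple)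

end

locale nondeg_pair = half_pair R V
  for R :: "('r, 'e) ring_scheme" and V :: "('r, 'a) jpair" +
  assumes nondeg: "jnondegenerate V"
begin

section \<open>Consequences of nondegeneracy\<close>

lemma nondegD:
  assumes "x \<in> jcarrier V s" "\<And>y. y \<in> jcarrier V (opp s) \<Longrightarrow> jQ V s x y = ze s"
  shows "x = ze s"
  using nondeg assms unfolding jnondegenerate_def by blast

lemma Q_dual_zero:
  assumes b: "b \<in> jcarrier V s" and 0: "\<And>x. x \<in> jcarrier V (opp s) \<Longrightarrow> jQ V (opp s) x b = ze (opp s)"
  shows "b = ze s"
proof (rule nondegD[OF b])
  have t0: "t (opp s) x b x' = ze (opp s)" if "x \<in> jcarrier V (opp s)" "x' \<in> jcarrier V (opp s)" for x x'
    using Q_plus_opp[of x s b x'] that b by (simp add: 0)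
  have t1: "t (opp s) x (jQ V s b x) z = ze (opp s)" if "x \<in> jcarrier V (opp s)" "z \<in> jcarrier V (opp s)" for x z
    using J.JP2[of x "opp s" b z] that b by (simp add: 0 t0)
  have t2: "t (opp s) x (jQ V s b y) x = ze (opp s)" if x: "x \<in> jcarrier V (opp s)" and y: "y \<in> jcarrier V (opp s)" for x y
  proof -
    have "t (opp s) y (jQ V s b x) x = ze (opp s)"
      using x y b t1[OF x y] triple_sym[of y "opp s" "jQ V s b x" x] by simp
    moreover have "jQ V s b (pl (opp s) x y) = pl s (jQ V s b x) (jQ V s b y)"
      using x y b J.Q_add by simp
    moreover have "t (opp s) (pl (opp s) x y) (jQ V s b (pl (opp s) x y)) x = ze (opp s)"
      using x y by (intro t1) auto
    moreover note t1[OF x x] t1[OF y x]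
    moreover have "t (opp s) (pl (opp s) x y) (pl s (jQ V s b x) (jQ V s b y)) x =
       pl (opp s) (pl (opp s) (t (opp s) x (jQ V s b x) x) (t (opp s) y (jQ V s b x) x))
        (pl (opp s) (t (opp s) x (jQ V s b y) x) (t (opp s) y (jQ V s b y) x))"
      using x y b t_add2[of _ "opp s" "jQ V s b x" "jQ V s b y" x] by (simp add: t_add1 M.add4)
    ultimately show ?thesis using x y b by simp
  qed
  have Q0: "jQ V s b y = ze s" if y: "y \<in> jcarrier V (opp s)" for y
  proof (rule nondegD)
    show "jQ V s b y \<in> jcarrier V s" using b y by simp
    fix z assume z: "z \<in> jcarrier V (opp s)"
    have "jQ V (opp s) y (jQ V s b z) = ze (opp s)"
      using y z b by (subst Q_half) (simp_all add: t2)
    then show "jQ V s (jQ V s b y) z = ze s"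
      using J.JP3[OF b y z] b Q_zero_right by simp
  qed
  show "jQ V s b y = ze s" if "y \<in> jcarrier V (opp s)" for y by (rule Q0[OF that])
qed

lemma t_dual_zero:
  assumes "b \<in> jcarrier V (opp s)" "\<And>x z. x \<in> jcarrier V s \<Longrightarrow> z \<in> jcarrier V s \<Longrightarrow> t s x b z = ze s"
  shows "b = ze (opp s)"
proof (rule Q_dual_zero[OF assms(1)])
  fix x assume "x \<in> jcarrier V (opp (opp s))"
  then show "jQ V (opp (opp s)) x b = ze (opp (opp s))" using assms by (simp add: Q_half)
qed

lemma dl_faithful:
  "b \<in> jcarrier V Neg \<Longrightarrow> (\<And>x. x \<in> jcarrier V Pos \<Longrightarrow> dl x b = \<zero>\<^bsub>E\<^esub>) \<Longrightarrow> b = ze Neg"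
  "a \<in> jcarrier V Pos \<Longrightarrow> (\<And>y. y \<in> jcarrier V Neg \<Longrightarrow> dl a y = \<zero>\<^bsub>E\<^esub>) \<Longrightarrow> a = ze Pos"
proof -
  assume b: "b \<in> jcarrier V Neg" and *: "\<And>x. x \<in> jcarrier V Pos \<Longrightarrow> dl x b = \<zero>\<^bsub>E\<^esub>"
  have "t Pos x b z = ze Pos" if "x \<in> jcarrier V Pos" "z \<in> jcarrier V Pos" for x z
    using *[OF that(1)] that(2) dl_apply(1)[of z x b] by simp
  then show "b = ze Neg" using t_dual_zero[of b Pos] b by simp
next
  assume a: "a \<in> jcarrier V Pos" and *: "\<And>y. y \<in> jcarrier V Neg \<Longrightarrow> dl a y = \<zero>\<^bsub>E\<^esub>"
  have "t Neg y a z = ze Neg" if "y \<in> jcarrier V Neg" "z \<in> jcarrier V Neg" for y z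
  proof -
    have "\<ominus>\<^bsub>jmod V Neg\<^esub> t Neg y a z = ze Neg"
      using *[OF that(1)] that(2) dl_apply(2)[of z a y] by simp
    then show ?thesis using that a by (simp add: M.diff_eq)
  qed
  then show "a = ze Pos" using t_dual_zero[of a Neg] a by simp
qed

lemma D_zero_if:
  assumes d: "d \<in> D" and 0: "\<And>x. x \<in> jcarrier V s \<Longrightarrow> d s x = ze s" and y: "y \<in> jcarrier V (opp s)"
  shows "d (opp s) y = ze (opp s)"
proof (rule t_dual_zero)
  note [simp] = D_E[OF d]
  show "d (opp s) y \<in> jcarrier V (opp s)" using y by simp
  show "t s x (d (opp s) y) z = ze s" if "x \<in> jcarrier V s" "z \<in> jcarrier V s" for x z
    using D_derivation[OF d that(1) y that(2)] that y by (simp add: 0 t_zero)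
qed

section \<open>Ideals of the Lie algebra\<close>

abbreviation lideal where "lideal \<equiv> lie_ideal R L"
abbreviation ess where "ess \<equiv> lie_essential R L"

lemma lidealD:
  assumes "lideal I"
  shows "I \<subseteq> carrier L" "\<zero>\<^bsub>L\<^esub> \<in> I" "\<And>x y. x \<in> I \<Longrightarrow> y \<in> I \<Longrightarrow> x \<oplus>\<^bsub>L\<^esub> y \<in> I" "\<And>x. x \<in> I \<Longrightarrow> \<ominus>\<^bsub>L\<^esub> x \<in> I"
    "\<And>x y. x \<in> I \<Longrightarrow> y \<in> I \<Longrightarrow> x \<ominus>\<^bsub>L\<^esub> y \<in> I" "\<And>r x. r \<in> carrier R \<Longrightarrow> x \<in> I \<Longrightarrow> r \<odot>\<^bsub>L\<^esub> x \<in> I"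
    "\<And>x y. x \<in> carrier L \<Longrightarrow> y \<in> I \<Longrightarrow> x \<otimes>\<^bsub>L\<^esub> y \<in> I" "\<And>x y. x \<in> carrier L \<Longrightarrow> y \<in> I \<Longrightarrow> y \<otimes>\<^bsub>L\<^esub> x \<in> I"
proof -
  have s: "submodule I R L" and b: "\<And>x y. x \<in> carrier L \<Longrightarrow> y \<in> I \<Longrightarrow> x \<otimes>\<^bsub>L\<^esub> y \<in> I"
    using assms unfolding lie_ideal_def by auto
  note E = L.submoduleE[OF s]
  show "I \<subseteq> carrier L" by (rule E(1))
  show "\<zero>\<^bsub>L\<^esub> \<in> I" by (rule L.submodule_zero[OF s])
  show "\<And>x y. x \<in> I \<Longrightarrow> y \<in> I \<Longrightarrow> x \<oplus>\<^bsub>L\<^esub> y \<in> I" by (rule E(5))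
  show inv: "\<And>x. x \<in> I \<Longrightarrow> \<ominus>\<^bsub>L\<^esub> x \<in> I" by (rule E(3))
  show "\<And>x y. x \<in> I \<Longrightarrow> y \<in> I \<Longrightarrow> x \<ominus>\<^bsub>L\<^esub> y \<in> I" by (rule L.submodule_minus[OF s])
  show "\<And>r x. r \<in> carrier R \<Longrightarrow> x \<in> I \<Longrightarrow> r \<odot>\<^bsub>L\<^esub> x \<in> I" by (rule E(4))
  show "\<And>x y. x \<in> carrier L \<Longrightarrow> y \<in> I \<Longrightarrow> x \<otimes>\<^bsub>L\<^esub> y \<in> I" by (rule b)
  show "y \<otimes>\<^bsub>L\<^esub> x \<in> I" if "x \<in> carrier L" "y \<in> I" for x y
  proof -
    have "y \<in> carrier L" using E(1) that(2) by (rule subsetD)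
    from L_anti[OF this that(1)] inv[OF b[OF that]] show ?thesis by simp
  qed
qed

lemma lidealI:
  assumes "I \<subseteq> carrier L" "\<zero>\<^bsub>L\<^esub> \<in> I" "\<And>x y. x \<in> I \<Longrightarrow> y \<in> I \<Longrightarrow> x \<oplus>\<^bsub>L\<^esub> y \<in> I"
    "\<And>r x. r \<in> carrier R \<Longrightarrow> x \<in> I \<Longrightarrow> r \<odot>\<^bsub>L\<^esub> x \<in> I" "\<And>x y. x \<in> carrier L \<Longrightarrow> y \<in> I \<Longrightarrow> x \<otimes>\<^bsub>L\<^esub> y \<in> I"
  shows "lideal I"
proof -
  have "\<ominus>\<^bsub>L\<^esub> x \<in> I" if "x \<in> I" for x
  proof -
    have "\<ominus>\<^bsub>L\<^esub> x = (\<ominus>\<^bsub>R\<^esub> \<one>\<^bsub>R\<^esub>) \<odot>\<^bsub>L\<^esub> x" using that assms(1) by (subst L.smult_l_minus) auto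
    then show ?thesis using that assms(4)[of "\<ominus>\<^bsub>R\<^esub> \<one>\<^bsub>R\<^esub>" x] by simp
  qed
  then show ?thesis unfolding lie_ideal_def using assms by (auto intro!: L.submoduleI)
qed

lemma lideal_Int: "lideal I \<Longrightarrow> lideal J \<Longrightarrow> lideal (I \<inter> J)"
  unfolding lie_ideal_def using L.submodule_Int by auto

text \<open>
  Iterated brackets with \<open>V\<^sup>+\<close> and \<open>V\<^sup>-\<close> move the components of an element of the ideal into \<open>V\<^sup>+\<close> or \<open>V\<^sup>-\<close>, and
  by nondegeneracy they cannot all vanish.
\<close>

lemma lideal_meets_V:
  assumes J: "lideal J" and "J \<noteq> {\<zero>\<^bsub>L\<^esub>}"
  obtains s x where "x \<in> jcarrier V s" "x \<noteq> ze s" "emb s x \<in> J"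
proof -
  note j = lidealD[OF J]
  obtain z where z: "z \<in> J" "z \<noteq> \<zero>\<^bsub>L\<^esub>" using assms(2) j(2) by blast
  obtain a d b where zz: "z = (a, d, b)" by (cases z)
  have mem: "a \<in> jcarrier V Pos" "d \<in> D" "b \<in> jcarrier V Neg"
    using z(1) j(1) unfolding zz by auto
  note [simp] = mem D_E[OF mem(2)]
  consider "b \<noteq> ze Neg" | "a \<noteq> ze Pos" | "a = ze Pos" "b = ze Neg" "d \<noteq> \<zero>\<^bsub>E\<^esub>"
    using z(2) unfolding zz L_zero by auto
  then show thesis
  proof cases
    case 1
    then obtain x where x: "x \<in> jcarrier V Pos" "jQ V Pos x b \<noteq> ze Pos"
      using Q_dual_zero[of b Neg] by auto
    then have "t Pos x b x \<noteq> ze Pos" using Q_half[of x Pos b] by auto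
    moreover have "emb Pos x \<otimes>\<^bsub>L\<^esub> (emb Pos x \<otimes>\<^bsub>L\<^esub> z) = emb Pos (\<ominus>\<^bsub>jmod V Pos\<^esub> t Pos x b x)"
      unfolding zz using x(1) by (simp add: bracket_emb dl_zero) (simp add: emb_simps)
    moreover have "emb Pos x \<otimes>\<^bsub>L\<^esub> (emb Pos x \<otimes>\<^bsub>L\<^esub> z) \<in> J"
      using x(1) z(1) by (intro j(7)) auto
    ultimately show thesis using x(1) that[of "\<ominus>\<^bsub>jmod V Pos\<^esub> t Pos x b x" Pos]
      by (auto simp: M.diff_eq)
  next
    case 2
    then obtain y where y: "y \<in> jcarrier V Neg" "jQ V Neg y a \<noteq> ze Neg"
      using Q_dual_zero[of a Pos] by auto
    then have "t Neg y a y \<noteq> ze Neg" using Q_half[of y Neg a] by auto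
    moreover have "emb Neg y \<otimes>\<^bsub>L\<^esub> (emb Neg y \<otimes>\<^bsub>L\<^esub> z) = emb Neg (\<ominus>\<^bsub>jmod V Neg\<^esub> t Neg y a y)"
      unfolding zz using y(1) by (simp add: bracket_emb dl_zero D_inv) (simp add: emb_simps)
    moreover have "emb Neg y \<otimes>\<^bsub>L\<^esub> (emb Neg y \<otimes>\<^bsub>L\<^esub> z) \<in> J"
      using y(1) z(1) by (intro j(7)) auto
    ultimately show thesis using y(1) that[of "\<ominus>\<^bsub>jmod V Neg\<^esub> t Neg y a y" Neg]
      by (auto simp: M.diff_eq)
  next
    case 3
    obtain s x where x: "x \<in> jcarrier V s" "d s x \<noteq> ze s"
      using 3(3) E_ext[of d "\<zero>\<^bsub>E\<^esub>"] by (auto simp: E_ops_closed)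
    then have "emb s (d s x) \<in> J"
      using j(8)[OF emb_closed[OF x(1)] z(1)] unfolding zz 3 by (simp add: bracket_emb0)
    with x show thesis by (intro that[of "d s x" s]) auto
  qed
qed

lemma lideal_not_abelian:
  assumes J: "lideal J" and "J \<noteq> {\<zero>\<^bsub>L\<^esub>}"
  obtains v w where "v \<in> J" "w \<in> J" "v \<otimes>\<^bsub>L\<^esub> w \<noteq> \<zero>\<^bsub>L\<^esub>"
proof -
  obtain s x where x: "x \<in> jcarrier V s" "x \<noteq> ze s" "emb s x \<in> J"
    using lideal_meets_V[OF assms] .
  obtain y where y: "y \<in> jcarrier V (opp s)" "jQ V s x y \<noteq> ze s" using nondegD[OF x(1)] x(2) by blast
  then have "t s x y x \<noteq> ze s" using Q_half[of x s y] x by auto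
  moreover have "emb s x \<otimes>\<^bsub>L\<^esub> emb (opp s) y \<in> J" using x y lidealD(8)[OF J] by simp
  ultimately show thesis
    using that[of "emb s x \<otimes>\<^bsub>L\<^esub> emb (opp s) y" "emb s x"] x y
    by (simp add: emb_triple[symmetric] emb_zero[of s, symmetric] emb_inj)
qed

lemma essD: "ess I \<Longrightarrow> lideal I"
  by (simp add: lie_essential_def)

lemma ess_in: "ess I \<Longrightarrow> x \<in> I \<Longrightarrow> x \<in> carrier L"
  using lidealD(1)[OF essD] by blast

lemma ess_carrier: "ess (carrier L)"
proof -
  have "lideal (carrier L)" by (rule lidealI) (auto intro: L_mult_closed)
  moreover have "carrier L \<inter> J \<noteq> {\<zero>\<^bsub>L\<^esub>}" if "lideal J" "J \<noteq> {\<zero>\<^bsub>L\<^esub>}" for J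
    using that lidealD(1) by (simp add: Int_absorb1)
  ultimately show ?thesis by (auto simp: lie_essential_def)
qed

lemma ess_Int:
  assumes "ess I" "ess J"
  shows "ess (I \<inter> J)"
proof -
  have "I \<inter> J \<inter> W \<noteq> {\<zero>\<^bsub>L\<^esub>}" if W: "lideal W" "W \<noteq> {\<zero>\<^bsub>L\<^esub>}" for W
  proof -
    have "J \<inter> W \<noteq> {\<zero>\<^bsub>L\<^esub>}" "lideal (J \<inter> W)" using assms(2) W lideal_Int by (auto simp: lie_essential_def)
    then have "I \<inter> (J \<inter> W) \<noteq> {\<zero>\<^bsub>L\<^esub>}" using assms(1) by (auto simp: lie_essential_def)
    then show ?thesis by (simp add: Int_assoc)
  qed
  then show ?thesis using assms lideal_Int by (simp add: lie_essential_def)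
qed

text \<open>
  The centralizer of an ideal is an ideal.  It meets an essential ideal in an abelian ideal, and \<open>L\<close>
  has no nonzero abelian ideals.
\<close>

lemma ess_centralizer:
  assumes I: "ess I" and z: "z \<in> carrier L" and 0: "\<And>y. y \<in> I \<Longrightarrow> z \<otimes>\<^bsub>L\<^esub> y = \<zero>\<^bsub>L\<^esub>"
  shows "z = \<zero>\<^bsub>L\<^esub>"
proof (rule ccontr)
  let ?C = "{z \<in> carrier L. \<forall>y\<in>I. z \<otimes>\<^bsub>L\<^esub> y = \<zero>\<^bsub>L\<^esub>}"
  note i = lidealD[OF essD[OF I]] and iL = ess_in[OF I]
  have C: "lideal ?C"
  proof (rule lidealI)
    fix x z assume x: "x \<in> carrier L" and z: "z \<in> ?C"
    have "(x \<otimes>\<^bsub>L\<^esub> z) \<otimes>\<^bsub>L\<^esub> y = \<zero>\<^bsub>L\<^esub>" if y: "y \<in> I" for y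
      using L_jacobi'[OF x _ iL[OF y], of z] x z y i(7)[OF x y]
      by (simp add: a_minus_def L_mult_closed)
    then show "x \<otimes>\<^bsub>L\<^esub> z \<in> ?C" using x z by (simp add: L_mult_closed)
  qed (auto simp: iL L_bracket_add L_bracket_smult)
  assume "z \<noteq> \<zero>\<^bsub>L\<^esub>"
  then have "?C \<noteq> {\<zero>\<^bsub>L\<^esub>}" using z 0 by blast
  then have "I \<inter> ?C \<noteq> {\<zero>\<^bsub>L\<^esub>}" using I C by (auto simp: lie_essential_def)
  with lideal_Int[OF essD[OF I] C] obtain v w where "v \<in> I \<inter> ?C" "w \<in> I \<inter> ?C" "v \<otimes>\<^bsub>L\<^esub> w \<noteq> \<zero>\<^bsub>L\<^esub>"
    by (rule lideal_not_abelian)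
  then show False by auto
qed

text \<open>Germs at the essential ideals: permissible maps are equivalent exactly when they agree eventually.\<close>

definition F :: "('a \<times> (sign \<Rightarrow> 'a \<Rightarrow> 'a) \<times> 'a) filter" where
  "F = (INF K\<in>{K. ess K}. principal K)"

lemma eventually_F: "eventually P F \<longleftrightarrow> (\<exists>K. ess K \<and> (\<forall>x\<in>K. P x))"
proof -
  have "eventually P F \<longleftrightarrow> (\<exists>K\<in>{K. ess K}. eventually P (principal K))"
    unfolding F_def
  proof (rule eventually_INF_base)
    show "{K. ess K} \<noteq> {}" using ess_carrier by blast
    fix a b assume "a \<in> {K. ess K}" "b \<in> {K. ess K}"
    then show "\<exists>x\<in>{K. ess K}. principal x \<le> inf (principal a) (principal b)"
      using ess_Int[of a b] by (intro bexI[of _ "a \<inter> b"]) auto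
  qed
  then show ?thesis by (auto simp: eventually_principal)
qed

lemma ev_ess: "ess K \<Longrightarrow> \<forall>\<^sub>F x in F. x \<in> K"
  by (auto simp: eventually_F)

lemma ev_carrier: "\<forall>\<^sub>F x in F. x \<in> carrier L"
  by (rule ev_ess[OF ess_carrier])

lemma ev_bracket:
  assumes "\<forall>\<^sub>F x in F. P x"
  shows "\<forall>\<^sub>F x in F. \<forall>y\<in>carrier L. P (y \<otimes>\<^bsub>L\<^esub> x) \<and> P (x \<otimes>\<^bsub>L\<^esub> y)"
  using assms lidealD(7,8)[OF essD] unfolding eventually_F by meson

lemma centralizer_zero:
  assumes "z \<in> carrier L" "\<forall>\<^sub>F y in F. z \<otimes>\<^bsub>L\<^esub> y = \<zero>\<^bsub>L\<^esub>"
  shows "z = \<zero>\<^bsub>L\<^esub>"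
  using assms ess_centralizer unfolding eventually_F by blast

section \<open>The extended centroid of the Lie algebra\<close>

abbreviation P where "P \<equiv> lie_permissible R L"
abbreviation lc where "lc \<equiv> lie_class R L"
abbreviation C where "C \<equiv> lie_centroid R L"

lemma permD:
  assumes "(f, I) \<in> P"
  shows "ess I" "\<And>x. x \<in> I \<Longrightarrow> f x \<in> carrier L" "\<And>x y. x \<in> I \<Longrightarrow> y \<in> I \<Longrightarrow> f (x \<oplus>\<^bsub>L\<^esub> y) = f x \<oplus>\<^bsub>L\<^esub> f y"
    "\<And>x y. x \<in> carrier L \<Longrightarrow> y \<in> I \<Longrightarrow> f (x \<otimes>\<^bsub>L\<^esub> y) = x \<otimes>\<^bsub>L\<^esub> f y"
    "f \<zero>\<^bsub>L\<^esub> = \<zero>\<^bsub>L\<^esub>" "\<And>x. x \<in> I \<Longrightarrow> f (\<ominus>\<^bsub>L\<^esub> x) = \<ominus>\<^bsub>L\<^esub> f x"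
    "\<And>x y. x \<in> carrier L \<Longrightarrow> y \<in> I \<Longrightarrow> f (y \<otimes>\<^bsub>L\<^esub> x) = f y \<otimes>\<^bsub>L\<^esub> x"
    "\<And>r x. r \<in> carrier R \<Longrightarrow> x \<in> I \<Longrightarrow> f (r \<odot>\<^bsub>L\<^esub> x) = r \<odot>\<^bsub>L\<^esub> f x"
proof -
  have e: "ess I" and cl: "\<And>x. x \<in> I \<Longrightarrow> f x \<in> carrier L"
    and ad: "\<And>x y. x \<in> I \<Longrightarrow> y \<in> I \<Longrightarrow> f (x \<oplus>\<^bsub>L\<^esub> y) = f x \<oplus>\<^bsub>L\<^esub> f y"
    and br: "\<And>x y. x \<in> carrier L \<Longrightarrow> y \<in> I \<Longrightarrow> f (x \<otimes>\<^bsub>L\<^esub> y) = x \<otimes>\<^bsub>L\<^esub> f y"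
    using assms unfolding lie_permissible_def by (auto simp: Pi_iff)
  note i = lidealD[OF essD[OF e]] and iL = ess_in[OF e]
  show "ess I" "\<And>x. x \<in> I \<Longrightarrow> f x \<in> carrier L" "\<And>x y. x \<in> I \<Longrightarrow> y \<in> I \<Longrightarrow> f (x \<oplus>\<^bsub>L\<^esub> y) = f x \<oplus>\<^bsub>L\<^esub> f y"
    "\<And>x y. x \<in> carrier L \<Longrightarrow> y \<in> I \<Longrightarrow> f (x \<otimes>\<^bsub>L\<^esub> y) = x \<otimes>\<^bsub>L\<^esub> f y"
    by fact+
  show z: "f \<zero>\<^bsub>L\<^esub> = \<zero>\<^bsub>L\<^esub>"
    using ad[of "\<zero>\<^bsub>L\<^esub>" "\<zero>\<^bsub>L\<^esub>"] cl i(2) by (intro L.add_self_zero) auto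
  show m: "f (\<ominus>\<^bsub>L\<^esub> x) = \<ominus>\<^bsub>L\<^esub> f x" if "x \<in> I" for x
    using ad[of "\<ominus>\<^bsub>L\<^esub> x" x] that i(4) cl iL z by (intro L.minus_equality[symmetric]) (auto simp: L.l_neg)
  show yx: "f (y \<otimes>\<^bsub>L\<^esub> x) = f y \<otimes>\<^bsub>L\<^esub> x" if "x \<in> carrier L" "y \<in> I" for x y
    using that iL cl by (simp add: L_anti[of y x] L_anti[of "f y" x] m i(7) br)
  show "f (r \<odot>\<^bsub>L\<^esub> x) = r \<odot>\<^bsub>L\<^esub> f x" if r: "r \<in> carrier R" and x: "x \<in> I" for r x
  proof -
    have rx: "r \<odot>\<^bsub>L\<^esub> x \<in> I" using i(6) r x .
    have "f (r \<odot>\<^bsub>L\<^esub> x) \<ominus>\<^bsub>L\<^esub> r \<odot>\<^bsub>L\<^esub> f x = \<zero>\<^bsub>L\<^esub>"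
    proof (rule ess_centralizer[OF e])
      show "f (r \<odot>\<^bsub>L\<^esub> x) \<ominus>\<^bsub>L\<^esub> r \<odot>\<^bsub>L\<^esub> f x \<in> carrier L" using rx x cl r by auto
      fix y assume y: "y \<in> I"
      note yL = iL[OF y] and xL = iL[OF x]
      have "y \<otimes>\<^bsub>L\<^esub> f (r \<odot>\<^bsub>L\<^esub> x) = f (y \<otimes>\<^bsub>L\<^esub> (r \<odot>\<^bsub>L\<^esub> x))" using br[OF yL rx] by simp
      also have "\<dots> = f ((r \<odot>\<^bsub>L\<^esub> y) \<otimes>\<^bsub>L\<^esub> x)" using yL xL r by (simp add: L_bracket_smult)
      also have "\<dots> = r \<odot>\<^bsub>L\<^esub> (y \<otimes>\<^bsub>L\<^esub> f x)" using yL x r cl by (simp add: br L_bracket_smult)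
      finally show "(f (r \<odot>\<^bsub>L\<^esub> x) \<ominus>\<^bsub>L\<^esub> r \<odot>\<^bsub>L\<^esub> f x) \<otimes>\<^bsub>L\<^esub> y = \<zero>\<^bsub>L\<^esub>"
        using yL x rx r cl by (intro L_diff_bracket_zero) (simp_all add: L_bracket_smult)
    qed
    then show ?thesis using rx x cl r by (subst (asm) L.eq_if_minus_zero) auto
  qed
qed

lemma permI:
  assumes "ess I" "\<And>x. x \<in> I \<Longrightarrow> f x \<in> carrier L" "\<And>x y. x \<in> I \<Longrightarrow> y \<in> I \<Longrightarrow> f (x \<oplus>\<^bsub>L\<^esub> y) = f x \<oplus>\<^bsub>L\<^esub> f y"
    "\<And>x y. x \<in> carrier L \<Longrightarrow> y \<in> I \<Longrightarrow> f (x \<otimes>\<^bsub>L\<^esub> y) = x \<otimes>\<^bsub>L\<^esub> f y"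
  shows "(f, I) \<in> P"
  unfolding lie_permissible_def using assms by auto

text \<open>
  A nonzero ideal \<open>W\<close> meets \<open>I \<inter> J\<close> in an ideal that is not abelian.  For \<open>v\<close> and \<open>w\<close> in it with \<open>[v, w] \<noteq> 0\<close>, the
  value \<open>f [v, w] = [v, f w]\<close> lies in \<open>J\<close>.
\<close>

lemma perm_preimage:
  assumes f: "(f, I) \<in> P" and J: "ess J"
  shows "ess {x \<in> I. f x \<in> J}"
proof -
  note p = permD[OF f] note i = lidealD[OF essD[OF p(1)]] and j = lidealD[OF essD[OF J]]
  let ?K = "{x \<in> I. f x \<in> J}"
  have K: "lideal ?K"
    by (rule lidealI) (use i j p in auto)
  moreover have "?K \<inter> W \<noteq> {\<zero>\<^bsub>L\<^esub>}" if W: "lideal W" "W \<noteq> {\<zero>\<^bsub>L\<^esub>}" for W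
  proof -
    let ?W = "I \<inter> J \<inter> W"
    have id: "lideal ?W" using lideal_Int essD p(1) J W(1) by blast
    have "?W \<noteq> {\<zero>\<^bsub>L\<^esub>}" using ess_Int[OF p(1) J] W by (auto simp: lie_essential_def)
    with id obtain v w where vw: "v \<in> ?W" "w \<in> ?W" "v \<otimes>\<^bsub>L\<^esub> w \<noteq> \<zero>\<^bsub>L\<^esub>" by (rule lideal_not_abelian)
    have "v \<otimes>\<^bsub>L\<^esub> w \<in> ?W" using vw lidealD(1,7)[OF id] by blast
    moreover have "f (v \<otimes>\<^bsub>L\<^esub> w) = v \<otimes>\<^bsub>L\<^esub> f w" using vw i(1) by (intro p(4)) blast+
    then have "f (v \<otimes>\<^bsub>L\<^esub> w) \<in> J" using vw p(2)[of w] j(8)[of "f w" v] by simp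
    ultimately show ?thesis using vw(3) by blast
  qed
  ultimately show ?thesis by (auto simp: lie_essential_def)
qed

lemma lequiv_iff: "((f, I), (g, J)) \<in> lie_equiv R L \<longleftrightarrow>
    (f, I) \<in> P \<and> (g, J) \<in> P \<and> (\<forall>\<^sub>F y in F. f y = g y)"
proof -
  have "\<exists>K. ess K \<and> K \<subseteq> I \<inter> J \<and> (\<forall>x\<in>K. f x = g x)"
    if "(f, I) \<in> P" "(g, J) \<in> P" "ess K" "\<forall>x\<in>K. f x = g x" for K
    using that ess_Int[OF ess_Int[OF permD(1)[OF that(1)] permD(1)[OF that(2)]] that(3)]
    by (intro exI[of _ "I \<inter> J \<inter> K"]) auto
  then show ?thesis unfolding lie_equiv_def eventually_F by auto
qed

lemma lequiv: "equiv P (lie_equiv R L)"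
proof (rule equivI)
  show "lie_equiv R L \<subseteq> P \<times> P" by (auto simp: lequiv_iff)
  show "refl_on P (lie_equiv R L)" by (auto simp: refl_on_def lequiv_iff)
  show "sym (lie_equiv R L)" by (auto simp: sym_def lequiv_iff elim: eventually_mono)
  show "trans (lie_equiv R L)"
    by (auto simp: trans_def lequiv_iff) (drule (1) eventually_conj, erule eventually_mono, simp)
qed

lemma lc_eq: "(f, I) \<in> P \<Longrightarrow> (g, J) \<in> P \<Longrightarrow> lc (f, I) = lc (g, J) \<longleftrightarrow> (\<forall>\<^sub>F y in F. f y = g y)"
  unfolding lie_class_def using eq_equiv_class_iff[OF lequiv] by (simp add: lequiv_iff)

lemma C_carrier: "carrier C = lc ` P"
  by (auto simp: lie_centroid_def quotient_def lie_class_def)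

lemma lc_closed [simp]: "p \<in> P \<Longrightarrow> lc p \<in> carrier C"
  by (simp add: C_carrier)

lemma mem_lc: "(g, J) \<in> lc (f, I) \<longleftrightarrow> (f, I) \<in> P \<and> (g, J) \<in> P \<and> (\<forall>\<^sub>F y in F. f y = g y)"
  by (simp add: lie_class_def lequiv_iff)

text \<open>
  Classes are handled through a chosen representative, with map \<open>ev c\<close> and domain \<open>dm c\<close>.
\<close>

definition "rp c = (SOME p. p \<in> c)"
definition "ev c = fst (rp c)"
definition "dm c = snd (rp c)"

lemma rp: assumes "c \<in> carrier C" shows "(ev c, dm c) \<in> P" "lc (ev c, dm c) = c"
proof -
  obtain f I where p: "(f, I) \<in> P" "c = lc (f, I)" using assms by (auto simp: C_carrier)
  then have "(f, I) \<in> c" by (simp add: mem_lc)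
  then have "rp c \<in> c" unfolding rp_def by (rule someI)
  then have m: "(ev c, dm c) \<in> lc (f, I)" by (simp add: ev_def dm_def p)
  then show "(ev c, dm c) \<in> P" by (simp add: mem_lc)
  then show "lc (ev c, dm c) = c" using m p by (simp add: lc_eq mem_lc) (auto elim: eventually_mono)
qed

lemmas evD = permD[OF rp(1)]

lemma ev_lc: "(f, I) \<in> P \<Longrightarrow> \<forall>\<^sub>F y in F. ev (lc (f, I)) y = f y"
  using rp[of "lc (f, I)"] lc_eq by auto

lemma C_eqI: "c \<in> carrier C \<Longrightarrow> e \<in> carrier C \<Longrightarrow> \<forall>\<^sub>F y in F. ev c y = ev e y \<Longrightarrow> c = e"
  using lc_eq[OF rp(1) rp(1), of c e] by (simp add: rp(2))

lemma ev_dm: "c \<in> carrier C \<Longrightarrow> \<forall>\<^sub>F y in F. y \<in> dm c"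
  by (intro ev_ess evD(1))

lemma ev_closed: "c \<in> carrier C \<Longrightarrow> \<forall>\<^sub>F y in F. ev c y \<in> carrier L"
  using ev_dm[of c] by (rule eventually_mono) (auto intro: evD(2))

lemma ev_preimage:
  assumes c: "c \<in> carrier C" and "\<forall>\<^sub>F y in F. Q y"
  shows "\<forall>\<^sub>F y in F. Q (ev c y)"
proof -
  obtain K where "ess K" "\<forall>x\<in>K. Q x" using assms(2) by (auto simp: eventually_F)
  then show ?thesis using perm_preimage[OF rp(1)[OF c], of K] by (auto simp: eventually_F)
qed

lemma lc_eventually: "(g, J) \<in> lc (f, I) \<Longrightarrow> (\<forall>\<^sub>F y in F. g y = f y)"
  by (auto simp: mem_lc elim: eventually_mono)

lemma Union_lc:
  assumes "p \<in> P" "\<And>q. q \<in> lc p \<Longrightarrow> H q = H p"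
  shows "(\<Union>q\<in>lc p. H q) = H p"
proof -
  have "p \<in> lc p" using assms(1) by (cases p) (simp add: mem_lc)
  with assms(2) show ?thesis by blast
qed

lemma Union_lc2:
  assumes "p \<in> P" "q \<in> P" "\<And>p' q'. p' \<in> lc p \<Longrightarrow> q' \<in> lc q \<Longrightarrow> H p' q' = H p q"
  shows "(\<Union>p'\<in>lc p. \<Union>q'\<in>lc q. H p' q') = H p q"
proof -
  have q: "q \<in> lc q" "p \<in> lc p" using assms(1,2) by (cases p, cases q, simp add: mem_lc)+
  have "(\<Union>q'\<in>lc q. H p' q') = H p q" if "p' \<in> lc p" for p'
    using q(1) assms(3)[OF that] by blast
  with q(2) show ?thesis by blast
qed

lemma perm_add:
  assumes "(f, I) \<in> P" "(g, J) \<in> P"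
  shows "(\<lambda>x. f x \<oplus>\<^bsub>L\<^esub> g x, I \<inter> J) \<in> P"
proof -
  note p = permD[OF assms(1)] and q = permD[OF assms(2)]
  show ?thesis
    by (rule permI[OF ess_Int[OF p(1) q(1)]]) (auto simp: p q L.add4 L_bracket_add)
qed

lemma perm_comp:
  assumes "(f, I) \<in> P" "(g, J) \<in> P"
  shows "(\<lambda>x. f (g x), {x \<in> J. g x \<in> I}) \<in> P"
proof -
  note p = permD[OF assms(1)] and q = permD[OF assms(2)]
  show ?thesis
    by (rule permI[OF perm_preimage[OF assms(2) p(1)]]) (auto simp: p q)
qed

lemma perm_smult:
  assumes "r \<in> carrier R" "(f, I) \<in> P"
  shows "(\<lambda>x. r \<odot>\<^bsub>L\<^esub> f x, I) \<in> P"
proof -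
  note p = permD[OF assms(2)]
  show ?thesis
    by (rule permI[OF p(1)]) (auto simp: p assms(1) L.smult_r_distr L_bracket_smult)
qed

lemma perm_one: "(\<lambda>x. x, carrier L) \<in> P"
  by (rule permI[OF ess_carrier]) auto

lemma perm_zero: "(\<lambda>x. \<zero>\<^bsub>L\<^esub>, carrier L) \<in> P"
  by (rule permI[OF ess_carrier]) auto

lemma lc_add: assumes "(f, I) \<in> P" "(g, J) \<in> P"
  shows "lc (f, I) \<oplus>\<^bsub>C\<^esub> lc (g, J) = lc (\<lambda>x. f x \<oplus>\<^bsub>L\<^esub> g x, I \<inter> J)"
proof -
  have "lc (\<lambda>x. f' x \<oplus>\<^bsub>L\<^esub> g' x, I' \<inter> J') = lc (\<lambda>x. f x \<oplus>\<^bsub>L\<^esub> g x, I \<inter> J)"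
    if f: "(f', I') \<in> lc (f, I)" and g: "(g', J') \<in> lc (g, J)" for f' I' g' J'
    using lc_eventually[OF f] lc_eventually[OF g] f g assms
    by (subst lc_eq) (auto simp: perm_add mem_lc elim: eventually_elim2)
  then show ?thesis
    using Union_lc2[OF assms, of "\<lambda>p q. case p of (f, I) \<Rightarrow> case q of (g, J) \<Rightarrow> lc (\<lambda>x. f x \<oplus>\<^bsub>L\<^esub> g x, I \<inter> J)"]
    by (simp add: lie_centroid_def case_prod_unfold split: prod.splits)
qed

lemma lc_mult: assumes "(f, I) \<in> P" "(g, J) \<in> P"
  shows "lc (f, I) \<otimes>\<^bsub>C\<^esub> lc (g, J) = lc (\<lambda>x. f (g x), {x \<in> J. g x \<in> I})"
proof -
  have "lc (\<lambda>x. f' (g' x), {x \<in> J'. g' x \<in> I'}) = lc (\<lambda>x. f (g x), {x \<in> J. g x \<in> I})"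
    if f: "(f', I') \<in> lc (f, I)" and g: "(g', J') \<in> lc (g, J)" for f' I' g' J'
  proof -
    obtain K where K: "ess K" "\<forall>x\<in>K. f' x = f x" using lc_eventually[OF f] by (auto simp: eventually_F)
    have "\<forall>\<^sub>F x in F. g x \<in> K" using perm_preimage[OF assms(2) K(1)] by (auto simp: eventually_F)
    then have "\<forall>\<^sub>F x in F. f' (g' x) = f (g x)"
      using lc_eventually[OF g] by eventually_elim (simp add: K)
    then show ?thesis using f g assms by (subst lc_eq) (auto simp: perm_comp mem_lc)
  qed
  then show ?thesis
    using Union_lc2[OF assms, of "\<lambda>p q. case p of (f, I) \<Rightarrow> case q of (g, J) \<Rightarrow> lc (\<lambda>x. f (g x), {x \<in> J. g x \<in> I})"]
    by (simp add: lie_centroid_def case_prod_unfold split: prod.splits)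
qed

lemma lc_smult: assumes "r \<in> carrier R" "(f, I) \<in> P"
  shows "r \<odot>\<^bsub>C\<^esub> lc (f, I) = lc (\<lambda>x. r \<odot>\<^bsub>L\<^esub> f x, I)"
proof -
  have "lc (\<lambda>x. r \<odot>\<^bsub>L\<^esub> f' x, I') = lc (\<lambda>x. r \<odot>\<^bsub>L\<^esub> f x, I)" if f: "(f', I') \<in> lc (f, I)" for f' I'
    using lc_eventually[OF f] f assms
    by (subst lc_eq) (auto simp: perm_smult mem_lc elim: eventually_mono)
  then show ?thesis
    using Union_lc[OF assms(2), of "\<lambda>p. case p of (f, I) \<Rightarrow> lc (\<lambda>x. r \<odot>\<^bsub>L\<^esub> f x, I)"]
    by (simp add: lie_centroid_def case_prod_unfold split: prod.splits)
qed

lemma C_one: "\<one>\<^bsub>C\<^esub> = lc (\<lambda>x. x, carrier L)" and C_zero: "\<zero>\<^bsub>C\<^esub> = lc (\<lambda>x. \<zero>\<^bsub>L\<^esub>, carrier L)"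
  by (simp_all add: lie_centroid_def)

lemma C_closed [simp]:
  "c \<in> carrier C \<Longrightarrow> e \<in> carrier C \<Longrightarrow> c \<oplus>\<^bsub>C\<^esub> e \<in> carrier C"
  "c \<in> carrier C \<Longrightarrow> e \<in> carrier C \<Longrightarrow> c \<otimes>\<^bsub>C\<^esub> e \<in> carrier C"
  "r \<in> carrier R \<Longrightarrow> c \<in> carrier C \<Longrightarrow> r \<odot>\<^bsub>C\<^esub> c \<in> carrier C"
  "\<one>\<^bsub>C\<^esub> \<in> carrier C" "\<zero>\<^bsub>C\<^esub> \<in> carrier C"
  by (auto simp: C_carrier lc_add lc_mult lc_smult C_one C_zero
    intro!: imageI perm_add perm_comp perm_smult perm_one perm_zero)

lemma ev_add: "c \<in> carrier C \<Longrightarrow> e \<in> carrier C \<Longrightarrow> \<forall>\<^sub>F y in F. ev (c \<oplus>\<^bsub>C\<^esub> e) y = ev c y \<oplus>\<^bsub>L\<^esub> ev e y"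
  using lc_add[OF rp(1) rp(1), of c e] ev_lc[OF perm_add[OF rp(1) rp(1)], of c e] by (simp add: rp)

lemma ev_mult: "c \<in> carrier C \<Longrightarrow> e \<in> carrier C \<Longrightarrow> \<forall>\<^sub>F y in F. ev (c \<otimes>\<^bsub>C\<^esub> e) y = ev c (ev e y)"
  using lc_mult[OF rp(1) rp(1), of c e] ev_lc[OF perm_comp[OF rp(1) rp(1)], of c e] by (simp add: rp)

lemma ev_smult: "r \<in> carrier R \<Longrightarrow> c \<in> carrier C \<Longrightarrow> \<forall>\<^sub>F y in F. ev (r \<odot>\<^bsub>C\<^esub> c) y = r \<odot>\<^bsub>L\<^esub> ev c y"
  using lc_smult[OF _ rp(1), of r c] ev_lc[OF perm_smult[OF _ rp(1)], of r c] by (simp add: rp)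

lemma ev_one: "\<forall>\<^sub>F y in F. ev \<one>\<^bsub>C\<^esub> y = y"
  unfolding C_one by (rule ev_lc[OF perm_one])

lemma ev_zero: "\<forall>\<^sub>F y in F. ev \<zero>\<^bsub>C\<^esub> y = \<zero>\<^bsub>L\<^esub>"
  unfolding C_zero by (rule ev_lc[OF perm_zero])

lemma ev_comm:
  assumes c: "c \<in> carrier C" and e: "e \<in> carrier C"
  shows "\<forall>\<^sub>F y in F. ev c (ev e y) = ev e (ev c y)"
proof -
  obtain K where K: "ess K" "\<And>y. y \<in> K \<Longrightarrow> y \<in> dm c \<and> y \<in> dm e \<and> ev c y \<in> dm e \<and> ev e y \<in> dm c"
    using eventually_conj[OF eventually_conj[OF ev_dm[OF c] ev_dm[OF e]]
      eventually_conj[OF ev_preimage[OF c ev_dm[OF e]] ev_preimage[OF e ev_dm[OF c]]]]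
    by (auto simp: eventually_F)
  note k = lidealD[OF essD[OF K(1)]] and kL = ess_in[OF K(1)]
  have "ev c (ev e y) = ev e (ev c y)" if y: "y \<in> K" for y
  proof -
    have cl: "ev c (ev e y) \<in> carrier L" "ev e (ev c y) \<in> carrier L" using K(2)[OF y] evD(2) c e by auto
    have "ev c (ev e y) \<ominus>\<^bsub>L\<^esub> ev e (ev c y) = \<zero>\<^bsub>L\<^esub>"
    proof (rule ess_centralizer[OF K(1)])
      show "ev c (ev e y) \<ominus>\<^bsub>L\<^esub> ev e (ev c y) \<in> carrier L" using cl by simp
      fix x assume x: "x \<in> K"
      have xy: "x \<otimes>\<^bsub>L\<^esub> y \<in> K" using k(7) kL x y by blast
      have "x \<otimes>\<^bsub>L\<^esub> ev c (ev e y) = ev c (ev e (x \<otimes>\<^bsub>L\<^esub> y))"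
        using K(2)[OF x] K(2)[OF y] kL x y evD(4)[OF c] evD(4)[OF e] by simp
      also have "\<dots> = ev c (ev e x \<otimes>\<^bsub>L\<^esub> y)"
        using K(2)[OF x] kL x y evD(7)[OF e] by simp
      also have "\<dots> = ev e x \<otimes>\<^bsub>L\<^esub> ev c y"
        using K(2)[OF x] K(2)[OF y] kL x y evD(2,4)[OF c] evD(2,4)[OF e] by simp
      also have "\<dots> = ev e (x \<otimes>\<^bsub>L\<^esub> ev c y)"
        using K(2)[OF x] K(2)[OF y] kL x y evD(2)[OF c] evD(7)[OF e] by simp
      also have "\<dots> = x \<otimes>\<^bsub>L\<^esub> ev e (ev c y)"
        using K(2)[OF x] K(2)[OF y] kL x y evD(4)[OF e] by simp
      finally show "(ev c (ev e y) \<ominus>\<^bsub>L\<^esub> ev e (ev c y)) \<otimes>\<^bsub>L\<^esub> x = \<zero>\<^bsub>L\<^esub>"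
        using cl kL[OF x] by (intro L_diff_bracket_zero) simp_all
    qed
    then show ?thesis using cl by (subst (asm) L.eq_if_minus_zero) auto
  qed
  then show ?thesis using K(1) by (auto simp: eventually_F)
qed

lemma C_abelian_group: "abelian_group C"
proof (rule abelian_groupI)
  fix c e f assume *: "c \<in> carrier C" "e \<in> carrier C" "f \<in> carrier C"
  show "c \<oplus>\<^bsub>C\<^esub> e \<oplus>\<^bsub>C\<^esub> f = c \<oplus>\<^bsub>C\<^esub> (e \<oplus>\<^bsub>C\<^esub> f)"
  proof (rule C_eqI)
    show "\<forall>\<^sub>F y in F. ev (c \<oplus>\<^bsub>C\<^esub> e \<oplus>\<^bsub>C\<^esub> f) y = ev (c \<oplus>\<^bsub>C\<^esub> (e \<oplus>\<^bsub>C\<^esub> f)) y"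
      using ev_add[OF C_closed(1)[OF *(1,2)] *(3)] ev_add[OF *(1,2)] ev_add[OF *(1) C_closed(1)[OF *(2,3)]]
        ev_add[OF *(2,3)] ev_closed[OF *(1)] ev_closed[OF *(2)] ev_closed[OF *(3)]
      by eventually_elim (simp add: L.a_assoc)
  qed (use * in simp_all)
next
  fix c e assume *: "c \<in> carrier C" "e \<in> carrier C"
  show "c \<oplus>\<^bsub>C\<^esub> e = e \<oplus>\<^bsub>C\<^esub> c"
  proof (rule C_eqI)
    show "\<forall>\<^sub>F y in F. ev (c \<oplus>\<^bsub>C\<^esub> e) y = ev (e \<oplus>\<^bsub>C\<^esub> c) y"
      using ev_add[OF *] ev_add[OF *(2,1)] ev_closed[OF *(1)] ev_closed[OF *(2)]
      by eventually_elim (simp add: L.a_comm)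
  qed (use * in simp_all)
next
  fix c assume c: "c \<in> carrier C"
  show "\<zero>\<^bsub>C\<^esub> \<oplus>\<^bsub>C\<^esub> c = c"
  proof (rule C_eqI)
    show "\<forall>\<^sub>F y in F. ev (\<zero>\<^bsub>C\<^esub> \<oplus>\<^bsub>C\<^esub> c) y = ev c y"
      using ev_add[OF C_closed(5) c] ev_zero ev_closed[OF c]
      by eventually_elim simp
  qed (use c in simp_all)
  have m: "\<ominus>\<^bsub>R\<^esub> \<one>\<^bsub>R\<^esub> \<in> carrier R" by simp
  let ?e = "\<ominus>\<^bsub>R\<^esub> \<one>\<^bsub>R\<^esub> \<odot>\<^bsub>C\<^esub> c"
  have e: "?e \<in> carrier C" using c m by simp
  have "?e \<oplus>\<^bsub>C\<^esub> c = \<zero>\<^bsub>C\<^esub>"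
  proof (rule C_eqI)
    show "\<forall>\<^sub>F y in F. ev (?e \<oplus>\<^bsub>C\<^esub> c) y = ev \<zero>\<^bsub>C\<^esub> y"
      using ev_add[OF e c] ev_zero ev_closed[OF c] ev_smult[OF m c]
      by eventually_elim (simp add: L.smult_l_minus L.l_neg)
  qed (use c e in simp_all)
  then show "\<exists>e\<in>carrier C. e \<oplus>\<^bsub>C\<^esub> c = \<zero>\<^bsub>C\<^esub>" using e by blast
qed simp_all

lemma C_cring: "cring C"
proof (rule cringI[OF C_abelian_group])
  show "comm_monoid C"
  proof (rule comm_monoidI)
    fix c e f assume *: "c \<in> carrier C" "e \<in> carrier C" "f \<in> carrier C"
    show "c \<otimes>\<^bsub>C\<^esub> e \<otimes>\<^bsub>C\<^esub> f = c \<otimes>\<^bsub>C\<^esub> (e \<otimes>\<^bsub>C\<^esub> f)"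
    proof (rule C_eqI)
      show "\<forall>\<^sub>F y in F. ev (c \<otimes>\<^bsub>C\<^esub> e \<otimes>\<^bsub>C\<^esub> f) y = ev (c \<otimes>\<^bsub>C\<^esub> (e \<otimes>\<^bsub>C\<^esub> f)) y"
        using ev_mult[OF C_closed(2)[OF *(1,2)] *(3)] ev_preimage[OF *(3) ev_mult[OF *(1,2)]]
          ev_mult[OF *(1) C_closed(2)[OF *(2,3)]] ev_mult[OF *(2,3)]
        by eventually_elim simp
    qed (use * in simp_all)
  next
    fix c e assume *: "c \<in> carrier C" "e \<in> carrier C"
    show "c \<otimes>\<^bsub>C\<^esub> e = e \<otimes>\<^bsub>C\<^esub> c"
    proof (rule C_eqI)
      show "\<forall>\<^sub>F y in F. ev (c \<otimes>\<^bsub>C\<^esub> e) y = ev (e \<otimes>\<^bsub>C\<^esub> c) y"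
        using ev_mult[OF *] ev_mult[OF *(2,1)] ev_comm[OF *] by eventually_elim simp
    qed (use * in simp_all)
  next
    fix c assume c: "c \<in> carrier C"
    show "\<one>\<^bsub>C\<^esub> \<otimes>\<^bsub>C\<^esub> c = c"
    proof (rule C_eqI)
      show "\<forall>\<^sub>F y in F. ev (\<one>\<^bsub>C\<^esub> \<otimes>\<^bsub>C\<^esub> c) y = ev c y"
        using ev_mult[OF C_closed(4) c] ev_preimage[OF c ev_one] by eventually_elim simp
    qed (use c in simp_all)
  qed simp_all
  fix c e f assume *: "c \<in> carrier C" "e \<in> carrier C" "f \<in> carrier C"
  show "(c \<oplus>\<^bsub>C\<^esub> e) \<otimes>\<^bsub>C\<^esub> f = c \<otimes>\<^bsub>C\<^esub> f \<oplus>\<^bsub>C\<^esub> e \<otimes>\<^bsub>C\<^esub> f"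
  proof (rule C_eqI)
    show "\<forall>\<^sub>F y in F. ev ((c \<oplus>\<^bsub>C\<^esub> e) \<otimes>\<^bsub>C\<^esub> f) y = ev (c \<otimes>\<^bsub>C\<^esub> f \<oplus>\<^bsub>C\<^esub> e \<otimes>\<^bsub>C\<^esub> f) y"
      using ev_mult[OF C_closed(1)[OF *(1,2)] *(3)] ev_preimage[OF *(3) ev_add[OF *(1,2)]]
        ev_mult[OF *(1,3)] ev_mult[OF *(2,3)] ev_add[OF C_closed(2)[OF *(1,3)] C_closed(2)[OF *(2,3)]]
      by eventually_elim simp
  qed (use * in simp_all)
qed

lemma C_algebra: "algebra R C"
proof -
  have a1: "(r \<oplus>\<^bsub>R\<^esub> r') \<odot>\<^bsub>C\<^esub> c = r \<odot>\<^bsub>C\<^esub> c \<oplus>\<^bsub>C\<^esub> r' \<odot>\<^bsub>C\<^esub> c" if r: "r \<in> carrier R" "r' \<in> carrier R" and c: "c \<in> carrier C" "e \<in> carrier C" for r r' c e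
  proof (rule C_eqI)
    show "\<forall>\<^sub>F y in F. ev ((r \<oplus>\<^bsub>R\<^esub> r') \<odot>\<^bsub>C\<^esub> c) y = ev (r \<odot>\<^bsub>C\<^esub> c \<oplus>\<^bsub>C\<^esub> r' \<odot>\<^bsub>C\<^esub> c) y"
      using ev_smult[OF M.R.a_closed[OF r] c(1)] ev_smult[OF r(1) c(1)] ev_smult[OF r(2) c(1)]
        ev_add[OF C_closed(3)[OF r(1) c(1)] C_closed(3)[OF r(2) c(1)]] ev_closed[OF c(1)]
      by eventually_elim (simp add: L.smult_l_distr r)
  qed (use r c in simp_all)
  have a2: "r \<odot>\<^bsub>C\<^esub> (c \<oplus>\<^bsub>C\<^esub> e) = r \<odot>\<^bsub>C\<^esub> c \<oplus>\<^bsub>C\<^esub> r \<odot>\<^bsub>C\<^esub> e" if r: "r \<in> carrier R" "r' \<in> carrier R" and c: "c \<in> carrier C" "e \<in> carrier C" for r r' c e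
  proof (rule C_eqI)
    show "\<forall>\<^sub>F y in F. ev (r \<odot>\<^bsub>C\<^esub> (c \<oplus>\<^bsub>C\<^esub> e)) y = ev (r \<odot>\<^bsub>C\<^esub> c \<oplus>\<^bsub>C\<^esub> r \<odot>\<^bsub>C\<^esub> e) y"
      using ev_smult[OF r(1) C_closed(1)[OF c]] ev_smult[OF r(1) c(1)] ev_smult[OF r(1) c(2)] ev_add[OF c]
        ev_add[OF C_closed(3)[OF r(1) c(1)] C_closed(3)[OF r(1) c(2)]] ev_closed[OF c(1)] ev_closed[OF c(2)]
      by eventually_elim (simp add: L.smult_r_distr r)
  qed (use r c in simp_all)
  have a3: "r \<otimes>\<^bsub>R\<^esub> r' \<odot>\<^bsub>C\<^esub> c = r \<odot>\<^bsub>C\<^esub> (r' \<odot>\<^bsub>C\<^esub> c)" if r: "r \<in> carrier R" "r' \<in> carrier R" and c: "c \<in> carrier C" "e \<in> carrier C" for r r' c e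
  proof (rule C_eqI)
    show "\<forall>\<^sub>F y in F. ev (r \<otimes>\<^bsub>R\<^esub> r' \<odot>\<^bsub>C\<^esub> c) y = ev (r \<odot>\<^bsub>C\<^esub> (r' \<odot>\<^bsub>C\<^esub> c)) y"
      using ev_smult[OF M.R.m_closed[OF r] c(1)] ev_smult[OF r(1) C_closed(3)[OF r(2) c(1)]]
        ev_smult[OF r(2) c(1)] ev_closed[OF c(1)]
      by eventually_elim (simp add: L.smult_assoc1 r)
  qed (use r c in simp_all)
  have a4: "\<one>\<^bsub>R\<^esub> \<odot>\<^bsub>C\<^esub> c = c" if r: "r \<in> carrier R" "r' \<in> carrier R" and c: "c \<in> carrier C" "e \<in> carrier C" for r r' c e
  proof (rule C_eqI)
    show "\<forall>\<^sub>F y in F. ev (\<one>\<^bsub>R\<^esub> \<odot>\<^bsub>C\<^esub> c) y = ev c y"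
      using ev_smult[OF M.R.one_closed c(1)] ev_closed[OF c(1)] by eventually_elim simp
  qed (use c in simp_all)
  have a5: "r \<odot>\<^bsub>C\<^esub> c \<otimes>\<^bsub>C\<^esub> e = r \<odot>\<^bsub>C\<^esub> (c \<otimes>\<^bsub>C\<^esub> e)" if r: "r \<in> carrier R" "r' \<in> carrier R" and c: "c \<in> carrier C" "e \<in> carrier C" for r r' c e
  proof (rule C_eqI)
    show "\<forall>\<^sub>F y in F. ev (r \<odot>\<^bsub>C\<^esub> c \<otimes>\<^bsub>C\<^esub> e) y = ev (r \<odot>\<^bsub>C\<^esub> (c \<otimes>\<^bsub>C\<^esub> e)) y"
      using ev_mult[OF C_closed(3)[OF r(1) c(1)] c(2)] ev_preimage[OF c(2) ev_smult[OF r(1) c(1)]]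
        ev_smult[OF r(1) C_closed(2)[OF c]] ev_mult[OF c]
      by eventually_elim simp
  qed (use r c in simp_all)
  show ?thesis
    by (rule algebraI[OF M.R.is_cring C_cring]) (simp_all add: a1 a2 a3 a4[OF M.R.one_closed M.R.one_closed _ C_closed(4)] a5)
qed

end

context nondeg_pair
begin

section \<open>Ideals of the Jordan pair\<close>

abbreviation jid where "jid \<equiv> jideal R V"
abbreviation jess where "jess \<equiv> jessential R V"

lemma jidD:
  assumes "jid U"
  shows "submodule (U s) R (jmod V s)" "\<And>x. x \<in> U s \<Longrightarrow> x \<in> jcarrier V s" "ze s \<in> U s"
    "\<And>x y. x \<in> U s \<Longrightarrow> y \<in> U s \<Longrightarrow> pl s x y \<in> U s" "\<And>x. x \<in> U s \<Longrightarrow> \<ominus>\<^bsub>jmod V s\<^esub> x \<in> U s"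
    "\<And>x y. x \<in> U s \<Longrightarrow> y \<in> U s \<Longrightarrow> mi s x y \<in> U s" "\<And>r x. r \<in> carrier R \<Longrightarrow> x \<in> U s \<Longrightarrow> sm s r x \<in> U s"
    "\<And>u y. u \<in> U s \<Longrightarrow> y \<in> jcarrier V (opp s) \<Longrightarrow> jQ V s u y \<in> U s"
    "\<And>u x. x \<in> jcarrier V s \<Longrightarrow> u \<in> U (opp s) \<Longrightarrow> jQ V s x u \<in> U s"
    "\<And>u y z. u \<in> U s \<Longrightarrow> y \<in> jcarrier V (opp s) \<Longrightarrow> z \<in> jcarrier V s \<Longrightarrow> t s u y z \<in> U s"
    "\<And>u y z. u \<in> U s \<Longrightarrow> y \<in> jcarrier V (opp s) \<Longrightarrow> z \<in> jcarrier V s \<Longrightarrow> t s z y u \<in> U s"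
    "\<And>u x z. x \<in> jcarrier V s \<Longrightarrow> u \<in> U (opp s) \<Longrightarrow> z \<in> jcarrier V s \<Longrightarrow> t s x u z \<in> U s"
proof -
  have sub: "submodule (U s) R (jmod V s)" for s using assms by (auto simp: jideal_def)
  note M = M.submoduleE[OF sub]
  show "submodule (U s) R (jmod V s)" "ze s \<in> U s"
    "\<And>x y. x \<in> U s \<Longrightarrow> y \<in> U s \<Longrightarrow> pl s x y \<in> U s" "\<And>x. x \<in> U s \<Longrightarrow> \<ominus>\<^bsub>jmod V s\<^esub> x \<in> U s"
    "\<And>x y. x \<in> U s \<Longrightarrow> y \<in> U s \<Longrightarrow> mi s x y \<in> U s" "\<And>r x. r \<in> carrier R \<Longrightarrow> x \<in> U s \<Longrightarrow> sm s r x \<in> U s"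
    using sub M.submodule_zero[OF sub] M.submodule_minus[OF sub] M(3,4,5) by auto
  have mem: "x \<in> U s \<Longrightarrow> x \<in> jcarrier V s" for s x using M(1) by blast
  then show "x \<in> U s \<Longrightarrow> x \<in> jcarrier V s" for x .
  show "u \<in> U s \<Longrightarrow> y \<in> jcarrier V (opp s) \<Longrightarrow> jQ V s u y \<in> U s"
    and q: "x \<in> jcarrier V s \<Longrightarrow> u \<in> U (opp s) \<Longrightarrow> jQ V s x u \<in> U s"
    and "u \<in> U s \<Longrightarrow> y \<in> jcarrier V (opp s) \<Longrightarrow> z \<in> jcarrier V s \<Longrightarrow> t s u y z \<in> U s" for u x y z
    using assms unfolding jideal_def by blast+
  then show "u \<in> U s \<Longrightarrow> y \<in> jcarrier V (opp s) \<Longrightarrow> z \<in> jcarrier V s \<Longrightarrow> t s z y u \<in> U s" for u y z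
    using mem triple_sym[of z s y u] by simp
  show "x \<in> jcarrier V s \<Longrightarrow> u \<in> U (opp s) \<Longrightarrow> z \<in> jcarrier V s \<Longrightarrow> t s x u z \<in> U s" for u x z
    unfolding jtriple_def using q M.submodule_minus[OF sub] by simp
qed

lemma jidI:
  assumes "\<And>s. submodule (U s) R (jmod V s)"
    and "\<And>s x u. x \<in> jcarrier V s \<Longrightarrow> u \<in> U (opp s) \<Longrightarrow> jQ V s x u \<in> U s"
    and tr: "\<And>s u y z. u \<in> U s \<Longrightarrow> y \<in> jcarrier V (opp s) \<Longrightarrow> z \<in> jcarrier V s \<Longrightarrow> t s u y z \<in> U s"
  shows "jid U"
proof -
  have "jQ V s u y \<in> U s" if "u \<in> U s" "y \<in> jcarrier V (opp s)" for s u y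
  proof -
    have u: "u \<in> jcarrier V s" using M.submoduleE(1)[OF assms(1)] that(1) by blast
    show ?thesis using tr[OF that u] M.submoduleE(4)[OF assms(1)] u that(2) by (simp add: Q_half)
  qed
  then show ?thesis unfolding jideal_def using assms by auto
qed

lemma inner:
  assumes "x \<in> jcarrier V s" "y \<in> jcarrier V (opp s)"
  obtains e where "e \<in> D" "\<And>z. z \<in> jcarrier V s \<Longrightarrow> e s z = t s x y z"
    "\<And>z. z \<in> jcarrier V (opp s) \<Longrightarrow> e (opp s) z = \<ominus>\<^bsub>jmod V (opp s)\<^esub> t (opp s) y x z"
proof (cases s)
  case Pos
  then show thesis using assms that[of "dl x y"] by simp
next
  case Neg
  then show thesis using assms that[of "\<ominus>\<^bsub>E\<^esub> dl y x"] by (simp add: D_inv)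
qed

lemma jid_D:
  assumes U: "jid U" and d: "d \<in> D" and u: "u \<in> U s"
  shows "d s u \<in> U s"
proof -
  note j = jidD[OF U]
  let ?H = "{d \<in> carrier E. \<forall>s. \<forall>u\<in>U s. d s u \<in> U s}"
  have "submodule ?H R E"
    by (rule E.submoduleI) (auto simp: E_ops_closed j)
  moreover have "deltas \<subseteq> ?H"
  proof safe
    fix x y s u assume "x \<in> jcarrier V Pos" "y \<in> jcarrier V Neg" "u \<in> U s"
    then show "dl x y s u \<in> U s" using j(2,5,11)[of _ s] by (cases s) auto
  qed auto
  ultimately show ?thesis using D_subsetI[of ?H] d u by blast
qed

definition "Uof I s = {x \<in> jcarrier V s. emb s x \<in> I}"

lemma Uof_iff: "x \<in> Uof I s \<longleftrightarrow> x \<in> jcarrier V s \<and> emb s x \<in> I"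
  by (simp add: Uof_def)

lemma Uof_jid:
  assumes "lideal I"
  shows "jid (Uof I)"
proof (rule jidI)
  note i = lidealD[OF assms]
  have m: "emb s (\<ominus>\<^bsub>jmod V s\<^esub> x) = \<ominus>\<^bsub>L\<^esub> emb s x" if "x \<in> jcarrier V s" for s x
    using that emb_add[of "\<ominus>\<^bsub>jmod V s\<^esub> x" s x] by (intro L.minus_equality[symmetric]) (auto simp: M.l_neg emb_zero)
  show "submodule (Uof I s) R (jmod V s)" for s
    by (rule M.submoduleI) (auto simp: Uof_iff emb_zero emb_add emb_smult m i)
  show "jQ V s x u \<in> Uof I s" if "x \<in> jcarrier V s" "u \<in> Uof I (opp s)" for s x u
    using that by (auto simp: Uof_iff emb_Q i(6,7,8))
  show "t s u y z \<in> Uof I s" if "u \<in> Uof I s" "y \<in> jcarrier V (opp s)" "z \<in> jcarrier V s" for s u y z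
    using that by (auto simp: Uof_iff emb_triple i(8))
qed

text \<open>
  A homomorphism \<open>g\<close> on an ideal \<open>U\<close> of the pair extends to all \<open>x + d + y\<close> with \<open>x, y \<in> U\<close> for which
  \<open>d\<close> maps \<open>V\<close> into \<open>U\<close> and \<open>g \<circ> d\<close> is again inner.
\<close>

definition cmp :: "(sign \<Rightarrow> 'a \<Rightarrow> 'a) \<Rightarrow> (sign \<Rightarrow> 'a \<Rightarrow> 'a) \<Rightarrow> sign \<Rightarrow> 'a \<Rightarrow> 'a" where
  "cmp g d s = (\<lambda>v\<in>jcarrier V s. g s (d s v))"

definition dom :: "(sign \<Rightarrow> 'a \<Rightarrow> 'a) \<Rightarrow> (sign \<Rightarrow> 'a set) \<Rightarrow> ('a \<times> (sign \<Rightarrow> 'a \<Rightarrow> 'a) \<times> 'a) set" where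
  "dom g U = {(a, d, b). a \<in> U Pos \<and> d \<in> D \<and> b \<in> U Neg \<and> (\<forall>s. \<forall>v\<in>jcarrier V s. d s v \<in> U s) \<and> cmp g d \<in> D}"

definition ext :: "(sign \<Rightarrow> 'a \<Rightarrow> 'a) \<Rightarrow> 'a \<times> (sign \<Rightarrow> 'a \<Rightarrow> 'a) \<times> 'a \<Rightarrow> 'a \<times> (sign \<Rightarrow> 'a \<Rightarrow> 'a) \<times> 'a" where
  "ext g = (\<lambda>(a, d, b). (g Pos a, cmp g d, g Neg b))"

text \<open>The conditions on a homomorphism that remain when \<open>2\<close> is invertible.\<close>

definition lin :: "(sign \<Rightarrow> 'a set) \<Rightarrow> (sign \<Rightarrow> 'a \<Rightarrow> 'a) \<Rightarrow> bool" where
  "lin U g \<longleftrightarrow> (\<forall>s. (\<forall>u\<in>U s. g s u \<in> jcarrier V s) \<and>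
      (\<forall>u\<in>U s. \<forall>u'\<in>U s. g s (pl s u u') = pl s (g s u) (g s u')) \<and>
      (\<forall>r\<in>carrier R. \<forall>u\<in>U s. g s (sm s r u) = sm s r (g s u)) \<and>
      (\<forall>x\<in>jcarrier V s. \<forall>y\<in>U (opp s). g s (jQ V s x y) = jQ V s x (g (opp s) y)) \<and>
      (\<forall>y\<in>U s. \<forall>z\<in>jcarrier V (opp s). \<forall>x\<in>jcarrier V s. g s (t s y z x) = t s (g s y) z x))"

lemma linD:
  assumes "jid U" "lin U g"
  shows "\<And>u. u \<in> U s \<Longrightarrow> g s u \<in> jcarrier V s" "\<And>u u'. u \<in> U s \<Longrightarrow> u' \<in> U s \<Longrightarrow> g s (pl s u u') = pl s (g s u) (g s u')"
    "\<And>r u. r \<in> carrier R \<Longrightarrow> u \<in> U s \<Longrightarrow> g s (sm s r u) = sm s r (g s u)"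
    "\<And>x y. x \<in> jcarrier V s \<Longrightarrow> y \<in> U (opp s) \<Longrightarrow> g s (jQ V s x y) = jQ V s x (g (opp s) y)"
    "\<And>x y z. y \<in> U s \<Longrightarrow> z \<in> jcarrier V (opp s) \<Longrightarrow> x \<in> jcarrier V s \<Longrightarrow> g s (t s y z x) = t s (g s y) z x"
    "g s (ze s) = ze s" "\<And>u. u \<in> U s \<Longrightarrow> g s (\<ominus>\<^bsub>jmod V s\<^esub> u) = \<ominus>\<^bsub>jmod V s\<^esub> g s u"
    "\<And>u u'. u \<in> U s \<Longrightarrow> u' \<in> U s \<Longrightarrow> g s (mi s u u') = mi s (g s u) (g s u')"
    "\<And>x y z. y \<in> U (opp s) \<Longrightarrow> z \<in> jcarrier V s \<Longrightarrow> x \<in> jcarrier V s \<Longrightarrow> g s (t s x y z) = t s x (g (opp s) y) z"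
    "\<And>x y z. y \<in> U s \<Longrightarrow> z \<in> jcarrier V (opp s) \<Longrightarrow> x \<in> jcarrier V s \<Longrightarrow> g s (t s x z y) = t s x z (g s y)"
proof -
  note j = jidD[OF assms(1)]
  show cl: "\<And>s u. u \<in> U s \<Longrightarrow> g s u \<in> jcarrier V s" and ad: "\<And>s u u'. u \<in> U s \<Longrightarrow> u' \<in> U s \<Longrightarrow> g s (pl s u u') = pl s (g s u) (g s u')"
    and "\<And>r u. r \<in> carrier R \<Longrightarrow> u \<in> U s \<Longrightarrow> g s (sm s r u) = sm s r (g s u)"
    and q: "\<And>x y. x \<in> jcarrier V s \<Longrightarrow> y \<in> U (opp s) \<Longrightarrow> g s (jQ V s x y) = jQ V s x (g (opp s) y)"
    and tr: "\<And>x y z. y \<in> U s \<Longrightarrow> z \<in> jcarrier V (opp s) \<Longrightarrow> x \<in> jcarrier V s \<Longrightarrow> g s (t s y z x) = t s (g s y) z x"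
    using assms(2) unfolding lin_def by blast+
  show z: "g s (ze s) = ze s" using ad[of "ze s" s "ze s"] cl[of "ze s" s] j(3) by (intro M.add_self_zero) auto
  show n: "g s (\<ominus>\<^bsub>jmod V s\<^esub> u) = \<ominus>\<^bsub>jmod V s\<^esub> g s u" if "u \<in> U s" for u
    using ad[of "\<ominus>\<^bsub>jmod V s\<^esub> u" s u] that j(2,5) cl z by (intro M.minus_equality[symmetric]) (auto simp: M.l_neg)
  show m: "g s (mi s u u') = mi s (g s u) (g s u')" if "u \<in> U s" "u' \<in> U s" for u u'
    using that by (simp add: a_minus_def ad n j(5))
  show "g s (t s x y z) = t s x (g (opp s) y) z"
    if "y \<in> U (opp s)" "z \<in> jcarrier V s" "x \<in> jcarrier V s" for x y z
    using that by (simp add: jtriple_def m j(6,9) q)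
  show "g s (t s x z y) = t s x z (g s y)" if "y \<in> U s" "z \<in> jcarrier V (opp s)" "x \<in> jcarrier V s" for x y z
    using that triple_sym[of x s z y] triple_sym[of x s z "g s y"] j(2) cl by (simp add: tr)
qed

lemma lin_D:
  assumes U: "jid U" and g: "lin U g" and d: "d \<in> D" and u: "u \<in> U s"
  shows "g s (d s u) = d s (g s u)"
proof -
  note j = jidD[OF U] and l = linD[OF U g]
  let ?H = "{d \<in> carrier E. \<forall>s. \<forall>u\<in>U s. d s u \<in> U s \<and> g s (d s u) = d s (g s u)}"
  have "submodule ?H R E"
    by (rule E.submoduleI) (auto simp: E_ops_closed j l)
  moreover have "deltas \<subseteq> ?H"
  proof safe
    fix x y s u assume *: "x \<in> jcarrier V Pos" "y \<in> jcarrier V Neg" "u \<in> U s"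
    then show "dl x y s u \<in> U s" using jid_D[OF U] by simp
    show "g s (dl x y s u) = dl x y s (g s u)"
      using * j(2)[of _ s] j(11)[of _ s] l(1,7,10)[of _ s] by (cases s) auto
  qed auto
  ultimately show ?thesis using D_subsetI[of ?H] d u by blast
qed

lemma E_eqI: "e \<in> carrier E \<Longrightarrow> (\<And>s v. v \<in> jcarrier V s \<Longrightarrow> f s v = e s v) \<Longrightarrow> (\<lambda>s. \<lambda>v\<in>jcarrier V s. f s v) = e"
proof (rule ext)
  fix s assume "e \<in> carrier E" "\<And>s v. v \<in> jcarrier V s \<Longrightarrow> f s v = e s v"
  then have "e s \<in> extensional (jcarrier V s)" unfolding E_carrier by (auto simp: PiE_def)
  with \<open>\<And>s v. v \<in> jcarrier V s \<Longrightarrow> f s v = e s v\<close> show "(\<lambda>v\<in>jcarrier V s. f s v) = e s"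
    by (intro extensionalityI[of _ "jcarrier V s"]) auto
qed

lemma cmp_eqI: "e \<in> carrier E \<Longrightarrow> (\<And>s v. v \<in> jcarrier V s \<Longrightarrow> g s (d s v) = e s v) \<Longrightarrow> cmp g d = e"
  using E_eqI[of e "\<lambda>s v. g s (d s v)"] by (simp add: cmp_def[abs_def])

lemma cmp_apply: "v \<in> jcarrier V s \<Longrightarrow> cmp g d s v = g s (d s v)"
  by (simp add: cmp_def)

lemma cmp_PN: "v \<in> jcarrier V Pos \<Longrightarrow> cmp g d Pos v = g Pos (d Pos v)"
  "v \<in> jcarrier V Neg \<Longrightarrow> cmp g d Neg v = g Neg (d Neg v)"
  by (simp_all add: cmp_def)

lemma emb_dom:
  assumes "jid U" "lin U g"
  shows "emb s x \<in> dom g U \<longleftrightarrow> x \<in> U s"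
proof -
  have "cmp g \<zero>\<^bsub>E\<^esub> = \<zero>\<^bsub>E\<^esub>"
    using linD(6)[OF assms] by (intro cmp_eqI) (auto simp: E_ops_closed)
  then show ?thesis using jidD(3)[OF assms(1)] by (cases s) (auto simp: emb_simps dom_def D_zero)
qed

lemma dom_bracket:
  assumes U: "jid U" and g: "lin U g" and X: "X \<in> carrier L" and Z: "Z \<in> dom g U"
  shows "X \<otimes>\<^bsub>L\<^esub> Z \<in> dom g U" "ext g (X \<otimes>\<^bsub>L\<^esub> Z) = X \<otimes>\<^bsub>L\<^esub> ext g Z"
proof -
  note j = jidD[OF U] and l = linD[OF U g]
  obtain x e y where XX: "X = (x, e, y)" by (cases X)
  obtain a d b where ZZ: "Z = (a, d, b)" by (cases Z)
  have x: "x \<in> jcarrier V Pos" "e \<in> D" "y \<in> jcarrier V Neg" using X unfolding XX by auto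
  have z: "a \<in> U Pos" "d \<in> D" "b \<in> U Neg" "\<And>s v. v \<in> jcarrier V s \<Longrightarrow> d s v \<in> U s" "cmp g d \<in> D"
    using Z unfolding ZZ dom_def by auto
  note [simp] = D_E[OF x(2)] D_E[OF z(2)] D_E[OF z(5)] and [simp] = j(2)[OF z(1)] j(2)[OF z(3)] l(1)[OF z(1)] l(1)[OF z(3)]
  let ?m = "(e \<otimes>\<^bsub>E\<^esub> d \<oplus>\<^bsub>E\<^esub> dl x b) \<ominus>\<^bsub>E\<^esub> dl a y"
  let ?n = "(e \<otimes>\<^bsub>E\<^esub> cmp g d \<oplus>\<^bsub>E\<^esub> dl x (g Neg b)) \<ominus>\<^bsub>E\<^esub> dl (g Pos a) y"
  have n: "?n \<in> D" using x z by (intro D_minus D_add D_mult_closed D_dl) auto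
  have mD: "?m \<in> D" using x z by (intro D_minus D_add D_mult_closed D_dl) auto
  have P: "?m Pos v \<in> U Pos" "g Pos (?m Pos v) = ?n Pos v" if v: "v \<in> jcarrier V Pos" for v
  proof -
    have 1: "e Pos (d Pos v) \<in> U Pos" "d Pos (e Pos v) \<in> U Pos" "t Pos x b v \<in> U Pos" "t Pos a y v \<in> U Pos"
      using jid_D[OF U x(2) z(4)[OF v]] z(4)[of "e Pos v" Pos] j(12)[of x Pos b v] j(10)[of a Pos y v] x z v by auto
    then show "?m Pos v \<in> U Pos" using v x by (simp add: E_ops_closed j(4,6))
    show "g Pos (?m Pos v) = ?n Pos v"
      using 1 v x z lin_D[OF U g x(2) z(4)[OF v]] l(9)[of b Pos v x] l(5)[of a Pos y v]
      by (simp add: E_ops_closed j(4,6) l(2,8) cmp_PN)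
  qed
  have N: "?m Neg v \<in> U Neg" "g Neg (?m Neg v) = ?n Neg v" if v: "v \<in> jcarrier V Neg" for v
  proof -
    have 1: "e Neg (d Neg v) \<in> U Neg" "d Neg (e Neg v) \<in> U Neg" "t Neg b x v \<in> U Neg" "t Neg y a v \<in> U Neg"
      using jid_D[OF U x(2) z(4)[OF v]] z(4)[of "e Neg v" Neg] j(12)[of y Neg a v] j(10)[of b Neg x v] x z v by auto
    then show "?m Neg v \<in> U Neg" using v x by (simp add: E_ops_closed j(4,5,6))
    show "g Neg (?m Neg v) = ?n Neg v"
      using 1 v x z lin_D[OF U g x(2) z(4)[OF v]] l(9)[of a Neg v y] l(5)[of b Neg x v]
      by (simp add: E_ops_closed j(4,5,6) l(2,7,8) cmp_PN)
  qed
  have m: "?m s v \<in> U s" "g s (?m s v) = ?n s v" if "v \<in> jcarrier V s" for s v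
    using that P N by (cases s; simp)+
  have c: "cmp g ?m = ?n" using n by (intro cmp_eqI D_E m)
  have 2: "e Pos a \<in> U Pos" "d Pos x \<in> U Pos" "e Neg b \<in> U Neg" "d Neg y \<in> U Neg"
    using jid_D[OF U x(2)] z x by auto
  show "X \<otimes>\<^bsub>L\<^esub> Z \<in> dom g U"
    unfolding XX ZZ L_mult dom_def using m(1) c n mD 2 by (simp add: j(6))
  show "ext g (X \<otimes>\<^bsub>L\<^esub> Z) = X \<otimes>\<^bsub>L\<^esub> ext g Z"
    unfolding XX ZZ L_mult ext_def prod.case c
    using 2 x z lin_D[OF U g x(2) z(1)] lin_D[OF U g x(2) z(3)] by (simp add: l(8) cmp_PN)
qed

lemma dom_lideal:
  assumes U: "jid U" and g: "lin U g"
  shows "lideal (dom g U)"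
    "\<And>X Y. X \<in> dom g U \<Longrightarrow> Y \<in> dom g U \<Longrightarrow> ext g (X \<oplus>\<^bsub>L\<^esub> Y) = ext g X \<oplus>\<^bsub>L\<^esub> ext g Y"
    "\<And>X. X \<in> dom g U \<Longrightarrow> ext g X \<in> carrier L"
proof -
  note j = jidD[OF U] and l = linD[OF U g]
  have ad: "cmp g (d \<oplus>\<^bsub>E\<^esub> e) = cmp g d \<oplus>\<^bsub>E\<^esub> cmp g e"
    if "d \<in> D" "e \<in> D" "cmp g d \<in> D" "cmp g e \<in> D" "\<forall>s. \<forall>v\<in>jcarrier V s. d s v \<in> U s" "\<forall>s. \<forall>v\<in>jcarrier V s. e s v \<in> U s" for d e
    using that by (intro cmp_eqI) (simp_all add: E_ops_closed D_E l(2) cmp_apply)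
  have sc: "cmp g (r \<odot>\<^bsub>E\<^esub> d) = r \<odot>\<^bsub>E\<^esub> cmp g d"
    if "r \<in> carrier R" "d \<in> D" "cmp g d \<in> D" "\<forall>s. \<forall>v\<in>jcarrier V s. d s v \<in> U s" for d r
    using that by (intro cmp_eqI) (simp_all add: E_ops_closed D_E l(3) cmp_apply)
  show "lideal (dom g U)"
  proof (rule lidealI)
    show "dom g U \<subseteq> carrier L" using j(2) by (auto simp: dom_def)
    show "\<zero>\<^bsub>L\<^esub> \<in> dom g U" using emb_dom[OF assms, of Pos "ze Pos"] j(3) by (simp add: emb_zero)
    show "X \<oplus>\<^bsub>L\<^esub> Y \<in> dom g U" if "X \<in> dom g U" "Y \<in> dom g U" for X Y
      using that unfolding dom_def by (auto simp: j D_add ad D_E)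
    show "r \<odot>\<^bsub>L\<^esub> X \<in> dom g U" if "r \<in> carrier R" "X \<in> dom g U" for r X
      using that unfolding dom_def by (auto simp: j D_smult sc D_E)
  qed (rule dom_bracket[OF assms])
  show "ext g (X \<oplus>\<^bsub>L\<^esub> Y) = ext g X \<oplus>\<^bsub>L\<^esub> ext g Y" if "X \<in> dom g U" "Y \<in> dom g U" for X Y
    using that unfolding dom_def ext_def by (auto simp: ad l)
  show "ext g X \<in> carrier L" if "X \<in> dom g U" for X
    using that unfolding dom_def ext_def by (auto simp: l)
qed

lemma jessD: "jess U \<Longrightarrow> jid U"
  by (simp add: jessential_def)

lemma jess_meets:
  assumes "jess U" "jid W" "x \<in> W s" "x \<noteq> ze s"
  obtains s' x' where "x' \<in> U s'" "x' \<in> W s'" "x' \<noteq> ze s'"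
proof -
  have "\<exists>s. W s \<noteq> {ze s}" using assms(3,4) by blast
  then obtain s where "U s \<inter> W s \<noteq> {ze s}" using assms(1,2) unfolding jessential_def by blast
  moreover have "ze s \<in> U s \<inter> W s" using jidD(3) assms(2) jessD[OF assms(1)] by auto
  ultimately show thesis using that by blast
qed

lemma jessI:
  assumes "jid U" "\<And>W s x. jid W \<Longrightarrow> x \<in> W s \<Longrightarrow> x \<noteq> ze s \<Longrightarrow> \<exists>s x. x \<in> U s \<and> x \<in> W s \<and> x \<noteq> ze s"
  shows "jess U"
  unfolding jessential_def
proof (intro conjI allI impI assms(1))
  fix W assume "jid W \<and> (\<exists>s. W s \<noteq> {ze s})"
  then obtain s x where "x \<in> W s" "x \<noteq> ze s" "jid W" using jidD(3) by blast
  then show "\<exists>s. U s \<inter> W s \<noteq> {ze s}" using assms(2) by blast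
qed

lemma dom_ess:
  assumes U: "jess U" and g: "lin U g"
  shows "ess (dom g U)"
proof -
  note d = dom_lideal[OF jessD[OF U] g]
  have "dom g U \<inter> W \<noteq> {\<zero>\<^bsub>L\<^esub>}" if W: "lideal W" "W \<noteq> {\<zero>\<^bsub>L\<^esub>}" for W
  proof -
    obtain s x where "x \<in> jcarrier V s" "x \<noteq> ze s" "emb s x \<in> W" using lideal_meets_V[OF W] .
    then have "x \<in> Uof W s" "x \<noteq> ze s" by (auto simp: Uof_iff)
    then obtain s' x' where x': "x' \<in> U s'" "x' \<in> Uof W s'" "x' \<noteq> ze s'"
      using jess_meets[OF U Uof_jid[OF W(1)]] by metis
    then have "emb s' x' \<in> dom g U \<inter> W" "emb s' x' \<noteq> \<zero>\<^bsub>L\<^esub>"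
      using emb_dom[OF jessD[OF U] g] by (auto simp: Uof_iff emb_zero[of s', symmetric] emb_inj)
    then show ?thesis by blast
  qed
  with d(1) show ?thesis by (auto simp: lie_essential_def)
qed

lemma ext_perm: "jess U \<Longrightarrow> lin U g \<Longrightarrow> (ext g, dom g U) \<in> P"
  by (intro permI dom_ess dom_lideal(2,3)[OF jessD] dom_bracket(2)[OF jessD])

lemma ext_emb:
  assumes "jid U" "lin U g"
  shows "ext g (emb s x) = emb s (g s x)"
proof -
  have "cmp g \<zero>\<^bsub>E\<^esub> = \<zero>\<^bsub>E\<^esub>"
    using linD(6)[OF assms] by (intro cmp_eqI) (auto simp: E_ops_closed)
  then show ?thesis by (cases s) (simp_all add: emb_simps ext_def linD(6)[OF assms])
qed

lemma lin_id: "jid U \<Longrightarrow> lin U (\<lambda>s x. x)"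
  by (simp add: lin_def jidD(2))

lemma Uof_jess:
  assumes I: "ess I"
  shows "jess (Uof I)"
proof (rule jessI[OF Uof_jid[OF essD[OF I]]])
  fix W s x assume W: "jid W" and x: "x \<in> W s" "x \<noteq> ze s"
  let ?d = "dom (\<lambda>s x. x) W"
  note d = dom_lideal(1)[OF W lin_id[OF W]] and e = emb_dom[OF W lin_id[OF W]]
  have "emb s x \<in> ?d" "emb s x \<noteq> \<zero>\<^bsub>L\<^esub>" using x e by (auto simp: emb_zero[of s, symmetric] emb_inj)
  then have "I \<inter> ?d \<noteq> {\<zero>\<^bsub>L\<^esub>}" using I d unfolding lie_essential_def by blast
  with lideal_Int[OF essD[OF I] d] obtain s x where "x \<in> jcarrier V s" "x \<noteq> ze s" "emb s x \<in> I \<inter> ?d"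
    by (rule lideal_meets_V)
  then show "\<exists>s x. x \<in> Uof I s \<and> x \<in> W s \<and> x \<noteq> ze s" using e by (auto simp: Uof_iff)
qed

lemma jess_Int: "jess U \<Longrightarrow> jess W \<Longrightarrow> jess (\<lambda>s. U s \<inter> W s)"
proof (rule jessI)
  assume UW: "jess U" "jess W"
  have int: "jid (\<lambda>s. A s \<inter> B s)" if "jid A" "jid B" for A B
    using jidD[OF that(1)] jidD[OF that(2)] by (intro jidI M.submodule_Int) auto
  show "jid (\<lambda>s. U s \<inter> W s)" using int UW jessD by blast
  fix A s x assume A: "jid A" "x \<in> A s" "x \<noteq> ze s"
  obtain s1 x1 where 1: "x1 \<in> W s1" "x1 \<in> A s1" "x1 \<noteq> ze s1" using jess_meets[OF UW(2) A] .
  show "\<exists>s x. x \<in> U s \<inter> W s \<and> x \<in> A s \<and> x \<noteq> ze s"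
    using jess_meets[OF UW(1) int[OF jessD[OF UW(2)] A(1)], of x1 s1] 1 by blast
qed

lemma jess_carrier: "jess (jcarrier V)"
proof (rule jessI)
  show "jid (jcarrier V)" by (intro jidI M.carrier_is_submodule) auto
  show "\<exists>s x. x \<in> jcarrier V s \<and> x \<in> W s \<and> x \<noteq> ze s" if "jid W" "x \<in> W s" "x \<noteq> ze s" for W s x
    using that jidD(2) by blast
qed

section \<open>Annihilators of essential ideals\<close>

lemma ideal_nondeg:
  assumes U: "jid U" and p: "p \<in> U s" and 0: "\<And>u. u \<in> U (opp s) \<Longrightarrow> t s p u p = ze s"
  shows "p = ze s"
proof (rule nondegD)
  note j = jidD[OF U]
  show pV: "p \<in> jcarrier V s" by (rule j(2)[OF p])
  have Q0: "jQ V s p u = ze s" if "u \<in> U (opp s)" for u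
    using 0[OF that] pV j(2)[OF that] by (simp add: Q_half)
  fix v assume v: "v \<in> jcarrier V (opp s)"
  show "jQ V s p v = ze s"
  proof (rule nondegD)
    show "jQ V s p v \<in> jcarrier V s" using pV v by simp
    fix z assume z: "z \<in> jcarrier V (opp s)"
    have "jQ V (opp s) v (jQ V s p z) \<in> U (opp s)"
      using j(9)[of v "opp s" "jQ V s p z"] j(8)[OF p z] v by simp
    then show "jQ V s (jQ V s p v) z = ze s" using J.JP3[OF pV v z] by (simp add: Q0)
  qed
qed

lemma annihilator_zero:
  assumes U: "jess U" and w: "w \<in> jcarrier V s"
    and 0: "\<And>u. u \<in> U (opp s) \<Longrightarrow> emb s w \<otimes>\<^bsub>L\<^esub> emb (opp s) u = \<zero>\<^bsub>L\<^esub>"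
  shows "w = ze s"
proof -
  note j = jidD[OF jessD[OF U]]
  have dw: "d s w = ze s" if d: "d \<in> D" "\<And>s v. v \<in> jcarrier V s \<Longrightarrow> d s v \<in> U s" for d
  proof (rule ideal_nondeg[OF jessD[OF U]])
    note [simp] = D_E[OF d(1)]
    have twu: "t s w u z = ze s" if "u \<in> U (opp s)" "z \<in> jcarrier V s" for u z
    proof -
      have "emb s (t s w u z) = \<zero>\<^bsub>L\<^esub>"
        using emb_triple[of w s u z] that w j(2)[OF that(1)] 0[OF that(1)] by simp
      then show ?thesis by (simp add: emb_zero[of s, symmetric] emb_inj)
    qed
    show "d s w \<in> U s" by (rule d(2)[OF w])
    fix u assume u: "u \<in> U (opp s)"
    have "d s (t s w u (d s w)) = pl s (t s (d s w) u (d s w)) (pl s (t s w (d (opp s) u) (d s w)) (t s w u (d s (d s w))))"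
      using D_derivation[OF d(1) w j(2)[OF u], of "d s w"] w by simp
    then show "t s (d s w) u (d s w) = ze s"
      using twu u w d(2)[of u "opp s"] j(2)[OF u] by simp
  qed
  have "emb s w = \<zero>\<^bsub>L\<^esub>"
  proof (rule ess_centralizer[OF dom_ess[OF U lin_id[OF jessD[OF U]]]])
    show "emb s w \<in> carrier L" using w by simp
    fix y assume "y \<in> dom (\<lambda>s x. x) U"
    then obtain a d b where y: "y = (a, d, b)" "a \<in> U Pos" "d \<in> D" "b \<in> U Neg" "\<And>s v. v \<in> jcarrier V s \<Longrightarrow> d s v \<in> U s"
      by (auto simp: dom_def)
    show "emb s w \<otimes>\<^bsub>L\<^esub> y = \<zero>\<^bsub>L\<^esub>"
    proof (cases s)
      case Pos
      have "dl w b = \<zero>\<^bsub>E\<^esub>" using 0[of b] y(4) w Pos j(2)[OF y(4)] by (simp add: emb_bracket L_zero)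
      with Pos w y j(2)[OF y(2)] j(2)[OF y(4)] dw[OF y(3,5)] show ?thesis
        by (simp add: bracket_emb L_zero)
    next
      case Neg
      have "\<ominus>\<^bsub>E\<^esub> dl a w = \<zero>\<^bsub>E\<^esub>" using 0[of a] y(2) w Neg j(2)[OF y(2)] by (simp add: emb_bracket L_zero)
      with Neg w y j(2)[OF y(2)] j(2)[OF y(4)] dw[OF y(3,5)] show ?thesis
        by (simp add: bracket_emb L_zero)
    qed
  qed
  then show ?thesis by (simp add: emb_zero[of s, symmetric] emb_inj)
qed

lemma D_annihilator_zero:
  assumes U: "jess U" and d: "d \<in> D" and 0: "\<And>s u. u \<in> U s \<Longrightarrow> d s u = ze s"
  shows "d = \<zero>\<^bsub>E\<^esub>"
proof (rule E_ext)
  note j = jidD[OF jessD[OF U]]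
  note [simp] = D_E[OF d]
  show "d \<in> carrier E" "\<zero>\<^bsub>E\<^esub> \<in> carrier E" by (simp_all add: E_ops_closed)
  fix s v assume v: "v \<in> jcarrier V s"
  have "d s v = ze s"
  proof (rule annihilator_zero[OF U])
    show x: "d s v \<in> jcarrier V s" using v by simp
    fix u assume u: "u \<in> U (opp s)"
    note uV = j(2)[OF u]
    have "\<exists>e\<in>D. (\<forall>z\<in>jcarrier V s. e s z = t s (d s v) u z) \<and>
      (\<forall>z\<in>jcarrier V (opp s). e (opp s) z = \<ominus>\<^bsub>jmod V (opp s)\<^esub> t (opp s) u (d s v) z)"
      by (rule inner[OF x uV]) blast
    then obtain e where eD: "e \<in> D" and eP: "\<forall>z\<in>jcarrier V s. e s z = t s (d s v) u z"
      and eN: "\<forall>z\<in>jcarrier V (opp s). e (opp s) z = \<ominus>\<^bsub>jmod V (opp s)\<^esub> t (opp s) u (d s v) z"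
      by blast
    note e = eD eP[rule_format] eN[rule_format]
    note [simp] = D_E[OF e(1)]
    have e1: "e s w = ze s" if w: "w \<in> U s" for w
    proof -
      have "d s (t s v u w) = ze s" using 0 j(11)[OF w uV v] by simp
      then show ?thesis
        using D_derivation[OF d v uV j(2)[OF w]] 0[OF u] 0[OF w] v uV j(2)[OF w] x
        by (simp add: t_zero e(2))
    qed
    have e2: "e (opp s) w = ze (opp s)" if w: "w \<in> U (opp s)" for w
    proof -
      have "d (opp s) (t (opp s) u v w) = ze (opp s)" using 0 j(11)[OF w, of v u] v uV by simp
      then show ?thesis
        using D_derivation[OF d uV _ j(2)[OF w], of v] 0[OF u] 0[OF w] v uV j(2)[OF w] x
        by (simp add: t_zero[of _ "opp s", simplified] e(3))
    qed
    have e0: "e s z = ze s" if z: "z \<in> jcarrier V s" for z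
    proof (rule ideal_nondeg[OF jessD[OF U]])
      show p: "e s z \<in> U s" using e(2)[OF z] j(12)[OF x u z] by simp
      fix u' assume u': "u' \<in> U (opp s)"
      have "e s (t s z u' (e s z)) = ze s" using e1 j(12)[OF z u' j(2)[OF p]] by simp
      then show "t s (e s z) u' (e s z) = ze s"
        using D_derivation[OF e(1) z j(2)[OF u'] j(2)[OF p]] e1[OF p] e2[OF u'] z j(2)[OF u'] j(2)[OF p]
        by (simp add: t_zero)
    qed
    have e0': "e (opp s) z = ze (opp s)" if "z \<in> jcarrier V (opp s)" for z
      using D_zero_if[OF e(1) e0 that] .
    show "emb s (d s v) \<otimes>\<^bsub>L\<^esub> emb (opp s) u = \<zero>\<^bsub>L\<^esub>"
    proof (cases s)
      case Pos
      have "dl (d Pos v) u = \<zero>\<^bsub>E\<^esub>"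
        using e e0 e0' x uV Pos by (intro E_extPN) (auto simp: E_ops_closed)
      then show ?thesis using Pos x uV by (simp add: emb_bracket L_zero)
    next
      case Neg
      have tP: "t Pos u (d Neg v) z = ze Pos" if z: "z \<in> jcarrier V Pos" for z
      proof -
        have "e Pos z = \<ominus>\<^bsub>jmod V Pos\<^esub> t Pos u (d Neg v) z" "e Pos z = ze Pos"
          using eN e0'[of z] z Neg by simp_all
        then have m: "\<ominus>\<^bsub>jmod V Pos\<^esub> t Pos u (d Neg v) z = ze Pos" by metis
        have "t Pos u (d Neg v) z = \<ominus>\<^bsub>jmod V Pos\<^esub> (\<ominus>\<^bsub>jmod V Pos\<^esub> t Pos u (d Neg v) z)"
          using x uV z Neg by simp
        then show ?thesis unfolding m by simp
      qed
      have tN: "t Neg (d Neg v) u z = ze Neg" if z: "z \<in> jcarrier V Neg" for z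
        using eP e0[of z] z Neg by simp
      have "dl u (d Neg v) = \<zero>\<^bsub>E\<^esub>"
        using x uV Neg by (intro E_extPN) (simp_all add: E_ops_closed tP tN)
      then show ?thesis using Neg x uV by (simp add: emb_bracket L_zero)
    qed
  qed
  then show "d s v = \<zero>\<^bsub>E\<^esub> s v" using v by simp
qed

lemma L_annihilator_zero:
  assumes U: "jess U" and w: "w \<in> carrier L" and 0: "\<And>s u. u \<in> U s \<Longrightarrow> w \<otimes>\<^bsub>L\<^esub> emb s u = \<zero>\<^bsub>L\<^esub>"
  shows "w = \<zero>\<^bsub>L\<^esub>"
proof -
  note j = jidD[OF jessD[OF U]]
  obtain a d b where ww: "w = (a, d, b)" by (cases w)
  have m: "a \<in> jcarrier V Pos" "d \<in> D" "b \<in> jcarrier V Neg" using w unfolding ww by auto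
  have P: "d Pos u = ze Pos" "dl u b = \<zero>\<^bsub>E\<^esub>" if u: "u \<in> U Pos" for u
    using 0[OF u] j(2)[OF u] m unfolding ww by (simp_all add: bracket_emb L_zero E.diff_eq)
  have N: "d Neg u = ze Neg" "dl a u = \<zero>\<^bsub>E\<^esub>" if u: "u \<in> U Neg" for u
    using 0[OF u] j(2)[OF u] m unfolding ww by (simp_all add: bracket_emb L_zero)
  have "d = \<zero>\<^bsub>E\<^esub>"
  proof (rule D_annihilator_zero[OF U m(2)])
    show "d s u = ze s" if "u \<in> U s" for s u using that P N by (cases s) auto
  qed
  moreover have "a = ze Pos"
    using N j(2) m(1) by (intro annihilator_zero[OF U, of a Pos]) (auto simp: emb_bracket L_zero)
  moreover have "b = ze Neg"
    using P j(2) m(3) by (intro annihilator_zero[OF U, of b Neg]) (auto simp: emb_bracket L_zero)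
  ultimately show ?thesis by (simp add: ww L_zero)
qed

lemma perm_eqV:
  assumes f: "(f, I) \<in> P" and g: "(g, J) \<in> P" and U: "jess U"
    and eq: "\<And>s u. u \<in> U s \<Longrightarrow> emb s u \<in> I \<and> emb s u \<in> J \<and> f (emb s u) = g (emb s u)"
  shows "\<forall>\<^sub>F z in F. f z = g z"
proof -
  note p = permD[OF f] and q = permD[OF g] and j = jidD[OF jessD[OF U]]
  show ?thesis using ev_ess[OF p(1)] ev_ess[OF q(1)] ev_carrier
  proof eventually_elim
    case (elim z)
    have "f z \<ominus>\<^bsub>L\<^esub> g z = \<zero>\<^bsub>L\<^esub>"
    proof (rule L_annihilator_zero[OF U])
      show "f z \<ominus>\<^bsub>L\<^esub> g z \<in> carrier L" using elim p(2) q(2) by auto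
      fix s u assume u: "u \<in> U s"
      have eu: "emb s u \<in> carrier L" using j(2)[OF u] by simp
      have "f z \<otimes>\<^bsub>L\<^esub> emb s u = z \<otimes>\<^bsub>L\<^esub> f (emb s u)" using p(4)[of z "emb s u"] p(7)[of "emb s u" z] eq[OF u] elim eu by simp
      moreover have "g z \<otimes>\<^bsub>L\<^esub> emb s u = z \<otimes>\<^bsub>L\<^esub> g (emb s u)" using q(4)[of z "emb s u"] q(7)[of "emb s u" z] eq[OF u] elim eu by simp
      ultimately have "emb s u \<otimes>\<^bsub>L\<^esub> f z = emb s u \<otimes>\<^bsub>L\<^esub> g z"
        using eq[OF u] L_anti[OF eu p(2)[OF elim(1)]] L_anti[OF eu q(2)[OF elim(2)]] by simp
      then show "(f z \<ominus>\<^bsub>L\<^esub> g z) \<otimes>\<^bsub>L\<^esub> emb s u = \<zero>\<^bsub>L\<^esub>"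
        using eu elim p(2) q(2) by (intro L_diff_bracket_zero) simp_all
    qed
    then show ?case using elim p(2) q(2) by (subst (asm) L.eq_if_minus_zero) auto
  qed
qed

end

text \<open>
  Structure is pulled back along an injection that respects the operations; in this way the extended
  centroid of the pair inherits its algebra axioms from that of the Lie algebra.
\<close>

lemma algebra_transfer:
  fixes A :: "('r, 'c, 'f) module_scheme" and B :: "('r, 'd, 'g) module_scheme"
  assumes B: "algebra R B" and inj: "inj_on \<psi> (carrier A)" and im: "\<psi> ` carrier A = carrier B"
    and add: "\<And>x y. x \<in> carrier A \<Longrightarrow> y \<in> carrier A \<Longrightarrow> x \<oplus>\<^bsub>A\<^esub> y \<in> carrier A \<and> \<psi> (x \<oplus>\<^bsub>A\<^esub> y) = \<psi> x \<oplus>\<^bsub>B\<^esub> \<psi> y"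
    and mult: "\<And>x y. x \<in> carrier A \<Longrightarrow> y \<in> carrier A \<Longrightarrow> x \<otimes>\<^bsub>A\<^esub> y \<in> carrier A \<and> \<psi> (x \<otimes>\<^bsub>A\<^esub> y) = \<psi> x \<otimes>\<^bsub>B\<^esub> \<psi> y"
    and sm: "\<And>r x. r \<in> carrier R \<Longrightarrow> x \<in> carrier A \<Longrightarrow> r \<odot>\<^bsub>A\<^esub> x \<in> carrier A \<and> \<psi> (r \<odot>\<^bsub>A\<^esub> x) = r \<odot>\<^bsub>B\<^esub> \<psi> x"
    and one: "\<one>\<^bsub>A\<^esub> \<in> carrier A" "\<psi> \<one>\<^bsub>A\<^esub> = \<one>\<^bsub>B\<^esub>" and zero: "\<zero>\<^bsub>A\<^esub> \<in> carrier A" "\<psi> \<zero>\<^bsub>A\<^esub> = \<zero>\<^bsub>B\<^esub>"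
  shows "algebra R A"
proof -
  interpret B: algebra R B by fact
  have cl: "x \<in> carrier A \<Longrightarrow> \<psi> x \<in> carrier B" for x using im by blast
  have eq: "x = y" if "x \<in> carrier A" "y \<in> carrier A" "\<psi> x = \<psi> y" for x y using inj that by (auto dest: inj_onD)
  have ag: "abelian_group A"
  proof (rule abelian_groupI)
    show "\<exists>y\<in>carrier A. y \<oplus>\<^bsub>A\<^esub> x = \<zero>\<^bsub>A\<^esub>" if x: "x \<in> carrier A" for x
    proof -
      have "\<ominus>\<^bsub>B\<^esub> \<psi> x \<in> \<psi> ` carrier A" using cl[OF x] by (simp add: im)
      then obtain y where y: "y \<in> carrier A" "\<psi> y = \<ominus>\<^bsub>B\<^esub> \<psi> x" by (metis imageE)
      have "y \<oplus>\<^bsub>A\<^esub> x = \<zero>\<^bsub>A\<^esub>"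
        using x y cl[OF x] by (intro eq) (simp_all add: add zero B.l_neg)
      with y show ?thesis by blast
    qed
  qed (auto intro!: eq simp: add zero cl B.M.a_ac)
  have cr: "cring A"
  proof (rule cringI[OF ag])
    show "comm_monoid A"
    proof (rule comm_monoidI)
      show "x \<otimes>\<^bsub>A\<^esub> y = y \<otimes>\<^bsub>A\<^esub> x" if "x \<in> carrier A" "y \<in> carrier A" for x y
        using that by (intro eq) (simp_all add: mult cl B.m_comm)
    qed (auto intro!: eq simp: mult one cl B.m_assoc)
  qed (auto intro!: eq simp: add mult cl B.l_distr)
  show ?thesis
    by (rule algebraI[OF B.R_cring cr])
       (auto intro!: eq simp: add mult sm cl B.smult_l_distr B.smult_r_distr B.smult_assoc1 B.smult_assoc2)
qed

context nondeg_pair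
begin

section \<open>The two extended centroids agree\<close>

text \<open>
  The restriction of a map of \<open>L\<close> to \<open>V\<^sup>+\<close> and \<open>V\<^sup>-\<close>, read as a map of the pair.
\<close>

definition res :: "('a \<times> (sign \<Rightarrow> 'a \<Rightarrow> 'a) \<times> 'a \<Rightarrow> 'a \<times> (sign \<Rightarrow> 'a \<Rightarrow> 'a) \<times> 'a) \<Rightarrow> sign \<Rightarrow> 'a \<Rightarrow> 'a" where
  "res f s x = (case s of Pos \<Rightarrow> fst (f (emb s x)) | Neg \<Rightarrow> snd (snd (f (emb s x))))"

lemma emb_same: "x \<in> jcarrier V s \<Longrightarrow> y \<in> jcarrier V s \<Longrightarrow> emb s x \<otimes>\<^bsub>L\<^esub> emb s y = \<zero>\<^bsub>L\<^esub>"
  by (cases s; subst (2) emb_def) (simp_all add: bracket_emb D_zero dl_zero L_zero)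

text \<open>
  If \<open>x\<close> lies in \<open>V\<^sup>\<sigma>\<close>, then \<open>[x', f x] = f [x', x] = 0\<close> for all \<open>x'\<close> in \<open>V\<^sup>\<sigma>\<close>.  By faithfulness this kills
  the components of \<open>f x\<close> in \<open>IDer V\<close> and in the opposite module.
\<close>

lemma perm_graded:
  assumes f: "(f, I) \<in> P" and x: "x \<in> Uof I s"
  shows "res f s x \<in> jcarrier V s" "f (emb s x) = emb s (res f s x)"
proof -
  note p = permD[OF f] and xV = x[unfolded Uof_iff]
  obtain a d b where z: "f (emb s x) = (a, d, b)" by (cases "f (emb s x)")
  have m: "a \<in> jcarrier V Pos" "d \<in> D" "b \<in> jcarrier V Neg" using p(2)[of "emb s x"] xV unfolding z by auto
  note [simp] = D_E[OF m(2)]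
  have 0: "emb s x' \<otimes>\<^bsub>L\<^esub> (a, d, b) = \<zero>\<^bsub>L\<^esub>" if "x' \<in> jcarrier V s" for x'
    using p(4)[of "emb s x'" "emb s x"] that xV by (simp add: emb_same p(5) z)
  have "res f s x \<in> jcarrier V s \<and> f (emb s x) = emb s (res f s x)"
  proof (cases s)
    case Pos
    have "dl x' b = \<zero>\<^bsub>E\<^esub>" "d Pos x' = ze Pos" if "x' \<in> jcarrier V Pos" for x'
      using 0[of x'] that m Pos by (simp_all add: bracket_emb L_zero M.diff_eq)
    then have b: "b = ze Neg" and dP: "\<And>x'. x' \<in> jcarrier V Pos \<Longrightarrow> d Pos x' = ze Pos"
      using dl_faithful(1)[of b] m by auto
    have "d = \<zero>\<^bsub>E\<^esub>"
      using dP D_zero_if[OF m(2), of Pos] by (intro E_extPN) (auto simp: E_ops_closed)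
    then show ?thesis using z b m Pos by (simp add: res_def emb_simps)
  next
    case Neg
    have "dl a x' = \<zero>\<^bsub>E\<^esub>" "d Neg x' = ze Neg" if "x' \<in> jcarrier V Neg" for x'
      using 0[of x'] that m Neg by (simp_all add: bracket_emb L_zero M.diff_eq E.diff_eq)
    then have a: "a = ze Pos" and dN: "\<And>x'. x' \<in> jcarrier V Neg \<Longrightarrow> d Neg x' = ze Neg"
      using dl_faithful(2)[of a] m by auto
    have "d = \<zero>\<^bsub>E\<^esub>"
      using dN D_zero_if[OF m(2), of Neg] by (intro E_extPN) (auto simp: E_ops_closed)
    then show ?thesis using z a m Neg by (simp add: res_def emb_simps)
  qed
  then show "res f s x \<in> jcarrier V s" "f (emb s x) = emb s (res f s x)" by auto
qed

lemma res_lin: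
  assumes f: "(f, I) \<in> P"
  shows "lin (Uof I) (res f)"
proof -
  note p = permD[OF f] and g = perm_graded[OF f] and i = lidealD[OF essD[OF permD(1)[OF f]]]
  note j = jidD[OF Uof_jid[OF essD[OF p(1)]]]
  have e: "res f s x = y" if "x \<in> Uof I s" "f (emb s x) = emb s y" for s x y
    using that g(2)[OF that(1)] by (simp add: emb_inj)
  have c: "x \<in> Uof I s \<Longrightarrow> x \<in> jcarrier V s \<and> emb s x \<in> I" for s x by (simp add: Uof_iff)
  note cc = c[THEN conjunct1] c[THEN conjunct2]
  show ?thesis unfolding lin_def
  proof (intro allI conjI ballI)
    show "u \<in> Uof I s \<Longrightarrow> res f s u \<in> jcarrier V s" for s u by (rule g(1))
    show "res f s (pl s u u') = pl s (res f s u) (res f s u')" if "u \<in> Uof I s" "u' \<in> Uof I s" for s u u'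
      using that cc by (intro e j(4)) (simp_all add: emb_add p(3) g)
    show "res f s (sm s r u) = sm s r (res f s u)" if "r \<in> carrier R" "u \<in> Uof I s" for s r u
      using that cc by (intro e j(7)) (simp_all add: emb_smult p(8) g)
    show "res f s (jQ V s x y) = jQ V s x (res f (opp s) y)" if "x \<in> jcarrier V s" "y \<in> Uof I (opp s)" for s x y
      using that cc[OF that(2)]
      by (intro e j(9)) (simp_all add: emb_Q p(4,7,8) g i(6,7,8))
    show "res f s (t s y z x) = t s (res f s y) z x" if "y \<in> Uof I s" "z \<in> jcarrier V (opp s)" "x \<in> jcarrier V s" for s x y z
      using that cc[OF that(1)] by (intro e j(10)) (simp_all add: emb_triple p(7) g i(8))
  qed
qed

text \<open>The quadratic condition on homomorphisms follows from \<open>Q\<^sub>y x = {y, x, y} / 2\<close>.\<close>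

lemma jhom_iff:
  assumes U: "jid U"
  shows "jhom R V U g \<longleftrightarrow> lin U g"
proof
  assume "jhom R V U g"
  then show "lin U g" unfolding jhom_def lin_def by (auto simp: Pi_iff)
next
  assume g: "lin U g"
  note j = jidD[OF U] and l = linD[OF U g]
  have "g s (jQ V s y x) \<in> U s \<and> g s (g s (jQ V s y x)) = jQ V s (g s y) x"
    if y: "y \<in> U s" and x: "x \<in> jcarrier V (opp s)" for s x y
  proof -
    have 1: "g s (jQ V s y x) = sm s hf (t s (g s y) x y)"
      using y x j(2)[OF y] by (simp add: Q_half l(3) l(5) j(10))
    have 2: "t s (g s y) x y \<in> U s" by (rule j(11)[OF y x l(1)[OF y]])
    show ?thesis
      using y x l(1)[OF y] 2 by (simp add: 1 j(7) l(3) l(10) Q_half[of "g s y"])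
  qed
  then show "jhom R V U g" using l unfolding jhom_def by (auto simp: Pi_iff)
qed

abbreviation PJ where "PJ \<equiv> jpermissible R V"
abbreviation jc where "jc \<equiv> jclass R V"
abbreviation JC where "JC \<equiv> jcentroid R V"

lemma PJ_iff: "(g, U) \<in> PJ \<longleftrightarrow> jess U \<and> lin U g"
  unfolding jpermissible_def using jhom_iff jessD by auto

text \<open>
  The class of permissible maps of \<open>L\<close> that a permissible map of \<open>V\<close> extends to.
\<close>

definition "pc p = lc (ext (fst p), dom (fst p) (snd p))"

lemma pc_closed [simp]: "p \<in> PJ \<Longrightarrow> pc p \<in> carrier C"
  using ext_perm by (cases p) (auto simp: pc_def PJ_iff)

text \<open>
  Maps of the pair that agree on an essential ideal \<open>K\<close> have extensions that agree on the essential
  ideal above \<open>K\<close>; agreement of the extensions restricts back to the outer components.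
\<close>

lemma pc_eq:
  assumes "(g, U) \<in> PJ" "(h, W) \<in> PJ"
  shows "pc (g, U) = pc (h, W) \<longleftrightarrow> (\<exists>K. jess K \<and> (\<forall>s. K s \<subseteq> U s \<inter> W s) \<and> (\<forall>s. \<forall>x\<in>K s. g s x = h s x))"
proof -
  have g: "jess U" "lin U g" and h: "jess W" "lin W h" using assms by (auto simp: PJ_iff)
  note G = ext_perm[OF g] and H = ext_perm[OF h]
  note eg = emb_dom[OF jessD[OF g(1)] g(2)] ext_emb[OF jessD[OF g(1)] g(2)]
  note eh = emb_dom[OF jessD[OF h(1)] h(2)] ext_emb[OF jessD[OF h(1)] h(2)]
  have "pc (g, U) = pc (h, W) \<longleftrightarrow> (\<forall>\<^sub>F y in F. ext g y = ext h y)"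
    unfolding pc_def using lc_eq[OF G H] by simp
  also have "\<dots> \<longleftrightarrow> (\<exists>K. jess K \<and> (\<forall>s. K s \<subseteq> U s \<inter> W s) \<and> (\<forall>s. \<forall>x\<in>K s. g s x = h s x))"
  proof
    assume "\<forall>\<^sub>F y in F. ext g y = ext h y"
    then obtain K where K: "ess K" "\<forall>y\<in>K. ext g y = ext h y" by (auto simp: eventually_F)
    let ?K = "K \<inter> (dom g U \<inter> dom h W)"
    have "jess (Uof ?K)" by (intro Uof_jess ess_Int K(1) permD(1)[OF G] permD(1)[OF H])
    moreover have "x \<in> U s \<inter> W s \<and> g s x = h s x" if "x \<in> Uof ?K s" for s x
    proof -
      have "emb s x \<in> K" "x \<in> U s" "x \<in> W s" using that eg(1) eh(1) by (auto simp: Uof_iff)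
      moreover from this(1) have "ext g (emb s x) = ext h (emb s x)" using K(2) by blast
      ultimately show ?thesis by (simp add: eg eh emb_inj)
    qed
    ultimately show "\<exists>K. jess K \<and> (\<forall>s. K s \<subseteq> U s \<inter> W s) \<and> (\<forall>s. \<forall>x\<in>K s. g s x = h s x)" by blast
  next
    assume "\<exists>K. jess K \<and> (\<forall>s. K s \<subseteq> U s \<inter> W s) \<and> (\<forall>s. \<forall>x\<in>K s. g s x = h s x)"
    then obtain K where K: "jess K" "\<And>s. K s \<subseteq> U s \<inter> W s" "\<And>s x. x \<in> K s \<Longrightarrow> g s x = h s x" by blast
    show "\<forall>\<^sub>F y in F. ext g y = ext h y"
    proof (rule perm_eqV[OF G H K(1)])
      fix s u assume u: "u \<in> K s"
      have "u \<in> U s" "u \<in> W s" using K(2) u by auto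
      then show "emb s u \<in> dom g U \<and> emb s u \<in> dom h W \<and> ext g (emb s u) = ext h (emb s u)"
        using K(3)[OF u] by (simp add: eg eh)
    qed
  qed
  finally show ?thesis .
qed

lemma jequiv_iff: "(p, q) \<in> jequiv R V \<longleftrightarrow> p \<in> PJ \<and> q \<in> PJ \<and> pc p = pc q"
proof -
  obtain g U h W where pq: "p = (g, U)" "q = (h, W)" by (cases p, cases q)
  have "(p, q) \<in> jequiv R V \<longleftrightarrow> (g, U) \<in> PJ \<and> (h, W) \<in> PJ \<and>
      (\<exists>K. jess K \<and> (\<forall>s. K s \<subseteq> U s \<inter> W s) \<and> (\<forall>s. \<forall>x\<in>K s. g s x = h s x))"
    unfolding pq jequiv_def by simp
  also have "\<dots> \<longleftrightarrow> (g, U) \<in> PJ \<and> (h, W) \<in> PJ \<and> pc (g, U) = pc (h, W)"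
    by (intro conj_cong HOL.refl) (rule pc_eq[symmetric])
  finally show ?thesis unfolding pq .
qed

lemma mem_jc: "q \<in> jc p \<longleftrightarrow> p \<in> PJ \<and> q \<in> PJ \<and> pc p = pc q"
  by (simp add: jclass_def jequiv_iff)

lemma jc_eq: "p \<in> PJ \<Longrightarrow> q \<in> PJ \<Longrightarrow> jc p = jc q \<longleftrightarrow> pc p = pc q"
proof
  assume p: "p \<in> PJ" "q \<in> PJ"
  show "pc p = pc q" if "jc p = jc q"
  proof -
    have "q \<in> jc p" unfolding that using p by (simp add: mem_jc)
    then show ?thesis by (simp add: mem_jc)
  qed
  show "jc p = jc q" if "pc p = pc q"
    by (rule Set.set_eqI) (simp only: mem_jc p that simp_thms)
qed

lemma JC_carrier: "carrier JC = jc ` PJ"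
  by (auto simp: jcentroid_def Let_def quotient_def jclass_def)

text \<open>
  The isomorphism of the extended centroids: the class of a homomorphism goes to the class of its extension.
\<close>

definition "psi c = pc (SOME p. p \<in> c)"

lemma psi_jc: "p \<in> PJ \<Longrightarrow> psi (jc p) = pc p"
proof -
  assume p: "p \<in> PJ"
  define r where "r = (SOME q. q \<in> jc p)"
  have "p \<in> jc p" using p by (simp add: mem_jc)
  then have "r \<in> jc p" unfolding r_def by (rule someI)
  then have "pc r = pc p" by (simp add: mem_jc)
  then show ?thesis unfolding psi_def r_def .
qed

lemma psi_inj: "inj_on psi (carrier JC)"
proof (rule inj_onI)
  fix c e assume "c \<in> carrier JC" "e \<in> carrier JC" and eq: "psi c = psi e"
  then obtain p q where p: "p \<in> PJ" "q \<in> PJ" "c = jc p" "e = jc q" unfolding JC_carrier by blast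
  with eq have "pc p = pc q" by (simp only: psi_jc)
  with p show "c = e" by (simp only: jc_eq)
qed

lemma psi_image: "psi ` carrier JC = carrier C"
proof
  show "psi ` carrier JC \<subseteq> carrier C" by (auto simp: JC_carrier psi_jc)
  show "carrier C \<subseteq> psi ` carrier JC"
  proof
    fix c assume "c \<in> carrier C"
    then obtain f I where f: "(f, I) \<in> P" "c = lc (f, I)" by (auto simp: C_carrier)
    note U = Uof_jess[OF permD(1)[OF f(1)]] and g = res_lin[OF f(1)]
    have p: "(res f, Uof I) \<in> PJ" using U g by (simp add: PJ_iff)
    have "\<forall>\<^sub>F y in F. ext (res f) y = f y"
    proof (rule perm_eqV[OF ext_perm[OF U g] f(1) U])
      show "emb s u \<in> dom (res f) (Uof I) \<and> emb s u \<in> I \<and> ext (res f) (emb s u) = f (emb s u)" if "u \<in> Uof I s" for s u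
        using that emb_dom[OF jessD[OF U] g] ext_emb[OF jessD[OF U] g] perm_graded(2)[OF f(1) that] by (simp add: Uof_iff)
    qed
    then have "pc (res f, Uof I) = c"
      unfolding pc_def f(2) using lc_eq[OF ext_perm[OF U g] f(1)] by simp
    then show "c \<in> psi ` carrier JC" using p psi_jc[OF p] by (force simp: JC_carrier)
  qed
qed

text \<open>
  With \<open>2\<close> invertible, \<open>2 Q\<^sub>w Q\<^sub>v = D\<^bsub>w,v\<^esub> D\<^bsub>w,v\<^esub> - D\<^bsub>Q\<^sub>w v,v\<^esub>\<close>.  So the span of \<open>Q\<^sub>K V\<close> and
  \<open>Q\<^sub>V Q\<^sub>K V\<close> is closed under \<open>Q\<^sub>V\<close>, because the span of \<open>Q\<^sub>K V\<close> is closed under derivations.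
\<close>

lemma QQ:
  assumes "w \<in> jcarrier V s" "v \<in> jcarrier V (opp s)" "m \<in> jcarrier V s"
  shows "jQ V s w (jQ V (opp s) v m) =
    sm s hf (sm s hf (mi s (pl s (t s w v (t s w v m)) (t s w v (t s w v m))) (t s (t s w v w) v m)))"
proof -
  have "pl s (t s w v (t s w v m)) (t s w v (t s w v m)) =
    pl s (t s (t s w v w) v m) (t s w (t (opp s) v m v) w)"
    using JP16[of w s w m v v] assms by simp
  then have "t s w (t (opp s) v m v) w = mi s (pl s (t s w v (t s w v m)) (t s w v (t s w v m))) (t s (t s w v w) v m)"
    using assms by (simp add: M.diff_eq M.a_comm)
  moreover have "jQ V s w (jQ V (opp s) v m) = sm s hf (t s w (sm (opp s) hf (t (opp s) v m v)) w)"
    using assms by (subst Q_half) (simp_all add: Q_half[of v])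
  ultimately show ?thesis using assms by (simp add: t_smult2)
qed

text \<open>
  The domains \<open>K * V\<close> of sums and products of classes.
\<close>

abbreviation S where "S K \<equiv> jstar R V K (jcarrier V)"
abbreviation S1 where "S1 K s \<equiv> mspan R (jmod V s) {jQ V s k i | k i. k \<in> K s \<and> i \<in> jcarrier V (opp s)}"

lemma S_ideal:
  assumes K: "jid K"
  shows "jid (S K)" "\<And>s. S K s \<subseteq> K s" "\<And>s x y. x \<in> K s \<Longrightarrow> y \<in> jcarrier V (opp s) \<Longrightarrow> jQ V s x y \<in> S K s"
proof -
  note k = jidD[OF K]
  have g1: "{jQ V s k i | k i. k \<in> K s \<and> i \<in> jcarrier V (opp s)} \<subseteq> jcarrier V s" for s using k(2) by auto
  have g2: "{jQ V s v (jQ V (opp s) k i) | v k i. v \<in> jcarrier V s \<and> k \<in> K (opp s) \<and> i \<in> jcarrier V s} \<subseteq> jcarrier V s" for s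
    using k(2) by auto
  have S1: "submodule (S1 K s) R (jmod V s)" for s using g1 by (rule M.mspan_submodule)
  have S: "submodule (S K s) R (jmod V s)" for s unfolding jstar_def using g1 g2 by (intro M.mspan_submodule) auto
  note e1 = M.submoduleE[OF S1] and e = M.submoduleE[OF S]
  have Q1: "jQ V s x i \<in> S1 K s" if "x \<in> K s" "i \<in> jcarrier V (opp s)" for s x i
    using that by (intro mspan_inc) blast
  have sub: "S1 K s \<subseteq> S K s" for s
    by (rule mspan_subset[OF S]) (auto simp: jstar_def intro!: mspan_inc)
  show SK: "S K s \<subseteq> K s" for s
  proof -
    have "jQ V s v (jQ V (opp s) x i) \<in> K s" if "v \<in> jcarrier V s" "x \<in> K (opp s)" "i \<in> jcarrier V s" for v x i
      using that k(9)[of v s "jQ V (opp s) x i"] k(8)[of x "opp s" i] by simp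
    then show ?thesis unfolding jstar_def using k(8) by (intro mspan_subset[OF k(1)]) auto
  qed
  have gen2: "jQ V s v (jQ V (opp s) x i) \<in> S K s" if "v \<in> jcarrier V s" "x \<in> K (opp s)" "i \<in> jcarrier V s" for s v x i
    unfolding jstar_def using that by (intro mspan_inc) blast
  show "jQ V s x y \<in> S K s" if "x \<in> K s" "y \<in> jcarrier V (opp s)" for s x y using Q1[OF that] sub by blast
  have a: "t s x i x' \<in> S1 K s" if "x \<in> K s" "x' \<in> K s" "i \<in> jcarrier V (opp s)" for s x x' i
    unfolding jtriple_def using that k(4) by (intro M.submodule_minus[OF S1] Q1) auto
  have D1: "d s m \<in> S1 K s" if d: "d \<in> D" and m: "m \<in> S1 K s" for s d m
  proof -
    note [simp] = D_E[OF d]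
    let ?H = "{m \<in> jcarrier V s. d s m \<in> S1 K s}"
    have "submodule ?H R (jmod V s)"
      by (rule M.submoduleI) (auto simp: E_minus_hom e1 M.submodule_zero[OF S1])
    moreover have "d s (jQ V s x i) \<in> S1 K s" if "x \<in> K s" "i \<in> jcarrier V (opp s)" for x i
    proof -
      have x: "x \<in> jcarrier V s" using k(2) that by simp
      have "d s (jQ V s x i) = sm s hf (d s (t s x i x))" using x that by (simp add: Q_half)
      moreover have "d s (t s x i x) \<in> S1 K s"
        unfolding D_derivation[OF d x that(2) x]
        using that jid_D[OF K d that(1)] by (intro e1(5) a) auto
      ultimately show ?thesis by (simp add: e1(4))
    qed
    ultimately have "S1 K s \<subseteq> ?H" using k(2) by (intro mspan_subset) auto
    with m show ?thesis by blast
  qed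
  have c: "jQ V s v m \<in> S K s" if v: "v \<in> jcarrier V s" and m: "m \<in> S1 K (opp s)" for s v m
  proof -
    let ?H = "{m \<in> jcarrier V (opp s). jQ V s v m \<in> S K s}"
    have n: "jQ V s v (\<ominus>\<^bsub>jmod V (opp s)\<^esub> x) = \<ominus>\<^bsub>jmod V s\<^esub> jQ V s v x" if "x \<in> jcarrier V (opp s)" for x
      using that v by (simp add: Q_half t_minus M.smult_r_minus)
    have "submodule ?H R (jmod V (opp s))"
      by (rule M.submoduleI) (use v in \<open>auto simp: Q_zero_right J.Q_add J.Q_smult n e M.submodule_zero[OF S]\<close>)
    then have "S1 K (opp s) \<subseteq> ?H"
    proof (rule mspan_subset)
      show "{jQ V (opp s) x i | x i. x \<in> K (opp s) \<and> i \<in> jcarrier V (opp (opp s))} \<subseteq> ?H"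
        using k(2) gen2[OF v] by auto
    qed
    with m show ?thesis by blast
  qed
  have c': "t s v m v' \<in> S K s" if "v \<in> jcarrier V s" "v' \<in> jcarrier V s" "m \<in> S1 K (opp s)" for s v v' m
    unfolding jtriple_def using that by (intro M.submodule_minus[OF S] c) auto
  have S1V: "m \<in> S1 K s \<Longrightarrow> m \<in> jcarrier V s" for s m using e1(1) by blast
  have SV: "m \<in> S K s \<Longrightarrow> m \<in> jcarrier V s" for s m using e(1) by blast
  have D2: "d s m \<in> S K s" if d: "d \<in> D" and m: "m \<in> S K s" for s d m
  proof -
    note [simp] = D_E[OF d]
    let ?H = "{m \<in> jcarrier V s. d s m \<in> S K s}"
    have "submodule ?H R (jmod V s)"
      by (rule M.submoduleI) (auto simp: E_minus_hom e M.submodule_zero[OF S])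
    moreover have "d s (jQ V s v m) \<in> S K s" if "v \<in> jcarrier V s" "m \<in> S1 K (opp s)" for v m
    proof -
      note mV = S1V[OF that(2)]
      have "d s (jQ V s v m) = sm s hf (d s (t s v m v))" using that mV by (simp add: Q_half)
      moreover have "d s (t s v m v) \<in> S K s"
        unfolding D_derivation[OF d that(1) mV that(1)]
        using that D1[OF d that(2)] by (intro e(5) c') auto
      ultimately show ?thesis by (simp add: e(4))
    qed
    moreover have "jQ V (opp s) x i \<in> S1 K (opp s)" if "x \<in> K (opp s)" "i \<in> jcarrier V s" for x i
      using Q1[of x "opp s" i] that by simp
    moreover have "d s (jQ V s x i) \<in> S K s" if "x \<in> K s" "i \<in> jcarrier V (opp s)" for x i
      using D1[OF d Q1[OF that]] sub by blast
    ultimately have "S K s \<subseteq> ?H" unfolding jstar_def using k(2) by (intro mspan_subset) auto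
    with m show ?thesis by blast
  qed
  have tr: "t s x y m \<in> S K s" if "x \<in> jcarrier V s" "y \<in> jcarrier V (opp s)" "m \<in> S K s" for s x y m
  proof -
    note a = that
    have "\<exists>e\<in>D. \<forall>z\<in>jcarrier V s. e s z = t s x y z" by (rule inner[OF a(1,2)]) blast
    then obtain e where e: "e \<in> D" "\<And>z. z \<in> jcarrier V s \<Longrightarrow> e s z = t s x y z" by blast
    show ?thesis using D2[OF e(1) a(3)] e(2)[OF SV[OF a(3)]] by simp
  qed
  have tr1: "t s x y m \<in> S1 K s" if "x \<in> jcarrier V s" "y \<in> jcarrier V (opp s)" "m \<in> S1 K s" for s x y m
  proof -
    note a = that
    have "\<exists>e\<in>D. \<forall>z\<in>jcarrier V s. e s z = t s x y z" by (rule inner[OF a(1,2)]) blast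
    then obtain e where e: "e \<in> D" "\<And>z. z \<in> jcarrier V s \<Longrightarrow> e s z = t s x y z" by blast
    show ?thesis using D1[OF e(1) a(3)] e(2)[OF S1V[OF a(3)]] by simp
  qed
  show "jid (S K)"
  proof (rule jidI[OF S])
    show "t s u y z \<in> S K s" if "u \<in> S K s" "y \<in> jcarrier V (opp s)" "z \<in> jcarrier V s" for s u y z
      using that SV tr[of z s y u] triple_sym[of u s y z] by simp
    fix s x u assume x: "x \<in> jcarrier V s" and u: "u \<in> S K (opp s)"
    let ?H = "{m \<in> jcarrier V (opp s). jQ V s x m \<in> S K s}"
    have n: "jQ V s x (\<ominus>\<^bsub>jmod V (opp s)\<^esub> m) = \<ominus>\<^bsub>jmod V s\<^esub> jQ V s x m" if "m \<in> jcarrier V (opp s)" for m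
      using that x by (simp add: Q_half t_minus M.smult_r_minus)
    have "submodule ?H R (jmod V (opp s))"
      by (rule M.submoduleI) (use x in \<open>auto simp: Q_zero_right J.Q_add J.Q_smult n e M.submodule_zero[OF S]\<close>)
    moreover have "jQ V s x (jQ V (opp s) y i) \<in> S K s" if "y \<in> K (opp s)" "i \<in> jcarrier V s" for y i
      using gen2[OF x that] .
    moreover have "jQ V s x (jQ V (opp s) v (jQ V s y i)) \<in> S K s"
      if "v \<in> jcarrier V (opp s)" "y \<in> K s" "i \<in> jcarrier V (opp s)" for v y i
    proof -
      let ?m = "jQ V s y i"
      have m: "?m \<in> S1 K s" by (rule Q1[OF that(2,3)])
      have "t s x v (t s x v ?m) \<in> S1 K s" "t s (t s x v x) v ?m \<in> S1 K s"
        using m x that by (auto intro!: tr1)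
      then have "jQ V s x (jQ V (opp s) v ?m) \<in> S1 K s"
        unfolding QQ[OF x that(1) S1V[OF m]] by (intro e1(4,5) M.submodule_minus[OF S1] hf_closed)
      then show ?thesis using sub by blast
    qed
    ultimately have "S K (opp s) \<subseteq> ?H"
      unfolding jstar_def[of _ _ _ _ "opp s"] using k(2) by (intro mspan_subset) auto
    then show "jQ V s x u \<in> S K s" using u by blast
  qed
qed

lemma S_jess: assumes "jess K" shows "jess (S K)"
proof (rule jessI[OF S_ideal(1)[OF jessD[OF assms]]])
  fix W s x assume W: "jid W" "x \<in> W s" "x \<noteq> ze s"
  obtain s' x' where x': "x' \<in> K s'" "x' \<in> W s'" "x' \<noteq> ze s'" using jess_meets[OF assms W] .
  note xV = jidD(2)[OF W(1) x'(2)]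
  obtain y where y: "y \<in> jcarrier V (opp s')" "jQ V s' x' y \<noteq> ze s'" using nondegD[OF xV] x'(3) by blast
  then show "\<exists>s x. x \<in> S K s \<and> x \<in> W s \<and> x \<noteq> ze s"
    using S_ideal(3)[OF jessD[OF assms] x'(1) y(1)] jidD(8)[OF W(1) x'(2) y(1)] by blast
qed

text \<open>
  On \<open>Q\<^sub>K V\<close> the value \<open>g (Q\<^sub>x i)\<close> is \<open>{g x, i, x} / 2\<close>, which lies in every ideal that contains \<open>x\<close>.  Hence \<open>g\<close>
  maps \<open>S K\<close> into every ideal above \<open>K\<close>, and composites are defined on such domains.
\<close>

lemma S_hom:
  assumes K: "jid K" and KU: "\<And>s. K s \<subseteq> U s" and U: "jid U" and g: "lin U g" and W: "jid W" and KW: "\<And>s. K s \<subseteq> W s"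
    and x: "x \<in> S K s"
  shows "g s x \<in> W s"
proof -
  note l = linD[OF U g] and u = jidD[OF U] and w = jidD[OF W] and k = jidD[OF K]
  let ?H = "{x \<in> U s. g s x \<in> W s}"
  have H: "submodule ?H R (jmod V s)"
    by (rule M.submoduleI) (auto simp: u w l)
  have q: "jQ V s x i \<in> U s \<and> g s (jQ V s x i) \<in> W s" if "x \<in> K s" "i \<in> jcarrier V (opp s)" for s x i
  proof -
    have m: "x \<in> U s" "x \<in> W s" using that KU KW by auto
    have "g s (jQ V s x i) = sm s hf (t s (g s x) i x)"
      using m that u(2)[OF m(1)] by (simp add: Q_half l(3,5) u(10))
    moreover have "t s (g s x) i x \<in> W s" by (rule w(11)[OF m(2) that(2) l(1)[OF m(1)]])
    ultimately show ?thesis using u(8)[OF m(1) that(2)] w(7) by simp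
  qed
  have "jQ V s v (jQ V (opp s) y i) \<in> ?H" if "v \<in> jcarrier V s" "y \<in> K (opp s)" "i \<in> jcarrier V s" for v y i
    using q[of y "opp s" i] that by (simp add: l(4) u(9) w(9))
  moreover have "jQ V s x i \<in> ?H" if "x \<in> K s" "i \<in> jcarrier V (opp s)" for x i
    using q[OF that] by simp
  ultimately have "S K s \<subseteq> ?H" unfolding jstar_def using H by (intro mspan_subset) auto
  with x show ?thesis by blast
qed

lemma lin_mono: "lin U g \<Longrightarrow> (\<And>s. K s \<subseteq> U s) \<Longrightarrow> lin K g"
  unfolding lin_def by (meson subsetD)

lemma PJ_pc:
  assumes "(g, U) \<in> PJ" "(f, I) \<in> P" "\<And>s u. u \<in> U s \<Longrightarrow> emb s u \<in> I \<and> f (emb s u) = emb s (g s u)"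
  shows "pc (g, U) = lc (f, I)"
proof -
  have g: "jess U" "lin U g" using assms(1) by (auto simp: PJ_iff)
  have "\<forall>\<^sub>F y in F. ext g y = f y"
    using assms(3) emb_dom[OF jessD[OF g(1)] g(2)] ext_emb[OF jessD[OF g(1)] g(2)]
    by (intro perm_eqV[OF ext_perm[OF g] assms(2) g(1)]) simp
  then show ?thesis unfolding pc_def using lc_eq[OF ext_perm[OF g] assms(2)] by simp
qed

lemma PJ_add:
  assumes p: "(g, U) \<in> PJ" and q: "(h, W) \<in> PJ"
  defines "sm2 \<equiv> (\<lambda>s x. pl s (g s x) (h s x), S (\<lambda>s. U s \<inter> W s))"
  shows "sm2 \<in> PJ" "pc sm2 = pc (g, U) \<oplus>\<^bsub>C\<^esub> pc (h, W)"
proof -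
  let ?K = "\<lambda>s. U s \<inter> W s"
  have g: "jess U" "lin U g" and h: "jess W" "lin W h" using p q by (auto simp: PJ_iff)
  have K: "jess ?K" by (rule jess_Int[OF g(1) h(1)])
  have sub: "S ?K s \<subseteq> U s" "S ?K s \<subseteq> W s" for s using S_ideal(2)[OF jessD[OF K]] by blast+
  note kK = jidD[OF S_ideal(1)[OF jessD[OF K]]]
  have lg: "lin (S ?K) g" and lh: "lin (S ?K) h" using lin_mono g(2) h(2) sub by blast+
  note lg = linD[OF S_ideal(1)[OF jessD[OF K]] lg] and lh = linD[OF S_ideal(1)[OF jessD[OF K]] lh]
  have "lin (S ?K) (\<lambda>s x. pl s (g s x) (h s x))"
    unfolding lin_def
    by (auto simp: lg(1,2,3,4,5) lh(1,2,3,4,5) M.add4 M.smult_r_distr J.Q_add t_add1)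
  then show s: "sm2 \<in> PJ" unfolding sm2_def using S_jess[OF K] by (simp add: PJ_iff)
  note G = ext_perm[OF g] and H = ext_perm[OF h]
  show "pc sm2 = pc (g, U) \<oplus>\<^bsub>C\<^esub> pc (h, W)"
    unfolding pc_def[of "(_, U)"] pc_def[of "(_, W)"] fst_conv snd_conv lc_add[OF G H] unfolding sm2_def
  proof (rule PJ_pc[OF s[unfolded sm2_def] perm_add[OF G H]])
    fix s u assume u: "u \<in> S ?K s"
    have "u \<in> U s" "u \<in> W s" using u sub by blast+
    then show "emb s u \<in> dom g U \<inter> dom h W \<and> ext g (emb s u) \<oplus>\<^bsub>L\<^esub> ext h (emb s u) = emb s (pl s (g s u) (h s u))"
      using emb_dom[OF jessD[OF g(1)] g(2)] emb_dom[OF jessD[OF h(1)] h(2)] ext_emb[OF jessD[OF g(1)] g(2)]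
        ext_emb[OF jessD[OF h(1)] h(2)] lg(1)[OF u] lh(1)[OF u] by (simp add: emb_add)
  qed
qed

lemma PJ_mult:
  assumes p: "(g, U) \<in> PJ" and q: "(h, W) \<in> PJ"
  defines "prd \<equiv> (\<lambda>s x. g s (h s x), S (S (\<lambda>s. U s \<inter> W s)))"
  shows "prd \<in> PJ" "pc prd = pc (g, U) \<otimes>\<^bsub>C\<^esub> pc (h, W)"
proof -
  let ?K = "\<lambda>s. U s \<inter> W s"
  have g: "jess U" "lin U g" and h: "jess W" "lin W h" using p q by (auto simp: PJ_iff)
  note gU = linD[OF jessD[OF g(1)] g(2)]
  have K: "jess ?K" by (rule jess_Int[OF g(1) h(1)])
  have SK: "jess (S ?K)" and SSK: "jess (S (S ?K))" using S_jess K by blast+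
  have subK: "S (S ?K) s \<subseteq> S ?K s" "S ?K s \<subseteq> ?K s" for s using S_ideal(2)[OF jessD] K SK by blast+
  have sub: "S (S ?K) s \<subseteq> W s" for s using subK by blast
  have hU: "h s x \<in> U s" if "x \<in> S (S ?K) s" for s x
    using subK that by (intro S_hom[OF jessD[OF K] _ jessD[OF h(1)] h(2) jessD[OF g(1)]]) auto
  have lh: "lin (S (S ?K)) h" using lin_mono h(2) sub by blast
  note lh = linD[OF jessD[OF SSK] lh]
  have "lin (S (S ?K)) (\<lambda>s x. g s (h s x))"
    unfolding lin_def by (auto simp: lh(1,2,3,4,5) gU(1,2,3,4,5) hU)
  then show s: "prd \<in> PJ" unfolding prd_def using SSK by (simp add: PJ_iff)
  note G = ext_perm[OF g] and H = ext_perm[OF h]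
  show "pc prd = pc (g, U) \<otimes>\<^bsub>C\<^esub> pc (h, W)"
    unfolding pc_def[of "(_, U)"] pc_def[of "(_, W)"] fst_conv snd_conv lc_mult[OF G H] unfolding prd_def
  proof (rule PJ_pc[OF s[unfolded prd_def] perm_comp[OF G H]])
    fix s u assume u: "u \<in> S (S ?K) s"
    have "u \<in> W s" "h s u \<in> U s" using u sub hU by blast+
    then show "emb s u \<in> {x \<in> dom h W. ext h x \<in> dom g U} \<and> ext g (ext h (emb s u)) = emb s (g s (h s u))"
      using emb_dom[OF jessD[OF g(1)] g(2)] emb_dom[OF jessD[OF h(1)] h(2)] ext_emb[OF jessD[OF g(1)] g(2)]
        ext_emb[OF jessD[OF h(1)] h(2)] by simp
  qed
qed

lemma PJ_smult:
  assumes r: "r \<in> carrier R" and p: "(g, U) \<in> PJ"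
  shows "(\<lambda>s x. sm s r (g s x), U) \<in> PJ" "pc (\<lambda>s x. sm s r (g s x), U) = r \<odot>\<^bsub>C\<^esub> pc (g, U)"
proof -
  have g: "jess U" "lin U g" using p by (auto simp: PJ_iff)
  note gU = linD[OF jessD[OF g(1)] g(2)]
  have "lin U (\<lambda>s x. sm s r (g s x))"
    unfolding lin_def using r
    by (auto simp: gU(1,2,3,4,5) M.smult_r_distr J.Q_smult t_smult1 M.smult_assoc1[symmetric] M.R.m_comm)
  then show s: "(\<lambda>s x. sm s r (g s x), U) \<in> PJ" using g by (simp add: PJ_iff)
  note G = ext_perm[OF g]
  show "pc (\<lambda>s x. sm s r (g s x), U) = r \<odot>\<^bsub>C\<^esub> pc (g, U)"
    unfolding pc_def[of "(g, U)"] fst_conv snd_conv lc_smult[OF r G]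
    using emb_dom[OF jessD[OF g(1)] g(2)] ext_emb[OF jessD[OF g(1)] g(2)] gU(1) r
    by (intro PJ_pc[OF s perm_smult[OF r G]]) (simp add: emb_smult)
qed

lemma PJ_one: "(\<lambda>s x. x, jcarrier V) \<in> PJ" "pc (\<lambda>s x. x, jcarrier V) = \<one>\<^bsub>C\<^esub>"
proof -
  show p: "(\<lambda>s x. x, jcarrier V) \<in> PJ" using jess_carrier lin_id[OF jessD] by (simp add: PJ_iff)
  show "pc (\<lambda>s x. x, jcarrier V) = \<one>\<^bsub>C\<^esub>"
    unfolding C_one by (rule PJ_pc[OF p perm_one]) simp
qed

lemma PJ_zero: "(\<lambda>s x. ze s, jcarrier V) \<in> PJ" "pc (\<lambda>s x. ze s, jcarrier V) = \<zero>\<^bsub>C\<^esub>"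
proof -
  have "lin (jcarrier V) (\<lambda>s x. ze s)" by (auto simp: lin_def Q_zero_right t_zero)
  then show p: "(\<lambda>s x. ze s, jcarrier V) \<in> PJ" using jess_carrier by (simp add: PJ_iff)
  show "pc (\<lambda>s x. ze s, jcarrier V) = \<zero>\<^bsub>C\<^esub>"
    unfolding C_zero by (rule PJ_pc[OF p perm_zero]) (simp add: emb_zero)
qed

lemma Union_jc:
  assumes "p \<in> PJ" "\<And>q. q \<in> jc p \<Longrightarrow> H q = H p"
  shows "(\<Union>q\<in>jc p. H q) = H p"
proof -
  have "p \<in> jc p" using assms(1) by (simp add: mem_jc)
  with assms(2) show ?thesis by blast
qed

lemma Union_jc2:
  assumes "p \<in> PJ" "q \<in> PJ" "\<And>p' q'. p' \<in> jc p \<Longrightarrow> q' \<in> jc q \<Longrightarrow> H p' q' = H p q"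
  shows "(\<Union>p'\<in>jc p. \<Union>q'\<in>jc q. H p' q') = H p q"
proof -
  have q: "q \<in> jc q" "p \<in> jc p" using assms(1,2) by (simp_all add: mem_jc)
  have 1: "(\<Union>q'\<in>jc q. H p' q') = H p q" if "p' \<in> jc p" for p'
  proof -
    have "(\<Union>q'\<in>jc q. H p' q') = H p' q"
      by (rule Union_jc[OF assms(2)]) (simp only: assms(3)[OF that] assms(3)[OF that q(1)])
    then show ?thesis by (simp only: assms(3)[OF that q(1)])
  qed
  have "(\<Union>p'\<in>jc p. \<Union>q'\<in>jc q. H p' q') = (\<Union>q'\<in>jc q. H p q')"
    by (rule Union_jc[OF assms(1)]) (simp only: 1 1[OF q(2)])
  then show ?thesis by (simp only: 1[OF q(2)])
qed

lemma jc_add: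
  assumes "(g, U) \<in> PJ" "(h, W) \<in> PJ"
  shows "jc (g, U) \<oplus>\<^bsub>JC\<^esub> jc (h, W) = jc (\<lambda>s x. pl s (g s x) (h s x), S (\<lambda>s. U s \<inter> W s))"
proof -
  let ?H = "\<lambda>p q. jc (\<lambda>s x. pl s (fst p s x) (fst q s x), S (\<lambda>s. snd p s \<inter> snd q s))"
  have *: "jc (\<lambda>s x. pl s (g' s x) (h' s x), S (\<lambda>s. U' s \<inter> W' s)) = jc (\<lambda>s x. pl s (g s x) (h s x), S (\<lambda>s. U s \<inter> W s))"
    if "(g', U') \<in> jc (g, U)" "(h', W') \<in> jc (h, W)" for g' U' h' W'
    proof -
    have p': "(g', U') \<in> PJ" "(h', W') \<in> PJ" and e: "pc (g, U) = pc (g', U')" "pc (h, W) = pc (h', W')"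
      using that unfolding mem_jc by blast+
    show ?thesis
      by (rule jc_eq[OF PJ_add(1)[OF p'] PJ_add(1)[OF assms], THEN iffD2])
         (simp only: PJ_add(2)[OF p'] PJ_add(2)[OF assms] e)
  qed
  have 1: "?H p q = ?H (g, U) (h, W)" if "p \<in> jc (g, U)" "q \<in> jc (h, W)" for p q
  proof -
    obtain g' U' h' W' where eq: "p = (g', U')" "q = (h', W')" by (cases p, cases q)
    show ?thesis unfolding eq fst_conv snd_conv by (rule *[OF that[unfolded eq]])
  qed
  have "jc (g, U) \<oplus>\<^bsub>JC\<^esub> jc (h, W) = (\<Union>p\<in>jc (g, U). \<Union>q\<in>jc (h, W). ?H p q)"
    by (simp add: jcentroid_def Let_def case_prod_unfold)
  also have "\<dots> = ?H (g, U) (h, W)" by (rule Union_jc2[OF assms, of ?H, OF 1])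
  finally show ?thesis by simp
qed

lemma jc_mult:
  assumes "(g, U) \<in> PJ" "(h, W) \<in> PJ"
  shows "jc (g, U) \<otimes>\<^bsub>JC\<^esub> jc (h, W) = jc (\<lambda>s x. g s (h s x), S (S (\<lambda>s. U s \<inter> W s)))"
proof -
  let ?H = "\<lambda>p q. jc (\<lambda>s x. fst p s (fst q s x), S (S (\<lambda>s. snd p s \<inter> snd q s)))"
  have *: "jc (\<lambda>s x. g' s (h' s x), S (S (\<lambda>s. U' s \<inter> W' s))) = jc (\<lambda>s x. g s (h s x), S (S (\<lambda>s. U s \<inter> W s)))"
    if "(g', U') \<in> jc (g, U)" "(h', W') \<in> jc (h, W)" for g' U' h' W'
    proof -
    have p': "(g', U') \<in> PJ" "(h', W') \<in> PJ" and e: "pc (g, U) = pc (g', U')" "pc (h, W) = pc (h', W')"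
      using that unfolding mem_jc by blast+
    show ?thesis
      by (rule jc_eq[OF PJ_mult(1)[OF p'] PJ_mult(1)[OF assms], THEN iffD2])
         (simp only: PJ_mult(2)[OF p'] PJ_mult(2)[OF assms] e)
  qed
  have 1: "?H p q = ?H (g, U) (h, W)" if "p \<in> jc (g, U)" "q \<in> jc (h, W)" for p q
  proof -
    obtain g' U' h' W' where eq: "p = (g', U')" "q = (h', W')" by (cases p, cases q)
    show ?thesis unfolding eq fst_conv snd_conv by (rule *[OF that[unfolded eq]])
  qed
  have "jc (g, U) \<otimes>\<^bsub>JC\<^esub> jc (h, W) = (\<Union>p\<in>jc (g, U). \<Union>q\<in>jc (h, W). ?H p q)"
    by (simp add: jcentroid_def Let_def case_prod_unfold)
  also have "\<dots> = ?H (g, U) (h, W)" by (rule Union_jc2[OF assms, of ?H, OF 1])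
  finally show ?thesis by simp
qed

lemma jc_smult:
  assumes "r \<in> carrier R" "(g, U) \<in> PJ"
  shows "r \<odot>\<^bsub>JC\<^esub> jc (g, U) = jc (\<lambda>s x. sm s r (g s x), U)"
proof -
  let ?H = "\<lambda>p. jc (\<lambda>s x. sm s r (fst p s x), snd p)"
  have "jc (\<lambda>s x. sm s r (g' s x), U') = jc (\<lambda>s x. sm s r (g s x), U)" if "(g', U') \<in> jc (g, U)" for g' U'
    proof -
    have p': "(g', U') \<in> PJ" and e: "pc (g, U) = pc (g', U')" using that unfolding mem_jc by blast+
    show ?thesis
      by (rule jc_eq[OF PJ_smult(1)[OF assms(1) p'] PJ_smult(1)[OF assms], THEN iffD2])
         (simp only: PJ_smult(2)[OF assms(1) p'] PJ_smult(2)[OF assms] e)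
  qed
  then have 1: "?H p = ?H (g, U)" if "p \<in> jc (g, U)" for p
    using that by (cases p) simp
  have "r \<odot>\<^bsub>JC\<^esub> jc (g, U) = (\<Union>p\<in>jc (g, U). ?H p)"
    by (simp add: jcentroid_def Let_def case_prod_unfold)
  also have "\<dots> = ?H (g, U)" by (rule Union_jc[OF assms(2), of ?H, OF 1])
  finally show ?thesis by simp
qed

lemma JC_one: "\<one>\<^bsub>JC\<^esub> = jc (\<lambda>s x. x, jcarrier V)" and JC_zero: "\<zero>\<^bsub>JC\<^esub> = jc (\<lambda>s x. ze s, jcarrier V)"
  by (simp_all add: jcentroid_def Let_def)

lemma psi_hom:
  "c \<in> carrier JC \<Longrightarrow> e \<in> carrier JC \<Longrightarrow> c \<oplus>\<^bsub>JC\<^esub> e \<in> carrier JC \<and> psi (c \<oplus>\<^bsub>JC\<^esub> e) = psi c \<oplus>\<^bsub>C\<^esub> psi e"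
  "c \<in> carrier JC \<Longrightarrow> e \<in> carrier JC \<Longrightarrow> c \<otimes>\<^bsub>JC\<^esub> e \<in> carrier JC \<and> psi (c \<otimes>\<^bsub>JC\<^esub> e) = psi c \<otimes>\<^bsub>C\<^esub> psi e"
  "r \<in> carrier R \<Longrightarrow> c \<in> carrier JC \<Longrightarrow> r \<odot>\<^bsub>JC\<^esub> c \<in> carrier JC \<and> psi (r \<odot>\<^bsub>JC\<^esub> c) = r \<odot>\<^bsub>C\<^esub> psi c"
  "\<one>\<^bsub>JC\<^esub> \<in> carrier JC" "psi \<one>\<^bsub>JC\<^esub> = \<one>\<^bsub>C\<^esub>" "\<zero>\<^bsub>JC\<^esub> \<in> carrier JC" "psi \<zero>\<^bsub>JC\<^esub> = \<zero>\<^bsub>C\<^esub>"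
proof -
  show "c \<oplus>\<^bsub>JC\<^esub> e \<in> carrier JC \<and> psi (c \<oplus>\<^bsub>JC\<^esub> e) = psi c \<oplus>\<^bsub>C\<^esub> psi e"
    "c \<otimes>\<^bsub>JC\<^esub> e \<in> carrier JC \<and> psi (c \<otimes>\<^bsub>JC\<^esub> e) = psi c \<otimes>\<^bsub>C\<^esub> psi e"
    if ce: "c \<in> carrier JC" "e \<in> carrier JC"
  proof -
    obtain p' q' where p': "p' \<in> PJ" "c = jc p'" "q' \<in> PJ" "e = jc q'"
      using ce unfolding JC_carrier by blast
    obtain g U h W where pq: "p' = (g, U)" "q' = (h, W)" by (cases p', cases q')
    note p = p'(1,3,2,4)[unfolded pq]
    note a = PJ_add[OF p(1,2)] and m = PJ_mult[OF p(1,2)]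
    show "c \<oplus>\<^bsub>JC\<^esub> e \<in> carrier JC \<and> psi (c \<oplus>\<^bsub>JC\<^esub> e) = psi c \<oplus>\<^bsub>C\<^esub> psi e"
      unfolding p(3,4) jc_add[OF p(1,2)] psi_jc[OF p(1)] psi_jc[OF p(2)] psi_jc[OF a(1)] JC_carrier
      by (rule conjI[OF imageI[OF a(1)] a(2)])
    show "c \<otimes>\<^bsub>JC\<^esub> e \<in> carrier JC \<and> psi (c \<otimes>\<^bsub>JC\<^esub> e) = psi c \<otimes>\<^bsub>C\<^esub> psi e"
      unfolding p(3,4) jc_mult[OF p(1,2)] psi_jc[OF p(1)] psi_jc[OF p(2)] psi_jc[OF m(1)] JC_carrier
      by (rule conjI[OF imageI[OF m(1)] m(2)])
  qed
  show "r \<odot>\<^bsub>JC\<^esub> c \<in> carrier JC \<and> psi (r \<odot>\<^bsub>JC\<^esub> c) = r \<odot>\<^bsub>C\<^esub> psi c" if r: "r \<in> carrier R" "c \<in> carrier JC"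
  proof -
    obtain p' where p': "p' \<in> PJ" "c = jc p'" using r(2) unfolding JC_carrier by blast
    obtain g U where pq: "p' = (g, U)" by (cases p')
    note p = p'[unfolded pq]
    note a = PJ_smult[OF r(1) p(1)]
    show ?thesis
      unfolding p(2) jc_smult[OF r(1) p(1)] psi_jc[OF p(1)] psi_jc[OF a(1)] JC_carrier
      by (rule conjI[OF imageI[OF a(1)] a(2)])
  qed
  show "\<one>\<^bsub>JC\<^esub> \<in> carrier JC" "\<zero>\<^bsub>JC\<^esub> \<in> carrier JC"
    unfolding JC_one JC_zero JC_carrier using PJ_one PJ_zero by blast+
  show "psi \<one>\<^bsub>JC\<^esub> = \<one>\<^bsub>C\<^esub>" "psi \<zero>\<^bsub>JC\<^esub> = \<zero>\<^bsub>C\<^esub>"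
    unfolding JC_one JC_zero by (simp_all only: psi_jc PJ_one PJ_zero)
qed

lemma JC_algebra: "algebra R JC"
  by (rule algebra_transfer[OF C_algebra psi_inj psi_image psi_hom])

end

context nondeg_pair
begin

section \<open>The central closure of the Lie algebra\<close>

sublocale TL: tensor_algebra R C L
proof -
  interpret C: algebra R C by (rule C_algebra)
  show "tensor_algebra R C L"
    by unfold_locales (auto intro: L_mult_closed simp: L_bracket_add L_bracket_smult)
qed

lemma L_minus_zero: "\<ominus>\<^bsub>L\<^esub> \<zero>\<^bsub>L\<^esub> = \<zero>\<^bsub>L\<^esub>"
  by (rule L.minus_equality) simp_all

text \<open>A formal sum \<open>\<Sum>\<^sub>i c\<^sub>i \<otimes> x\<^sub>i\<close> acts on small ideals by \<open>y \<mapsto> \<Sum>\<^sub>i [x\<^sub>i, c\<^sub>i y]\<close>.\<close>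

definition "Ev xs y = lsum L (\<lambda>(c, x). x \<otimes>\<^bsub>L\<^esub> ev c y) xs"
definition "ok xs y \<longleftrightarrow> (\<forall>(c, x)\<in>set xs. y \<in> dm c)"

lemma Ev_simps [simp]: "Ev [] y = \<zero>\<^bsub>L\<^esub>" "Ev ((c, x) # xs) y = x \<otimes>\<^bsub>L\<^esub> ev c y \<oplus>\<^bsub>L\<^esub> Ev xs y"
  by (simp_all add: Ev_def)

lemma ok_simps [simp]: "ok [] y" "ok ((c, x) # xs) y \<longleftrightarrow> y \<in> dm c \<and> ok xs y"
  by (simp_all add: ok_def)

lemma ok_ess: "xs \<in> TL.tlists \<Longrightarrow> ess {y \<in> carrier L. ok xs y}"
proof (induction rule: TL.tlists_induct)
  case Nil
  then show ?case using ess_carrier by simp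
next
  case (Cons a x xs)
  have "{y \<in> carrier L. ok ((a, x) # xs) y} = dm a \<inter> {y \<in> carrier L. ok xs y}"
    using ess_in[OF evD(1)[OF Cons(1)]] by auto
  then show ?case using ess_Int[OF evD(1)[OF Cons(1)] Cons(4)] by simp
qed

lemma ok_closed:
  assumes "xs \<in> TL.tlists" "ok xs y" "y \<in> carrier L" "z \<in> carrier L"
  shows "ok xs (y \<otimes>\<^bsub>L\<^esub> z)" "ok xs (z \<otimes>\<^bsub>L\<^esub> y)"
  using lidealD(7,8)[OF essD[OF ok_ess[OF assms(1)]], of z y] assms(2-4) by simp_all

lemma Ev_closed: "xs \<in> TL.tlists \<Longrightarrow> ok xs y \<Longrightarrow> Ev xs y \<in> carrier L"
  by (induction rule: TL.tlists_induct) (simp_all add: L_mult_closed evD(2))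

lemma Ev_add:
  assumes "xs \<in> TL.tlists" "ok xs y" "ok xs z"
  shows "Ev xs (y \<oplus>\<^bsub>L\<^esub> z) = Ev xs y \<oplus>\<^bsub>L\<^esub> Ev xs z"
  using assms
proof (induction rule: TL.tlists_induct)
  case (Cons c x xs)
  then show ?case by (simp add: evD(2,3) L_bracket_add L_mult_closed Ev_closed L.add4)
qed simp

text \<open>
  Since \<open>c\<close> commutes with brackets, \<open>y \<mapsto> [x, c y]\<close> satisfies the product rule
  \<open>[x, c [y, z]] = [[x, c y], z] + [y, [x, c z]]\<close>.
\<close>

lemma Ev_bracket:
  assumes "xs \<in> TL.tlists" "ok xs y" "ok xs z" "y \<in> carrier L" "z \<in> carrier L"
  shows "Ev xs (y \<otimes>\<^bsub>L\<^esub> z) = Ev xs y \<otimes>\<^bsub>L\<^esub> z \<oplus>\<^bsub>L\<^esub> y \<otimes>\<^bsub>L\<^esub> Ev xs z"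
  using assms
proof (induction rule: TL.tlists_induct)
  case (Cons c x xs)
  have y: "y \<in> dm c" and z: "z \<in> dm c" using Cons.prems by auto
  note v = evD[OF Cons(1)]
  have "x \<otimes>\<^bsub>L\<^esub> ev c (y \<otimes>\<^bsub>L\<^esub> z) = x \<otimes>\<^bsub>L\<^esub> (ev c y \<otimes>\<^bsub>L\<^esub> z)" using v(7) Cons.prems y by simp
  also have "\<dots> = (x \<otimes>\<^bsub>L\<^esub> ev c y) \<otimes>\<^bsub>L\<^esub> z \<oplus>\<^bsub>L\<^esub> ev c y \<otimes>\<^bsub>L\<^esub> (x \<otimes>\<^bsub>L\<^esub> z)"
    using v(2)[OF y] Cons by (intro L_jacobi) auto
  also have "ev c y \<otimes>\<^bsub>L\<^esub> (x \<otimes>\<^bsub>L\<^esub> z) = ev c (y \<otimes>\<^bsub>L\<^esub> (x \<otimes>\<^bsub>L\<^esub> z))"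
    using v(7)[of "x \<otimes>\<^bsub>L\<^esub> z" y] y Cons by (simp add: L_mult_closed)
  also have "\<dots> = y \<otimes>\<^bsub>L\<^esub> ev c (x \<otimes>\<^bsub>L\<^esub> z)"
    using v(4)[of y "x \<otimes>\<^bsub>L\<^esub> z"] lidealD(7)[OF essD[OF v(1)], of x z] z Cons by simp
  also have "ev c (x \<otimes>\<^bsub>L\<^esub> z) = x \<otimes>\<^bsub>L\<^esub> ev c z" using v(4) z Cons by simp
  finally have 1: "x \<otimes>\<^bsub>L\<^esub> ev c (y \<otimes>\<^bsub>L\<^esub> z) = (x \<otimes>\<^bsub>L\<^esub> ev c y) \<otimes>\<^bsub>L\<^esub> z \<oplus>\<^bsub>L\<^esub> y \<otimes>\<^bsub>L\<^esub> (x \<otimes>\<^bsub>L\<^esub> ev c z)" .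
  then show ?case
    using Cons v(2)[OF y] v(2)[OF z] by (simp add: L_bracket_add L_mult_closed Ev_closed L.add4)
qed simp

lemma Ev_mem:
  assumes "xs \<in> TL.tlists" "ess K"
  shows "\<forall>\<^sub>F y in F. Ev xs y \<in> K"
  using assms(1)
proof (induction rule: TL.tlists_induct)
  case Nil
  then show ?case using lidealD(2)[OF essD[OF assms(2)]] by simp
next
  case (Cons c x xs)
  from ev_preimage[OF Cons(1) ev_ess[OF assms(2)]] Cons(4) show ?case
    by eventually_elim (simp add: lidealD[OF essD[OF assms(2)]] Cons(2))
qed

lemma Ev_L: "xs \<in> TL.tlists \<Longrightarrow> \<forall>\<^sub>F y in F. Ev xs y \<in> carrier L"
  by (rule Ev_mem[OF _ ess_carrier])

lemma Ev_append:
  assumes "xs \<in> TL.tlists" "ys \<in> TL.tlists"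
  shows "\<forall>\<^sub>F y in F. Ev (xs @ ys) y = Ev xs y \<oplus>\<^bsub>L\<^esub> Ev ys y"
  using assms(1)
proof (induction rule: TL.tlists_induct)
  case Nil
  from Ev_L[OF assms(2)] show ?case by eventually_elim simp
next
  case (Cons c x xs)
  from Cons(4) Ev_L[OF assms(2)] Ev_L[OF Cons(3)] ev_closed[OF Cons(1)] show ?case
    by eventually_elim (simp add: Cons(2) L.a_assoc L_mult_closed)
qed

text \<open>
  The action of a formal sum respects the generators of the tensor congruence, so it depends on the
  tensor only, up to passing to a smaller essential ideal.
\<close>

lemma Ev_cong: "TL.teq xs ys \<Longrightarrow> \<forall>\<^sub>F y in F. Ev xs y = Ev ys y"
proof (induction rule: tensor_eq.induct)
  case (sym xs ys)
  then show ?case by (auto elim: eventually_mono)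
next
  case (trans xs ys zs)
  from trans.IH show ?case by eventually_elim simp
next
  case (append xs xs' ys ys')
  have l: "xs \<in> TL.tlists" "xs' \<in> TL.tlists" "ys \<in> TL.tlists" "ys' \<in> TL.tlists"
    using append TL.teq_lists by auto
  from append.IH Ev_append[OF l(1,3)] Ev_append[OF l(2,4)] show ?case by eventually_elim simp
next
  case (commute xs ys)
  then have l: "xs \<in> TL.tlists" "ys \<in> TL.tlists" by (simp_all add: TL.tlists_def)
  from Ev_append[OF l] Ev_append[OF l(2,1)] Ev_L[OF l(1)] Ev_L[OF l(2)] show ?case
    by eventually_elim (simp add: L.a_comm)
next
  case (zero x)
  from ev_zero show ?case by eventually_elim (simp add: zero)
next
  case (add_left a b x)
  from ev_add[OF add_left(1,2)] ev_closed[OF add_left(1)] ev_closed[OF add_left(2)] show ?case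
    by eventually_elim (simp add: add_left L_bracket_add L_mult_closed)
next
  case (add_right a x y)
  from ev_closed[OF add_right(1)] show ?case
    by eventually_elim (simp add: add_right L_bracket_add L_mult_closed)
next
  case (balance r a x)
  from ev_smult[OF balance(1,2)] ev_closed[OF balance(2)] show ?case
    by eventually_elim (simp add: balance L_bracket_smult L_mult_closed)
qed simp

definition "NL = {TL.tc xs | xs. xs \<in> TL.tlists \<and> (\<forall>\<^sub>F y in F. Ev xs y = \<zero>\<^bsub>L\<^esub>)}"

lemma NL_iff: "xs \<in> TL.tlists \<Longrightarrow> TL.tc xs \<in> NL \<longleftrightarrow> (\<forall>\<^sub>F y in F. Ev xs y = \<zero>\<^bsub>L\<^esub>)"
proof
  assume xs: "xs \<in> TL.tlists" and "TL.tc xs \<in> NL"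
  then obtain ys where ys: "TL.tc xs = TL.tc ys" "\<forall>\<^sub>F y in F. Ev ys y = \<zero>\<^bsub>L\<^esub>" by (auto simp: NL_def)
  have "TL.teq xs ys" using ys(1) TL.tc_eq_iff[OF xs] by simp
  from Ev_cong[OF this] ys(2) show "\<forall>\<^sub>F y in F. Ev xs y = \<zero>\<^bsub>L\<^esub>" by eventually_elim simp
qed (auto simp: NL_def)

lemma Ev_scale:
  assumes c: "c \<in> carrier C" and xs: "xs \<in> TL.tlists"
  shows "\<forall>\<^sub>F y in F. Ev (TL.scale c xs) y = ev c (Ev xs y)"
  using xs
proof (induction rule: TL.tlists_induct)
  case Nil
  then show ?case using evD(5)[OF c] by simp
next
  case (Cons a x xs)
  from Cons(4) ev_mult[OF c Cons(1)] ev_preimage[OF Cons(1) ev_dm[OF c]] Ev_mem[OF Cons(3) evD(1)[OF c]]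
  show ?case
    by eventually_elim (simp add: Cons(2) evD(3,4)[OF c] lidealD(7)[OF essD[OF evD(1)[OF c]]])
qed

text \<open>
  The tensor \<open>(c \<otimes> x) Y\<close> acts as \<open>c\<close> times the commutator of \<open>ad x\<close> with the action of \<open>Y\<close>, by the Jacobi
  identity.
\<close>

lemma Ev_prod:
  assumes c: "c \<in> carrier C" and x: "x \<in> carrier L" and ys: "ys \<in> TL.tlists"
  shows "\<forall>\<^sub>F y in F. Ev (tprod C L [(c, x)] ys) y = ev c (x \<otimes>\<^bsub>L\<^esub> Ev ys y \<ominus>\<^bsub>L\<^esub> Ev ys (x \<otimes>\<^bsub>L\<^esub> y))"
  using ys
proof (induction rule: TL.tlists_induct)
  case Nil
  then show ?case using evD(5)[OF c] x by (simp add: tprod_def a_minus_def L_minus_zero)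
next
  case (Cons e z ys)
  note i = lidealD[OF essD[OF evD(1)[OF c]]] and iL = ess_in[OF evD(1)[OF c]]
  from Cons(4) ev_mult[OF c Cons(1)] ev_preimage[OF Cons(1) ev_dm[OF c]] Ev_mem[OF Cons(3) evD(1)[OF c]]
    ev_bracket[OF Ev_mem[OF Cons(3) evD(1)[OF c]]] ev_dm[OF Cons(1)] ev_carrier
  show ?case
  proof eventually_elim
    case (elim y)
    let ?f = "ev e y"
    have f: "?f \<in> carrier L" "?f \<in> dm c" using iL[OF elim(3)] elim(3) by simp_all
    have xf: "ev e (x \<otimes>\<^bsub>L\<^esub> y) = x \<otimes>\<^bsub>L\<^esub> ?f" by (rule evD(4)[OF Cons(1) x elim(6)])
    have Eyx: "Ev ys (x \<otimes>\<^bsub>L\<^esub> y) \<in> dm c" using elim(5) x by simp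
    have a: "x \<otimes>\<^bsub>L\<^esub> (z \<otimes>\<^bsub>L\<^esub> ?f) \<in> dm c" "z \<otimes>\<^bsub>L\<^esub> (x \<otimes>\<^bsub>L\<^esub> ?f) \<in> dm c" "x \<otimes>\<^bsub>L\<^esub> Ev ys y \<in> dm c"
      using f(2) elim(4) x Cons(2) by (auto intro: i)
    have "Ev (tprod C L [(c, x)] ((e, z) # ys)) y = (x \<otimes>\<^bsub>L\<^esub> z) \<otimes>\<^bsub>L\<^esub> ev c ?f \<oplus>\<^bsub>L\<^esub> ev c (x \<otimes>\<^bsub>L\<^esub> Ev ys y \<ominus>\<^bsub>L\<^esub> Ev ys (x \<otimes>\<^bsub>L\<^esub> y))"
      using elim(1,2) by (simp add: tprod_def)
    also have "(x \<otimes>\<^bsub>L\<^esub> z) \<otimes>\<^bsub>L\<^esub> ev c ?f = ev c ((x \<otimes>\<^bsub>L\<^esub> z) \<otimes>\<^bsub>L\<^esub> ?f)"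
      using evD(4)[OF c, of "x \<otimes>\<^bsub>L\<^esub> z" ?f] f x Cons(2) by (simp add: L_mult_closed)
    also have "(x \<otimes>\<^bsub>L\<^esub> z) \<otimes>\<^bsub>L\<^esub> ?f = x \<otimes>\<^bsub>L\<^esub> (z \<otimes>\<^bsub>L\<^esub> ?f) \<ominus>\<^bsub>L\<^esub> z \<otimes>\<^bsub>L\<^esub> (x \<otimes>\<^bsub>L\<^esub> ?f)"
      using L_jacobi' x Cons(2) f by blast
    also have "ev c (x \<otimes>\<^bsub>L\<^esub> (z \<otimes>\<^bsub>L\<^esub> ?f) \<ominus>\<^bsub>L\<^esub> z \<otimes>\<^bsub>L\<^esub> (x \<otimes>\<^bsub>L\<^esub> ?f)) \<oplus>\<^bsub>L\<^esub> ev c (x \<otimes>\<^bsub>L\<^esub> Ev ys y \<ominus>\<^bsub>L\<^esub> Ev ys (x \<otimes>\<^bsub>L\<^esub> y))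
       = ev c ((x \<otimes>\<^bsub>L\<^esub> (z \<otimes>\<^bsub>L\<^esub> ?f) \<ominus>\<^bsub>L\<^esub> z \<otimes>\<^bsub>L\<^esub> (x \<otimes>\<^bsub>L\<^esub> ?f)) \<oplus>\<^bsub>L\<^esub> (x \<otimes>\<^bsub>L\<^esub> Ev ys y \<ominus>\<^bsub>L\<^esub> Ev ys (x \<otimes>\<^bsub>L\<^esub> y)))"
      using a Eyx by (intro evD(3)[OF c, symmetric] i(5)) auto
    also have "(x \<otimes>\<^bsub>L\<^esub> (z \<otimes>\<^bsub>L\<^esub> ?f) \<ominus>\<^bsub>L\<^esub> z \<otimes>\<^bsub>L\<^esub> (x \<otimes>\<^bsub>L\<^esub> ?f)) \<oplus>\<^bsub>L\<^esub> (x \<otimes>\<^bsub>L\<^esub> Ev ys y \<ominus>\<^bsub>L\<^esub> Ev ys (x \<otimes>\<^bsub>L\<^esub> y)) =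
       x \<otimes>\<^bsub>L\<^esub> Ev ((e, z) # ys) y \<ominus>\<^bsub>L\<^esub> Ev ((e, z) # ys) (x \<otimes>\<^bsub>L\<^esub> y)"
      using iL[OF a(1)] iL[OF a(2)] iL[OF a(3)] iL[OF Eyx] iL[OF elim(4)] elim(7) x Cons(2) f
      by (simp add: xf L_bracket_add L_mult_closed L.minus_add4)
    finally show ?case .
  qed
qed

lemma TL_zero_mult:
  assumes Y: "Y \<in> carrier TL.T"
  shows "\<zero>\<^bsub>TL.T\<^esub> \<otimes>\<^bsub>TL.T\<^esub> Y = \<zero>\<^bsub>TL.T\<^esub>" "Y \<otimes>\<^bsub>TL.T\<^esub> \<zero>\<^bsub>TL.T\<^esub> = \<zero>\<^bsub>TL.T\<^esub>"
proof -
  let ?z = "\<zero>\<^bsub>TL.T\<^esub>"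
  have z: "?z \<in> carrier TL.T" "?z \<oplus>\<^bsub>TL.T\<^esub> ?z = ?z" by simp_all
  have "?z \<otimes>\<^bsub>TL.T\<^esub> Y \<oplus>\<^bsub>TL.T\<^esub> ?z \<otimes>\<^bsub>TL.T\<^esub> Y = (?z \<oplus>\<^bsub>TL.T\<^esub> ?z) \<otimes>\<^bsub>TL.T\<^esub> Y"
    by (rule TL.T_mult_add_left[OF z(1) z(1) Y, symmetric])
  then show "?z \<otimes>\<^bsub>TL.T\<^esub> Y = ?z" unfolding z(2) by (rule TL.T.add_self_zero[OF TL.T_mult_closed[OF z(1) Y]])
  have "Y \<otimes>\<^bsub>TL.T\<^esub> ?z \<oplus>\<^bsub>TL.T\<^esub> Y \<otimes>\<^bsub>TL.T\<^esub> ?z = Y \<otimes>\<^bsub>TL.T\<^esub> (?z \<oplus>\<^bsub>TL.T\<^esub> ?z)"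
    by (rule TL.T_mult_add_right[OF Y z(1) z(1), symmetric])
  then show "Y \<otimes>\<^bsub>TL.T\<^esub> ?z = ?z" unfolding z(2) by (rule TL.T.add_self_zero[OF TL.T_mult_closed[OF Y z(1)]])
qed

lemma TL_anti: "X \<in> carrier TL.T \<Longrightarrow> Y \<in> carrier TL.T \<Longrightarrow> X \<otimes>\<^bsub>TL.T\<^esub> Y \<oplus>\<^bsub>TL.T\<^esub> Y \<otimes>\<^bsub>TL.T\<^esub> X = \<zero>\<^bsub>TL.T\<^esub>"
proof (induction X rule: TL.T_induct)
  case zero
  then show ?case
    by (simp add: TL_zero_mult)
next
  case (add a x X)
  have 1: "TL.pt a x \<otimes>\<^bsub>TL.T\<^esub> Y \<oplus>\<^bsub>TL.T\<^esub> Y \<otimes>\<^bsub>TL.T\<^esub> TL.pt a x = \<zero>\<^bsub>TL.T\<^esub>"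
    using add.prems
  proof (induction Y rule: TL.T_induct)
    case zero
    then show ?case
      using add(1,2) by (simp add: TL_zero_mult)
  next
    case Y: (add b y Y)
    have "TL.pt a x \<otimes>\<^bsub>TL.T\<^esub> TL.pt b y \<oplus>\<^bsub>TL.T\<^esub> TL.pt b y \<otimes>\<^bsub>TL.T\<^esub> TL.pt a x = \<zero>\<^bsub>TL.T\<^esub>"
      using add(1,2) Y(1,2)
      by (simp add: TL.pt_mult TL.A.m_comm[of b a] TL.pt_add_right[symmetric] L_mult_closed L_antisym TL.pt_zero_right)
    with Y add(1,2) show ?case
      using TL.T.add4[of "TL.pt a x \<otimes>\<^bsub>TL.T\<^esub> TL.pt b y" "TL.pt a x \<otimes>\<^bsub>TL.T\<^esub> Y" "TL.pt b y \<otimes>\<^bsub>TL.T\<^esub> TL.pt a x" "Y \<otimes>\<^bsub>TL.T\<^esub> TL.pt a x"]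
      by (simp add: TL.T_mult_add_left TL.T_mult_add_right TL.T_mult_closed)
  qed
  with add show ?case
    using TL.T.add4[of "TL.pt a x \<otimes>\<^bsub>TL.T\<^esub> Y" "X \<otimes>\<^bsub>TL.T\<^esub> Y" "Y \<otimes>\<^bsub>TL.T\<^esub> TL.pt a x" "Y \<otimes>\<^bsub>TL.T\<^esub> X"]
    by (simp add: TL.T_mult_add_left TL.T_mult_add_right TL.T_mult_closed)
qed

lemma NL_sub: "X \<in> NL \<Longrightarrow> X \<in> carrier TL.T"
  by (auto simp: NL_def)

lemma NL_add: "X \<in> NL \<Longrightarrow> Y \<in> NL \<Longrightarrow> X \<oplus>\<^bsub>TL.T\<^esub> Y \<in> NL"
proof -
  assume "X \<in> NL" "Y \<in> NL"
  then obtain xs ys where *: "xs \<in> TL.tlists" "ys \<in> TL.tlists" "X = TL.tc xs" "Y = TL.tc ys"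
    "\<forall>\<^sub>F y in F. Ev xs y = \<zero>\<^bsub>L\<^esub>" "\<forall>\<^sub>F y in F. Ev ys y = \<zero>\<^bsub>L\<^esub>" by (auto simp: NL_def)
  from *(5,6) Ev_append[OF *(1,2)] have "\<forall>\<^sub>F y in F. Ev (xs @ ys) y = \<zero>\<^bsub>L\<^esub>"
    by eventually_elim simp
  with * show ?thesis by (simp add: TL.T_add NL_iff)
qed

lemma NL_smult: "c \<in> carrier C \<Longrightarrow> X \<in> NL \<Longrightarrow> c \<odot>\<^bsub>TL.T\<^esub> X \<in> NL"
proof -
  assume c: "c \<in> carrier C" and "X \<in> NL"
  then obtain xs where *: "xs \<in> TL.tlists" "X = TL.tc xs" "\<forall>\<^sub>F y in F. Ev xs y = \<zero>\<^bsub>L\<^esub>" by (auto simp: NL_def)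
  from *(3) Ev_scale[OF c *(1)] have "\<forall>\<^sub>F y in F. Ev (TL.scale c xs) y = \<zero>\<^bsub>L\<^esub>"
    by eventually_elim (simp add: evD(5)[OF c])
  with * c show ?thesis by (simp add: TL.T_smult NL_iff)
qed

lemma NL_zero: "\<zero>\<^bsub>TL.T\<^esub> \<in> NL"
  by (simp add: TL.T_zero NL_iff)

lemma NL_bracket: "X \<in> carrier TL.T \<Longrightarrow> Y \<in> NL \<Longrightarrow> X \<otimes>\<^bsub>TL.T\<^esub> Y \<in> NL"
proof (induction X rule: TL.T_induct)
  case zero
  have "\<zero>\<^bsub>TL.T\<^esub> \<otimes>\<^bsub>TL.T\<^esub> Y = \<zero>\<^bsub>TL.T\<^esub>" by (rule TL_zero_mult(1)[OF NL_sub[OF zero]])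
  then show ?case by (simp add: NL_zero)
next
  case (add a x X)
  from add.prems obtain ys where *: "ys \<in> TL.tlists" "Y = TL.tc ys" "\<forall>\<^sub>F y in F. Ev ys y = \<zero>\<^bsub>L\<^esub>" by (auto simp: NL_def)
  from *(3) ev_bracket[OF *(3)] Ev_prod[OF add(1,2) *(1)]
  have "\<forall>\<^sub>F y in F. Ev (tprod C L [(a, x)] ys) y = \<zero>\<^bsub>L\<^esub>"
    by eventually_elim (simp add: evD(5)[OF add(1)] add(2) a_minus_def L_minus_zero)
  then have "TL.pt a x \<otimes>\<^bsub>TL.T\<^esub> Y \<in> NL"
    using * add(1,2) TL.tprod_lists[of "[(a, x)]" ys] by (simp add: TL.T_mult NL_iff)
  then show ?case using add NL_sub by (simp add: TL.T_mult_add_left NL_add)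
qed

lemma NL_ideal: "lie_ideal C TL.T NL"
proof -
  have "\<ominus>\<^bsub>TL.T\<^esub> X \<in> NL" if "X \<in> NL" for X
  proof -
    have "\<ominus>\<^bsub>TL.T\<^esub> X = (\<ominus>\<^bsub>C\<^esub> \<one>\<^bsub>C\<^esub>) \<odot>\<^bsub>TL.T\<^esub> X" using NL_sub[OF that] by (simp add: TL.T.smult_l_minus)
    then show ?thesis using NL_smult[OF _ that, of "\<ominus>\<^bsub>C\<^esub> \<one>\<^bsub>C\<^esub>"] by simp
  qed
  then have "submodule NL C TL.T"
    using NL_sub NL_add NL_smult NL_zero by (intro TL.T.submoduleI) auto
  then show ?thesis using NL_bracket by (simp add: lie_ideal_def)
qed

lemma NL_submodule: "submodule NL C TL.T"
  using NL_ideal by (simp add: lie_ideal_def)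

lemma NL_bracket_right: "X \<in> carrier TL.T \<Longrightarrow> Y \<in> NL \<Longrightarrow> Y \<otimes>\<^bsub>TL.T\<^esub> X \<in> NL"
proof -
  assume X: "X \<in> carrier TL.T" and Y: "Y \<in> NL"
  have "Y \<otimes>\<^bsub>TL.T\<^esub> X = \<ominus>\<^bsub>TL.T\<^esub> (X \<otimes>\<^bsub>TL.T\<^esub> Y)"
    using TL_anti[OF NL_sub[OF Y] X] X NL_sub[OF Y]
    by (intro TL.T.minus_equality[symmetric]) (simp_all add: TL.T_mult_closed)
  then show ?thesis using TL.T.submoduleE(3)[OF NL_submodule] NL_bracket[OF X Y] by simp
qed

lemma NL_pt: "x \<in> carrier L \<Longrightarrow> TL.pt \<one>\<^bsub>C\<^esub> x \<in> NL \<Longrightarrow> x = \<zero>\<^bsub>L\<^esub>"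
proof (rule centralizer_zero)
  assume x: "x \<in> carrier L" and "TL.pt \<one>\<^bsub>C\<^esub> x \<in> NL"
  then have "\<forall>\<^sub>F y in F. Ev [(\<one>\<^bsub>C\<^esub>, x)] y = \<zero>\<^bsub>L\<^esub>" by (simp only: NL_iff TL.tlists_simps C_closed simp_thms)
  from this ev_one ev_carrier show "\<forall>\<^sub>F y in F. x \<otimes>\<^bsub>L\<^esub> y = \<zero>\<^bsub>L\<^esub>"
    by eventually_elim (simp add: x L_mult_closed)
qed

text \<open>
  Both tensors act by \<open>y \<mapsto> [u, f y] = f [u, y] = [f u, y]\<close>.
\<close>

lemma NL_rel:
  assumes f: "(f, U) \<in> P" and u: "u \<in> U"
  shows "TL.pt (lc (f, U)) u \<ominus>\<^bsub>TL.T\<^esub> TL.pt \<one>\<^bsub>C\<^esub> (f u) \<in> NL"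
proof -
  note p = permD[OF f] and uL = ess_in[OF permD(1)[OF f] u]
  let ?xs = "[(lc (f, U), u), (\<one>\<^bsub>C\<^esub>, \<ominus>\<^bsub>L\<^esub> f u)]"
  have l: "?xs \<in> TL.tlists" using f uL p(2)[OF u] by simp
  have "TL.pt (lc (f, U)) u \<ominus>\<^bsub>TL.T\<^esub> TL.pt \<one>\<^bsub>C\<^esub> (f u) = TL.tc ?xs"
    using l p(2)[OF u] by (simp add: a_minus_def TL.pt_minus_right[symmetric] TL.T_add)
  moreover from ev_lc[OF f] ev_one ev_ess[OF p(1)] ev_carrier have "\<forall>\<^sub>F y in F. Ev ?xs y = \<zero>\<^bsub>L\<^esub>"
  proof eventually_elim
    case (elim y)
    have "u \<otimes>\<^bsub>L\<^esub> f y = f u \<otimes>\<^bsub>L\<^esub> y" using p(4)[OF uL elim(3)] p(7)[OF elim(4) u] by simp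
    then show ?case using elim p(2)[OF u] by (simp add: L_bracket_minus L_mult_closed L.r_neg)
  qed
  ultimately show ?thesis using l by (simp add: NL_iff)
qed

text \<open>
  Modulo the relations, the bracket of \<open>1 \<otimes> y\<close> with \<open>X = \<Sum>\<^sub>i c\<^sub>i \<otimes> x\<^sub>i\<close> is \<open>1 \<otimes> w\<close>, where \<open>-w\<close> is the value at
  \<open>y\<close> of the action of \<open>X\<close>.  If \<open>X\<close> lies in \<open>N\<close>, then so does \<open>1 \<otimes> w\<close>, hence \<open>w = 0\<close>.
\<close>

lemma NL_max:
  assumes N: "lie_ideal C TL.T N"
    and rel: "\<And>f U u. (f, U) \<in> P \<Longrightarrow> u \<in> U \<Longrightarrow> TL.pt (lc (f, U)) u \<ominus>\<^bsub>TL.T\<^esub> TL.pt \<one>\<^bsub>C\<^esub> (f u) \<in> N"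
    and 0: "\<And>x. x \<in> carrier L \<Longrightarrow> TL.pt \<one>\<^bsub>C\<^esub> x \<in> N \<Longrightarrow> x = \<zero>\<^bsub>L\<^esub>"
  shows "N \<subseteq> NL"
proof
  fix X assume X: "X \<in> N"
  have sub: "submodule N C TL.T" and br: "\<And>x y. x \<in> carrier TL.T \<Longrightarrow> y \<in> N \<Longrightarrow> x \<otimes>\<^bsub>TL.T\<^esub> y \<in> N"
    using N unfolding lie_ideal_def by blast+
  note s = TL.T.submoduleE[OF sub]
  obtain xs where xs: "xs \<in> TL.tlists" "X = TL.tc xs" by (rule TL.T_cases[OF subsetD[OF s(1) X]])
  have *: "TL.pt \<one>\<^bsub>C\<^esub> y \<otimes>\<^bsub>TL.T\<^esub> TL.tc xs \<oplus>\<^bsub>TL.T\<^esub> TL.pt \<one>\<^bsub>C\<^esub> (Ev xs y) \<in> N"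
    if "xs \<in> TL.tlists" "y \<in> carrier L" "ok xs y" for xs y
    using that
  proof (induction rule: TL.tlists_induct)
    case Nil
    have "TL.pt \<one>\<^bsub>C\<^esub> y \<otimes>\<^bsub>TL.T\<^esub> TL.tc [] = \<zero>\<^bsub>TL.T\<^esub>"
      using Nil by (simp add: TL.T_mult tprod_def TL.T_zero)
    then show ?case using TL.T.submodule_zero[OF sub] by (simp add: TL.pt_zero_right)
  next
    case (Cons c x xs)
    have y: "y \<in> dm c" "ok xs y" "y \<in> carrier L" using Cons by auto
    note v = evD[OF Cons(1)]
    have yx: "y \<otimes>\<^bsub>L\<^esub> x \<in> dm c" using lidealD(8)[OF essD[OF v(1)] Cons(2) y(1)] .
    have fx: "ev c (y \<otimes>\<^bsub>L\<^esub> x) = \<ominus>\<^bsub>L\<^esub> (x \<otimes>\<^bsub>L\<^esub> ev c y)"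
      using v(7)[OF Cons(2) y(1)] L_anti[OF v(2)[OF y(1)] Cons(2)] by simp
    have xL: "x \<otimes>\<^bsub>L\<^esub> ev c y \<in> carrier L" "y \<otimes>\<^bsub>L\<^esub> x \<in> carrier L" using Cons(2) v(2)[OF y(1)] y by (simp_all add: L_mult_closed)
    have "TL.pt c (y \<otimes>\<^bsub>L\<^esub> x) \<ominus>\<^bsub>TL.T\<^esub> TL.pt \<one>\<^bsub>C\<^esub> (ev c (y \<otimes>\<^bsub>L\<^esub> x)) \<in> N"
      using rel[OF rp(1)[OF Cons(1)] yx] rp(2)[OF Cons(1)] by simp
    then have 1: "TL.pt c (y \<otimes>\<^bsub>L\<^esub> x) \<oplus>\<^bsub>TL.T\<^esub> TL.pt \<one>\<^bsub>C\<^esub> (x \<otimes>\<^bsub>L\<^esub> ev c y) \<in> N"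
      using xL by (simp add: fx TL.pt_minus_right a_minus_def)
    have "TL.tc ((c, x) # xs) = TL.pt c x \<oplus>\<^bsub>TL.T\<^esub> TL.tc xs" using Cons(1-3) by (simp add: TL.T_add)
    moreover have "Ev xs y \<in> carrier L" using Ev_closed[OF Cons(3) y(2)] .
    ultimately have "TL.pt \<one>\<^bsub>C\<^esub> y \<otimes>\<^bsub>TL.T\<^esub> TL.tc ((c, x) # xs) \<oplus>\<^bsub>TL.T\<^esub> TL.pt \<one>\<^bsub>C\<^esub> (Ev ((c, x) # xs) y) =
      (TL.pt c (y \<otimes>\<^bsub>L\<^esub> x) \<oplus>\<^bsub>TL.T\<^esub> TL.pt \<one>\<^bsub>C\<^esub> (x \<otimes>\<^bsub>L\<^esub> ev c y)) \<oplus>\<^bsub>TL.T\<^esub>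
      (TL.pt \<one>\<^bsub>C\<^esub> y \<otimes>\<^bsub>TL.T\<^esub> TL.tc xs \<oplus>\<^bsub>TL.T\<^esub> TL.pt \<one>\<^bsub>C\<^esub> (Ev xs y))"
      using Cons(1-3) y xL
      by (simp add: TL.T_mult_add_right TL.pt_mult TL.pt_add_right TL.T_mult_closed TL.T.add4)
    then show ?case using s(5)[OF 1 Cons(4)[OF y(3,2)]] by simp
  qed
  have "Ev xs y = \<zero>\<^bsub>L\<^esub>" if y: "y \<in> carrier L" "ok xs y" for y
  proof (rule 0)
    show "Ev xs y \<in> carrier L" by (rule Ev_closed[OF xs(1) y(2)])
    let ?b = "TL.pt \<one>\<^bsub>C\<^esub> y \<otimes>\<^bsub>TL.T\<^esub> X"
    have b: "?b \<in> N" using br[OF _ X] y by simp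
    have "TL.pt \<one>\<^bsub>C\<^esub> (Ev xs y) = (?b \<oplus>\<^bsub>TL.T\<^esub> TL.pt \<one>\<^bsub>C\<^esub> (Ev xs y)) \<ominus>\<^bsub>TL.T\<^esub> ?b"
      using y Ev_closed[OF xs(1) y(2)] s(1) X
      by (subst TL.T.diff_eq(2)) (auto simp: TL.T.a_comm TL.T_mult_closed)
    also have "\<dots> \<in> N" using TL.T.submodule_minus[OF sub] *[OF xs(1) y] b xs(2) by simp
    finally show "TL.pt \<one>\<^bsub>C\<^esub> (Ev xs y) \<in> N" .
  qed
  then have "\<forall>\<^sub>F y in F. Ev xs y = \<zero>\<^bsub>L\<^esub>"
    using ok_ess[OF xs(1)] by (auto simp: eventually_F)
  then show "X \<in> NL" using xs by (simp add: NL_iff)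
qed

lemma closure_rel_subset:
  assumes "lie_ideal C TL.T N"
  shows "lie_closure_rel R L \<subseteq> N \<longleftrightarrow>
    (\<forall>f U u. (f, U) \<in> P \<longrightarrow> u \<in> U \<longrightarrow> TL.pt (lc (f, U)) u \<ominus>\<^bsub>TL.T\<^esub> TL.pt \<one>\<^bsub>C\<^esub> (f u) \<in> N)"
proof -
  have g: "{H f U u | f U u. Q f U u} \<subseteq> N \<longleftrightarrow> (\<forall>f U u. Q f U u \<longrightarrow> H f U u \<in> N)" for H Q N by blast
  have "lie_closure_rel R L \<subseteq> N \<longleftrightarrow>
    {TL.pt (lc (f, U)) u \<ominus>\<^bsub>TL.T\<^esub> TL.pt \<one>\<^bsub>C\<^esub> (f u) | f U u. (f, U) \<in> P \<and> u \<in> U} \<subseteq> N"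
    unfolding lie_closure_rel_def Let_def pure_tensor_def
    by (rule subset_hull[where S="\<lambda>I. lie_ideal C TL.T I" and t=N, OF assms])
  also have "\<dots> \<longleftrightarrow> (\<forall>f U u. (f, U) \<in> P \<and> u \<in> U \<longrightarrow> TL.pt (lc (f, U)) u \<ominus>\<^bsub>TL.T\<^esub> TL.pt \<one>\<^bsub>C\<^esub> (f u) \<in> N)"
    by (rule g)
  finally show ?thesis by (simp only: imp_conjL)
qed

lemma lie_closure_cond_iff:
  "lie_closure_cond R L N \<longleftrightarrow> lie_ideal C TL.T N \<and>
    (\<forall>f U u. (f, U) \<in> P \<longrightarrow> u \<in> U \<longrightarrow> TL.pt (lc (f, U)) u \<ominus>\<^bsub>TL.T\<^esub> TL.pt \<one>\<^bsub>C\<^esub> (f u) \<in> N) \<and>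
    (\<forall>x\<in>carrier L. TL.pt \<one>\<^bsub>C\<^esub> x \<in> N \<longrightarrow> x = \<zero>\<^bsub>L\<^esub>)"
proof -
  have z: "\<zero>\<^bsub>TL.T\<^esub> \<in> N" if "lie_ideal C TL.T N" for N
    using that TL.T.submodule_zero by (simp add: lie_ideal_def)
  have inj: "TL.pt \<one>\<^bsub>C\<^esub> x = \<zero>\<^bsub>TL.T\<^esub> \<longleftrightarrow> x = \<zero>\<^bsub>L\<^esub>" if "x \<in> carrier L" for x
  proof
    assume "TL.pt \<one>\<^bsub>C\<^esub> x = \<zero>\<^bsub>TL.T\<^esub>"
    then have "TL.pt \<one>\<^bsub>C\<^esub> x \<in> NL" by (simp only: NL_zero)
    then show "x = \<zero>\<^bsub>L\<^esub>" by (rule NL_pt[OF that])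
  qed (simp only: TL.pt_zero_right TL.A.one_closed)
  have 1: "N \<inter> TL.pt \<one>\<^bsub>C\<^esub> ` carrier L = {\<zero>\<^bsub>TL.T\<^esub>} \<longleftrightarrow> (\<forall>x\<in>carrier L. TL.pt \<one>\<^bsub>C\<^esub> x \<in> N \<longrightarrow> x = \<zero>\<^bsub>L\<^esub>)" (is "?l \<longleftrightarrow> ?r")
    if N: "lie_ideal C TL.T N"
  proof
    show ?r if ?l
    proof (intro ballI impI)
      fix x assume "x \<in> carrier L" "TL.pt \<one>\<^bsub>C\<^esub> x \<in> N"
      then have "TL.pt \<one>\<^bsub>C\<^esub> x \<in> N \<inter> TL.pt \<one>\<^bsub>C\<^esub> ` carrier L" by (intro IntI imageI)
      with that have "TL.pt \<one>\<^bsub>C\<^esub> x = \<zero>\<^bsub>TL.T\<^esub>" by blast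
      then show "x = \<zero>\<^bsub>L\<^esub>" using inj[OF \<open>x \<in> carrier L\<close>] by blast
    qed
    show ?l if r: ?r
    proof
      have "\<zero>\<^bsub>TL.T\<^esub> = TL.pt \<one>\<^bsub>C\<^esub> \<zero>\<^bsub>L\<^esub>" by (rule TL.pt_zero_right[symmetric]) simp
      then have "\<zero>\<^bsub>TL.T\<^esub> \<in> TL.pt \<one>\<^bsub>C\<^esub> ` carrier L" by (rule image_eqI[OF _ L.zero_closed])
      then show "{\<zero>\<^bsub>TL.T\<^esub>} \<subseteq> N \<inter> TL.pt \<one>\<^bsub>C\<^esub> ` carrier L" using z[OF N] by blast
      show "N \<inter> TL.pt \<one>\<^bsub>C\<^esub> ` carrier L \<subseteq> {\<zero>\<^bsub>TL.T\<^esub>}"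
      proof
        fix X assume "X \<in> N \<inter> TL.pt \<one>\<^bsub>C\<^esub> ` carrier L"
        then obtain x where x: "x \<in> carrier L" "X = TL.pt \<one>\<^bsub>C\<^esub> x" "TL.pt \<one>\<^bsub>C\<^esub> x \<in> N" by blast
        with r have "x = \<zero>\<^bsub>L\<^esub>" by blast
        with x inj show "X \<in> {\<zero>\<^bsub>TL.T\<^esub>}" by simp
      qed
    qed
  qed
  show ?thesis
    unfolding lie_closure_cond_def Let_def pure_tensor_def
    by (rule conj_cong[OF HOL.refl], rule conj_cong, erule closure_rel_subset, erule 1)
qed

lemma lie_closure_ideal_eq: "lie_closure_ideal R L = NL"
  unfolding lie_closure_ideal_def
proof (rule the_equality)
  have M: "lie_closure_cond R L NL"
    unfolding lie_closure_cond_iff using NL_ideal NL_rel NL_pt by blast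
  have max: "N \<subseteq> NL" if "lie_closure_cond R L N" for N
    using that NL_max unfolding lie_closure_cond_iff by blast
  show "lie_closure_cond R L NL \<and> (\<forall>N. lie_closure_cond R L N \<and> NL \<subseteq> N \<longrightarrow> N = NL)" using M max by blast
  show "N = NL" if "lie_closure_cond R L N \<and> (\<forall>N'. lie_closure_cond R L N' \<and> N \<subseteq> N' \<longrightarrow> N' = N)" for N
    using that M max by blast
qed

text \<open>A formal sum that kills \<open>U\<^sup>+\<close> and \<open>U\<^sup>-\<close> for an essential ideal \<open>U\<close> of the pair acts as a derivation, so it
  kills the Lie ideal they generate and is eventually zero.\<close>

lemma Ev_zero_if:
  assumes xs: "xs \<in> TL.tlists" and U: "jess U" and k: "\<And>s u. u \<in> U s \<Longrightarrow> ok xs (emb s u)"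
    and 0: "\<And>s u. u \<in> U s \<Longrightarrow> Ev xs (emb s u) = \<zero>\<^bsub>L\<^esub>"
  shows "\<forall>\<^sub>F y in F. Ev xs y = \<zero>\<^bsub>L\<^esub>"
proof -
  let ?d = "dom (\<lambda>s x. x) U"
  note j = jidD[OF jessD[OF U]]
  note eL = emb_closed[OF j(2)]
  have br: "Ev xs (emb s u \<otimes>\<^bsub>L\<^esub> emb s' u') = \<zero>\<^bsub>L\<^esub>" "ok xs (emb s u \<otimes>\<^bsub>L\<^esub> emb s' u')" if "u \<in> U s" "u' \<in> U s'" for s u s' u'
    using Ev_bracket[OF xs k[OF that(1)] k[OF that(2)] eL[OF that(1)] eL[OF that(2)]] 0 that eL[OF that(1)] eL[OF that(2)]
      ok_closed[OF xs k[OF that(1)]] by simp_all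
  from ev_ess[OF dom_ess[OF U lin_id[OF jessD[OF U]]]] ev_ess[OF ok_ess[OF xs]]
  show ?thesis
  proof eventually_elim
    case (elim y)
    then obtain a d b where y: "y = (a, d, b)" "a \<in> U Pos" "d \<in> D" "b \<in> U Neg" "\<And>s v. v \<in> jcarrier V s \<Longrightarrow> d s v \<in> U s"
      by (auto simp: dom_def)
    have yL: "y \<in> carrier L" and ky: "ok xs y" using elim by auto
    note [simp] = j(2)[OF y(2)] j(2)[OF y(4)] y(3) D_E[OF y(3)]
    have z: "Ev xs (y \<otimes>\<^bsub>L\<^esub> emb s u) = \<zero>\<^bsub>L\<^esub>" if u: "u \<in> U s" for s u
    proof (cases s)
      case Pos
      then have "y \<otimes>\<^bsub>L\<^esub> emb s u = emb Pos (d Pos u) \<oplus>\<^bsub>L\<^esub> emb Neg b \<otimes>\<^bsub>L\<^esub> emb Pos u"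
        using j(2)[OF u] unfolding y(1) by (simp add: bracket_emb emb_bracket) (simp add: emb_simps)
      then show ?thesis using Ev_add[OF xs k br(2)] br(1)[OF y(4)] 0 y(5)[OF j(2)[OF u]] u y(4) Pos by simp
    next
      case Neg
      then have "y \<otimes>\<^bsub>L\<^esub> emb s u = emb Neg (d Neg u) \<oplus>\<^bsub>L\<^esub> emb Pos a \<otimes>\<^bsub>L\<^esub> emb Neg u"
        using j(2)[OF u] unfolding y(1) by (simp add: bracket_emb emb_bracket) (simp add: emb_simps)
      then show ?thesis using Ev_add[OF xs k br(2)] br(1)[OF y(2)] 0 y(5)[OF j(2)[OF u]] u y(2) Neg by simp
    qed
    show "Ev xs y = \<zero>\<^bsub>L\<^esub>"
    proof (rule L_annihilator_zero[OF U Ev_closed[OF xs ky]])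
      fix s u assume u: "u \<in> U s"
      have "Ev xs (y \<otimes>\<^bsub>L\<^esub> emb s u) = Ev xs y \<otimes>\<^bsub>L\<^esub> emb s u \<oplus>\<^bsub>L\<^esub> y \<otimes>\<^bsub>L\<^esub> Ev xs (emb s u)"
        by (rule Ev_bracket[OF xs ky k[OF u] yL eL[OF u]])
      then show "Ev xs y \<otimes>\<^bsub>L\<^esub> emb s u = \<zero>\<^bsub>L\<^esub>"
        using z[OF u] 0[OF u] yL eL[OF u] Ev_closed[OF xs ky] by (simp add: L_mult_closed)
    qed
  qed
qed

end

section \<open>Scalar extensions of triple systems\<close>

text \<open>
  When \<open>2\<close> is invertible, the quadratic operators and the triple product determine each other.  This is
  the part of the structure that passes to scalar extensions and quotients by direct computation.
\<close>

locale half_triple_system = triple_system +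
  fixes h
  assumes h_closed: "h \<in> carrier R" and h_half: "h \<oplus>\<^bsub>R\<^esub> h = \<one>\<^bsub>R\<^esub>"
    and Q_cl: "x \<in> jcarrier V s \<Longrightarrow> y \<in> jcarrier V (opp s) \<Longrightarrow> jQ V s x y \<in> jcarrier V s"
    and t_Q: "x \<in> jcarrier V s \<Longrightarrow> y \<in> jcarrier V (opp s) \<Longrightarrow> t s x y x = pl s (jQ V s x y) (jQ V s x y)"
    and t_comm: "\<lbrakk>x \<in> jcarrier V s; y \<in> jcarrier V (opp s); z \<in> jcarrier V s\<rbrakk> \<Longrightarrow> t s x y z = t s z y x"
begin

lemma h_double: "x \<in> jcarrier V s \<Longrightarrow> sm s h (pl s x x) = x"
  using h_closed by (simp add: M.smult_r_distr M.smult_l_distr[symmetric] h_half)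

lemma Q_h: "x \<in> jcarrier V s \<Longrightarrow> y \<in> jcarrier V (opp s) \<Longrightarrow> jQ V s x y = sm s h (t s x y x)"
  by (simp add: t_Q h_double Q_cl)

lemma jideal_triple:
  assumes sub: "\<And>s. submodule (U s) R (jmod V s)"
    and 1: "\<And>s u y z. u \<in> U s \<Longrightarrow> y \<in> jcarrier V (opp s) \<Longrightarrow> z \<in> jcarrier V s \<Longrightarrow> t s u y z \<in> U s"
    and 2: "\<And>s u x z. x \<in> jcarrier V s \<Longrightarrow> u \<in> U (opp s) \<Longrightarrow> z \<in> jcarrier V s \<Longrightarrow> t s x u z \<in> U s"
  shows "jideal R V U"
proof -
  note m = M.submoduleE(1)[OF sub, THEN subsetD] and sc = M.submoduleE(4)[OF sub]
  have "jQ V s u y \<in> U s" if "u \<in> U s" "y \<in> jcarrier V (opp s)" for s u y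
    unfolding Q_h[OF m[OF that(1)] that(2)] by (intro sc h_closed 1 that m[OF that(1)])
  moreover have "jQ V s x u \<in> U s" if "x \<in> jcarrier V s" "u \<in> U (opp s)" for s x u
    unfolding Q_h[OF that(1) m[OF that(2)]] by (intro sc h_closed 2 that)
  ultimately show ?thesis using sub 1 unfolding jideal_def by blast
qed

lemma jid_triple:
  assumes "jideal R V U"
  shows "\<And>s. submodule (U s) R (jmod V s)" "\<And>s u. u \<in> U s \<Longrightarrow> u \<in> jcarrier V s"
    "\<And>s u y z. u \<in> U s \<Longrightarrow> y \<in> jcarrier V (opp s) \<Longrightarrow> z \<in> jcarrier V s \<Longrightarrow> t s u y z \<in> U s"
    "\<And>s u x z. x \<in> jcarrier V s \<Longrightarrow> u \<in> U (opp s) \<Longrightarrow> z \<in> jcarrier V s \<Longrightarrow> t s x u z \<in> U s"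
proof -
  show sub: "\<And>s. submodule (U s) R (jmod V s)"
    and "\<And>s u y z. u \<in> U s \<Longrightarrow> y \<in> jcarrier V (opp s) \<Longrightarrow> z \<in> jcarrier V s \<Longrightarrow> t s u y z \<in> U s"
    using assms unfolding jideal_def by blast+
  show "\<And>s u. u \<in> U s \<Longrightarrow> u \<in> jcarrier V s" using M.submoduleE(1)[OF sub] by blast
  have q: "\<And>s x u. x \<in> jcarrier V s \<Longrightarrow> u \<in> U (opp s) \<Longrightarrow> jQ V s x u \<in> U s"
    using assms unfolding jideal_def by blast
  show "t s x u z \<in> U s" if "x \<in> jcarrier V s" "u \<in> U (opp s)" "z \<in> jcarrier V s" for s u x z
    unfolding jtriple_def using that by (intro M.submodule_minus[OF sub] q) auto
qed

end

locale quotient_system = half_triple_system R V h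
  for R :: "('r, 'e) ring_scheme" and V :: "('r, 'a) jpair" and h +
  fixes U assumes U: "jideal R V U"
begin

sublocale QM: quotient_module R "jmod V s" "U s" for s
  using jid_triple(1)[OF U] modules by (simp add: quotient_module_def quotient_module_axioms_def)

abbreviation VQ where "VQ \<equiv> jquot V U"

lemma VQ_mod [simp]: "jmod VQ s = QM.Q s"
  by (simp add: jquot_def)

lemma VQ_Q:
  assumes x: "x \<in> jcarrier V s" and y: "y \<in> jcarrier V (opp s)"
  shows "jQ VQ s (QM.cs s x) (QM.cs (opp s) y) = QM.cs s (jQ V s x y)"
proof -
  note u = jid_triple[OF U]
  have 1: "QM.cs s (jQ V s x' (pl (opp s) y n)) = QM.cs s (jQ V s x' y)" if "n \<in> U (opp s)" "x' \<in> jcarrier V s" for x' n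
  proof -
    have n: "n \<in> jcarrier V (opp s)" by (rule u(2)[OF that(1)])
    have "jQ V s x' (pl (opp s) y n) = pl s (jQ V s x' y) (sm s h (t s x' n x'))"
      using that n y by (simp add: Q_h t_add2 M.smult_r_distr h_closed)
    moreover have "sm s h (t s x' n x') \<in> U s"
      using M.submoduleE(4)[OF u(1)] h_closed u(4)[OF that(2,1,2)] by blast
    ultimately show ?thesis using that y by (simp add: QM.cs_add_N Q_cl)
  qed
  have 2: "QM.cs s (jQ V s (pl s x n) y) = QM.cs s (jQ V s x y)" if "n \<in> U s" for n
  proof -
    have n: "n \<in> jcarrier V s" by (rule u(2)[OF that])
    let ?r = "pl s (t s n y x) (pl s (t s x y n) (t s n y n))"
    have "jQ V s (pl s x n) y = pl s (jQ V s x y) (sm s h ?r)"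
      using x n y by (simp add: Q_h t_add1 t_add3 M.smult_r_distr h_closed M.a_ac)
    moreover have "t s x y n \<in> U s" using u(3)[OF that y x] t_comm[OF x y n] by simp
    then have "sm s h ?r \<in> U s"
      using M.submoduleE(4,5)[OF u(1)] h_closed u(3)[OF that y x] u(3)[OF that y n] by blast
    ultimately show ?thesis using x y by (simp add: QM.cs_add_N Q_cl)
  qed
  have "(\<Union>y'\<in>QM.cs (opp s) y. QM.cs s (jQ V s x' y')) = QM.cs s (jQ V s x' y)" if "x' \<in> jcarrier V s" for x'
    by (rule QM.Union_cs[OF y]) (simp add: 1 that)
  moreover have "QM.cs s x \<subseteq> jcarrier V s" by (rule M.a_r_coset_subset_G[OF QM.N.a_subset x])
  ultimately have "jQ VQ s (QM.cs s x) (QM.cs (opp s) y) = (\<Union>x'\<in>QM.cs s x. QM.cs s (jQ V s x' y))"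
    by (simp add: jquot_def subset_iff)
  also have "\<dots> = QM.cs s (jQ V s x y)" by (rule QM.Union_cs[OF x]) (simp add: 2)
  finally show ?thesis .
qed

lemma VQ_t:
  assumes "x \<in> jcarrier V s" "y \<in> jcarrier V (opp s)" "z \<in> jcarrier V s"
  shows "jtriple VQ s (QM.cs s x) (QM.cs (opp s) y) (QM.cs s z) = QM.cs s (t s x y z)"
  using assms unfolding jtriple_def[of VQ]
  by (simp add: QM.Q_add VQ_Q QM.cs_minus Q_cl jtriple_def[symmetric])

lemma VQ_system: "triple_system R VQ"
proof (rule triple_system.intro)
  show "module R (jmod VQ s)" for s by (simp add: QM.Q_module)
  show "jtriple VQ s x y z \<in> jcarrier VQ s"
    if "x \<in> jcarrier VQ s" "y \<in> jcarrier VQ (opp s)" "z \<in> jcarrier VQ s" for s x y z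
    using that unfolding VQ_mod by (elim QM.Q_cases) (simp add: VQ_t)
  show "jtriple VQ s (x \<oplus>\<^bsub>jmod VQ s\<^esub> x') y z = jtriple VQ s x y z \<oplus>\<^bsub>jmod VQ s\<^esub> jtriple VQ s x' y z"
    if "x \<in> jcarrier VQ s" "x' \<in> jcarrier VQ s" "y \<in> jcarrier VQ (opp s)" "z \<in> jcarrier VQ s" for s x x' y z
    using that unfolding VQ_mod by (elim QM.Q_cases) (simp add: VQ_t QM.Q_add t_add1)
  show "jtriple VQ s x (y \<oplus>\<^bsub>jmod VQ (opp s)\<^esub> y') z = jtriple VQ s x y z \<oplus>\<^bsub>jmod VQ s\<^esub> jtriple VQ s x y' z"
    if "x \<in> jcarrier VQ s" "y \<in> jcarrier VQ (opp s)" "y' \<in> jcarrier VQ (opp s)" "z \<in> jcarrier VQ s" for s x y y' z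
    using that unfolding VQ_mod by (elim QM.Q_cases) (simp add: VQ_t QM.Q_add t_add2)
  show "jtriple VQ s x y (z \<oplus>\<^bsub>jmod VQ s\<^esub> z') = jtriple VQ s x y z \<oplus>\<^bsub>jmod VQ s\<^esub> jtriple VQ s x y z'"
    if "x \<in> jcarrier VQ s" "y \<in> jcarrier VQ (opp s)" "z \<in> jcarrier VQ s" "z' \<in> jcarrier VQ s" for s x y z z'
    using that unfolding VQ_mod by (elim QM.Q_cases) (simp add: VQ_t QM.Q_add t_add3)
  show "jtriple VQ s (r \<odot>\<^bsub>jmod VQ s\<^esub> x) y z = r \<odot>\<^bsub>jmod VQ s\<^esub> jtriple VQ s x y z"
    if "r \<in> carrier R" "x \<in> jcarrier VQ s" "y \<in> jcarrier VQ (opp s)" "z \<in> jcarrier VQ s" for r s x y z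
    using that unfolding VQ_mod by (elim QM.Q_cases) (simp add: VQ_t QM.Q_smult t_smult1)
  show "jtriple VQ s x (r \<odot>\<^bsub>jmod VQ (opp s)\<^esub> y) z = r \<odot>\<^bsub>jmod VQ s\<^esub> jtriple VQ s x y z"
    if "r \<in> carrier R" "x \<in> jcarrier VQ s" "y \<in> jcarrier VQ (opp s)" "z \<in> jcarrier VQ s" for r s x y z
    using that unfolding VQ_mod by (elim QM.Q_cases) (simp add: VQ_t QM.Q_smult t_smult2)
  show "jtriple VQ s x y (r \<odot>\<^bsub>jmod VQ s\<^esub> z) = r \<odot>\<^bsub>jmod VQ s\<^esub> jtriple VQ s x y z"
    if "r \<in> carrier R" "x \<in> jcarrier VQ s" "y \<in> jcarrier VQ (opp s)" "z \<in> jcarrier VQ s" for r s x y z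
    using that unfolding VQ_mod by (elim QM.Q_cases) (simp add: VQ_t QM.Q_smult t_smult3)
qed

end

locale tensor_system = half_triple_system R V h + A: algebra R A
  for R :: "('r, 'e) ring_scheme" and V :: "('r, 'a) jpair" and h and A :: "('r, 'c, 'f) module_scheme"
begin

sublocale TV: tensor_module R A "jmod V s" for s
  by (simp add: tensor_module_def A.algebra_axioms modules)

abbreviation VT where "VT \<equiv> jtensor R A V"

lemma VT_mod [simp]: "jmod VT s = TV.T s"
  by (simp add: jtensor_def)

definition "\<tau> s xs ys zs = lsum (TV.T s) (\<lambda>(a, x). lsum (TV.T s) (\<lambda>(b, y). lsum (TV.T s)
    (\<lambda>(c, z). TV.pt s (a \<otimes>\<^bsub>A\<^esub> b \<otimes>\<^bsub>A\<^esub> c) (t s x y z)) zs) ys) xs"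

abbreviation "row s a x b y \<equiv> (\<lambda>(c, z). TV.pt s (a \<otimes>\<^bsub>A\<^esub> b \<otimes>\<^bsub>A\<^esub> c) (t s x y z))"

lemma row_closed:
  "a \<in> carrier A \<Longrightarrow> x \<in> jcarrier V s \<Longrightarrow> b \<in> carrier A \<Longrightarrow> y \<in> jcarrier V (opp s) \<Longrightarrow> zs \<in> TV.tlists s \<Longrightarrow>
    lsum (TV.T s) (row s a x b y) zs \<in> carrier (TV.T s)"
  by (rule TV.T.lsum_closed) (auto dest!: TV.tlistsD)

lemma mat_closed:
  "a \<in> carrier A \<Longrightarrow> x \<in> jcarrier V s \<Longrightarrow> ys \<in> TV.tlists (opp s) \<Longrightarrow> zs \<in> TV.tlists s \<Longrightarrow>
    lsum (TV.T s) (\<lambda>(b, y). lsum (TV.T s) (row s a x b y) zs) ys \<in> carrier (TV.T s)"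
  by (rule TV.T.lsum_closed) (auto dest!: TV.tlistsD intro!: row_closed)

lemma \<tau>_closed: "xs \<in> TV.tlists s \<Longrightarrow> ys \<in> TV.tlists (opp s) \<Longrightarrow> zs \<in> TV.tlists s \<Longrightarrow> \<tau> s xs ys zs \<in> carrier (TV.T s)"
  unfolding \<tau>_def by (rule TV.T.lsum_closed) (auto dest!: TV.tlistsD intro!: mat_closed)

lemma \<tau>_simps1:
  "\<tau> s [] ys zs = \<zero>\<^bsub>TV.T s\<^esub>"
  "\<tau> s ((a, x) # xs) ys zs = lsum (TV.T s) (\<lambda>(b, y). lsum (TV.T s) (row s a x b y) zs) ys \<oplus>\<^bsub>TV.T s\<^esub> \<tau> s xs ys zs"
  by (simp_all add: \<tau>_def)

lemma \<tau>_append1: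
  assumes "xs \<in> TV.tlists s" "xs' \<in> TV.tlists s" "ys \<in> TV.tlists (opp s)" "zs \<in> TV.tlists s"
  shows "\<tau> s (xs @ xs') ys zs = \<tau> s xs ys zs \<oplus>\<^bsub>TV.T s\<^esub> \<tau> s xs' ys zs"
  using assms(1)
proof (induction rule: TV.tlists_induct)
  case (Cons a x xs)
  then show ?case using assms(2-4) mat_closed[of a x s ys zs] by (simp add: \<tau>_simps1 \<tau>_closed TV.T.a_assoc)
qed (simp add: \<tau>_simps1 \<tau>_closed assms)

lemma mat_append:
  assumes "a \<in> carrier A" "x \<in> jcarrier V s" "ys \<in> TV.tlists (opp s)" "ys' \<in> TV.tlists (opp s)" "zs \<in> TV.tlists s"
  shows "lsum (TV.T s) (\<lambda>(b, y). lsum (TV.T s) (row s a x b y) zs) (ys @ ys') =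
    lsum (TV.T s) (\<lambda>(b, y). lsum (TV.T s) (row s a x b y) zs) ys \<oplus>\<^bsub>TV.T s\<^esub> lsum (TV.T s) (\<lambda>(b, y). lsum (TV.T s) (row s a x b y) zs) ys'"
  using assms by (intro TV.T.lsum_append) (auto dest!: TV.tlistsD intro!: row_closed)

lemma \<tau>_append2:
  assumes "xs \<in> TV.tlists s" "ys \<in> TV.tlists (opp s)" "ys' \<in> TV.tlists (opp s)" "zs \<in> TV.tlists s"
  shows "\<tau> s xs (ys @ ys') zs = \<tau> s xs ys zs \<oplus>\<^bsub>TV.T s\<^esub> \<tau> s xs ys' zs"
  using assms(1)
proof (induction rule: TV.tlists_induct)
  case (Cons a x xs)
  then show ?case using assms(2-4) mat_closed[of a x s ys zs] mat_closed[of a x s ys' zs]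
    by (simp add: \<tau>_simps1 mat_append \<tau>_closed TV.T.add4)
qed (simp add: \<tau>_simps1)

lemma \<tau>_single:
  assumes "a \<in> carrier A" "x \<in> jcarrier V s" "b \<in> carrier A" "y \<in> jcarrier V (opp s)" "c \<in> carrier A" "z \<in> jcarrier V s"
  shows "\<tau> s [(a, x)] [(b, y)] [(c, z)] = TV.pt s (a \<otimes>\<^bsub>A\<^esub> b \<otimes>\<^bsub>A\<^esub> c) (t s x y z)"
  using assms by (simp add: \<tau>_def)

lemma row_cong:
  assumes "a \<in> carrier A" "x \<in> jcarrier V s" "b \<in> carrier A" "y \<in> jcarrier V (opp s)" "TV.teq s zs zs'"
  shows "lsum (TV.T s) (row s a x b y) zs = lsum (TV.T s) (row s a x b y) zs'"
  using assms
  by (intro TV.teq_lift[OF assms(5) TV.T_abelian_group])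
     (simp_all add: A.r_distr TV.pt_add_left t_add3 TV.pt_add_right TV.smult_comm TV.pt_balance t_smult3)

lemma \<tau>_cong3:
  assumes "xs \<in> TV.tlists s" "ys \<in> TV.tlists (opp s)" "TV.teq s zs zs'"
  shows "\<tau> s xs ys zs = \<tau> s xs ys zs'"
proof -
  have 1: "lsum (TV.T s) (\<lambda>(b, y). lsum (TV.T s) (row s a x b y) zs) ys = lsum (TV.T s) (\<lambda>(b, y). lsum (TV.T s) (row s a x b y) zs') ys"
    if "a \<in> carrier A" "x \<in> jcarrier V s" for a x
  proof (rule lsum_cong)
    fix p assume p: "p \<in> set ys"
    obtain b y where pe: "p = (b, y)" by (cases p)
    have "b \<in> carrier A \<and> y \<in> jcarrier V (opp s)" using TV.tlistsD p assms(2) unfolding pe by blast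
    then show "(case p of (b, y) \<Rightarrow> lsum (TV.T s) (row s a x b y) zs) = (case p of (b, y) \<Rightarrow> lsum (TV.T s) (row s a x b y) zs')"
      unfolding pe prod.case using row_cong[OF that _ _ assms(3)] by blast
  qed
  then show ?thesis unfolding \<tau>_def using assms(1) by (intro lsum_cong) (auto dest!: TV.tlistsD)
qed

lemma pt_comm:
  assumes "a \<in> carrier A" "x \<in> jcarrier V s" "b \<in> carrier A" "y \<in> jcarrier V (opp s)" "c \<in> carrier A" "z \<in> jcarrier V s"
  shows "TV.pt s (a \<otimes>\<^bsub>A\<^esub> b \<otimes>\<^bsub>A\<^esub> c) (t s x y z) = TV.pt s (c \<otimes>\<^bsub>A\<^esub> b \<otimes>\<^bsub>A\<^esub> a) (t s z y x)"
  using assms t_comm[of x s y z] by (simp add: A.m_ac)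

lemma row_append:
  assumes "a \<in> carrier A" "x \<in> jcarrier V s" "b \<in> carrier A" "y \<in> jcarrier V (opp s)" "zs \<in> TV.tlists s" "zs' \<in> TV.tlists s"
  shows "lsum (TV.T s) (row s a x b y) (zs @ zs') = lsum (TV.T s) (row s a x b y) zs \<oplus>\<^bsub>TV.T s\<^esub> lsum (TV.T s) (row s a x b y) zs'"
  using assms by (intro TV.T.lsum_append) (auto dest!: TV.tlistsD)

lemma mat_append3:
  assumes "a \<in> carrier A" "x \<in> jcarrier V s" "ys \<in> TV.tlists (opp s)" "zs \<in> TV.tlists s" "zs' \<in> TV.tlists s"
  shows "lsum (TV.T s) (\<lambda>(b, y). lsum (TV.T s) (row s a x b y) (zs @ zs')) ys =
    lsum (TV.T s) (\<lambda>(b, y). lsum (TV.T s) (row s a x b y) zs) ys \<oplus>\<^bsub>TV.T s\<^esub> lsum (TV.T s) (\<lambda>(b, y). lsum (TV.T s) (row s a x b y) zs') ys"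
  using assms(3)
proof (induction rule: TV.tlists_induct)
  case (Cons b y ys)
  then show ?case using assms row_closed[of a x s b y zs] row_closed[of a x s b y zs'] mat_closed[of a x s ys zs] mat_closed[of a x s ys zs']
    by (simp add: row_append TV.T.add4)
qed simp

lemma \<tau>_append3:
  assumes "xs \<in> TV.tlists s" "ys \<in> TV.tlists (opp s)" "zs \<in> TV.tlists s" "zs' \<in> TV.tlists s"
  shows "\<tau> s xs ys (zs @ zs') = \<tau> s xs ys zs \<oplus>\<^bsub>TV.T s\<^esub> \<tau> s xs ys zs'"
  using assms(1)
proof (induction rule: TV.tlists_induct)
  case (Cons a x xs)
  then show ?case using assms(2-4) mat_closed[of a x s ys zs] mat_closed[of a x s ys zs']
    by (simp add: \<tau>_simps1 mat_append3 \<tau>_closed TV.T.add4)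
qed (simp add: \<tau>_simps1)

lemma \<tau>_Nil: "\<tau> s xs [] zs = \<zero>\<^bsub>TV.T s\<^esub>" "\<tau> s xs ys [] = \<zero>\<^bsub>TV.T s\<^esub>"
  unfolding \<tau>_def by (auto intro!: TV.T.lsum_zero)

lemma \<tau>_Cons:
  assumes "xs \<in> TV.tlists s" "ys \<in> TV.tlists (opp s)" "zs \<in> TV.tlists s"
  shows "a \<in> carrier A \<Longrightarrow> x \<in> jcarrier V s \<Longrightarrow> \<tau> s ((a, x) # xs) ys zs = \<tau> s [(a, x)] ys zs \<oplus>\<^bsub>TV.T s\<^esub> \<tau> s xs ys zs"
    "b \<in> carrier A \<Longrightarrow> y \<in> jcarrier V (opp s) \<Longrightarrow> \<tau> s xs ((b, y) # ys) zs = \<tau> s xs [(b, y)] zs \<oplus>\<^bsub>TV.T s\<^esub> \<tau> s xs ys zs"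
    "c \<in> carrier A \<Longrightarrow> z \<in> jcarrier V s \<Longrightarrow> \<tau> s xs ys ((c, z) # zs) = \<tau> s xs ys [(c, z)] \<oplus>\<^bsub>TV.T s\<^esub> \<tau> s xs ys zs"
  using \<tau>_append1[of "[(a, x)]" s xs ys zs] \<tau>_append2[of xs s "[(b, y)]" ys zs] \<tau>_append3[of xs s ys "[(c, z)]" zs] assms
  by simp_all

lemma \<tau>_sym:
  assumes "xs \<in> TV.tlists s" "ys \<in> TV.tlists (opp s)" "zs \<in> TV.tlists s"
  shows "\<tau> s xs ys zs = \<tau> s zs ys xs"
  using assms(1)
proof (induction rule: TV.tlists_induct)
  case p: (Cons a x xs)
  have "\<tau> s [(a, x)] ys zs = \<tau> s zs ys [(a, x)]" using assms(2)
  proof (induction rule: TV.tlists_induct)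
    case q: (Cons b y ys)
    have "\<tau> s [(a, x)] [(b, y)] zs = \<tau> s zs [(b, y)] [(a, x)]" using assms(3)
    proof (induction rule: TV.tlists_induct)
      case r: (Cons c z zs)
      have "\<tau> s [(a, x)] [(b, y)] [(c, z)] = \<tau> s [(c, z)] [(b, y)] [(a, x)]"
        using p(1,2) q(1,2) r(1,2) pt_comm by (simp add: \<tau>_single)
      with p(1,2) q(1,2) r show ?case by (simp add: \<tau>_Cons(3)[of _ _ _ zs] \<tau>_Cons(1)[of zs])
    qed (simp add: \<tau>_Nil \<tau>_simps1)
    with p(1,2) q assms(3) show ?case by (simp add: \<tau>_Cons(2)[of _ _ ys])
  qed (simp add: \<tau>_Nil)
  with p assms(2,3) show ?case by (simp add: \<tau>_Cons(1)[of xs] \<tau>_Cons(3)[of _ _ _ xs])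
qed (simp add: \<tau>_Nil \<tau>_simps1)

lemma \<tau>_cong2:
  assumes "xs \<in> TV.tlists s" "zs \<in> TV.tlists s" "TV.teq (opp s) ys ys'"
  shows "\<tau> s xs ys zs = \<tau> s xs ys' zs"
proof -
  have "lsum (TV.T s) (\<lambda>(b, y). lsum (TV.T s) (row s a x b y) zs) ys = lsum (TV.T s) (\<lambda>(b, y). lsum (TV.T s) (row s a x b y) zs) ys'"
    if ax: "a \<in> carrier A" "x \<in> jcarrier V s" for a x
  proof (rule TV.teq_lift[OF assms(3) TV.T_abelian_group])
    show "lsum (TV.T s) (row s a x b y) zs \<in> carrier (TV.T s)" if "b \<in> carrier A" "y \<in> jcarrier V (opp s)" for b y
      using row_closed ax that assms(2) by blast
    show "lsum (TV.T s) (row s a x (b \<oplus>\<^bsub>A\<^esub> b') y) zs = lsum (TV.T s) (row s a x b y) zs \<oplus>\<^bsub>TV.T s\<^esub> lsum (TV.T s) (row s a x b' y) zs"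
      if "b \<in> carrier A" "b' \<in> carrier A" "y \<in> jcarrier V (opp s)" for b b' y
      using assms(2) ax that
      by (subst TV.T.lsum_add[symmetric]) (auto intro!: lsum_cong simp: A.r_distr A.l_distr TV.pt_add_left dest!: TV.tlistsD)
    show "lsum (TV.T s) (row s a x b (pl (opp s) y y')) zs = lsum (TV.T s) (row s a x b y) zs \<oplus>\<^bsub>TV.T s\<^esub> lsum (TV.T s) (row s a x b y') zs"
      if "b \<in> carrier A" "y \<in> jcarrier V (opp s)" "y' \<in> jcarrier V (opp s)" for b y y'
      using assms(2) ax that
      by (subst TV.T.lsum_add[symmetric]) (auto intro!: lsum_cong simp: t_add2 TV.pt_add_right dest!: TV.tlistsD)
    show "lsum (TV.T s) (row s a x (r \<odot>\<^bsub>A\<^esub> b) y) zs = lsum (TV.T s) (row s a x b (sm (opp s) r y)) zs"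
      if "r \<in> carrier R" "b \<in> carrier A" "y \<in> jcarrier V (opp s)" for r b y
      using assms(2) ax that
      by (intro lsum_cong) (auto simp: TV.smult_comm A.smult_assoc2 t_smult2 TV.pt_balance dest!: TV.tlistsD)
  qed
  then show ?thesis unfolding \<tau>_def using assms(1) by (intro lsum_cong) (auto dest!: TV.tlistsD)
qed

lemma \<tau>_cong:
  assumes "TV.teq s xs xs'" "TV.teq (opp s) ys ys'" "TV.teq s zs zs'"
  shows "\<tau> s xs ys zs = \<tau> s xs' ys' zs'"
proof -
  have l: "xs \<in> TV.tlists s" "xs' \<in> TV.tlists s" "ys \<in> TV.tlists (opp s)" "ys' \<in> TV.tlists (opp s)" "zs \<in> TV.tlists s" "zs' \<in> TV.tlists s"
    using assms TV.teq_lists by blast+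
  have "\<tau> s xs ys zs = \<tau> s xs ys' zs'"
    using \<tau>_cong2[OF l(1,5) assms(2)] \<tau>_cong3[OF l(1,4) assms(3)] by simp
  also have "\<dots> = \<tau> s zs' ys' xs" by (rule \<tau>_sym[OF l(1,4,6)])
  also have "\<dots> = \<tau> s zs' ys' xs'" by (rule \<tau>_cong3[OF l(6,4) assms(1)])
  also have "\<dots> = \<tau> s xs' ys' zs'" by (rule \<tau>_sym[OF l(6,4,2)])
  finally show ?thesis .
qed

definition "hA = h \<odot>\<^bsub>A\<^esub> \<one>\<^bsub>A\<^esub>"

lemma hA: "hA \<in> carrier A" "hA \<oplus>\<^bsub>A\<^esub> hA = \<one>\<^bsub>A\<^esub>"
  unfolding hA_def using h_closed by (simp_all add: A.smult_l_distr[symmetric] h_half)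

lemma T_double:
  assumes "X \<in> carrier (TV.T s)" "Y \<in> carrier (TV.T s)" "X \<oplus>\<^bsub>TV.T s\<^esub> X = Y \<oplus>\<^bsub>TV.T s\<^esub> Y"
  shows "X = Y"
proof -
  have d: "hA \<odot>\<^bsub>TV.T s\<^esub> (Z \<oplus>\<^bsub>TV.T s\<^esub> Z) = Z" if "Z \<in> carrier (TV.T s)" for Z
    using that hA by (simp add: TV.T.smult_r_distr TV.T.smult_l_distr[symmetric])
  have "X = hA \<odot>\<^bsub>TV.T s\<^esub> (X \<oplus>\<^bsub>TV.T s\<^esub> X)" by (rule d[OF assms(1), symmetric])
  also have "\<dots> = hA \<odot>\<^bsub>TV.T s\<^esub> (Y \<oplus>\<^bsub>TV.T s\<^esub> Y)" unfolding assms(3) ..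
  also have "\<dots> = Y" by (rule d[OF assms(2)])
  finally show ?thesis .
qed

text \<open>
  The double of the quadratic operator on lists is the diagonal of the trilinear product \<open>\<tau>\<close>.  As \<open>2\<close> is
  invertible, this shows that the operator is well defined on tensors.
\<close>

lemma tensor_Q_double:
  assumes "xs \<in> TV.tlists s" "ys \<in> TV.tlists (opp s)"
  shows "tensor_Q A V s xs ys \<in> TV.tlists s \<and>
    TV.tc s (tensor_Q A V s xs ys) \<oplus>\<^bsub>TV.T s\<^esub> TV.tc s (tensor_Q A V s xs ys) = \<tau> s xs ys xs"
  using assms(1)
proof (induction rule: TV.tlists_induct)
  case Nil
  then show ?case by (simp add: \<tau>_Nil TV.T_zero[symmetric])
next
  case (Cons a x xs)
  let ?A = "\<lambda>ys. [(a \<otimes>\<^bsub>A\<^esub> a \<otimes>\<^bsub>A\<^esub> b, jQ V s x y). (b, y) \<leftarrow> ys]"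
  let ?B = "\<lambda>ys. [(a \<otimes>\<^bsub>A\<^esub> c \<otimes>\<^bsub>A\<^esub> b, jtriple V s x y z). (b, y) \<leftarrow> ys, (c, z) \<leftarrow> xs]"
  have A: "?A ys \<in> TV.tlists s \<and> TV.tc s (?A ys) \<oplus>\<^bsub>TV.T s\<^esub> TV.tc s (?A ys) = \<tau> s [(a, x)] ys [(a, x)]"
    using assms(2)
  proof (induction rule: TV.tlists_induct)
    case Nil
    then show ?case by (simp add: \<tau>_Nil TV.T_zero[symmetric])
  next
    case q: (Cons b y ys)
    let ?p = "TV.pt s (a \<otimes>\<^bsub>A\<^esub> a \<otimes>\<^bsub>A\<^esub> b) (jQ V s x y)"
    have e: "TV.tc s (?A ((b, y) # ys)) = ?p \<oplus>\<^bsub>TV.T s\<^esub> TV.tc s (?A ys)"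
      using q Cons(1,2) TV.T_add[of "[(a \<otimes>\<^bsub>A\<^esub> a \<otimes>\<^bsub>A\<^esub> b, jQ V s x y)]" s "?A ys"] by (simp add: Q_cl)
    have p: "?p \<oplus>\<^bsub>TV.T s\<^esub> ?p = \<tau> s [(a, x)] [(b, y)] [(a, x)]"
      using q(1,2) Cons(1,2) by (simp add: \<tau>_single TV.pt_add_right[symmetric] Q_cl t_Q A.m_ac)
    show ?case
      unfolding e using q Cons(1,2) p
      by (simp add: \<tau>_Cons(2)[of _ _ ys] Q_cl TV.T.add4)
  qed
  have B: "?B ys \<in> TV.tlists s \<and> TV.tc s (?B ys) = \<tau> s [(a, x)] ys xs"
    using assms(2)
  proof (induction rule: TV.tlists_induct)
    case Nil
    then show ?case by (simp add: \<tau>_Nil TV.T_zero[symmetric])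
  next
    case q: (Cons b y ys)
    let ?r = "[(a \<otimes>\<^bsub>A\<^esub> c \<otimes>\<^bsub>A\<^esub> b, jtriple V s x y z). (c, z) \<leftarrow> xs]"
    have r: "[(a \<otimes>\<^bsub>A\<^esub> c \<otimes>\<^bsub>A\<^esub> b, jtriple V s x y z). (c, z) \<leftarrow> zs] \<in> TV.tlists s \<and>
      TV.tc s [(a \<otimes>\<^bsub>A\<^esub> c \<otimes>\<^bsub>A\<^esub> b, jtriple V s x y z). (c, z) \<leftarrow> zs] = \<tau> s [(a, x)] [(b, y)] zs" if "zs \<in> TV.tlists s" for zs
      using that
    proof (induction rule: TV.tlists_induct)
      case Nil
      then show ?case by (simp add: \<tau>_Nil TV.T_zero[symmetric])
    next
      case z: (Cons c z zs)
      let ?m = "[(a \<otimes>\<^bsub>A\<^esub> c \<otimes>\<^bsub>A\<^esub> b, jtriple V s x y z). (c, z) \<leftarrow> zs]"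
      have "TV.tc s ((a \<otimes>\<^bsub>A\<^esub> c \<otimes>\<^bsub>A\<^esub> b, t s x y z) # ?m) = TV.pt s (a \<otimes>\<^bsub>A\<^esub> c \<otimes>\<^bsub>A\<^esub> b) (t s x y z) \<oplus>\<^bsub>TV.T s\<^esub> TV.tc s ?m"
        using z q(1,2) Cons(1,2) TV.T_add[of "[(a \<otimes>\<^bsub>A\<^esub> c \<otimes>\<^bsub>A\<^esub> b, t s x y z)]" s ?m] by simp
      with z q(1,2) Cons(1,2) show ?case
        by (simp add: \<tau>_Cons(3)[of _ _ _ zs] \<tau>_single A.m_ac)
    qed
    have e: "?B ((b, y) # ys) = ?r @ ?B ys" by simp
    show ?case unfolding e using r[OF Cons(3)] q Cons(1-3)
      by (simp add: TV.T_add[symmetric] \<tau>_Cons(2)[of _ _ ys])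
  qed
  have e: "tensor_Q A V s ((a, x) # xs) ys = ?A ys @ ?B ys @ tensor_Q A V s xs ys" by simp
  have l: "?A ys \<in> TV.tlists s" "?B ys \<in> TV.tlists s" "tensor_Q A V s xs ys \<in> TV.tlists s" using A B Cons(4) by blast+
  have g: "((a \<oplus>\<^bsub>TV.T s\<^esub> a) \<oplus>\<^bsub>TV.T s\<^esub> b) \<oplus>\<^bsub>TV.T s\<^esub> (b \<oplus>\<^bsub>TV.T s\<^esub> (q \<oplus>\<^bsub>TV.T s\<^esub> q)) =
    (a \<oplus>\<^bsub>TV.T s\<^esub> (b \<oplus>\<^bsub>TV.T s\<^esub> q)) \<oplus>\<^bsub>TV.T s\<^esub> (a \<oplus>\<^bsub>TV.T s\<^esub> (b \<oplus>\<^bsub>TV.T s\<^esub> q))"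
    if "a \<in> carrier (TV.T s)" "b \<in> carrier (TV.T s)" "q \<in> carrier (TV.T s)" for a b q
    using that by (simp add: TV.T.a_ac)
  let ?Q = "TV.tc s (tensor_Q A V s xs ys)"
  have s: "\<tau> s xs ys [(a, x)] = TV.tc s (?B ys)" using B \<tau>_sym[of xs s ys "[(a, x)]"] Cons(1-3) assms(2) by simp
  have "\<tau> s ((a, x) # xs) ys ((a, x) # xs) =
      (\<tau> s [(a, x)] ys [(a, x)] \<oplus>\<^bsub>TV.T s\<^esub> \<tau> s [(a, x)] ys xs) \<oplus>\<^bsub>TV.T s\<^esub> (\<tau> s xs ys [(a, x)] \<oplus>\<^bsub>TV.T s\<^esub> \<tau> s xs ys xs)"
    using Cons(1-3) assms(2) \<tau>_Cons(1)[of xs s ys "(a, x) # xs" a x] \<tau>_Cons(3)[of "[(a, x)]" s ys xs a x] \<tau>_Cons(3)[of xs s ys xs a x]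
    by simp
  also have "\<dots> = ((TV.tc s (?A ys) \<oplus>\<^bsub>TV.T s\<^esub> TV.tc s (?A ys)) \<oplus>\<^bsub>TV.T s\<^esub> TV.tc s (?B ys)) \<oplus>\<^bsub>TV.T s\<^esub> (TV.tc s (?B ys) \<oplus>\<^bsub>TV.T s\<^esub> (?Q \<oplus>\<^bsub>TV.T s\<^esub> ?Q))"
    unfolding s using A B Cons(4) by simp
  also have "\<dots> = (TV.tc s (?A ys) \<oplus>\<^bsub>TV.T s\<^esub> (TV.tc s (?B ys) \<oplus>\<^bsub>TV.T s\<^esub> ?Q)) \<oplus>\<^bsub>TV.T s\<^esub> (TV.tc s (?A ys) \<oplus>\<^bsub>TV.T s\<^esub> (TV.tc s (?B ys) \<oplus>\<^bsub>TV.T s\<^esub> ?Q))"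
    by (rule g) (rule TV.tc_closed, rule l)+
  also have "TV.tc s (?A ys) \<oplus>\<^bsub>TV.T s\<^esub> (TV.tc s (?B ys) \<oplus>\<^bsub>TV.T s\<^esub> ?Q) = TV.tc s (tensor_Q A V s ((a, x) # xs) ys)"
    unfolding e using l by (simp only: TV.T_add TV.tlists_simps simp_thms)
  finally have 1: "TV.tc s (tensor_Q A V s ((a, x) # xs) ys) \<oplus>\<^bsub>TV.T s\<^esub> TV.tc s (tensor_Q A V s ((a, x) # xs) ys) = \<tau> s ((a, x) # xs) ys ((a, x) # xs)"
    by (rule HOL.sym)
  have 2: "tensor_Q A V s ((a, x) # xs) ys \<in> TV.tlists s"
    unfolding e using l by (simp only: TV.tlists_simps simp_thms)
  from 1 2 show ?case by (rule conjI[rotated])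
qed

lemma VT_Q:
  assumes "xs \<in> TV.tlists s" "ys \<in> TV.tlists (opp s)"
  shows "jQ VT s (TV.tc s xs) (TV.tc (opp s) ys) = TV.tc s (tensor_Q A V s xs ys)"
proof -
  have eq: "TV.tc s (tensor_Q A V s xs' ys') = TV.tc s (tensor_Q A V s xs ys)" if "TV.teq s xs xs'" "TV.teq (opp s) ys ys'" for xs' ys'
  proof (rule T_double)
    have l: "xs' \<in> TV.tlists s" "ys' \<in> TV.tlists (opp s)" using that TV.teq_lists by blast+
    show "TV.tc s (tensor_Q A V s xs' ys') \<in> carrier (TV.T s)" "TV.tc s (tensor_Q A V s xs ys) \<in> carrier (TV.T s)"
      by (rule TV.tc_closed, use tensor_Q_double[OF l] tensor_Q_double[OF assms] in blast)+
    show "TV.tc s (tensor_Q A V s xs' ys') \<oplus>\<^bsub>TV.T s\<^esub> TV.tc s (tensor_Q A V s xs' ys') =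
      TV.tc s (tensor_Q A V s xs ys) \<oplus>\<^bsub>TV.T s\<^esub> TV.tc s (tensor_Q A V s xs ys)"
      using tensor_Q_double[OF l] tensor_Q_double[OF assms] \<tau>_cong[OF that that(1)] by simp
  qed
  have "(\<Union>ys'\<in>TV.tc (opp s) ys. TV.tc s (tensor_Q A V s xs' ys')) = TV.tc s (tensor_Q A V s xs ys)" if "TV.teq s xs xs'" for xs'
    using TV.Union_tc[OF assms(2), of "\<lambda>ys'. TV.tc s (tensor_Q A V s xs' ys')"] eq[OF that] TV.teq_refl[OF assms(2)] by simp
  then show ?thesis
    using TV.Union_tc[OF assms(1), of "\<lambda>xs'. \<Union>ys'\<in>TV.tc (opp s) ys. TV.tc s (tensor_Q A V s xs' ys')"] TV.teq_refl[OF assms(1)]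
    by (simp add: jtensor_def)
qed

lemma VT_t:
  assumes "xs \<in> TV.tlists s" "ys \<in> TV.tlists (opp s)" "zs \<in> TV.tlists s"
  shows "jtriple VT s (TV.tc s xs) (TV.tc (opp s) ys) (TV.tc s zs) = \<tau> s xs ys zs"
proof (rule T_double)
  let ?q = "\<lambda>xs. TV.tc s (tensor_Q A V s xs ys)"
  have q: "?q us \<in> carrier (TV.T s)" "?q us \<oplus>\<^bsub>TV.T s\<^esub> ?q us = \<tau> s us ys us" if "us \<in> TV.tlists s" for us
    by (rule TV.tc_closed[OF tensor_Q_double[OF that assms(2), THEN conjunct1]],
        rule tensor_Q_double[OF that assms(2), THEN conjunct2])
  have xz: "xs @ zs \<in> TV.tlists s" using assms by simp
  have e: "jtriple VT s (TV.tc s xs) (TV.tc (opp s) ys) (TV.tc s zs) = (?q (xs @ zs) \<ominus>\<^bsub>TV.T s\<^esub> ?q xs) \<ominus>\<^bsub>TV.T s\<^esub> ?q zs"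
    using assms by (simp add: jtriple_def[of VT] TV.T_add VT_Q)
  show "jtriple VT s (TV.tc s xs) (TV.tc (opp s) ys) (TV.tc s zs) \<in> carrier (TV.T s)"
    unfolding e using q assms xz by simp
  show "\<tau> s xs ys zs \<in> carrier (TV.T s)" by (rule \<tau>_closed[OF assms])
  have "(?q (xs @ zs) \<ominus>\<^bsub>TV.T s\<^esub> ?q xs \<ominus>\<^bsub>TV.T s\<^esub> ?q zs) \<oplus>\<^bsub>TV.T s\<^esub> (?q (xs @ zs) \<ominus>\<^bsub>TV.T s\<^esub> ?q xs \<ominus>\<^bsub>TV.T s\<^esub> ?q zs)
    = (?q (xs @ zs) \<oplus>\<^bsub>TV.T s\<^esub> ?q (xs @ zs)) \<ominus>\<^bsub>TV.T s\<^esub> (?q xs \<oplus>\<^bsub>TV.T s\<^esub> ?q xs) \<ominus>\<^bsub>TV.T s\<^esub> (?q zs \<oplus>\<^bsub>TV.T s\<^esub> ?q zs)"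
    using q(1)[OF xz] q(1)[OF assms(1)] q(1)[OF assms(3)] by (simp add: a_minus_def TV.T.minus_add TV.T.a_ac)
  also have "\<dots> = \<tau> s (xs @ zs) ys (xs @ zs) \<ominus>\<^bsub>TV.T s\<^esub> \<tau> s xs ys xs \<ominus>\<^bsub>TV.T s\<^esub> \<tau> s zs ys zs"
    using q(2) assms xz by simp
  also have "\<dots> = \<tau> s xs ys zs \<oplus>\<^bsub>TV.T s\<^esub> \<tau> s zs ys xs"
    using assms by (simp add: \<tau>_append1 \<tau>_append3 \<tau>_closed TV.T.diff_eq TV.T.a_ac)
  also have "\<tau> s zs ys xs = \<tau> s xs ys zs" by (rule \<tau>_sym[OF assms(3,2,1)])
  finally show "jtriple VT s (TV.tc s xs) (TV.tc (opp s) ys) (TV.tc s zs) \<oplus>\<^bsub>TV.T s\<^esub> jtriple VT s (TV.tc s xs) (TV.tc (opp s) ys) (TV.tc s zs) =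
    \<tau> s xs ys zs \<oplus>\<^bsub>TV.T s\<^esub> \<tau> s xs ys zs"
    unfolding e .
qed

lemma \<tau>_scale:
  assumes "r \<in> carrier A" "xs \<in> TV.tlists s" "ys \<in> TV.tlists (opp s)" "zs \<in> TV.tlists s"
  shows "\<tau> s (TV.scale r xs) ys zs = r \<odot>\<^bsub>TV.T s\<^esub> \<tau> s xs ys zs" "\<tau> s xs (TV.scale r ys) zs = r \<odot>\<^bsub>TV.T s\<^esub> \<tau> s xs ys zs"
proof -
  have h: "lsum (TV.T s) (\<lambda>p. r \<odot>\<^bsub>TV.T s\<^esub> f p) ps = r \<odot>\<^bsub>TV.T s\<^esub> lsum (TV.T s) f ps" if "\<And>p. p \<in> set ps \<Longrightarrow> f p \<in> carrier (TV.T s)" for f and ps :: "('c \<times> 'a) list"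
    using that assms(1) by (intro TV.T.lsum_hom[symmetric]) (auto simp: TV.T.smult_r_distr TV.T_abelian_group)
  have 1: "lsum (TV.T s) (row s (r \<otimes>\<^bsub>A\<^esub> a) x b y) zs = r \<odot>\<^bsub>TV.T s\<^esub> lsum (TV.T s) (row s a x b y) zs"
    "lsum (TV.T s) (row s a x (r \<otimes>\<^bsub>A\<^esub> b) y) zs = r \<odot>\<^bsub>TV.T s\<^esub> lsum (TV.T s) (row s a x b y) zs"
    if "a \<in> carrier A" "x \<in> jcarrier V s" "b \<in> carrier A" "y \<in> jcarrier V (opp s)" for a x b y
    using that assms(1,4) by (subst h[symmetric]; auto intro!: lsum_cong simp: TV.pt_smult A.m_ac dest!: TV.tlistsD)+
  have S: "lsum (TV.T s) g ps = r \<odot>\<^bsub>TV.T s\<^esub> lsum (TV.T s) f ps"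
    if "\<And>a x. (a, x) \<in> set ps \<Longrightarrow> f (a, x) \<in> carrier (TV.T s) \<and> g (a, x) = r \<odot>\<^bsub>TV.T s\<^esub> f (a, x)"
    for f g and ps :: "('c \<times> 'a) list"
  proof -
    have "lsum (TV.T s) g ps = lsum (TV.T s) (\<lambda>p. r \<odot>\<^bsub>TV.T s\<^esub> f p) ps"
    proof (rule lsum_cong)
      fix p assume "p \<in> set ps"
      then show "g p = r \<odot>\<^bsub>TV.T s\<^esub> f p" using that[of "fst p" "snd p"] by simp
    qed
    also have "\<dots> = r \<odot>\<^bsub>TV.T s\<^esub> lsum (TV.T s) f ps"
    proof (rule h)
      fix p assume "p \<in> set ps"
      then show "f p \<in> carrier (TV.T s)" using that[of "fst p" "snd p"] by simp
    qed
    finally show ?thesis .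
  qed
  have 2: "lsum (TV.T s) (\<lambda>(b, y). lsum (TV.T s) (row s (r \<otimes>\<^bsub>A\<^esub> a) x b y) zs) ys = r \<odot>\<^bsub>TV.T s\<^esub> lsum (TV.T s) (\<lambda>(b, y). lsum (TV.T s) (row s a x b y) zs) ys"
    if ax: "a \<in> carrier A" "x \<in> jcarrier V s" for a x
  proof (rule S)
    fix b y assume "(b, y) \<in> set ys"
    then have "b \<in> carrier A" "y \<in> jcarrier V (opp s)" using TV.tlistsD assms(3) by blast+
    then show "(\<lambda>(b, y). lsum (TV.T s) (row s a x b y) zs) (b, y) \<in> carrier (TV.T s) \<and>
      (\<lambda>(b, y). lsum (TV.T s) (row s (r \<otimes>\<^bsub>A\<^esub> a) x b y) zs) (b, y) = r \<odot>\<^bsub>TV.T s\<^esub> (\<lambda>(b, y). lsum (TV.T s) (row s a x b y) zs) (b, y)"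
      unfolding prod.case using ax assms(4) by (intro conjI row_closed 1(1))
  qed
  have 3: "lsum (TV.T s) (\<lambda>(b, y). lsum (TV.T s) (row s a x b y) zs) (TV.scale r ys) = r \<odot>\<^bsub>TV.T s\<^esub> lsum (TV.T s) (\<lambda>(b, y). lsum (TV.T s) (row s a x b y) zs) ys"
    if ax: "a \<in> carrier A" "x \<in> jcarrier V s" for a x
    unfolding lsum_map
  proof (rule S)
    fix b y assume "(b, y) \<in> set ys"
    then have "b \<in> carrier A" "y \<in> jcarrier V (opp s)" using TV.tlistsD assms(3) by blast+
    then show "(\<lambda>(b, y). lsum (TV.T s) (row s a x b y) zs) (b, y) \<in> carrier (TV.T s) \<and>
      (case (case (b, y) of (b, y) \<Rightarrow> (r \<otimes>\<^bsub>A\<^esub> b, y)) of (b, y) \<Rightarrow> lsum (TV.T s) (row s a x b y) zs) = r \<odot>\<^bsub>TV.T s\<^esub> (\<lambda>(b, y). lsum (TV.T s) (row s a x b y) zs) (b, y)"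
      unfolding prod.case using ax assms(4) by (intro conjI row_closed 1(2))
  qed
  show "\<tau> s (TV.scale r xs) ys zs = r \<odot>\<^bsub>TV.T s\<^esub> \<tau> s xs ys zs"
    unfolding \<tau>_def lsum_map
  proof (rule S)
    fix a x assume "(a, x) \<in> set xs"
    then have "a \<in> carrier A" "x \<in> jcarrier V s" using TV.tlistsD assms(2) by blast+
    then show "(\<lambda>(a, x). lsum (TV.T s) (\<lambda>(b, y). lsum (TV.T s) (row s a x b y) zs) ys) (a, x) \<in> carrier (TV.T s) \<and>
      (case (case (a, x) of (a, x) \<Rightarrow> (r \<otimes>\<^bsub>A\<^esub> a, x)) of (a, x) \<Rightarrow> lsum (TV.T s) (\<lambda>(b, y). lsum (TV.T s) (row s a x b y) zs) ys) =
      r \<odot>\<^bsub>TV.T s\<^esub> (\<lambda>(a, x). lsum (TV.T s) (\<lambda>(b, y). lsum (TV.T s) (row s a x b y) zs) ys) (a, x)"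
      unfolding prod.case using assms(3,4) by (intro conjI mat_closed 2)
  qed
  show "\<tau> s xs (TV.scale r ys) zs = r \<odot>\<^bsub>TV.T s\<^esub> \<tau> s xs ys zs"
    unfolding \<tau>_def
  proof (rule S)
    fix a x assume "(a, x) \<in> set xs"
    then have "a \<in> carrier A" "x \<in> jcarrier V s" using TV.tlistsD assms(2) by blast+
    then show "(\<lambda>(a, x). lsum (TV.T s) (\<lambda>(b, y). lsum (TV.T s) (row s a x b y) zs) ys) (a, x) \<in> carrier (TV.T s) \<and>
      (\<lambda>(a, x). lsum (TV.T s) (\<lambda>(b, y). lsum (TV.T s) (row s a x b y) zs) (TV.scale r ys)) (a, x) =
      r \<odot>\<^bsub>TV.T s\<^esub> (\<lambda>(a, x). lsum (TV.T s) (\<lambda>(b, y). lsum (TV.T s) (row s a x b y) zs) ys) (a, x)"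
      unfolding prod.case using assms(3,4) by (intro conjI mat_closed 3)
  qed
qed

lemma VT_sym:
  assumes "X \<in> carrier (TV.T s)" "Y \<in> carrier (TV.T (opp s))" "Z \<in> carrier (TV.T s)"
  shows "jtriple VT s X Y Z = jtriple VT s Z Y X"
  using assms by (elim TV.T_cases) (simp add: VT_t \<tau>_sym)

lemma VT_system: "half_triple_system A VT hA"
proof -
  have a1: "jtriple VT s (X \<oplus>\<^bsub>TV.T s\<^esub> X') Y Z = jtriple VT s X Y Z \<oplus>\<^bsub>TV.T s\<^esub> jtriple VT s X' Y Z"
    if "X \<in> carrier (TV.T s)" "X' \<in> carrier (TV.T s)" "Y \<in> carrier (TV.T (opp s))" "Z \<in> carrier (TV.T s)" for s X X' Y Z
    using that by (elim TV.T_cases) (simp add: VT_t TV.T_add \<tau>_append1)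
  have s1: "jtriple VT s (r \<odot>\<^bsub>TV.T s\<^esub> X) Y Z = r \<odot>\<^bsub>TV.T s\<^esub> jtriple VT s X Y Z"
    if "r \<in> carrier A" "X \<in> carrier (TV.T s)" "Y \<in> carrier (TV.T (opp s))" "Z \<in> carrier (TV.T s)" for r s X Y Z
    using that(2-4) that(1) by (elim TV.T_cases) (simp add: VT_t TV.T_smult \<tau>_scale del: map_map)
  show ?thesis
  proof (rule half_triple_system.intro[OF triple_system.intro half_triple_system_axioms.intro])
    show "module A (jmod VT s)" for s by (simp add: TV.T_module)
    show "jtriple VT s X Y Z \<in> jcarrier VT s"
      if "X \<in> jcarrier VT s" "Y \<in> jcarrier VT (opp s)" "Z \<in> jcarrier VT s" for s X Y Z
      using that unfolding VT_mod by (elim TV.T_cases) (simp add: VT_t \<tau>_closed)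
    show "jtriple VT s (X \<oplus>\<^bsub>jmod VT s\<^esub> X') Y Z = jtriple VT s X Y Z \<oplus>\<^bsub>jmod VT s\<^esub> jtriple VT s X' Y Z"
      if "X \<in> jcarrier VT s" "X' \<in> jcarrier VT s" "Y \<in> jcarrier VT (opp s)" "Z \<in> jcarrier VT s" for s X X' Y Z
      using that a1 by simp
    show "jtriple VT s X (Y \<oplus>\<^bsub>jmod VT (opp s)\<^esub> Y') Z = jtriple VT s X Y Z \<oplus>\<^bsub>jmod VT s\<^esub> jtriple VT s X Y' Z"
      if "X \<in> jcarrier VT s" "Y \<in> jcarrier VT (opp s)" "Y' \<in> jcarrier VT (opp s)" "Z \<in> jcarrier VT s" for s X Y Y' Z
      using that unfolding VT_mod by (elim TV.T_cases) (simp add: VT_t TV.T_add \<tau>_append2)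
    show "jtriple VT s X Y (Z \<oplus>\<^bsub>jmod VT s\<^esub> Z') = jtriple VT s X Y Z \<oplus>\<^bsub>jmod VT s\<^esub> jtriple VT s X Y Z'"
      if "X \<in> jcarrier VT s" "Y \<in> jcarrier VT (opp s)" "Z \<in> jcarrier VT s" "Z' \<in> jcarrier VT s" for s X Y Z Z'
      using that a1[of Z s Z' Y X] by (simp add: VT_sym[of X])
    show "jtriple VT s (r \<odot>\<^bsub>jmod VT s\<^esub> X) Y Z = r \<odot>\<^bsub>jmod VT s\<^esub> jtriple VT s X Y Z"
      if "r \<in> carrier A" "X \<in> jcarrier VT s" "Y \<in> jcarrier VT (opp s)" "Z \<in> jcarrier VT s" for r s X Y Z
      using that s1 by simp
    show "jtriple VT s X (r \<odot>\<^bsub>jmod VT (opp s)\<^esub> Y) Z = r \<odot>\<^bsub>jmod VT s\<^esub> jtriple VT s X Y Z"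
      if "r \<in> carrier A" "X \<in> jcarrier VT s" "Y \<in> jcarrier VT (opp s)" "Z \<in> jcarrier VT s" for r s X Y Z
      using that(2-4) that(1) unfolding VT_mod by (elim TV.T_cases) (simp add: VT_t TV.T_smult \<tau>_scale del: map_map)
    show "jtriple VT s X Y (r \<odot>\<^bsub>jmod VT s\<^esub> Z) = r \<odot>\<^bsub>jmod VT s\<^esub> jtriple VT s X Y Z"
      if "r \<in> carrier A" "X \<in> jcarrier VT s" "Y \<in> jcarrier VT (opp s)" "Z \<in> jcarrier VT s" for r s X Y Z
      using that s1[of r Z s Y X] by (simp add: VT_sym[of X])
    show "hA \<in> carrier A" "hA \<oplus>\<^bsub>A\<^esub> hA = \<one>\<^bsub>A\<^esub>" by (rule hA)+
    show "jQ VT s X Y \<in> jcarrier VT s" if "X \<in> jcarrier VT s" "Y \<in> jcarrier VT (opp s)" for s X Y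
      using that tensor_Q_double unfolding VT_mod by (elim TV.T_cases) (simp add: VT_Q)
    show "jtriple VT s X Y X = jQ VT s X Y \<oplus>\<^bsub>jmod VT s\<^esub> jQ VT s X Y" if "X \<in> jcarrier VT s" "Y \<in> jcarrier VT (opp s)" for s X Y
      using that tensor_Q_double unfolding VT_mod by (elim TV.T_cases) (simp add: VT_Q VT_t)
    show "jtriple VT s X Y Z = jtriple VT s Z Y X" if "X \<in> jcarrier VT s" "Y \<in> jcarrier VT (opp s)" "Z \<in> jcarrier VT s" for s X Y Z
      using that VT_sym by simp
  qed
qed

end

section \<open>Maps out of tensor products\<close>

lemma (in module) submoduleI':
  assumes "H \<subseteq> carrier M" "\<zero>\<^bsub>M\<^esub> \<in> H" "\<And>x y. x \<in> H \<Longrightarrow> y \<in> H \<Longrightarrow> x \<oplus>\<^bsub>M\<^esub> y \<in> H"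
    "\<And>r x. r \<in> carrier R \<Longrightarrow> x \<in> H \<Longrightarrow> r \<odot>\<^bsub>M\<^esub> x \<in> H"
  shows "submodule H R M"
proof -
  have "\<ominus>\<^bsub>M\<^esub> x \<in> H" if "x \<in> H" for x
  proof -
    have "x \<in> carrier M" using that assms(1) by blast
    then have "\<ominus>\<^bsub>M\<^esub> x = (\<ominus>\<^bsub>R\<^esub> \<one>\<^bsub>R\<^esub>) \<odot>\<^bsub>M\<^esub> x" by (simp add: smult_l_minus)
    then show ?thesis using assms(4)[OF _ that, of "\<ominus>\<^bsub>R\<^esub> \<one>\<^bsub>R\<^esub>"] by simp
  qed
  with assms show ?thesis by (intro submoduleI) blast+
qed

lemma (in abelian_group) minus_zero_eq [simp]: "\<ominus> \<zero> = \<zero>"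
  by (rule minus_equality) simp_all

lemma (in abelian_group) diff_zero_eq [simp]: "x \<in> carrier G \<Longrightarrow> x \<ominus> \<zero> = x"
  by (simp add: a_minus_def)

locale tensor_lift = tensor_module R A M + G: abelian_group G
  for R :: "('r, 'e) ring_scheme" and A :: "('r, 'c, 'f) module_scheme" and M :: "('r, 'a, 'g) module_scheme"
    and G :: "('h, 'k) ring_scheme" +
  fixes B :: "'c \<Rightarrow> 'a \<Rightarrow> 'h"
  assumes B_closed: "a \<in> carrier A \<Longrightarrow> x \<in> carrier M \<Longrightarrow> B a x \<in> carrier G"
    and B_add_left: "\<lbrakk>a \<in> carrier A; b \<in> carrier A; x \<in> carrier M\<rbrakk> \<Longrightarrow> B (a \<oplus>\<^bsub>A\<^esub> b) x = B a x \<oplus>\<^bsub>G\<^esub> B b x"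
    and B_add_right: "\<lbrakk>a \<in> carrier A; x \<in> carrier M; y \<in> carrier M\<rbrakk> \<Longrightarrow> B a (x \<oplus>\<^bsub>M\<^esub> y) = B a x \<oplus>\<^bsub>G\<^esub> B a y"
    and B_balance: "\<lbrakk>r \<in> carrier R; a \<in> carrier A; x \<in> carrier M\<rbrakk> \<Longrightarrow> B (r \<odot>\<^bsub>A\<^esub> a) x = B a (r \<odot>\<^bsub>M\<^esub> x)"
begin

definition "lift X = lsum G (\<lambda>(a, x). B a x) (SOME xs. xs \<in> X)"

lemma lift_tc:
  assumes "xs \<in> tlists"
  shows "lift (tc xs) = lsum G (\<lambda>(a, x). B a x) xs"
proof -
  have "xs \<in> tc xs" using teq_refl[OF assms] by (simp only: tc_mem)
  then have "(SOME ys. ys \<in> tc xs) \<in> tc xs" by (rule someI)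
  then have "teq xs (SOME ys. ys \<in> tc xs)" by (simp only: tc_mem)
  then have "lsum G (\<lambda>(a, x). B a x) xs = lsum G (\<lambda>(a, x). B a x) (SOME ys. ys \<in> tc xs)"
    by (rule teq_lift[OF _ G.abelian_group_axioms]) (simp_all add: B_closed B_add_left B_add_right B_balance)
  then show ?thesis unfolding lift_def by (rule HOL.sym)
qed

lemma list_closed: "xs \<in> tlists \<Longrightarrow> p \<in> set xs \<Longrightarrow> (\<lambda>(a, x). B a x) p \<in> carrier G"
  by (cases p) (auto dest!: tlistsD intro: B_closed)

lemma lift_closed [simp]: "X \<in> carrier T \<Longrightarrow> lift X \<in> carrier G"
  by (elim T_cases) (simp add: lift_tc G.lsum_closed list_closed)

lemma lift_add: "X \<in> carrier T \<Longrightarrow> Y \<in> carrier T \<Longrightarrow> lift (X \<oplus>\<^bsub>T\<^esub> Y) = lift X \<oplus>\<^bsub>G\<^esub> lift Y"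
proof (elim T_cases)
  fix xs ys assume *: "xs \<in> tlists" "ys \<in> tlists" "X = tc xs" "Y = tc ys"
  have "lsum G (\<lambda>(a, x). B a x) (xs @ ys) = lsum G (\<lambda>(a, x). B a x) xs \<oplus>\<^bsub>G\<^esub> lsum G (\<lambda>(a, x). B a x) ys"
    using * by (intro G.lsum_append) (auto dest!: tlistsD intro: B_closed)
  then show ?thesis using * by (simp add: T_add lift_tc)
qed

lemma lift_pt: "a \<in> carrier A \<Longrightarrow> x \<in> carrier M \<Longrightarrow> lift (pt a x) = B a x"
  by (simp add: lift_tc B_closed)

lemma lift_zero: "lift \<zero>\<^bsub>T\<^esub> = \<zero>\<^bsub>G\<^esub>"
  by (simp add: T_zero lift_tc)

lemma lift_diff:
  assumes "X \<in> carrier T" "Y \<in> carrier T"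
  shows "lift (X \<ominus>\<^bsub>T\<^esub> Y) = lift X \<ominus>\<^bsub>G\<^esub> lift Y"
proof -
  have "(X \<ominus>\<^bsub>T\<^esub> Y) \<oplus>\<^bsub>T\<^esub> Y = X" using assms by (simp add: a_minus_def T.a_assoc T.l_neg)
  then have "lift X = lift (X \<ominus>\<^bsub>T\<^esub> Y) \<oplus>\<^bsub>G\<^esub> lift Y" using lift_add[of "X \<ominus>\<^bsub>T\<^esub> Y" Y] assms by simp
  then show ?thesis using assms by (simp add: a_minus_def[of G] G.a_assoc G.r_neg)
qed

end

context nondeg_pair
begin

section \<open>The extended central closure of the pair\<close>

lemma psi_closed [simp]: "c \<in> carrier JC \<Longrightarrow> psi c \<in> carrier C"
  using psi_image by blast

lemmas psi_add = psi_hom(1)[THEN conjunct2] and psi_mult = psi_hom(2)[THEN conjunct2]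
  and psi_smult = psi_hom(3)[THEN conjunct2] and psi_one = psi_hom(5)

definition "phi c = inv_into (carrier JC) psi c"

lemma phi_closed [simp]: "c \<in> carrier C \<Longrightarrow> phi c \<in> carrier JC"
  unfolding phi_def using inv_into_into[of c psi "carrier JC"] by (simp only: psi_image)

lemma psi_phi [simp]: "c \<in> carrier C \<Longrightarrow> psi (phi c) = c"
  unfolding phi_def using f_inv_into_f[of c psi "carrier JC"] by (simp only: psi_image)

lemma phi_psi [simp]: "c \<in> carrier JC \<Longrightarrow> phi (psi c) = c"
  unfolding phi_def by (rule inv_into_f_f[OF psi_inj])

lemma half_triple: "half_triple_system R V hf"
proof (rule half_triple_system.intro[OF _ half_triple_system_axioms.intro])
  show "triple_system R V" by (rule triple_system_axioms)
  show "hf \<in> carrier R" by simp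
  have "hf \<otimes>\<^bsub>R\<^esub> (\<one>\<^bsub>R\<^esub> \<oplus>\<^bsub>R\<^esub> \<one>\<^bsub>R\<^esub>) = \<one>\<^bsub>R\<^esub>" unfolding hf_def using half by (rule M.R.Units_l_inv)
  then show "hf \<oplus>\<^bsub>R\<^esub> hf = \<one>\<^bsub>R\<^esub>" by (simp add: M.R.r_distr)
  show "jQ V s x y \<in> jcarrier V s" if "x \<in> jcarrier V s" "y \<in> jcarrier V (opp s)" for x s y
    using that by (rule J.Q_closed)
  show "t s x y x = pl s (jQ V s x y) (jQ V s x y)" if "x \<in> jcarrier V s" "y \<in> jcarrier V (opp s)" for x s y
    using that by (rule t_diag)
  show "t s x y z = t s z y x" if "x \<in> jcarrier V s" "y \<in> jcarrier V (opp s)" "z \<in> jcarrier V s" for x s y z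
    using that by (rule triple_sym)
qed

sublocale TS: tensor_system R V hf JC
  by (rule tensor_system.intro[OF half_triple JC_algebra])

sublocale TW: half_triple_system JC TS.VT TS.hA
  by (rule TS.VT_system)

lemma phi_eq: "e \<in> carrier JC \<Longrightarrow> psi e = c \<Longrightarrow> phi c = e"
  by (drule HOL.sym) simp

lemma phi_hom:
  "a \<in> carrier C \<Longrightarrow> b \<in> carrier C \<Longrightarrow> phi (a \<oplus>\<^bsub>C\<^esub> b) = phi a \<oplus>\<^bsub>JC\<^esub> phi b"
  "a \<in> carrier C \<Longrightarrow> b \<in> carrier C \<Longrightarrow> phi (a \<otimes>\<^bsub>C\<^esub> b) = phi a \<otimes>\<^bsub>JC\<^esub> phi b"
  "r \<in> carrier R \<Longrightarrow> a \<in> carrier C \<Longrightarrow> phi (r \<odot>\<^bsub>C\<^esub> a) = r \<odot>\<^bsub>JC\<^esub> phi a"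
  "phi \<one>\<^bsub>C\<^esub> = \<one>\<^bsub>JC\<^esub>"
  by (rule phi_eq; simp add: psi_add psi_mult psi_smult psi_one)+

lemmas VT_add = TW.t_add1[unfolded TS.VT_mod] TW.t_add2[unfolded TS.VT_mod] TW.t_add3[unfolded TS.VT_mod]
lemmas VT_closed = TW.t_closed[unfolded TS.VT_mod]
lemmas VT_zero = TW.t_zero[unfolded TS.VT_mod]

lemma VT_pt:
  assumes "a \<in> carrier JC" "x \<in> jcarrier V s" "b \<in> carrier JC" "y \<in> jcarrier V (opp s)" "c \<in> carrier JC" "z \<in> jcarrier V s"
  shows "TW.t s (TS.TV.pt s a x) (TS.TV.pt (opp s) b y) (TS.TV.pt s c z) = TS.TV.pt s (a \<otimes>\<^bsub>JC\<^esub> b \<otimes>\<^bsub>JC\<^esub> c) (t s x y z)"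
  using assms TS.VT_t[of "[(a, x)]" s "[(b, y)]" "[(c, z)]"] by (simp add: TS.\<tau>_single)

sublocale LAM: tensor_lift R JC "jmod V s" TL.T "\<lambda>c x. TL.pt (psi c) (emb s x)" for s
proof (rule tensor_lift.intro[OF _ _ tensor_lift_axioms.intro])
  show "tensor_module R JC (jmod V s)" by (rule TS.TV.tensor_module_axioms)
  show "abelian_group TL.T" by (rule TL.T_abelian_group)
qed (simp_all add: psi_add psi_smult emb_add emb_smult TL.pt_add_left TL.pt_add_right TL.pt_balance)

abbreviation Lam where "Lam \<equiv> LAM.lift"

lemma Lam_smult: "X \<in> carrier (TS.TV.T s) \<Longrightarrow> c \<in> carrier JC \<Longrightarrow> Lam s (c \<odot>\<^bsub>TS.TV.T s\<^esub> X) = psi c \<odot>\<^bsub>TL.T\<^esub> Lam s X"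
proof (induction X rule: TS.TV.T_induct)
  case zero
  then show ?case by (simp add: LAM.lift_zero)
next
  case (add a x Y)
  then show ?case
    by (simp add: TS.TV.T.smult_r_distr TS.TV.pt_smult LAM.lift_add LAM.lift_pt psi_mult TL.pt_smult TL.T.smult_r_distr)
qed

text \<open>
  The triple product of \<open>V\<close> is the iterated bracket \<open>[[x, y], z]\<close> in \<open>L\<close>, and the embedding of \<open>V\<close> into \<open>L\<close>
  keeps this property after the scalar extension along \<open>psi\<close>.
\<close>

lemma Lam_triple:
  assumes "X \<in> carrier (TS.TV.T s)" "Y \<in> carrier (TS.TV.T (opp s))" "Z \<in> carrier (TS.TV.T s)"
  shows "Lam s (TW.t s X Y Z) = (Lam s X \<otimes>\<^bsub>TL.T\<^esub> Lam (opp s) Y) \<otimes>\<^bsub>TL.T\<^esub> Lam s Z"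
  using assms(1)
proof (induction X rule: TS.TV.T_induct)
  case zero
  then show ?case using assms(2,3) by (simp add: VT_zero LAM.lift_zero TL_zero_mult)
next
  case p: (add a x X)
  have "Lam s (TW.t s (TS.TV.pt s a x) Y Z) = (Lam s (TS.TV.pt s a x) \<otimes>\<^bsub>TL.T\<^esub> Lam (opp s) Y) \<otimes>\<^bsub>TL.T\<^esub> Lam s Z"
    using assms(2)
  proof (induction Y rule: TS.TV.T_induct)
    case zero
    then show ?case using assms(3) p(1,2) by (simp add: VT_zero LAM.lift_zero TL_zero_mult)
  next
    case q: (add b y Y)
    have "Lam s (TW.t s (TS.TV.pt s a x) (TS.TV.pt (opp s) b y) Z) =
      (Lam s (TS.TV.pt s a x) \<otimes>\<^bsub>TL.T\<^esub> Lam (opp s) (TS.TV.pt (opp s) b y)) \<otimes>\<^bsub>TL.T\<^esub> Lam s Z"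
      using assms(3)
    proof (induction Z rule: TS.TV.T_induct)
      case zero
      then show ?case using p(1,2) q(1,2) by (simp add: VT_zero LAM.lift_zero TL_zero_mult TL.T_mult_closed)
    next
      case r: (add c z Z)
      have "Lam s (TW.t s (TS.TV.pt s a x) (TS.TV.pt (opp s) b y) (TS.TV.pt s c z)) =
        (Lam s (TS.TV.pt s a x) \<otimes>\<^bsub>TL.T\<^esub> Lam (opp s) (TS.TV.pt (opp s) b y)) \<otimes>\<^bsub>TL.T\<^esub> Lam s (TS.TV.pt s c z)"
        using p(1,2) q(1,2) r(1,2)
        by (simp add: VT_pt LAM.lift_pt TL.pt_mult L_mult_closed emb_triple psi_mult)
      with p(1,2) q(1,2) r show ?case
        by (simp add: VT_add VT_closed LAM.lift_add TL.T_mult_add_right TL.T_mult_closed)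
    qed
    with p(1,2) q assms(3) show ?case
      by (simp add: VT_add VT_closed LAM.lift_add TL.T_mult_add_left TL.T_mult_add_right TL.T_mult_closed)
  qed
  with p assms(2,3) show ?case
    by (simp add: VT_add VT_closed LAM.lift_add TL.T_mult_add_left TL.T_mult_closed)
qed

text \<open>
  The trace of \<open>NL\<close> on the scalar extension of the pair.
\<close>

definition "MV s = {X \<in> carrier (TS.TV.T s). Lam s X \<in> NL}"

lemma MV_jideal: "jideal JC TS.VT MV"
proof (rule TW.jideal_triple)
  show "submodule (MV s) JC (jmod TS.VT s)" for s
    unfolding TS.VT_mod
  proof (rule TS.TV.T.submoduleI')
    show "MV s \<subseteq> carrier (TS.TV.T s)" by (auto simp: MV_def)
    show "\<zero>\<^bsub>TS.TV.T s\<^esub> \<in> MV s" by (simp add: MV_def LAM.lift_zero NL_zero)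
    show "X \<oplus>\<^bsub>TS.TV.T s\<^esub> Y \<in> MV s" if "X \<in> MV s" "Y \<in> MV s" for X Y
      using that by (simp add: MV_def LAM.lift_add NL_add)
    show "c \<odot>\<^bsub>TS.TV.T s\<^esub> X \<in> MV s" if "c \<in> carrier JC" "X \<in> MV s" for c X
      using that by (simp add: MV_def Lam_smult NL_smult)
  qed
  show "TW.t s u y z \<in> MV s" if "u \<in> MV s" "y \<in> jcarrier TS.VT (opp s)" "z \<in> jcarrier TS.VT s" for s u y z
    using that unfolding TS.VT_mod by (simp add: MV_def VT_closed Lam_triple NL_bracket_right)
  show "TW.t s x u z \<in> MV s" if "x \<in> jcarrier TS.VT s" "u \<in> MV (opp s)" "z \<in> jcarrier TS.VT s" for s u x z
    using that unfolding TS.VT_mod by (simp add: MV_def VT_closed Lam_triple NL_bracket NL_bracket_right)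
qed

lemma MV_one: "x \<in> jcarrier V s \<Longrightarrow> TS.TV.pt s \<one>\<^bsub>JC\<^esub> x \<in> MV s \<Longrightarrow> x = ze s"
proof -
  assume x: "x \<in> jcarrier V s" and "TS.TV.pt s \<one>\<^bsub>JC\<^esub> x \<in> MV s"
  then have "TL.pt \<one>\<^bsub>C\<^esub> (emb s x) \<in> NL" by (simp add: MV_def LAM.lift_pt psi_one)
  then have "emb s x = \<zero>\<^bsub>L\<^esub>" using NL_pt x by simp
  then show ?thesis by (simp add: emb_zero[of s, symmetric] emb_inj)
qed

lemma MV_rel:
  assumes r: "\<rho> \<in> carrier JC" and g: "(g, U) \<in> PJ" and u: "u \<in> U s"
  shows "TS.TV.pt s (\<rho> \<otimes>\<^bsub>JC\<^esub> jc (g, U)) u \<ominus>\<^bsub>TS.TV.T s\<^esub> TS.TV.pt s \<rho> (g s u) \<in> MV s"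
proof -
  have g': "jess U" "lin U g" using g by (auto simp: PJ_iff)
  have uV: "u \<in> jcarrier V s" "g s u \<in> jcarrier V s" using jidD(2)[OF jessD[OF g'(1)] u] linD(1)[OF jessD[OF g'(1)] g'(2) u] by auto
  have c: "jc (g, U) \<in> carrier JC" unfolding JC_carrier using g by (rule imageI)
  have p: "psi (jc (g, U)) = lc (ext g, dom g U)" using psi_jc[OF g] by (simp add: pc_def)
  have "TL.pt (lc (ext g, dom g U)) (emb s u) \<ominus>\<^bsub>TL.T\<^esub> TL.pt \<one>\<^bsub>C\<^esub> (ext g (emb s u)) \<in> NL"
    by (rule NL_rel[OF ext_perm[OF g']]) (simp add: emb_dom[OF jessD[OF g'(1)] g'(2)] u)
  then have m: "psi \<rho> \<odot>\<^bsub>TL.T\<^esub> (TL.pt (lc (ext g, dom g U)) (emb s u) \<ominus>\<^bsub>TL.T\<^esub> TL.pt \<one>\<^bsub>C\<^esub> (emb s (g s u))) \<in> NL"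
    using r by (simp add: ext_emb[OF jessD[OF g'(1)] g'(2)] NL_smult)
  have C: "lc (ext g, dom g U) \<in> carrier C" using ext_perm[OF g'] by simp
  have "psi \<rho> \<odot>\<^bsub>TL.T\<^esub> (TL.pt (lc (ext g, dom g U)) (emb s u) \<ominus>\<^bsub>TL.T\<^esub> TL.pt \<one>\<^bsub>C\<^esub> (emb s (g s u))) =
    TL.pt (psi \<rho> \<otimes>\<^bsub>C\<^esub> lc (ext g, dom g U)) (emb s u) \<ominus>\<^bsub>TL.T\<^esub> TL.pt (psi \<rho>) (emb s (g s u))"
    using r uV C by (simp add: a_minus_def TL.T.smult_r_distr TL.T.smult_r_minus TL.pt_smult)
  then show ?thesis
    using m r uV c by (simp add: MV_def LAM.lift_diff LAM.lift_pt psi_mult p)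
qed

lemma jc_res:
  assumes "c \<in> carrier JC"
  shows "(res (ev (psi c)), Uof (dm (psi c))) \<in> PJ" "jc (res (ev (psi c)), Uof (dm (psi c))) = c"
proof -
  note f = rp[OF psi_closed[OF assms]]
  show p: "(res (ev (psi c)), Uof (dm (psi c))) \<in> PJ"
    using Uof_jess[OF permD(1)[OF f(1)]] res_lin[OF f(1)] by (simp add: PJ_iff)
  have "pc (res (ev (psi c)), Uof (dm (psi c))) = psi c"
    using PJ_pc[OF p f(1)] perm_graded(2)[OF f(1)] f(2) by (simp add: Uof_iff)
  then have "psi (jc (res (ev (psi c)), Uof (dm (psi c)))) = psi c" by (simp only: psi_jc[OF p])
  moreover have "jc (res (ev (psi c)), Uof (dm (psi c))) \<in> carrier JC" unfolding JC_carrier using p by (rule imageI)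
  ultimately show "jc (res (ev (psi c)), Uof (dm (psi c))) = c" using inj_onD[OF psi_inj] assms by blast
qed

lemma ev_emb:
  assumes "c \<in> carrier C" "u \<in> jcarrier V s" "emb s u \<in> dm c"
  shows "res (ev c) s u \<in> jcarrier V s" "ev c (emb s u) = emb s (res (ev c) s u)"
  using perm_graded[OF rp(1)[OF assms(1)], of u s] assms(2,3) by (simp_all add: Uof_iff)

definition "lam s = map (\<lambda>(c, x). (psi c, emb s x))"

lemma lam_simps [simp]: "lam s [] = []" "lam s ((c, x) # xs) = (psi c, emb s x) # lam s xs"
  by (simp_all add: lam_def)

lemma lam_lists [simp]: "xs \<in> TS.TV.tlists s \<Longrightarrow> lam s xs \<in> TL.tlists"
  by (induction rule: TS.TV.tlists_induct) simp_all

lemma Lam_tc: "xs \<in> TS.TV.tlists s \<Longrightarrow> Lam s (TS.TV.tc s xs) = TL.tc (lam s xs)"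
  by (simp add: LAM.lift_tc TL.tc_lsum) (simp add: lam_def lsum_map case_prod_unfold)

lemma Ev_same:
  assumes "xs \<in> TS.TV.tlists s" "ok (lam s xs) (emb s u)" "u \<in> jcarrier V s"
  shows "Ev (lam s xs) (emb s u) = \<zero>\<^bsub>L\<^esub>"
  using assms
proof (induction rule: TS.TV.tlists_induct)
  case (Cons c x xs)
  then show ?case using ev_emb[of "psi c" u s] by (simp add: emb_same)
qed simp

lemma emb_bracket_D:
  assumes "x \<in> jcarrier V s" "y \<in> jcarrier V (opp s)"
  shows "\<exists>d\<in>D. emb s x \<otimes>\<^bsub>L\<^esub> emb (opp s) y = (ze Pos, d, ze Neg)"
  using assms D_inv D_dl by (cases s) (auto simp: emb_bracket)

lemma Ev_opp_D:
  assumes "xs \<in> TS.TV.tlists s" "ok (lam s xs) (emb (opp s) u)" "u \<in> jcarrier V (opp s)"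
  shows "\<exists>d\<in>D. Ev (lam s xs) (emb (opp s) u) = (ze Pos, d, ze Neg)"
  using assms
proof (induction rule: TS.TV.tlists_induct)
  case Nil
  then show ?case using D_zero by (auto simp: L_zero)
next
  case (Cons c x xs)
  note e = ev_emb[of "psi c" u "opp s"]
  have e: "res (ev (psi c)) (opp s) u \<in> jcarrier V (opp s)" "ev (psi c) (emb (opp s) u) = emb (opp s) (res (ev (psi c)) (opp s) u)"
    using Cons e by simp_all
  obtain d where d: "d \<in> D" "Ev (lam s xs) (emb (opp s) u) = (ze Pos, d, ze Neg)" using Cons by auto
  obtain d' where d': "d' \<in> D" "emb s x \<otimes>\<^bsub>L\<^esub> emb (opp s) (res (ev (psi c)) (opp s) u) = (ze Pos, d', ze Neg)"
    using emb_bracket_D[OF Cons(2) e(1)] by auto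
  have "Ev (lam s ((c, x) # xs)) (emb (opp s) u) = (ze Pos, d' \<oplus>\<^bsub>E\<^esub> d, ze Neg)"
    by (simp add: e(2) d(2) d'(2))
  then show ?case using D_add[OF d'(1) d(1)] by blast
qed

text \<open>
  Modulo the relations, \<open>{X, 1 \<otimes> u, 1 \<otimes> z}\<close> collapses to \<open>1 \<otimes> q\<close>, because each coefficient \<open>c\<close> of \<open>X\<close> can be
  moved onto \<open>u\<close>.  The same \<open>q\<close> describes how the action of \<open>X\<close> on \<open>u\<close> operates on \<open>z\<close>.
\<close>

lemma closure_step:
  assumes N: "jideal JC TS.VT N"
    and rel: "\<And>s \<rho> g U u. \<rho> \<in> carrier JC \<Longrightarrow> (g, U) \<in> PJ \<Longrightarrow> u \<in> U s \<Longrightarrow>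
      TS.TV.pt s (\<rho> \<otimes>\<^bsub>JC\<^esub> jc (g, U)) u \<ominus>\<^bsub>TS.TV.T s\<^esub> TS.TV.pt s \<rho> (g s u) \<in> N s"
    and u: "u \<in> jcarrier V (opp s)" and z: "z \<in> jcarrier V s"
    and xs: "xs \<in> TS.TV.tlists s" and k: "ok (lam s xs) (emb (opp s) u)"
  shows "\<exists>q\<in>jcarrier V s. Ev (lam s xs) (emb (opp s) u) \<otimes>\<^bsub>L\<^esub> emb s z = emb s q \<and>
    TW.t s (TS.TV.tc s xs) (TS.TV.pt (opp s) \<one>\<^bsub>JC\<^esub> u) (TS.TV.pt s \<one>\<^bsub>JC\<^esub> z) \<ominus>\<^bsub>TS.TV.T s\<^esub> TS.TV.pt s \<one>\<^bsub>JC\<^esub> q \<in> N s"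
  using xs k
proof (induction rule: TS.TV.tlists_induct)
  note n = TW.jid_triple(1)[OF N, unfolded TS.VT_mod]
  case Nil
  have "TW.t s (TS.TV.tc s []) (TS.TV.pt (opp s) \<one>\<^bsub>JC\<^esub> u) (TS.TV.pt s \<one>\<^bsub>JC\<^esub> z) = \<zero>\<^bsub>TS.TV.T s\<^esub>"
    using u z by (simp add: TS.TV.T_zero[symmetric] VT_zero)
  then have "TW.t s (TS.TV.tc s []) (TS.TV.pt (opp s) \<one>\<^bsub>JC\<^esub> u) (TS.TV.pt s \<one>\<^bsub>JC\<^esub> z) \<ominus>\<^bsub>TS.TV.T s\<^esub> TS.TV.pt s \<one>\<^bsub>JC\<^esub> (ze s) \<in> N s"
    using TS.TV.T.submodule_zero[OF n] by (simp add: TS.TV.pt_zero_right)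
  then show ?case using z by (intro bexI[of _ "ze s"]) (simp_all add: emb_zero)
next
  note n = TW.jid_triple(1)[OF N, unfolded TS.VT_mod]
  case (Cons c x xs)
  let ?f = "ev (psi c)" let ?g = "res ?f" let ?U = "Uof (dm (psi c))"
  let ?q = "t s x (?g (opp s) u) z" and ?w = "TS.TV.pt (opp s) \<one>\<^bsub>JC\<^esub> u" and ?z = "TS.TV.pt s \<one>\<^bsub>JC\<^esub> z"
  have mem: "emb (opp s) u \<in> dm (psi c)" and ok: "ok (lam s xs) (emb (opp s) u)" using Cons(5) by simp_all
  note e = ev_emb[OF psi_closed[OF Cons(1)] u mem]
  obtain q where q: "q \<in> jcarrier V s" "Ev (lam s xs) (emb (opp s) u) \<otimes>\<^bsub>L\<^esub> emb s z = emb s q"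
    "TW.t s (TS.TV.tc s xs) ?w ?z \<ominus>\<^bsub>TS.TV.T s\<^esub> TS.TV.pt s \<one>\<^bsub>JC\<^esub> q \<in> N s"
    using Cons(4)[OF ok] by blast
  have qV: "?q \<in> jcarrier V s" using Cons(2) e(1) z by simp
  have "Ev (lam s ((c, x) # xs)) (emb (opp s) u) \<otimes>\<^bsub>L\<^esub> emb s z = emb s ?q \<oplus>\<^bsub>L\<^esub> emb s q"
    using Cons(2,3) e ok z q(2) Ev_closed[OF lam_lists[OF Cons(3)] ok] by (simp add: L_bracket_add L_mult_closed emb_triple)
  then have 1: "Ev (lam s ((c, x) # xs)) (emb (opp s) u) \<otimes>\<^bsub>L\<^esub> emb s z = emb s (pl s ?q q)"
    using q(1) qV by (simp add: emb_add)
  have uU: "u \<in> ?U (opp s)" using u mem by (simp add: Uof_iff)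
  have U: "jess ?U" "lin ?U ?g" using jc_res(1)[OF Cons(1)] by (simp_all add: PJ_iff)
  have tU: "t s x u z \<in> ?U s" by (rule jidD(12)[OF jessD[OF U(1)] Cons(2) uU z])
  have "?g s (t s x u z) = ?q" by (rule linD(9)[OF jessD[OF U(1)] U(2) uU z Cons(2)])
  then have 2: "TS.TV.pt s c (t s x u z) \<ominus>\<^bsub>TS.TV.T s\<^esub> TS.TV.pt s \<one>\<^bsub>JC\<^esub> ?q \<in> N s"
    using rel[OF TS.A.one_closed jc_res(1)[OF Cons(1)] tU] Cons(1) by (simp only: jc_res(2)[OF Cons(1)] TS.A.l_one)
  let ?a = "TS.TV.pt s c (t s x u z)" and ?b = "TS.TV.pt s \<one>\<^bsub>JC\<^esub> ?q" and ?c = "TW.t s (TS.TV.tc s xs) ?w ?z" and ?d = "TS.TV.pt s \<one>\<^bsub>JC\<^esub> q"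
  have cl: "?a \<in> carrier (TS.TV.T s)" "?b \<in> carrier (TS.TV.T s)" "?c \<in> carrier (TS.TV.T s)" "?d \<in> carrier (TS.TV.T s)"
    using Cons(1-3) u z qV q(1) by (simp_all add: VT_closed)
  have "TS.TV.tc s ((c, x) # xs) = TS.TV.pt s c x \<oplus>\<^bsub>TS.TV.T s\<^esub> TS.TV.tc s xs"
    using Cons(1-3) by (simp add: TS.TV.T_add)
  then have "TW.t s (TS.TV.tc s ((c, x) # xs)) ?w ?z = ?a \<oplus>\<^bsub>TS.TV.T s\<^esub> ?c"
    using Cons(1-3) u z by (simp add: VT_add VT_pt)
  moreover have "TS.TV.pt s \<one>\<^bsub>JC\<^esub> (pl s ?q q) = ?b \<oplus>\<^bsub>TS.TV.T s\<^esub> ?d" using qV q(1) by (simp add: TS.TV.pt_add_right)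
  moreover have "(?a \<oplus>\<^bsub>TS.TV.T s\<^esub> ?c) \<ominus>\<^bsub>TS.TV.T s\<^esub> (?b \<oplus>\<^bsub>TS.TV.T s\<^esub> ?d) = (?a \<ominus>\<^bsub>TS.TV.T s\<^esub> ?b) \<oplus>\<^bsub>TS.TV.T s\<^esub> (?c \<ominus>\<^bsub>TS.TV.T s\<^esub> ?d)"
    using cl by (simp add: a_minus_def TS.TV.T.minus_add TS.TV.T.a_ac)
  ultimately have "TW.t s (TS.TV.tc s ((c, x) # xs)) ?w ?z \<ominus>\<^bsub>TS.TV.T s\<^esub> TS.TV.pt s \<one>\<^bsub>JC\<^esub> (pl s ?q q) \<in> N s"
    using TS.TV.T.submoduleE(5)[OF n 2 q(3)] by simp
  with 1 qV q(1) show ?case by (intro bexI[of _ "pl s ?q q"] conjI) simp_all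
qed

text \<open>
  An element \<open>X\<close> of \<open>N\<close> acts as zero on the module of its own sign for degree reasons.  Its value on \<open>u\<close> in the opposite module is an
  inner derivation, which kills every \<open>z\<close> since the corresponding \<open>1 \<otimes> q\<close> lies in \<open>N\<close>.
\<close>

lemma MV_max:
  assumes N: "jideal JC TS.VT N"
    and rel: "\<And>s \<rho> g U u. \<rho> \<in> carrier JC \<Longrightarrow> (g, U) \<in> PJ \<Longrightarrow> u \<in> U s \<Longrightarrow>
      TS.TV.pt s (\<rho> \<otimes>\<^bsub>JC\<^esub> jc (g, U)) u \<ominus>\<^bsub>TS.TV.T s\<^esub> TS.TV.pt s \<rho> (g s u) \<in> N s"
    and 0: "\<And>s x. x \<in> jcarrier V s \<Longrightarrow> TS.TV.pt s \<one>\<^bsub>JC\<^esub> x \<in> N s \<Longrightarrow> x = ze s"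
  shows "N s \<subseteq> MV s"
proof
  fix X assume X: "X \<in> N s"
  note n = TW.jid_triple[OF N, unfolded TS.VT_mod]
  obtain xs where xs: "xs \<in> TS.TV.tlists s" "X = TS.TV.tc s xs" by (rule TS.TV.T_cases[OF n(2)[OF X]])
  let ?U = "Uof {y \<in> carrier L. ok (lam s xs) y}"
  have "\<forall>\<^sub>F y in F. Ev (lam s xs) y = \<zero>\<^bsub>L\<^esub>"
  proof (rule Ev_zero_if[OF lam_lists[OF xs(1)] Uof_jess[OF ok_ess[OF lam_lists[OF xs(1)]]]])
    fix s' u assume "u \<in> ?U s'"
    then have u: "u \<in> jcarrier V s'" and k: "ok (lam s xs) (emb s' u)" by (simp_all add: Uof_iff)
    show "ok (lam s xs) (emb s' u)" by (rule k)
    show "Ev (lam s xs) (emb s' u) = \<zero>\<^bsub>L\<^esub>"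
    proof (cases "s' = s")
      case True
      then show ?thesis using Ev_same[OF xs(1)] u k by simp
    next
      case False
      then have s': "s' = opp s" by (cases s; cases s') simp_all
      note u = u[unfolded s'] and k = k[unfolded s']
      obtain d where d: "d \<in> D" "Ev (lam s xs) (emb (opp s) u) = (ze Pos, d, ze Neg)" using Ev_opp_D[OF xs(1) k u] by blast
      have z: "d s z = ze s" if z: "z \<in> jcarrier V s" for z
      proof -
        let ?t = "TW.t s X (TS.TV.pt (opp s) \<one>\<^bsub>JC\<^esub> u) (TS.TV.pt s \<one>\<^bsub>JC\<^esub> z)"
        obtain q where q: "q \<in> jcarrier V s" "Ev (lam s xs) (emb (opp s) u) \<otimes>\<^bsub>L\<^esub> emb s z = emb s q"
          "?t \<ominus>\<^bsub>TS.TV.T s\<^esub> TS.TV.pt s \<one>\<^bsub>JC\<^esub> q \<in> N s"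
          using closure_step[OF N rel u z xs(1) k] unfolding xs(2) by blast
        have t: "?t \<in> N s" using n(3)[OF X, of "TS.TV.pt (opp s) \<one>\<^bsub>JC\<^esub> u" "TS.TV.pt s \<one>\<^bsub>JC\<^esub> z"] u z by simp
        have "TS.TV.pt s \<one>\<^bsub>JC\<^esub> q = ?t \<ominus>\<^bsub>TS.TV.T s\<^esub> (?t \<ominus>\<^bsub>TS.TV.T s\<^esub> TS.TV.pt s \<one>\<^bsub>JC\<^esub> q)"
          using n(2)[OF t] q(1) by (simp add: a_minus_def TS.TV.T.minus_add TS.TV.T.a_assoc[symmetric] TS.TV.T.r_neg)
        also have "\<dots> \<in> N s" by (rule TS.TV.T.submodule_minus[OF n(1) t q(3)])
        finally have "q = ze s" using 0 q(1) by blast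
        then have "emb s (d s z) = emb s (ze s)" using q(2) bracket_emb0[OF d(1) z] d(2) by simp
        then show ?thesis by (simp add: emb_inj)
      qed
      have "d = \<zero>\<^bsub>E\<^esub>"
      proof (rule E_ext[OF D_E[OF d(1)] E_ops_closed(4)])
        fix s'' x assume x: "x \<in> jcarrier V s''"
        have "s'' = s \<or> s'' = opp s" by (cases s; cases s'') simp_all
        then show "d s'' x = \<zero>\<^bsub>E\<^esub> s'' x" using z D_zero_if[OF d(1) z] x by auto
      qed
      then show ?thesis unfolding s' using d(2) by (simp add: L_zero)
    qed
  qed
  then have "Lam s X \<in> NL" unfolding xs(2) Lam_tc[OF xs(1)] by (simp only: NL_iff[OF lam_lists[OF xs(1)]])
  then show "X \<in> MV s" using n(2)[OF X] by (simp add: MV_def)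
qed

lemma Int_image_zero:
  assumes "z \<in> N" "f e = z" "e \<in> A" "\<And>x. x \<in> A \<Longrightarrow> f x = z \<Longrightarrow> x = e"
  shows "N \<inter> f ` A = {z} \<longleftrightarrow> (\<forall>x\<in>A. f x \<in> N \<longrightarrow> x = e)"
proof
  assume "N \<inter> f ` A = {z}"
  then show "\<forall>x\<in>A. f x \<in> N \<longrightarrow> x = e" using assms(4) by blast
next
  assume *: "\<forall>x\<in>A. f x \<in> N \<longrightarrow> x = e"
  have "y = z" if "y \<in> N \<inter> f ` A" for y using that * assms(2) by blast
  then show "N \<inter> f ` A = {z}" using assms(1-3) by blast
qed

lemma jclosure_cond_iff:
  "jclosure_cond R V N \<longleftrightarrow> jideal JC TS.VT N \<and>
    (\<forall>s \<rho> g U u. \<rho> \<in> carrier JC \<longrightarrow> (g, U) \<in> PJ \<longrightarrow> u \<in> U s \<longrightarrow>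
      TS.TV.pt s (\<rho> \<otimes>\<^bsub>JC\<^esub> jc (g, U)) u \<ominus>\<^bsub>TS.TV.T s\<^esub> TS.TV.pt s \<rho> (g s u) \<in> N s) \<and>
    (\<forall>s. \<forall>x\<in>jcarrier V s. TS.TV.pt s \<one>\<^bsub>JC\<^esub> x \<in> N s \<longrightarrow> x = ze s)"
proof -
  have 1: "N s \<inter> TS.TV.pt s \<one>\<^bsub>JC\<^esub> ` jcarrier V s = {\<zero>\<^bsub>TS.TV.T s\<^esub>} \<longleftrightarrow>
    (\<forall>x\<in>jcarrier V s. TS.TV.pt s \<one>\<^bsub>JC\<^esub> x \<in> N s \<longrightarrow> x = ze s)" if "jideal JC TS.VT N" for s
  proof (rule Int_image_zero)
    show "\<zero>\<^bsub>TS.TV.T s\<^esub> \<in> N s" using TS.TV.T.submodule_zero TW.jid_triple(1)[OF that] unfolding TS.VT_mod by blast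
    show "TS.TV.pt s \<one>\<^bsub>JC\<^esub> (ze s) = \<zero>\<^bsub>TS.TV.T s\<^esub>" by (rule TS.TV.pt_zero_right) simp
    show "ze s \<in> jcarrier V s" by simp
    fix x assume x: "x \<in> jcarrier V s" "TS.TV.pt s \<one>\<^bsub>JC\<^esub> x = \<zero>\<^bsub>TS.TV.T s\<^esub>"
    have "\<zero>\<^bsub>TS.TV.T s\<^esub> \<in> MV s" by (simp add: MV_def LAM.lift_zero NL_zero)
    with x show "x = ze s" using MV_one by simp
  qed
  have 2: "(\<forall>s. \<forall>\<rho>\<in>A. \<forall>(g, U)\<in>B. \<forall>u\<in>U s. H s \<rho> g U u) \<longleftrightarrow>
    (\<forall>s \<rho> g U u. \<rho> \<in> A \<longrightarrow> (g, U) \<in> B \<longrightarrow> u \<in> U s \<longrightarrow> H s \<rho> g U u)" for A B H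
    by (simp only: Ball_def split_paired_All prod.case) blast
  show ?thesis
    unfolding jclosure_cond_def Let_def pure_tensor_def TS.VT_mod
    by (rule conj_cong[OF HOL.refl], rule conj_cong, rule 2, simp only: 1)
qed

lemma jclosure_ideal_eq: "jclosure_ideal R V = MV"
  unfolding jclosure_ideal_def
proof (rule the_equality)
  have M: "jclosure_cond R V MV"
    unfolding jclosure_cond_iff using MV_jideal MV_rel MV_one by blast
  have max: "N \<le> MV" if "jclosure_cond R V N" for N
    using that unfolding jclosure_cond_iff by (intro le_funI MV_max) blast+
  show "jclosure_cond R V MV \<and> (\<forall>N. jclosure_cond R V N \<and> MV \<le> N \<longrightarrow> N = MV)"
    using M max order.antisym by blast
  show "N = MV" if "jclosure_cond R V N \<and> (\<forall>N'. jclosure_cond R V N' \<and> N \<le> N' \<longrightarrow> N' = N)" for N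
    using that M max by blast
qed

sublocale QS: quotient_system JC TS.VT TS.hA MV
  by (rule quotient_system.intro[OF TS.VT_system quotient_system_axioms.intro[OF MV_jideal]])

sublocale TJ: triple_system JC QS.VQ
  by (rule QS.VQ_system)

end

context nondeg_pair
begin

text \<open>The modules of the quotient are kept opaque from here on.\<close>

declare QS.VQ_mod [simp del]

abbreviation J where "J \<equiv> QS.VQ"
abbreviation K where "K \<equiv> TJ.L"

text \<open>
  The classes of tensors, and of pure tensors \<open>c \<otimes> x\<close>, in the extended central closure.
\<close>

definition "cq s X = QS.QM.cs s X"
definition "pq s c x = cq s (TS.TV.pt s c x)"

lemma cq_closed [simp]: "X \<in> carrier (TS.TV.T s) \<Longrightarrow> cq s X \<in> jcarrier J s"
  unfolding cq_def QS.VQ_mod by (rule QS.QM.cs_closed) (simp only: TS.VT_mod)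

lemma cq_add: "X \<in> carrier (TS.TV.T s) \<Longrightarrow> Y \<in> carrier (TS.TV.T s) \<Longrightarrow> cq s (X \<oplus>\<^bsub>TS.TV.T s\<^esub> Y) = cq s X \<oplus>\<^bsub>jmod J s\<^esub> cq s Y"
  unfolding cq_def QS.VQ_mod using QS.QM.Q_add[of X s Y] by (simp only: TS.VT_mod)

lemma cq_smult: "c \<in> carrier JC \<Longrightarrow> X \<in> carrier (TS.TV.T s) \<Longrightarrow> cq s (c \<odot>\<^bsub>TS.TV.T s\<^esub> X) = c \<odot>\<^bsub>jmod J s\<^esub> cq s X"
  unfolding cq_def QS.VQ_mod using QS.QM.Q_smult[of c X s] by (simp only: TS.VT_mod)

lemma cq_zero_iff: "X \<in> carrier (TS.TV.T s) \<Longrightarrow> cq s X = \<zero>\<^bsub>jmod J s\<^esub> \<longleftrightarrow> X \<in> MV s"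
  unfolding cq_def QS.VQ_mod using QS.QM.cs_zero_iff[of X s] by (simp only: TS.VT_mod)

lemma cq_zero: "cq s \<zero>\<^bsub>TS.TV.T s\<^esub> = \<zero>\<^bsub>jmod J s\<^esub>"
  unfolding cq_def QS.VQ_mod using QS.QM.cs_zero[of s] by (simp only: TS.VT_mod)

lemma cq_cases:
  assumes "Z \<in> jcarrier J s"
  obtains X where "X \<in> carrier (TS.TV.T s)" "Z = cq s X"
proof -
  have "Z \<in> carrier (QS.QM.Q s)" using assms by (simp only: QS.VQ_mod)
  then obtain X where "X \<in> jcarrier TS.VT s" "Z = QS.QM.cs s X" by (rule QS.QM.Q_cases)
  then show thesis by (intro that[of X]) (simp_all only: TS.VT_mod cq_def)
qed

lemma cq_triple:
  assumes "X \<in> carrier (TS.TV.T s)" "Y \<in> carrier (TS.TV.T (opp s))" "Z \<in> carrier (TS.TV.T s)"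
  shows "TJ.t s (cq s X) (cq (opp s) Y) (cq s Z) = cq s (TW.t s X Y Z)"
  unfolding cq_def using assms by (intro QS.VQ_t) (simp_all only: TS.VT_mod)

lemma pq_closed [simp]: "c \<in> carrier JC \<Longrightarrow> x \<in> jcarrier V s \<Longrightarrow> pq s c x \<in> jcarrier J s"
  by (simp add: pq_def)

lemma pq_add_left: "a \<in> carrier JC \<Longrightarrow> b \<in> carrier JC \<Longrightarrow> x \<in> jcarrier V s \<Longrightarrow>
    pq s (a \<oplus>\<^bsub>JC\<^esub> b) x = pq s a x \<oplus>\<^bsub>jmod J s\<^esub> pq s b x"
  by (simp add: pq_def TS.TV.pt_add_left cq_add)

lemma pq_add_right: "a \<in> carrier JC \<Longrightarrow> x \<in> jcarrier V s \<Longrightarrow> y \<in> jcarrier V s \<Longrightarrow>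
    pq s a (pl s x y) = pq s a x \<oplus>\<^bsub>jmod J s\<^esub> pq s a y"
  by (simp add: pq_def TS.TV.pt_add_right cq_add)

lemma pq_zero: "a \<in> carrier JC \<Longrightarrow> pq s a (ze s) = \<zero>\<^bsub>jmod J s\<^esub>"
  by (simp add: pq_def TS.TV.pt_zero_right cq_zero)

lemma pq_smult: "c \<in> carrier JC \<Longrightarrow> a \<in> carrier JC \<Longrightarrow> x \<in> jcarrier V s \<Longrightarrow> c \<odot>\<^bsub>jmod J s\<^esub> pq s a x = pq s (c \<otimes>\<^bsub>JC\<^esub> a) x"
  by (simp add: pq_def TS.TV.pt_smult cq_smult[symmetric])

lemma pq_balance: "r \<in> carrier R \<Longrightarrow> a \<in> carrier JC \<Longrightarrow> x \<in> jcarrier V s \<Longrightarrow> pq s (r \<odot>\<^bsub>JC\<^esub> a) x = pq s a (sm s r x)"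
  by (simp add: pq_def TS.TV.pt_balance)

lemma pq_minus: "a \<in> carrier JC \<Longrightarrow> x \<in> jcarrier V s \<Longrightarrow> pq s a (\<ominus>\<^bsub>jmod V s\<^esub> x) = \<ominus>\<^bsub>jmod J s\<^esub> pq s a x"
  by (rule TJ.M.minus_equality[symmetric]) (simp_all add: pq_add_right[symmetric] M.l_neg pq_zero)

lemma pq_diff: "a \<in> carrier JC \<Longrightarrow> x \<in> jcarrier V s \<Longrightarrow> y \<in> jcarrier V s \<Longrightarrow>
    pq s a (mi s x y) = pq s a x \<ominus>\<^bsub>jmod J s\<^esub> pq s a y"
  by (simp add: a_minus_def pq_add_right pq_minus)

lemma pq_triple:
  assumes "a \<in> carrier JC" "x \<in> jcarrier V s" "b \<in> carrier JC" "y \<in> jcarrier V (opp s)" "c \<in> carrier JC" "z \<in> jcarrier V s"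
  shows "TJ.t s (pq s a x) (pq (opp s) b y) (pq s c z) = pq s (a \<otimes>\<^bsub>JC\<^esub> b \<otimes>\<^bsub>JC\<^esub> c) (t s x y z)"
  using assms by (simp add: pq_def cq_triple VT_pt)

lemma pq_one_zero: "x \<in> jcarrier V s \<Longrightarrow> pq s \<one>\<^bsub>JC\<^esub> x = \<zero>\<^bsub>jmod J s\<^esub> \<Longrightarrow> x = ze s"
  using MV_one[of x s] cq_zero_iff[of "TS.TV.pt s \<one>\<^bsub>JC\<^esub> x" s] by (simp add: pq_def)

lemma J_induct [consumes 1, case_names zero add]:
  assumes "Z \<in> jcarrier J s" "Q \<zero>\<^bsub>jmod J s\<^esub>"
    and a: "\<And>c x W. \<lbrakk>c \<in> carrier JC; x \<in> jcarrier V s; W \<in> jcarrier J s; Q W\<rbrakk> \<Longrightarrow> Q (pq s c x \<oplus>\<^bsub>jmod J s\<^esub> W)"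
  shows "Q Z"
proof -
  obtain X where X: "X \<in> carrier (TS.TV.T s)" "Z = cq s X" using assms(1) by (rule cq_cases)
  from X(1) have "Q (cq s X)"
  proof (induction X rule: TS.TV.T_induct)
    case zero
    show ?case unfolding cq_zero by (rule assms(2))
  next
    case (add c x Y)
    then show ?case using a[of c x "cq s Y"] by (simp add: cq_add pq_def)
  qed
  then show ?thesis using X(2) by simp
qed

lemma J_ext:
  assumes "e \<in> carrier TJ.E" "e' \<in> carrier TJ.E"
    and eq: "\<And>s c v. c \<in> carrier JC \<Longrightarrow> v \<in> jcarrier V s \<Longrightarrow> e s (pq s c v) = e' s (pq s c v)"
  shows "e = e'"
proof (rule TJ.E_ext[OF assms(1,2)])
  fix s Z assume "Z \<in> jcarrier J s"
  then show "e s Z = e' s Z"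
    by (induction rule: J_induct) (simp_all add: assms(1,2) eq)
qed

section \<open>Inner derivations of the central closure\<close>

lemma dl_pq_apply:
  assumes "a \<in> carrier JC" "x \<in> jcarrier V Pos" "b \<in> carrier JC" "y \<in> jcarrier V Neg" "c \<in> carrier JC" "v \<in> jcarrier V s"
  shows "TJ.dl (pq Pos a x) (pq Neg b y) s (pq s c v) = pq s (a \<otimes>\<^bsub>JC\<^esub> b \<otimes>\<^bsub>JC\<^esub> c) (dl x y s v)"
proof (cases s)
  case Pos
  then show ?thesis using assms pq_triple[of a x Pos b y c v] by simp
next
  case Neg
  then show ?thesis using assms pq_triple[of b y Neg a x c v] by (simp add: pq_minus TS.A.m_comm[of b a])
qed

text \<open>
  The condition defines a submodule of \<open>IDer V\<close>, where a scalar \<open>r\<close> acts on the extension through \<open>r 1\<close>,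
  and \<open>\<delta>(x, y)\<close> extends to \<open>\<delta>(1 x, 1 y)\<close>.
\<close>

lemma dh_ex: "d \<in> D \<Longrightarrow> \<exists>e\<in>TJ.D. \<forall>s. \<forall>c\<in>carrier JC. \<forall>v\<in>jcarrier V s. e s (pq s c v) = pq s c (d s v)"
proof -
  let ?H = "{d \<in> carrier E. \<exists>e\<in>TJ.D. \<forall>s. \<forall>c\<in>carrier JC. \<forall>v\<in>jcarrier V s. e s (pq s c v) = pq s c (d s v)}"
  have "submodule ?H R E"
  proof (rule E.submoduleI')
    show "?H \<subseteq> carrier E" by blast
    show "\<zero>\<^bsub>E\<^esub> \<in> ?H" using TJ.D_zero by (auto simp: E_ops_closed pq_zero intro!: bexI[of _ "\<zero>\<^bsub>TJ.E\<^esub>"])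
    show "d \<oplus>\<^bsub>E\<^esub> d' \<in> ?H" if "d \<in> ?H" "d' \<in> ?H" for d d'
    proof -
      obtain e e' where e: "e \<in> TJ.D" "e' \<in> TJ.D"
        "\<And>s c v. c \<in> carrier JC \<Longrightarrow> v \<in> jcarrier V s \<Longrightarrow> e s (pq s c v) = pq s c (d s v)"
        "\<And>s c v. c \<in> carrier JC \<Longrightarrow> v \<in> jcarrier V s \<Longrightarrow> e' s (pq s c v) = pq s c (d' s v)" using \<open>d \<in> ?H\<close> \<open>d' \<in> ?H\<close> by blast
      have "\<forall>s. \<forall>c\<in>carrier JC. \<forall>v\<in>jcarrier V s. (e \<oplus>\<^bsub>TJ.E\<^esub> e') s (pq s c v) = pq s c ((d \<oplus>\<^bsub>E\<^esub> d') s v)"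
        using that by (simp add: e(3,4) pq_add_right)
      then show ?thesis using TJ.D_add[OF e(1,2)] E_ops_closed(1) that by blast
    qed
    show "r \<odot>\<^bsub>E\<^esub> d \<in> ?H" if r: "r \<in> carrier R" "d \<in> ?H" for r d
    proof -
      obtain e where e: "e \<in> TJ.D"
        "\<And>s c v. c \<in> carrier JC \<Longrightarrow> v \<in> jcarrier V s \<Longrightarrow> e s (pq s c v) = pq s c (d s v)" using \<open>d \<in> ?H\<close> by blast
      let ?r = "r \<odot>\<^bsub>JC\<^esub> \<one>\<^bsub>JC\<^esub>"
      have "\<forall>s. \<forall>c\<in>carrier JC. \<forall>v\<in>jcarrier V s. (?r \<odot>\<^bsub>TJ.E\<^esub> e) s (pq s c v) = pq s c ((r \<odot>\<^bsub>E\<^esub> d) s v)"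
        using that by (simp add: e(2) pq_smult TS.A.smult_assoc2 pq_balance)
      moreover have "?r \<odot>\<^bsub>TJ.E\<^esub> e \<in> TJ.D" using r(1) by (intro TJ.D_smult[OF _ e(1)]) simp
      moreover have "r \<odot>\<^bsub>E\<^esub> d \<in> carrier E" using that by (simp add: E_ops_closed)
      ultimately show ?thesis by blast
    qed
  qed
  moreover have "deltas \<subseteq> ?H"
  proof
    fix d assume "d \<in> deltas"
    then obtain x y where xy: "x \<in> jcarrier V Pos" "y \<in> jcarrier V Neg" "d = dl x y" by blast
    have "\<forall>s. \<forall>c\<in>carrier JC. \<forall>v\<in>jcarrier V s. TJ.dl (pq Pos \<one>\<^bsub>JC\<^esub> x) (pq Neg \<one>\<^bsub>JC\<^esub> y) s (pq s c v) = pq s c (dl x y s v)"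
      using xy dl_pq_apply[of "\<one>\<^bsub>JC\<^esub>" x "\<one>\<^bsub>JC\<^esub>" y] by simp
    moreover have "TJ.dl (pq Pos \<one>\<^bsub>JC\<^esub> x) (pq Neg \<one>\<^bsub>JC\<^esub> y) \<in> TJ.D" using xy by simp
    ultimately show "d \<in> ?H" using dl_closed[OF xy(1,2)] unfolding xy(3) by blast
  qed
  ultimately show "d \<in> D \<Longrightarrow> ?thesis" using D_subsetI[of ?H] by blast
qed

definition "dh d = (SOME e. e \<in> TJ.D \<and> (\<forall>s. \<forall>c\<in>carrier JC. \<forall>v\<in>jcarrier V s. e s (pq s c v) = pq s c (d s v)))"

lemma dh:
  assumes "d \<in> D"
  shows "dh d \<in> TJ.D" "c \<in> carrier JC \<Longrightarrow> v \<in> jcarrier V s \<Longrightarrow> dh d s (pq s c v) = pq s c (d s v)"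
proof -
  have "\<exists>e. e \<in> TJ.D \<and> (\<forall>s. \<forall>c\<in>carrier JC. \<forall>v\<in>jcarrier V s. e s (pq s c v) = pq s c (d s v))" using dh_ex[OF assms] by blast
  from someI_ex[OF this]
  have *: "dh d \<in> TJ.D \<and> (\<forall>s. \<forall>c\<in>carrier JC. \<forall>v\<in>jcarrier V s. dh d s (pq s c v) = pq s c (d s v))" unfolding dh_def .
  then show "dh d \<in> TJ.D" by blast
  show "c \<in> carrier JC \<Longrightarrow> v \<in> jcarrier V s \<Longrightarrow> dh d s (pq s c v) = pq s c (d s v)" using * by blast
qed

lemmas dh_E = TJ.D_E[OF dh(1)]

lemma dh_add: "d \<in> D \<Longrightarrow> e \<in> D \<Longrightarrow> dh (d \<oplus>\<^bsub>E\<^esub> e) = dh d \<oplus>\<^bsub>TJ.E\<^esub> dh e"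
  by (rule J_ext) (simp_all add: dh dh_E TJ.E_ops_closed D_add D_E pq_add_right)

lemma dh_smult: "r \<in> carrier R \<Longrightarrow> d \<in> D \<Longrightarrow> dh (r \<odot>\<^bsub>E\<^esub> d) = (r \<odot>\<^bsub>JC\<^esub> \<one>\<^bsub>JC\<^esub>) \<odot>\<^bsub>TJ.E\<^esub> dh d"
  by (rule J_ext) (simp_all add: dh dh_E TJ.E_ops_closed D_smult D_E pq_smult TS.A.smult_assoc2 pq_balance)

lemma dh_zero: "dh \<zero>\<^bsub>E\<^esub> = \<zero>\<^bsub>TJ.E\<^esub>"
  by (rule J_ext) (simp_all add: dh dh_E TJ.E_ops_closed D_zero pq_zero)

lemma dh_inj:
  assumes d: "d \<in> D" and 0: "dh d = \<zero>\<^bsub>TJ.E\<^esub>"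
  shows "d = \<zero>\<^bsub>E\<^esub>"
proof (rule E_ext[OF D_E[OF d] E_ops_closed(4)])
  fix s x assume x: "x \<in> jcarrier V s"
  have "pq s \<one>\<^bsub>JC\<^esub> (d s x) = \<zero>\<^bsub>jmod J s\<^esub>" using dh(2)[OF d TS.A.one_closed x] x by (simp add: 0)
  then show "d s x = \<zero>\<^bsub>E\<^esub> s x" using pq_one_zero[of "d s x" s] D_E[OF d] x by simp
qed

section \<open>The comparison map\<close>

text \<open>
  The comparison map on pure tensors.
\<close>

definition "KB c X = (case X of (a, d, b) \<Rightarrow> (pq Pos (phi c) a, phi c \<odot>\<^bsub>TJ.E\<^esub> dh d, pq Neg (phi c) b))"

lemma KB_simp [simp]: "KB c (a, d, b) = (pq Pos (phi c) a, phi c \<odot>\<^bsub>TJ.E\<^esub> dh d, pq Neg (phi c) b)"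
  by (simp add: KB_def)

sublocale HH: tensor_lift R C L K KB
proof (rule tensor_lift.intro[OF _ _ tensor_lift_axioms.intro])
  show "tensor_module R C L" by (rule TL.tensor_module_axioms)
  show "abelian_group K" by (rule TJ.L.abelian_group_axioms)
  show "KB c x \<in> carrier K" if "c \<in> carrier C" "x \<in> carrier L" for c x
    using that by (cases x) (simp add: TJ.D_smult dh)
  show "KB (a \<oplus>\<^bsub>C\<^esub> b) x = KB a x \<oplus>\<^bsub>K\<^esub> KB b x" if "a \<in> carrier C" "b \<in> carrier C" "x \<in> carrier L" for a b x
    using that by (cases x) (simp add: phi_hom pq_add_left TJ.E.smult_l_distr dh_E)
  show "KB c (x \<oplus>\<^bsub>L\<^esub> y) = KB c x \<oplus>\<^bsub>K\<^esub> KB c y" if "c \<in> carrier C" "x \<in> carrier L" "y \<in> carrier L" for c x y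
    using that by (cases x; cases y) (simp add: pq_add_right dh_add TJ.E.smult_r_distr dh_E)
  show "KB (r \<odot>\<^bsub>C\<^esub> c) x = KB c (r \<odot>\<^bsub>L\<^esub> x)" if "r \<in> carrier R" "c \<in> carrier C" "x \<in> carrier L" for r c x
    using that by (cases x) (simp add: phi_hom pq_balance dh_smult TJ.E.smult_assoc1[symmetric] dh_E TS.A.smult_assoc2[symmetric] TS.A.m_comm[of "phi c"] TS.A.smult_assoc2)
qed

abbreviation hh where "hh \<equiv> HH.lift"

lemma hh_smult: "X \<in> carrier TL.T \<Longrightarrow> c \<in> carrier C \<Longrightarrow> hh (c \<odot>\<^bsub>TL.T\<^esub> X) = phi c \<odot>\<^bsub>K\<^esub> hh X"
proof (induction X rule: TL.T_induct)
  case zero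
  then show ?case by (simp add: HH.lift_zero)
next
  case (add a x Y)
  have "KB (c \<otimes>\<^bsub>C\<^esub> a) x = phi c \<odot>\<^bsub>K\<^esub> KB a x"
    using add(1,2,5) by (cases x) (simp add: phi_hom pq_smult TJ.E.smult_assoc1 dh_E)
  with add show ?case
    by (simp add: TL.T.smult_r_distr TL.pt_smult HH.lift_add HH.lift_pt TJ.L.smult_r_distr HH.B_closed)
qed

lemma KB_mult:
  assumes c: "c \<in> carrier C" "c' \<in> carrier C" and x: "x \<in> carrier L" "y \<in> carrier L"
  shows "KB (c \<otimes>\<^bsub>C\<^esub> c') (x \<otimes>\<^bsub>L\<^esub> y) = KB c x \<otimes>\<^bsub>K\<^esub> KB c' y"
proof -
  obtain x1 d x2 where xe: "x = (x1, d, x2)" by (cases x)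
  obtain y1 e y2 where ye: "y = (y1, e, y2)" by (cases y)
  define a b where "a = phi c" and "b = phi c'"
  have ab: "a \<in> carrier JC" "b \<in> carrier JC" "phi (c \<otimes>\<^bsub>C\<^esub> c') = a \<otimes>\<^bsub>JC\<^esub> b" using c by (simp_all add: a_def b_def phi_hom)
  have m: "x1 \<in> jcarrier V Pos" "d \<in> D" "x2 \<in> jcarrier V Neg" "y1 \<in> jcarrier V Pos" "e \<in> D" "y2 \<in> jcarrier V Neg"
    using x by (simp_all add: xe ye)
  note mE = D_E[OF m(2)] D_E[OF m(5)] dh_E[OF m(2)] dh_E[OF m(5)]
  have 1: "(a \<odot>\<^bsub>TJ.E\<^esub> dh d) s (pq s b v) \<ominus>\<^bsub>jmod J s\<^esub> (b \<odot>\<^bsub>TJ.E\<^esub> dh e) s (pq s a w) = pq s (a \<otimes>\<^bsub>JC\<^esub> b) (mi s (d s v) (e s w))"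
    if "v \<in> jcarrier V s" "w \<in> jcarrier V s" for s v w
    using that ab m mE by (simp add: dh pq_smult pq_diff TS.A.m_comm[of b a])
  let ?l = "((a \<odot>\<^bsub>TJ.E\<^esub> dh d) \<otimes>\<^bsub>TJ.E\<^esub> (b \<odot>\<^bsub>TJ.E\<^esub> dh e) \<oplus>\<^bsub>TJ.E\<^esub> TJ.dl (pq Pos a x1) (pq Neg b y2)) \<ominus>\<^bsub>TJ.E\<^esub> TJ.dl (pq Pos b y1) (pq Neg a x2)"
  let ?m = "(d \<otimes>\<^bsub>E\<^esub> e \<oplus>\<^bsub>E\<^esub> dl x1 y2) \<ominus>\<^bsub>E\<^esub> dl y1 x2"
  have mD: "?m \<in> D" using m by (intro D_minus D_add D_mult_closed D_dl)
  have 2: "(a \<otimes>\<^bsub>JC\<^esub> b) \<odot>\<^bsub>TJ.E\<^esub> dh ?m = ?l"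
  proof (rule J_ext)
    show "(a \<otimes>\<^bsub>JC\<^esub> b) \<odot>\<^bsub>TJ.E\<^esub> dh ?m \<in> carrier TJ.E" using dh_E[OF mD] ab by (simp add: TJ.E_ops_closed)
    show "?l \<in> carrier TJ.E" using ab m mE by (simp add: TJ.E_ops_closed)
    fix s f v assume f: "f \<in> carrier JC" and v: "v \<in> jcarrier V s"
    have dlv: "dl x1 y2 s v \<in> jcarrier V s" "dl y1 x2 s v \<in> jcarrier V s"
      using E_closed[OF dl_closed v] m by blast+
    have r1: "((a \<otimes>\<^bsub>JC\<^esub> b) \<odot>\<^bsub>TJ.E\<^esub> dh ?m) s (pq s f v) = pq s (a \<otimes>\<^bsub>JC\<^esub> b \<otimes>\<^bsub>JC\<^esub> f) (?m s v)"
      using dh(2)[OF mD f v] E_closed[OF D_E[OF mD] v] ab f v by (simp add: pq_smult)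
    have r2: "?m s v = mi s (pl s (mi s (d s (e s v)) (e s (d s v))) (dl x1 y2 s v)) (dl y1 x2 s v)"
      using m mE v by (simp add: E_ops_closed)
    have r3: "((a \<odot>\<^bsub>TJ.E\<^esub> dh d) \<otimes>\<^bsub>TJ.E\<^esub> (b \<odot>\<^bsub>TJ.E\<^esub> dh e)) s (pq s f v) =
      pq s (a \<otimes>\<^bsub>JC\<^esub> b \<otimes>\<^bsub>JC\<^esub> f) (d s (e s v)) \<ominus>\<^bsub>jmod J s\<^esub> pq s (a \<otimes>\<^bsub>JC\<^esub> b \<otimes>\<^bsub>JC\<^esub> f) (e s (d s v))"
      using ab f v m mE by (simp add: dh pq_smult TS.A.m_ac)
    have "?l s (pq s f v) = (((a \<odot>\<^bsub>TJ.E\<^esub> dh d) \<otimes>\<^bsub>TJ.E\<^esub> (b \<odot>\<^bsub>TJ.E\<^esub> dh e)) s (pq s f v) \<oplus>\<^bsub>jmod J s\<^esub> TJ.dl (pq Pos a x1) (pq Neg b y2) s (pq s f v))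
      \<ominus>\<^bsub>jmod J s\<^esub> TJ.dl (pq Pos b y1) (pq Neg a x2) s (pq s f v)"
      using ab f v m mE by (simp add: TJ.E_ops_closed del: TJ.E_apply(2) TJ.dl_apply)
    then show "((a \<otimes>\<^bsub>JC\<^esub> b) \<odot>\<^bsub>TJ.E\<^esub> dh ?m) s (pq s f v) = ?l s (pq s f v)"
      unfolding r1 r2 r3 dl_pq_apply[OF ab(1) m(1) ab(2) m(6) f v] dl_pq_apply[OF ab(2) m(4) ab(1) m(3) f v] TS.A.m_comm[OF ab(2,1)]
      using ab f v m mE dlv by (simp add: pq_diff pq_add_right del: dl_apply)
  qed
  show ?thesis
    unfolding xe ye L_mult TJ.L_mult KB_simp ab(3) a_def[symmetric] b_def[symmetric] 2
    using m 1 by simp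
qed

lemma hh_mult:
  assumes "X \<in> carrier TL.T" "Y \<in> carrier TL.T"
  shows "hh (X \<otimes>\<^bsub>TL.T\<^esub> Y) = hh X \<otimes>\<^bsub>K\<^esub> hh Y"
proof -
  have 1: "hh (TL.pt a x \<otimes>\<^bsub>TL.T\<^esub> TL.pt b y) = hh (TL.pt a x) \<otimes>\<^bsub>K\<^esub> hh (TL.pt b y)"
    if "a \<in> carrier C" "x \<in> carrier L" "b \<in> carrier C" "y \<in> carrier L" for a x b y
    using that by (simp add: TL.pt_mult HH.lift_pt KB_mult L_mult_closed)
  have z: "\<zero>\<^bsub>TL.T\<^esub> = TL.pt \<one>\<^bsub>C\<^esub> \<zero>\<^bsub>L\<^esub>" by (rule TL.pt_zero_right[symmetric]) simp
  have 2: "hh (TL.pt a x \<otimes>\<^bsub>TL.T\<^esub> Y) = hh (TL.pt a x) \<otimes>\<^bsub>K\<^esub> hh Y"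
    if ax: "a \<in> carrier C" "x \<in> carrier L" and "Y \<in> carrier TL.T" for a x Y
    using that(3)
  proof (induction Y rule: TL.T_induct)
    case zero
    show ?case unfolding z using ax by (intro 1) simp_all
  next
    case (add b y Y)
    then show ?case using ax
      by (simp add: TL.T_mult_add_right HH.lift_add TL.T_mult_closed 1 TJ.L_bracket_add)
  qed
  show ?thesis using assms(1)
  proof (induction X rule: TL.T_induct)
    case zero
    show ?case unfolding z using assms(2) by (intro 2) simp_all
  next
    case (add a x X)
    then show ?case using assms(2)
      by (simp add: TL.T_mult_add_left HH.lift_add TL.T_mult_closed 2 TJ.L_bracket_add)
  qed
qed

text \<open>
  The embedding of the central closure of the pair into its Tits-Kantor-Koecher algebra.
\<close>

definition "ek s z = (case s of Pos \<Rightarrow> (z, \<zero>\<^bsub>TJ.E\<^esub>, \<zero>\<^bsub>jmod J Neg\<^esub>) | Neg \<Rightarrow> (\<zero>\<^bsub>jmod J Pos\<^esub>, \<zero>\<^bsub>TJ.E\<^esub>, z))"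

lemma ek_simps: "ek Pos z = (z, \<zero>\<^bsub>TJ.E\<^esub>, \<zero>\<^bsub>jmod J Neg\<^esub>)" "ek Neg z = (\<zero>\<^bsub>jmod J Pos\<^esub>, \<zero>\<^bsub>TJ.E\<^esub>, z)"
  by (simp_all add: ek_def)

lemma ek_zero: "ek s \<zero>\<^bsub>jmod J s\<^esub> = \<zero>\<^bsub>K\<^esub>"
  by (cases s) (simp_all add: ek_simps TJ.L_zero)

lemma ek_inj: "ek s z = \<zero>\<^bsub>K\<^esub> \<Longrightarrow> z = \<zero>\<^bsub>jmod J s\<^esub>"
  by (cases s) (simp_all add: ek_simps TJ.L_zero)

lemma ek_add: "z \<in> jcarrier J s \<Longrightarrow> z' \<in> jcarrier J s \<Longrightarrow> ek s (z \<oplus>\<^bsub>jmod J s\<^esub> z') = ek s z \<oplus>\<^bsub>K\<^esub> ek s z'"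
  by (cases s) (simp_all add: ek_simps TJ.E_ops_closed)

lemma hh_emb: "c \<in> carrier C \<Longrightarrow> x \<in> jcarrier V s \<Longrightarrow> KB c (emb s x) = ek s (pq s (phi c) x)"
  by (cases s) (simp_all add: emb_simps ek_simps dh_zero pq_zero)

lemma hh_Lam: "Z \<in> carrier (TS.TV.T s) \<Longrightarrow> hh (Lam s Z) = ek s (cq s Z)"
proof (induction Z rule: TS.TV.T_induct)
  case zero
  then show ?case by (simp add: LAM.lift_zero HH.lift_zero cq_zero ek_zero)
next
  case (add a x Y)
  then show ?case
    by (simp add: LAM.lift_add LAM.lift_pt HH.lift_add HH.lift_pt hh_emb cq_add ek_add pq_def[symmetric])
qed

lemma hh_Lam_NL: "Z \<in> carrier (TS.TV.T s) \<Longrightarrow> Lam s Z \<in> NL \<Longrightarrow> hh (Lam s Z) = \<zero>\<^bsub>K\<^esub>"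
  using cq_zero_iff[of Z s] by (simp add: hh_Lam MV_def ek_zero)

lemma ek_bracket:
  assumes "x \<in> jcarrier J Pos" "y \<in> jcarrier J Neg"
  shows "ek Pos x \<otimes>\<^bsub>K\<^esub> ek Neg y = (\<zero>\<^bsub>jmod J Pos\<^esub>, TJ.dl x y, \<zero>\<^bsub>jmod J Neg\<^esub>)"
proof -
  have "(\<zero>\<^bsub>TJ.E\<^esub> \<otimes>\<^bsub>TJ.E\<^esub> \<zero>\<^bsub>TJ.E\<^esub> \<oplus>\<^bsub>TJ.E\<^esub> TJ.dl x y) \<ominus>\<^bsub>TJ.E\<^esub> TJ.dl \<zero>\<^bsub>jmod J Pos\<^esub> \<zero>\<^bsub>jmod J Neg\<^esub> = TJ.dl x y"
    using assms TJ.t_zero(1)[of _ Pos] TJ.t_zero(1)[of _ Neg] by (intro TJ.E_extPN) (simp_all add: TJ.E_ops_closed)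
  then show ?thesis using assms by (simp add: ek_simps TJ.L_mult)
qed

lemma ek_bracket0:
  assumes "e \<in> TJ.D" "z \<in> jcarrier J s"
  shows "(\<zero>\<^bsub>jmod J Pos\<^esub>, e, \<zero>\<^bsub>jmod J Neg\<^esub>) \<otimes>\<^bsub>K\<^esub> ek s z = ek s (e s z)"
proof -
  note [simp] = TJ.D_E[OF assms(1)]
  note tz = TJ.t_zero[of _ Pos] TJ.t_zero[of _ Neg] TJ.t_zero(2)[of _ Pos, simplified] TJ.t_zero(2)[of _ Neg, simplified]
  show ?thesis
  proof (cases s)
    case Pos
    have "(e \<otimes>\<^bsub>TJ.E\<^esub> \<zero>\<^bsub>TJ.E\<^esub> \<oplus>\<^bsub>TJ.E\<^esub> TJ.dl \<zero>\<^bsub>jmod J Pos\<^esub> \<zero>\<^bsub>jmod J Neg\<^esub>) \<ominus>\<^bsub>TJ.E\<^esub> TJ.dl z \<zero>\<^bsub>jmod J Neg\<^esub> = \<zero>\<^bsub>TJ.E\<^esub>"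
      using assms(2) Pos by (intro TJ.E_extPN) (simp_all add: TJ.E_ops_closed tz)
    then show ?thesis using assms(2) Pos by (simp add: ek_simps TJ.L_mult)
  next
    case Neg
    have "(e \<otimes>\<^bsub>TJ.E\<^esub> \<zero>\<^bsub>TJ.E\<^esub> \<oplus>\<^bsub>TJ.E\<^esub> TJ.dl \<zero>\<^bsub>jmod J Pos\<^esub> z) \<ominus>\<^bsub>TJ.E\<^esub> TJ.dl \<zero>\<^bsub>jmod J Pos\<^esub> \<zero>\<^bsub>jmod J Neg\<^esub> = \<zero>\<^bsub>TJ.E\<^esub>"
      using assms(2) Neg by (intro TJ.E_extPN) (simp_all add: TJ.E_ops_closed tz)
    then show ?thesis using assms(2) Neg by (simp add: ek_simps TJ.L_mult)
  qed
qed

text \<open>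
  The outer components are scalar extensions of \<open>V\<^sup>+\<close> and \<open>V\<^sup>-\<close>, and \<open>IDer\<close> is spanned by their brackets.
\<close>

lemma hh_surj:
  assumes "k \<in> carrier K"
  shows "\<exists>X\<in>carrier TL.T. hh X = k"
proof -
  have v: "\<exists>X\<in>carrier TL.T. hh X = ek s z" if "z \<in> jcarrier J s" for s z
  proof -
    note z = that
    obtain Z where Z: "Z \<in> carrier (TS.TV.T s)" "z = cq s Z" using z by (rule cq_cases)
    then show ?thesis using hh_Lam[OF Z(1)] by (intro bexI[of _ "Lam s Z"]) simp_all
  qed
  let ?m = "\<lambda>e. (\<zero>\<^bsub>jmod J Pos\<^esub>, e, \<zero>\<^bsub>jmod J Neg\<^esub>)"
  let ?H = "{e \<in> carrier TJ.E. \<exists>X\<in>carrier TL.T. hh X = ?m e}"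
  have "submodule ?H JC TJ.E"
  proof (rule TJ.E.submoduleI')
    show "?H \<subseteq> carrier TJ.E" by blast
    have "hh \<zero>\<^bsub>TL.T\<^esub> = ?m \<zero>\<^bsub>TJ.E\<^esub>" by (simp add: HH.lift_zero TJ.L_zero)
    then show "\<zero>\<^bsub>TJ.E\<^esub> \<in> ?H" using TJ.E_ops_closed(4) TL.T.zero_closed by blast
    show "e \<oplus>\<^bsub>TJ.E\<^esub> e' \<in> ?H" if ee: "e \<in> ?H" "e' \<in> ?H" for e e'
    proof -
      obtain X X' where X: "X \<in> carrier TL.T" "X' \<in> carrier TL.T" "hh X = ?m e" "hh X' = ?m e'" using ee by blast
      have "hh (X \<oplus>\<^bsub>TL.T\<^esub> X') = ?m (e \<oplus>\<^bsub>TJ.E\<^esub> e')" using X by (simp add: HH.lift_add)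
      then show ?thesis using ee TJ.E_ops_closed(1) TL.T.a_closed[OF X(1,2)] by blast
    qed
    show "c \<odot>\<^bsub>TJ.E\<^esub> e \<in> ?H" if ce: "c \<in> carrier JC" "e \<in> ?H" for c e
    proof -
      obtain X where X: "X \<in> carrier TL.T" "hh X = ?m e" using ce by blast
      have "hh (psi c \<odot>\<^bsub>TL.T\<^esub> X) = ?m (c \<odot>\<^bsub>TJ.E\<^esub> e)" using X ce(1) by (simp add: hh_smult)
      then show ?thesis using ce TJ.E_ops_closed(3) TL.T.smult_closed[OF psi_closed[OF ce(1)] X(1)] by blast
    qed
  qed
  moreover have "TJ.deltas \<subseteq> ?H"
  proof
    fix e assume "e \<in> TJ.deltas"
    then obtain x y where xy: "x \<in> jcarrier J Pos" "y \<in> jcarrier J Neg" "e = TJ.dl x y" by blast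
    obtain X Y where X: "X \<in> carrier TL.T" "hh X = ek Pos x" "Y \<in> carrier TL.T" "hh Y = ek Neg y" using v xy(1,2) by blast
    have "hh (X \<otimes>\<^bsub>TL.T\<^esub> Y) = ?m e" using X xy by (simp add: hh_mult ek_bracket)
    then show "e \<in> ?H" using TJ.dl_closed[OF xy(1,2)] TL.T_mult_closed[OF X(1,3)] unfolding xy(3) by blast
  qed
  ultimately have D: "TJ.D \<subseteq> ?H" by (rule TJ.D_subsetI)
  obtain x e y where k: "k = (x, e, y)" by (cases k)
  have m: "x \<in> jcarrier J Pos" "e \<in> TJ.D" "y \<in> jcarrier J Neg" using assms by (simp_all add: k)
  obtain X where X: "X \<in> carrier TL.T" "hh X = ek Pos x" using v[OF m(1)] by blast
  obtain Y where Y: "Y \<in> carrier TL.T" "hh Y = ek Neg y" using v[OF m(3)] by blast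
  obtain Z where Z: "Z \<in> carrier TL.T" "hh Z = ?m e" using D m(2) by blast
  have "hh (X \<oplus>\<^bsub>TL.T\<^esub> (Z \<oplus>\<^bsub>TL.T\<^esub> Y)) = k"
    using X Y Z m TJ.D_E[OF m(2)] by (simp add: HH.lift_add k ek_simps)
  then show ?thesis using X(1) Y(1) Z(1) by (intro bexI[of _ "X \<oplus>\<^bsub>TL.T\<^esub> (Z \<oplus>\<^bsub>TL.T\<^esub> Y)"]) simp_all
qed

section \<open>The kernel of the comparison map\<close>

text \<open>
  A map \<open>\<pi>\<close> of \<open>L\<close> that can be read off from brackets with \<open>V\<^sup>+\<close> and \<open>V\<^sup>-\<close> preserves \<open>NL\<close>; the projections
  onto the three components are of this kind.
\<close>

lemma proj_NL:
  assumes xs: "xs \<in> TL.tlists" "TL.tc xs \<in> NL"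
    and pi: "\<And>x. x \<in> carrier L \<Longrightarrow> \<pi> x \<in> carrier L"
    and r0: "\<And>s. \<rho> s \<zero>\<^bsub>L\<^esub> = \<zero>\<^bsub>L\<^esub>"
    and ra: "\<And>s x y. x \<in> carrier L \<Longrightarrow> y \<in> carrier L \<Longrightarrow> \<rho> s (x \<oplus>\<^bsub>L\<^esub> y) = \<rho> s x \<oplus>\<^bsub>L\<^esub> \<rho> s y"
    and pr: "\<And>s x u. x \<in> carrier L \<Longrightarrow> u \<in> jcarrier V s \<Longrightarrow> \<pi> x \<otimes>\<^bsub>L\<^esub> emb s u = \<rho> s (x \<otimes>\<^bsub>L\<^esub> emb s u)"
  shows "TL.tc (map (\<lambda>(c, x). (c, \<pi> x)) xs) \<in> NL"
proof -
  let ?p = "map (\<lambda>(c, x). (c, \<pi> x))"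
  have ys: "?p xs \<in> TL.tlists" using xs(1) by (induction rule: TL.tlists_induct) (simp_all add: pi)
  have Ev: "Ev (?p zs) (emb s u) = \<rho> s (Ev zs (emb s u))"
    if "zs \<in> TL.tlists" "ok zs (emb s u)" "u \<in> jcarrier V s" for zs s u
    using that
  proof (induction rule: TL.tlists_induct)
    case Nil
    then show ?case by (simp add: r0)
  next
    case (Cons c x zs)
    then show ?case using ev_emb[of c u s]
      by (simp add: ra L_mult_closed Ev_closed pr)
  qed
  have ok: "ok (?p zs) y" if "zs \<in> TL.tlists" "ok zs y" for zs y
    using that by (induction rule: TL.tlists_induct) simp_all
  have "\<forall>\<^sub>F y in F. Ev xs y = \<zero>\<^bsub>L\<^esub>" using xs(2) by (simp only: NL_iff[OF xs(1)])
  then obtain K0 where K0: "ess K0" "\<forall>y\<in>K0. Ev xs y = \<zero>\<^bsub>L\<^esub>" by (auto simp: eventually_F)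
  let ?K = "K0 \<inter> {y \<in> carrier L. ok xs y}"
  have "\<forall>\<^sub>F y in F. Ev (?p xs) y = \<zero>\<^bsub>L\<^esub>"
  proof (rule Ev_zero_if[OF ys Uof_jess[OF ess_Int[OF K0(1) ok_ess[OF xs(1)]]]])
    fix s u assume "u \<in> Uof ?K s"
    then have u: "u \<in> jcarrier V s" "emb s u \<in> K0" "ok xs (emb s u)" by (simp_all add: Uof_iff)
    show "ok (?p xs) (emb s u)" by (rule ok[OF xs(1) u(3)])
    show "Ev (?p xs) (emb s u) = \<zero>\<^bsub>L\<^esub>" using Ev[OF xs(1) u(3,1)] K0(2) u(2) by (simp add: r0)
  qed
  then show ?thesis by (simp only: NL_iff[OF ys])
qed

lemma emb_list_Lam:
  assumes "xs \<in> TL.tlists" "\<And>x. x \<in> carrier L \<Longrightarrow> f x \<in> jcarrier V s"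
  shows "map (\<lambda>(c, x). (c, emb s (f x))) xs \<in> TL.tlists \<and>
    (\<exists>Z\<in>carrier (TS.TV.T s). TL.tc (map (\<lambda>(c, x). (c, emb s (f x))) xs) = Lam s Z)"
  using assms(1)
proof (induction rule: TL.tlists_induct)
  case Nil
  have "TL.tc [] = Lam s \<zero>\<^bsub>TS.TV.T s\<^esub>" by (simp add: LAM.lift_zero TL.T_zero)
  then have "\<exists>Z\<in>carrier (TS.TV.T s). TL.tc [] = Lam s Z" by (rule bexI[OF _ TS.TV.T.zero_closed])
  then show ?case unfolding list.map by (rule conjI[OF TL.tlists_simps(1)])
next
  case (Cons c x xs)
  let ?l = "map (\<lambda>(c, x). (c, emb s (f x))) xs"
  have l: "?l \<in> TL.tlists" by (rule Cons(4)[THEN conjunct1])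
  obtain Z where Z: "Z \<in> carrier (TS.TV.T s)" "TL.tc ?l = Lam s Z" using Cons(4)[THEN conjunct2] by (rule bexE) (rule that)
  have "TL.tc ((c, emb s (f x)) # ?l) = TL.pt c (emb s (f x)) \<oplus>\<^bsub>TL.T\<^esub> TL.tc ?l"
    using Cons(1,2) l assms(2) by (simp add: TL.T_add)
  also have "\<dots> = Lam s (TS.TV.pt s (phi c) (f x) \<oplus>\<^bsub>TS.TV.T s\<^esub> Z)"
    unfolding Z(2) using Cons(1,2) Z(1) assms(2) by (simp add: LAM.lift_add LAM.lift_pt)
  finally have e: "TL.tc ((c, emb s (f x)) # ?l) = Lam s (TS.TV.pt s (phi c) (f x) \<oplus>\<^bsub>TS.TV.T s\<^esub> Z)" .
  have m: "TS.TV.pt s (phi c) (f x) \<oplus>\<^bsub>TS.TV.T s\<^esub> Z \<in> carrier (TS.TV.T s)" "(c, emb s (f x)) # ?l \<in> TL.tlists"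
    using Cons(1,2) Z(1) l assms(2) by simp_all
  show ?case unfolding list.map prod.case by (intro conjI m(2) bexI[where x="TS.TV.pt s (phi c) (f x) \<oplus>\<^bsub>TS.TV.T s\<^esub> Z"] e m(1))
qed

abbreviation "mid x \<equiv> (ze Pos, fst (snd x), ze Neg)"

text \<open>
  The degree zero part of a tensor maps to \<open>IDer\<close>, and its bracket with an outer element is again outer.
\<close>

lemma mid_list:
  assumes "xs \<in> TL.tlists"
  shows "map (\<lambda>(c, x). (c, mid x)) xs \<in> TL.tlists \<and>
    (\<exists>e\<in>TJ.D. hh (TL.tc (map (\<lambda>(c, x). (c, mid x)) xs)) = (\<zero>\<^bsub>jmod J Pos\<^esub>, e, \<zero>\<^bsub>jmod J Neg\<^esub>)) \<and>
    (\<forall>s. \<forall>b\<in>carrier C. \<forall>v\<in>jcarrier V s. \<exists>Z\<in>carrier (TS.TV.T s).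
      TL.tc (map (\<lambda>(c, x). (c, mid x)) xs) \<otimes>\<^bsub>TL.T\<^esub> TL.pt b (emb s v) = Lam s Z)"
  using assms
proof (induction rule: TL.tlists_induct)
  case Nil
  have 1: "hh (TL.tc []) = (\<zero>\<^bsub>jmod J Pos\<^esub>, \<zero>\<^bsub>TJ.E\<^esub>, \<zero>\<^bsub>jmod J Neg\<^esub>)" by (simp add: TL.T_zero[symmetric] HH.lift_zero TJ.L_zero)
  have 2: "\<exists>Z\<in>carrier (TS.TV.T s). TL.tc [] \<otimes>\<^bsub>TL.T\<^esub> TL.pt b (emb s v) = Lam s Z" if "b \<in> carrier C" "v \<in> jcarrier V s" for s b v
    using that by (intro bexI[of _ "\<zero>\<^bsub>TS.TV.T s\<^esub>"]) (simp_all add: TL.T_zero[symmetric] TL_zero_mult LAM.lift_zero)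
  show ?case unfolding list.map by (intro conjI TL.tlists_simps(1) bexI[where x="\<zero>\<^bsub>TJ.E\<^esub>"] 1 TJ.D_zero allI ballI 2)
next
  case (Cons c x xs)
  let ?l = "map (\<lambda>(c, x). (c, mid x)) xs"
  obtain a d b' where x: "x = (a, d, b')" by (cases x)
  have d: "d \<in> D" using Cons(2) by (simp add: x)
  have l: "?l \<in> TL.tlists" by (rule Cons(4)[THEN conjunct1])
  have mL: "(ze Pos, d, ze Neg) \<in> carrier L" using d by simp
  have cons: "TL.tc ((c, (ze Pos, d, ze Neg)) # ?l) = TL.pt c (ze Pos, d, ze Neg) \<oplus>\<^bsub>TL.T\<^esub> TL.tc ?l"
    using Cons(1) l mL by (simp add: TL.T_add)
  obtain e where e: "e \<in> TJ.D" "hh (TL.tc ?l) = (\<zero>\<^bsub>jmod J Pos\<^esub>, e, \<zero>\<^bsub>jmod J Neg\<^esub>)"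
    using Cons(4)[THEN conjunct2, THEN conjunct1] by (rule bexE) (rule that)
  have 1: "hh (TL.tc ((c, (ze Pos, d, ze Neg)) # ?l)) = (\<zero>\<^bsub>jmod J Pos\<^esub>, phi c \<odot>\<^bsub>TJ.E\<^esub> dh d \<oplus>\<^bsub>TJ.E\<^esub> e, \<zero>\<^bsub>jmod J Neg\<^esub>)"
    unfolding cons using Cons(1) l mL e(2) by (simp add: HH.lift_add HH.lift_pt pq_zero)
  have 2: "phi c \<odot>\<^bsub>TJ.E\<^esub> dh d \<oplus>\<^bsub>TJ.E\<^esub> e \<in> TJ.D" using Cons(1) dh(1)[OF d] e(1) by (simp add: TJ.D_add TJ.D_smult)
  have 3: "\<exists>Z\<in>carrier (TS.TV.T s). TL.tc ((c, (ze Pos, d, ze Neg)) # ?l) \<otimes>\<^bsub>TL.T\<^esub> TL.pt b (emb s v) = Lam s Z"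
    if b: "b \<in> carrier C" "v \<in> jcarrier V s" for s b v
  proof -
    obtain Z where Z: "Z \<in> carrier (TS.TV.T s)" "TL.tc ?l \<otimes>\<^bsub>TL.T\<^esub> TL.pt b (emb s v) = Lam s Z"
      using Cons(4)[THEN conjunct2, THEN conjunct2, rule_format, OF b] by (rule bexE) (rule that)
    have dv: "d s v \<in> jcarrier V s" using D_E[OF d] b(2) by simp
    have "TL.tc ((c, (ze Pos, d, ze Neg)) # ?l) \<otimes>\<^bsub>TL.T\<^esub> TL.pt b (emb s v) = TL.pt (c \<otimes>\<^bsub>C\<^esub> b) (emb s (d s v)) \<oplus>\<^bsub>TL.T\<^esub> Lam s Z"
      unfolding cons Z(2)[symmetric] using Cons(1) l mL b by (simp add: TL.T_mult_add_left TL.pt_mult bracket_emb0[OF d])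
    also have "\<dots> = Lam s (TS.TV.pt s (phi (c \<otimes>\<^bsub>C\<^esub> b)) (d s v) \<oplus>\<^bsub>TS.TV.T s\<^esub> Z)"
      using Cons(1) b dv Z(1) by (simp add: LAM.lift_add LAM.lift_pt)
    finally show ?thesis using Cons(1) b dv Z(1) by (intro bexI[of _ "TS.TV.pt s (phi (c \<otimes>\<^bsub>C\<^esub> b)) (d s v) \<oplus>\<^bsub>TS.TV.T s\<^esub> Z"]) simp_all
  qed
  have 4: "(c, (ze Pos, d, ze Neg)) # ?l \<in> TL.tlists" using Cons(1) l mL by simp
  show ?case unfolding x list.map prod.case fst_conv snd_conv
    by (intro conjI 4 bexI[where x="phi c \<odot>\<^bsub>TJ.E\<^esub> dh d \<oplus>\<^bsub>TJ.E\<^esub> e"] 1 2 allI ballI 3)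
qed

text \<open>
  The outer parts of \<open>X\<close> lie in \<open>MV\<close>, so they vanish in the closure.  The degree zero part maps to a
  derivation that kills all \<open>c v\<close>, because its brackets with outer elements lie in \<open>NL\<close> and are outer.
\<close>

lemma NL_ker:
  assumes "X \<in> NL"
  shows "hh X = \<zero>\<^bsub>K\<^esub>"
proof -
  obtain xs where xs: "xs \<in> TL.tlists" "X = TL.tc xs" by (rule TL.T_cases[OF NL_sub[OF assms]])
  note xm = assms[unfolded xs(2)]
  let ?P = "\<lambda>xs. map (\<lambda>(c, x). (c, emb Pos (fst x))) xs" and ?N = "\<lambda>xs. map (\<lambda>(c, x). (c, emb Neg (snd (snd x)))) xs"
    and ?Z = "\<lambda>xs. map (\<lambda>(c, x). (c, mid x)) xs"
  have f: "fst x \<in> jcarrier V Pos \<and> fst (snd x) \<in> D \<and> snd (snd x) \<in> jcarrier V Neg" if "x \<in> carrier L" for x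
    using that by (cases x) simp
  note fP = f[THEN conjunct1] f[THEN conjunct2, THEN conjunct1] f[THEN conjunct2, THEN conjunct2]
  have P: "TL.tc (?P xs) \<in> NL"
  proof (rule proj_NL[OF xs(1) xm, of "\<lambda>x. emb Pos (fst x)" "\<lambda>s w. case s of Pos \<Rightarrow> \<zero>\<^bsub>L\<^esub> | Neg \<Rightarrow> mid w"])
    show "emb Pos (fst x) \<in> carrier L" if "x \<in> carrier L" for x using fP(1)[OF that] by simp
    show "(case s of Pos \<Rightarrow> \<zero>\<^bsub>L\<^esub> | Neg \<Rightarrow> mid \<zero>\<^bsub>L\<^esub>) = \<zero>\<^bsub>L\<^esub>" for s by (cases s) (simp_all add: L_zero)
    show "(case s of Pos \<Rightarrow> \<zero>\<^bsub>L\<^esub> | Neg \<Rightarrow> mid (x \<oplus>\<^bsub>L\<^esub> y)) = (case s of Pos \<Rightarrow> \<zero>\<^bsub>L\<^esub> | Neg \<Rightarrow> mid x) \<oplus>\<^bsub>L\<^esub> (case s of Pos \<Rightarrow> \<zero>\<^bsub>L\<^esub> | Neg \<Rightarrow> mid y)"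
      if "x \<in> carrier L" "y \<in> carrier L" for s x y using that by (cases s; cases x; cases y) simp_all
    show "emb Pos (fst x) \<otimes>\<^bsub>L\<^esub> emb s u = (case s of Pos \<Rightarrow> \<zero>\<^bsub>L\<^esub> | Neg \<Rightarrow> mid (x \<otimes>\<^bsub>L\<^esub> emb s u))"
      if "x \<in> carrier L" "u \<in> jcarrier V s" for s x u
      using that by (cases s; cases x) (simp_all add: emb_same emb_bracket bracket_emb)
  qed
  have N: "TL.tc (?N xs) \<in> NL"
  proof (rule proj_NL[OF xs(1) xm, of "\<lambda>x. emb Neg (snd (snd x))" "\<lambda>s w. case s of Neg \<Rightarrow> \<zero>\<^bsub>L\<^esub> | Pos \<Rightarrow> mid w"])
    show "emb Neg (snd (snd x)) \<in> carrier L" if "x \<in> carrier L" for x using fP(3)[OF that] by simp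
    show "(case s of Neg \<Rightarrow> \<zero>\<^bsub>L\<^esub> | Pos \<Rightarrow> mid \<zero>\<^bsub>L\<^esub>) = \<zero>\<^bsub>L\<^esub>" for s by (cases s) (simp_all add: L_zero)
    show "(case s of Neg \<Rightarrow> \<zero>\<^bsub>L\<^esub> | Pos \<Rightarrow> mid (x \<oplus>\<^bsub>L\<^esub> y)) = (case s of Neg \<Rightarrow> \<zero>\<^bsub>L\<^esub> | Pos \<Rightarrow> mid x) \<oplus>\<^bsub>L\<^esub> (case s of Neg \<Rightarrow> \<zero>\<^bsub>L\<^esub> | Pos \<Rightarrow> mid y)"
      if "x \<in> carrier L" "y \<in> carrier L" for s x y using that by (cases s; cases x; cases y) simp_all
    show "emb Neg (snd (snd x)) \<otimes>\<^bsub>L\<^esub> emb s u = (case s of Neg \<Rightarrow> \<zero>\<^bsub>L\<^esub> | Pos \<Rightarrow> mid (x \<otimes>\<^bsub>L\<^esub> emb s u))"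
      if "x \<in> carrier L" "u \<in> jcarrier V s" for s x u
      using that by (cases s; cases x) (simp_all add: emb_same emb_bracket bracket_emb)
  qed
  have Z: "TL.tc (?Z xs) \<in> NL"
  proof (rule proj_NL[OF xs(1) xm, of mid "\<lambda>s w. case s of Pos \<Rightarrow> emb Pos (fst w) | Neg \<Rightarrow> emb Neg (snd (snd w))"])
    show "mid x \<in> carrier L" if "x \<in> carrier L" for x using fP(2)[OF that] by simp
    show "(case s of Pos \<Rightarrow> emb Pos (fst \<zero>\<^bsub>L\<^esub>) | Neg \<Rightarrow> emb Neg (snd (snd \<zero>\<^bsub>L\<^esub>))) = \<zero>\<^bsub>L\<^esub>" for s
      by (cases s) (simp_all add: L_zero emb_simps)
    show "(case s of Pos \<Rightarrow> emb Pos (fst (x \<oplus>\<^bsub>L\<^esub> y)) | Neg \<Rightarrow> emb Neg (snd (snd (x \<oplus>\<^bsub>L\<^esub> y)))) =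
      (case s of Pos \<Rightarrow> emb Pos (fst x) | Neg \<Rightarrow> emb Neg (snd (snd x))) \<oplus>\<^bsub>L\<^esub> (case s of Pos \<Rightarrow> emb Pos (fst y) | Neg \<Rightarrow> emb Neg (snd (snd y)))"
      if "x \<in> carrier L" "y \<in> carrier L" for s x y using that by (cases s; cases x; cases y) (simp_all add: emb_add)
    show "mid x \<otimes>\<^bsub>L\<^esub> emb s u = (case s of Pos \<Rightarrow> emb Pos (fst (x \<otimes>\<^bsub>L\<^esub> emb s u)) | Neg \<Rightarrow> emb Neg (snd (snd (x \<otimes>\<^bsub>L\<^esub> emb s u))))"
      if "x \<in> carrier L" "u \<in> jcarrier V s" for s x u
      using that by (cases s; cases x; simp add: bracket_emb dl_zero; simp add: emb_simps)
  qed
  have lP: "?P ys \<in> TL.tlists \<and> (\<exists>Z\<in>carrier (TS.TV.T Pos). TL.tc (?P ys) = Lam Pos Z)" if "ys \<in> TL.tlists" for ys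
    by (rule emb_list_Lam[OF that, of fst Pos]) (rule fP(1))
  have lN: "?N ys \<in> TL.tlists \<and> (\<exists>Z\<in>carrier (TS.TV.T Neg). TL.tc (?N ys) = Lam Neg Z)" if "ys \<in> TL.tlists" for ys
    by (rule emb_list_Lam[OF that, of "\<lambda>x. snd (snd x)" Neg]) (rule fP(3))
  note lZ = mid_list[OF xs(1)]
  have hP: "hh (TL.tc (?P xs)) = \<zero>\<^bsub>K\<^esub>"
  proof -
    obtain W where W: "W \<in> carrier (TS.TV.T Pos)" "TL.tc (?P xs) = Lam Pos W" using lP[OF xs(1), THEN conjunct2] by (rule bexE) (rule that)
    then show ?thesis using hh_Lam_NL[OF W(1)] P by simp
  qed
  have hN: "hh (TL.tc (?N xs)) = \<zero>\<^bsub>K\<^esub>"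
  proof -
    obtain W where W: "W \<in> carrier (TS.TV.T Neg)" "TL.tc (?N xs) = Lam Neg W" using lN[OF xs(1), THEN conjunct2] by (rule bexE) (rule that)
    then show ?thesis using hh_Lam_NL[OF W(1)] N by simp
  qed
  have hZ: "hh (TL.tc (?Z xs)) = \<zero>\<^bsub>K\<^esub>"
  proof -
    obtain e where e: "e \<in> TJ.D" "hh (TL.tc (?Z xs)) = (\<zero>\<^bsub>jmod J Pos\<^esub>, e, \<zero>\<^bsub>jmod J Neg\<^esub>)"
      using lZ[THEN conjunct2, THEN conjunct1] by (rule bexE) (rule that)
    have "e = \<zero>\<^bsub>TJ.E\<^esub>"
    proof (rule J_ext[OF TJ.D_E[OF e(1)] TJ.E_ops_closed(4)])
      fix s c v assume c: "c \<in> carrier JC" and v: "v \<in> jcarrier V s"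
      let ?y = "TL.pt (psi c) (emb s v)"
      have y: "?y \<in> carrier TL.T" using c v by simp
      obtain W where W: "W \<in> carrier (TS.TV.T s)" "TL.tc (?Z xs) \<otimes>\<^bsub>TL.T\<^esub> ?y = Lam s W"
        using lZ[THEN conjunct2, THEN conjunct2, rule_format, OF psi_closed[OF c] v] by (rule bexE) (rule that)
      have "Lam s W \<in> NL" using NL_bracket_right[OF y Z] by (simp only: W(2))
      then have "\<zero>\<^bsub>K\<^esub> = hh (TL.tc (?Z xs) \<otimes>\<^bsub>TL.T\<^esub> ?y)" using hh_Lam_NL[OF W(1)] W(2) by simp
      also have "\<dots> = ek s (e s (pq s c v))"
        using hh_mult[OF NL_sub[OF Z] y] c v by (simp add: e(2) HH.lift_pt hh_emb ek_bracket0[OF e(1)])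
      finally have "e s (pq s c v) = \<zero>\<^bsub>jmod J s\<^esub>" by (intro ek_inj) (rule HOL.sym)
      then show "e s (pq s c v) = \<zero>\<^bsub>TJ.E\<^esub> s (pq s c v)" using c v by simp
    qed
    then show ?thesis using e(2) by (simp add: TJ.L_zero)
  qed
  have "hh (TL.tc xs) = hh (TL.tc (?P xs)) \<oplus>\<^bsub>K\<^esub> (hh (TL.tc (?Z xs)) \<oplus>\<^bsub>K\<^esub> hh (TL.tc (?N xs)))"
    if "xs \<in> TL.tlists" for xs
    using that
  proof (induction rule: TL.tlists_induct)
    case Nil
    then show ?case by (simp add: TL.T_zero[symmetric] HH.lift_zero)
  next
    case (Cons c x xs)
    note l = lP[OF Cons(3), THEN conjunct1] mid_list[OF Cons(3), THEN conjunct1] lN[OF Cons(3), THEN conjunct1]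
    note y = emb_closed[OF fP(1)[OF Cons(2)]] emb_closed[OF fP(3)[OF Cons(2)]]
    have m: "mid x \<in> carrier L" using fP(2)[OF Cons(2)] by simp
    have e: "hh (TL.tc ((c, y) # ws)) = KB c y \<oplus>\<^bsub>K\<^esub> hh (TL.tc ws)" if "y \<in> carrier L" "ws \<in> TL.tlists" for y ws
      using TL.T_add[of "[(c, y)]" ws] HH.lift_add[of "TL.pt c y" "TL.tc ws"] HH.lift_pt[of c y] Cons(1) that by simp
    have kb: "KB c x = KB c (emb Pos (fst x)) \<oplus>\<^bsub>K\<^esub> (KB c (mid x) \<oplus>\<^bsub>K\<^esub> KB c (emb Neg (snd (snd x))))"
      using Cons(1,2) by (cases x) (simp add: emb_simps pq_zero dh_zero dh_E TJ.E_ops_closed)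
    have g: "(k1 \<oplus>\<^bsub>K\<^esub> (k2 \<oplus>\<^bsub>K\<^esub> k3)) \<oplus>\<^bsub>K\<^esub> (l1 \<oplus>\<^bsub>K\<^esub> (l2 \<oplus>\<^bsub>K\<^esub> l3)) = (k1 \<oplus>\<^bsub>K\<^esub> l1) \<oplus>\<^bsub>K\<^esub> ((k2 \<oplus>\<^bsub>K\<^esub> l2) \<oplus>\<^bsub>K\<^esub> (k3 \<oplus>\<^bsub>K\<^esub> l3))"
      if "k1 \<in> carrier K" "k2 \<in> carrier K" "k3 \<in> carrier K" "l1 \<in> carrier K" "l2 \<in> carrier K" "l3 \<in> carrier K"
      for k1 k2 k3 l1 l2 l3 using that by (simp add: TJ.L.a_ac)
    show ?case
      unfolding list.map prod.case e[OF Cons(2,3)] e[OF y(1) l(1)] e[OF m l(2)] e[OF y(2) l(3)] Cons(4) kb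
      by (rule g) (rule HH.B_closed[OF Cons(1) y(1)] HH.B_closed[OF Cons(1) m] HH.B_closed[OF Cons(1) y(2)]
        HH.lift_closed[OF TL.tc_closed[OF l(1)]] HH.lift_closed[OF TL.tc_closed[OF l(2)]] HH.lift_closed[OF TL.tc_closed[OF l(3)]])+
  qed
  from this[OF xs(1)] show ?thesis unfolding xs(2) hP hZ hN by simp
qed

text \<open>
  The kernel is an ideal that contains the relations, which lie in \<open>NL\<close>, and it meets \<open>1 \<otimes> L\<close> trivially
  because \<open>V\<close> embeds into its central closure.  So it is contained in the largest such ideal.
\<close>

lemma ker_NL:
  assumes "X \<in> carrier TL.T" "hh X = \<zero>\<^bsub>K\<^esub>"
  shows "X \<in> NL"
proof -
  let ?N = "{X \<in> carrier TL.T. hh X = \<zero>\<^bsub>K\<^esub>}"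
  have "?N \<subseteq> NL"
  proof (rule NL_max)
    have "submodule ?N C TL.T"
      by (rule TL.T.submoduleI') (simp_all add: HH.lift_zero HH.lift_add hh_smult subset_eq)
    moreover have "hh (X \<otimes>\<^bsub>TL.T\<^esub> Y) = \<zero>\<^bsub>K\<^esub>" if "X \<in> carrier TL.T" "Y \<in> carrier TL.T" "hh Y = \<zero>\<^bsub>K\<^esub>" for X Y
    proof -
      have "hh (X \<otimes>\<^bsub>TL.T\<^esub> Y) = hh X \<otimes>\<^bsub>K\<^esub> hh \<zero>\<^bsub>TL.T\<^esub>" using hh_mult[OF that(1,2)] that(3) by (simp add: HH.lift_zero)
      also have "\<dots> = hh (X \<otimes>\<^bsub>TL.T\<^esub> \<zero>\<^bsub>TL.T\<^esub>)" by (rule hh_mult[symmetric]) (simp_all add: that)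
      finally show ?thesis using that(1) by (simp add: TL_zero_mult HH.lift_zero)
    qed
    ultimately show "lie_ideal C TL.T ?N" by (simp add: lie_ideal_def TL.T_mult_closed)
    show "TL.pt (lc (f, U)) u \<ominus>\<^bsub>TL.T\<^esub> TL.pt \<one>\<^bsub>C\<^esub> (f u) \<in> ?N" if "(f, U) \<in> P" "u \<in> U" for f U u
      unfolding mem_Collect_eq by (rule conjI[OF NL_sub[OF NL_rel[OF that]] NL_ker[OF NL_rel[OF that]]])
    show "x = \<zero>\<^bsub>L\<^esub>" if x: "x \<in> carrier L" "TL.pt \<one>\<^bsub>C\<^esub> x \<in> ?N" for x
    proof -
      obtain a d b where xe: "x = (a, d, b)" by (cases x)
      have m: "a \<in> jcarrier V Pos" "d \<in> D" "b \<in> jcarrier V Neg" using x(1) by (simp_all add: xe)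
      have "KB \<one>\<^bsub>C\<^esub> x = \<zero>\<^bsub>K\<^esub>" using x by (simp add: HH.lift_pt)
      then have "pq Pos \<one>\<^bsub>JC\<^esub> a = \<zero>\<^bsub>jmod J Pos\<^esub>" "dh d = \<zero>\<^bsub>TJ.E\<^esub>" "pq Neg \<one>\<^bsub>JC\<^esub> b = \<zero>\<^bsub>jmod J Neg\<^esub>"
        using dh_E[OF m(2)] by (simp_all add: xe phi_hom TJ.L_zero)
      then show ?thesis using pq_one_zero m dh_inj by (simp add: xe L_zero)
    qed
  qed
  then show ?thesis using assms by blast
qed

section \<open>The isomorphism\<close>

sublocale QL: quotient_module C TL.T NL
  by (rule quotient_module.intro[OF TL.T_module quotient_module_axioms.intro[OF NL_submodule]])

definition "kiso Y = hh (SOME X. X \<in> carrier TL.T \<and> QL.cs X = Y)"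

lemma kiso_cs:
  assumes X: "X \<in> carrier TL.T"
  shows "kiso (QL.cs X) = hh X"
proof -
  define Z where "Z = (SOME Z. Z \<in> carrier TL.T \<and> QL.cs Z = QL.cs X)"
  have z: "Z \<in> carrier TL.T \<and> QL.cs Z = QL.cs X"
    unfolding Z_def by (rule someI[of "\<lambda>Z. Z \<in> carrier TL.T \<and> QL.cs Z = QL.cs X" X]) (rule conjI[OF X HOL.refl])
  note Z = z[THEN conjunct1] QL.cs_eq_iff[OF z[THEN conjunct1] X, THEN iffD1, OF z[THEN conjunct2]]
  have "hh Z \<ominus>\<^bsub>K\<^esub> hh X = \<zero>\<^bsub>K\<^esub>" using NL_ker[OF Z(2)] HH.lift_diff[OF Z(1) X] by simp
  then have "hh Z = hh X" using Z(1) X TJ.L.eq_if_minus_zero by simp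
  then show ?thesis unfolding kiso_def Z_def .
qed

lemma kiso_bij: "bij_betw kiso (carrier QL.Q) (carrier K)"
proof (rule bij_betw_imageI)
  show "inj_on kiso (carrier QL.Q)"
  proof (rule inj_onI)
    fix A B assume AB: "A \<in> carrier QL.Q" "B \<in> carrier QL.Q" "kiso A = kiso B"
    obtain X where X: "X \<in> carrier TL.T" "A = QL.cs X" using AB(1) by (rule QL.Q_cases)
    obtain Y where Y: "Y \<in> carrier TL.T" "B = QL.cs Y" using AB(2) by (rule QL.Q_cases)
    have "hh X = hh Y" using AB(3) X Y by (simp add: kiso_cs)
    then have "hh (X \<ominus>\<^bsub>TL.T\<^esub> Y) = \<zero>\<^bsub>K\<^esub>" using X Y TJ.L.eq_if_minus_zero by (simp add: HH.lift_diff)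
    then have "X \<ominus>\<^bsub>TL.T\<^esub> Y \<in> NL" using X Y by (intro ker_NL) simp_all
    then show "A = B" unfolding X(2) Y(2) by (rule QL.cs_eq_iff[OF X(1) Y(1), THEN iffD2])
  qed
  show "kiso ` carrier QL.Q = carrier K"
  proof
    show "kiso ` carrier QL.Q \<subseteq> carrier K"
    proof
      fix k assume "k \<in> kiso ` carrier QL.Q"
      then obtain A where A: "A \<in> carrier QL.Q" "k = kiso A" by blast
      obtain X where X: "X \<in> carrier TL.T" "A = QL.cs X" using A(1) by (rule QL.Q_cases)
      then show "k \<in> carrier K" using A(2) by (simp add: kiso_cs)
    qed
    show "carrier K \<subseteq> kiso ` carrier QL.Q"
    proof
      fix k assume "k \<in> carrier K"
      then obtain X where X: "X \<in> carrier TL.T" "hh X = k" using hh_surj by blast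
      then have "k = kiso (QL.cs X)" by (simp add: kiso_cs)
      then show "k \<in> kiso ` carrier QL.Q" using QL.cs_closed[OF X(1)] by blast
    qed
  qed
qed

lemma kiso_hom:
  assumes "A \<in> carrier QL.Q" "B \<in> carrier QL.Q"
  shows "kiso (A \<oplus>\<^bsub>QL.Q\<^esub> B) = kiso A \<oplus>\<^bsub>K\<^esub> kiso B" "kiso (A \<otimes>\<^bsub>QL.Q\<^esub> B) = kiso A \<otimes>\<^bsub>K\<^esub> kiso B"
    "r \<in> carrier R \<Longrightarrow> kiso ((r \<odot>\<^bsub>C\<^esub> \<one>\<^bsub>C\<^esub>) \<odot>\<^bsub>QL.Q\<^esub> A) = (r \<odot>\<^bsub>JC\<^esub> \<one>\<^bsub>JC\<^esub>) \<odot>\<^bsub>K\<^esub> kiso A"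
proof -
  obtain X where X: "X \<in> carrier TL.T" "A = QL.cs X" using assms(1) by (rule QL.Q_cases)
  obtain Y where Y: "Y \<in> carrier TL.T" "B = QL.cs Y" using assms(2) by (rule QL.Q_cases)
  show "kiso (A \<oplus>\<^bsub>QL.Q\<^esub> B) = kiso A \<oplus>\<^bsub>K\<^esub> kiso B" using X Y by (simp add: QL.Q_add kiso_cs HH.lift_add)
  have "QL.cs X \<otimes>\<^bsub>QL.Q\<^esub> QL.cs Y = QL.cs (X \<otimes>\<^bsub>TL.T\<^esub> Y)"
    using X(1) Y(1) by (rule QL.Q_mult) (simp_all add: TL.T_mult_closed TL.T_mult_add_left TL.T_mult_add_right NL_bracket NL_bracket_right)
  then show "kiso (A \<otimes>\<^bsub>QL.Q\<^esub> B) = kiso A \<otimes>\<^bsub>K\<^esub> kiso B" using X Y by (simp add: kiso_cs hh_mult TL.T_mult_closed)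
  show "kiso ((r \<odot>\<^bsub>C\<^esub> \<one>\<^bsub>C\<^esub>) \<odot>\<^bsub>QL.Q\<^esub> A) = (r \<odot>\<^bsub>JC\<^esub> \<one>\<^bsub>JC\<^esub>) \<odot>\<^bsub>K\<^esub> kiso A" if "r \<in> carrier R"
    using X that by (simp add: QL.Q_smult kiso_cs hh_smult phi_hom)
qed

end

theorem theorem4p3:
  fixes \<Phi> :: "('r, 'e) ring_scheme" and V :: "('r, 'a) jpair"
  assumes "cring \<Phi>"
    and "\<one>\<^bsub>\<Phi>\<^esub> \<oplus>\<^bsub>\<Phi>\<^esub> \<one>\<^bsub>\<Phi>\<^esub> \<in> Units \<Phi>"
    and "jordan_pair \<Phi> V"
    and "jnondegenerate V"
  shows "algebra_isomorphic \<Phi>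
    (restrict_scalars (lie_centroid \<Phi> (TKK \<Phi> V)) (lie_central_closure \<Phi> (TKK \<Phi> V)))
    (restrict_scalars (jcentroid \<Phi> V) (TKK (jcentroid \<Phi> V) (jcentral_closure \<Phi> V)))"
proof -
  interpret nondeg_pair \<Phi> V
    by (intro nondeg_pair.intro half_pair.intro half_pair_axioms.intro nondeg_pair_axioms.intro assms)
  show ?thesis
    unfolding algebra_isomorphic_def lie_central_closure_def jcentral_closure_def lie_closure_ideal_eq jclosure_ideal_eq
    by (intro exI[of _ kiso] conjI ballI) (simp_all add: restrict_scalars_def kiso_bij kiso_hom)
qed

end
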